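(* Let $k\in\mathbb Z^+$ and let $\lambda$ be a partition. Then: - $\mathbf{I}_k(n)\in\boldsymbol\zeta(n)^{(k)}$ and $\mathbf{i}_{n+1,n}(\mathbf{I}_k(n))=\mathbf{I}_k(n+1)$ for all $n\ge k$; - $\mathbf{K}_\lambda(n)\in\boldsymbol\zeta(n)^{(|\lambda|)}$ and $\mathbf{i}_{n+1,n}(\mathbf{K}_\lambda(n))=\mathbf{K}_\lambda(n+1)$ for all $n\ge|\lambda|$; - $\mathbf{J}_\lambda(n)\in\boldsymbol\zeta(n)^{(|\lambda|)}$ and $\mathbf{i}_{n+1,n}(\mathbf{J}_\lambda(n))=\mathbf{J}_\lambda(n+1)$ for all $n\ge|\lambda|$; - $\mathbf{S}_\lambda(n)\in\boldsymbol\zeta(n)^{(|\lambda|)}$ and $\mathbf{i}_{n+1,n}(\mathbf{S}_\lambda(n))=\mathbf{S}_\lambda(n+1)$ for all $n\ge|\lambda|$.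
   Context: $\boldsymbol\zeta(n)$, $n\ge1$, is the center of $\mathbf{U}(gl(n))$, $gl(n)=gl(n,\mathbb C)$ with standard basis $e_{i,j}$; $\boldsymbol\zeta(n)^{(m)}$ is the $m$-th element of the filtration induced by the standard filtration of $\mathbf{U}(gl(n))$. Capelli monomorphisms. With $\mathbf{cdet}(A)=\sum_\sigma(-1)^{|\sigma|}a_{\sigma(1),1}\cdots a_{\sigma(k),k}$, put $\mathbf{H}_k(n)=\sum_{1\le i_1<\cdots<i_k\le n}\mathbf{cdet}[e_{i_a,i_b}+\delta_{ab}(k-a)]_{a,b=1,\dots,k}$; $\mathbf{H}_1(n),\dots,\mathbf{H}_n(n)$ are algebraically independent generators of $\boldsymbol\zeta(n)$ (Capelli). $\mathbf{i}_{n+1,n}:\boldsymbol\zeta(n)\to\boldsymbol\zeta(n+1)$ is the algebra map with $\mathbf{H}_k(n)\mapsto\mathbf{H}_k(n+1)$, $k=1,\dots,n$. Virtual method (for each $n$). $gl(m_0|m_1+n)$ ($m_0,m_1$ sufficiently large) is the complex general linear Lie superalgebra with basis $e_{a,b}$, $a,b\in A_0\cup A_1\cup L$, $A_0=\{\alpha_1,\dots,\alpha_{m_0}\}$ (parity $0$), $A_1=\{\beta_1,\dots,\beta_{m_1}\}$ (parity $1$), $L=\{1,\dots,n\}$ (parity $1$), $|e_{a,b}|=|a|+|b|$, and $[e_{a,b},e_{c,d}]=\delta_{bc}e_{a,d}-(-1)^{(|a|+|b|)(|c|+|d|)}\delta_{ad}e_{c,b}$. Symbols in $A_0\cup A_1$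 are virtual. $gl(n)$ is the subalgebra spanned by $e_{i,j}$, $i,j\in L$. A product $e_{a_M,b_M}\cdots e_{a_1,b_1}$ is irregular if there are $i\le M$ and a virtual symbol $\gamma$ with $\#\{j\le i: b_j=\gamma\}>\#\{j<i: a_j=\gamma\}$. Let $\mathbf{Irr}$ be the left ideal generated by irregular products. $Virt(m_0+m_1,n)=\mathbf{U}(gl(n))\oplus\mathbf{Irr}$ is a direct sum and a subalgebra of $\mathbf{U}(gl(m_0|m_1+n))$ in which $\mathbf{Irr}$ is a two-sided ideal; $\mathfrak p:Virt(m_0+m_1,n)\to\mathbf{U}(gl(n))$ is the projection with kernel $\mathbf{Irr}$. All monomials below lie in $Virt(m_0+m_1,n)$. For tableaux $S,T$ of the same shape, $e_{S,T}$ is the product of the $e_{s,t}$ with $s,t$ the entries of $S,T$ in the same cell, cells being read row by row, top to bottom and left to right. $C^*_\lambda$ (shape $\lambda$) has all entries of row $i$ equal to $\alpha_i$; $D^*_\lambda$ has all entries of column $j$ equal to $\beta_j$. $\widetilde\lambda$ is the conjugate partition and $H(\lambda)$ the product of the hook lengths of $\lambda$. Define the following elements (all central in $\mathbf{U}(gl(n))$), all equal to $1$ for $\lambda=\emptyset$ in the last three cases: - $\mathbf{I}_k(n)=\sum_{h_1+\cdots+h_n=k}\frac1{h_1!\cdots h_n!}\mathfrak p(e_{n,\beta}^{h_n}\cdots e_{1,\beta}^{h_1}e_{\beta,1}^{h_1}\cdots e_{\beta,n}^{h_n})$, any $\beta\in A_1$; - $\mathbf{K}_\lambda(n)=\sum_S\mathfrak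 p(e_{S,C^*_\lambda}e_{C^*_\lambda,S})$ ($\lambda_1\le n$), over tableaux $S$ of shape $\lambda$ on $\{1,\dots,n\}$ with strictly increasing rows; - $\mathbf{J}_\lambda(n)=\sum_S\frac1{o_S}\mathfrak p(e_{S,D^*_{\widetilde\lambda}}e_{D^*_{\widetilde\lambda},S})$, over tableaux $S$ of shape $\widetilde\lambda$ on $\{1,\dots,n\}$ with weakly increasing columns, $o_S$ being the product over columns and symbols of the factorials of the multiplicities of the symbol in the column; - $\mathbf{S}_\lambda(n)=\frac1{H(\lambda)}\sum_S\mathfrak p(e_{S,C^*_\lambda}e_{C^*_\lambda,D^*_\lambda}e_{D^*_\lambda,C^*_\lambda}e_{C^*_\lambda,S})$ ($\lambda_1\le n$), over tableaux $S$ of shape $\lambda$ on $\{1,\dots,n\}$ with strictly increasing rows. *)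

theory Defs
  imports
    Complex_Main
    "HOL-Library.Poly_Mapping"
    "HOL-Library.FuncSet"
    "HOL-Combinatorics.Permutations"
    "HOL-Algebra.QuotRing"
begin

section \<open>Free associative algebras\<close>

datatype 'a fword = FWord (letters: "'a list")

instantiation fword :: (type) monoid_add
begin

definition zero_fword :: "'a fword" where
  "0 = FWord []"

definition plus_fword :: "'a fword \<Rightarrow> 'a fword \<Rightarrow> 'a fword" where
  "u + v = FWord (letters u @ letters v)"

instance
  by standard (simp_all add: zero_fword_def plus_fword_def)

end

lemma letters_zero [simp]: "letters 0 = []"
  by (simp add: zero_fword_def)

lemma letters_plus [simp]: "letters (u + v) = letters u @ letters v"
  by (simp add: plus_fword_def)

text \<open>
  The type \<open>'a fword \<Rightarrow>\<^sub>0 complex\<close> with its convolution product is the free associative unital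
  \<open>\<complex>\<close>-algebra on \<open>'a\<close>; \<open>free_alg X\<close> is its subalgebra on the letters in \<open>X\<close>, that is, the
  tensor algebra of the vector space with basis \<open>X\<close>.
\<close>

definition free_alg :: "'a set \<Rightarrow> ('a fword \<Rightarrow>\<^sub>0 complex) ring" where
  "free_alg X =
     \<lparr>carrier = {f. \<forall>w\<in>Poly_Mapping.keys f. set (letters w) \<subseteq> X},
      monoid.mult = (*), one = 1, zero = 0, add = (+)\<rparr>"

definition const :: "complex \<Rightarrow> ('a fword \<Rightarrow>\<^sub>0 complex)" where
  "const c = Poly_Mapping.single 0 c"

definition gen :: "'a \<Rightarrow> 'a \<Rightarrow> (('a \<times> 'a) fword \<Rightarrow>\<^sub>0 complex)" where
  "gen a b = Poly_Mapping.single (FWord [(a, b)]) 1"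


section \<open>The Lie superalgebra \<open>gl(m\<^sub>0|m\<^sub>1+n)\<close> and its enveloping algebra\<close>

datatype symb = Alpha nat | Beta nat | Prop nat

fun parity :: "symb \<Rightarrow> nat" where
  "parity (Alpha i) = 0"
| "parity (Beta i) = 1"
| "parity (Prop i) = 1"

definition virtual :: "symb \<Rightarrow> bool" where
  "virtual a \<longleftrightarrow> (\<forall>i. a \<noteq> Prop i)"

definition alphabet :: "nat \<Rightarrow> nat \<Rightarrow> nat \<Rightarrow> symb set" where
  "alphabet m0 m1 n = Alpha ` {1..m0} \<union> Beta ` {1..m1} \<union> Prop ` {1..n}"

type_synonym tens = "(symb \<times> symb) fword \<Rightarrow>\<^sub>0 complex"

definition koszul_sign :: "symb \<Rightarrow> symb \<Rightarrow> symb \<Rightarrow> symb \<Rightarrow> tens" where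
  "koszul_sign a b c d = (-1) ^ ((parity a + parity b) * (parity c + parity d))"

text \<open>The superbracket of \<open>e\<^bsub>a,b\<^esub>\<close> and \<open>e\<^bsub>c,d\<^esub>\<close>, as an element of degree one of the tensor algebra.\<close>

definition gl_bracket :: "symb \<Rightarrow> symb \<Rightarrow> symb \<Rightarrow> symb \<Rightarrow> tens" where
  "gl_bracket a b c d =
     of_bool (b = c) * gen a d - koszul_sign a b c d * of_bool (a = d) * gen c b"

definition gl_relations :: "symb set \<Rightarrow> tens set" where
  "gl_relations A =
     {gen a b * gen c d - koszul_sign a b c d * (gen c d * gen a b) - gl_bracket a b c d
       | a b c d. a \<in> A \<and> b \<in> A \<and> c \<in> A \<and> d \<in> A}"

definition gl_ideal :: "symb set \<Rightarrow> tens set" where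
  "gl_ideal A = Idl\<^bsub>free_alg (A \<times> A)\<^esub> (gl_relations A)"

text \<open>\<open>U A\<close> is the universal enveloping algebra of the general linear Lie superalgebra with basis
  \<open>e\<^bsub>a,b\<^esub>\<close>, \<open>a, b \<in> A\<close>; its elements are cosets, and \<open>cls A f\<close> is the coset of \<open>f\<close>.\<close>

definition U :: "symb set \<Rightarrow> tens set ring" where
  "U A = free_alg (A \<times> A) Quot gl_ideal A"

definition cls :: "symb set \<Rightarrow> tens \<Rightarrow> tens set" where
  "cls A f = gl_ideal A +>\<^bsub>free_alg (A \<times> A)\<^esub> f"

definition smul :: "symb set \<Rightarrow> complex \<Rightarrow> tens set \<Rightarrow> tens set" where
  "smul A c x = cls A (const c) \<otimes>\<^bsub>U A\<^esub> x"

text \<open>The standard filtration: \<open>U_filt A m\<close> is spanned by the products of at most \<open>m\<close> generators.\<close>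

definition U_filt :: "symb set \<Rightarrow> nat \<Rightarrow> tens set set" where
  "U_filt A m =
     cls A ` {f \<in> carrier (free_alg (A \<times> A)). \<forall>w\<in>Poly_Mapping.keys f. length (letters w) \<le> m}"

text \<open>All proper symbols have the same parity, so \<open>U (proper n)\<close> is the enveloping algebra of the
  ordinary Lie algebra \<open>gl(n)\<close>.\<close>

definition proper :: "nat \<Rightarrow> symb set" where
  "proper n = Prop ` {1..n}"

lemma alphabet_0_0: "alphabet 0 0 n = proper n"
  by (simp add: alphabet_def proper_def)

lemma keys_times_letters:
  assumes "w \<in> Poly_Mapping.keys (f * g :: 'a fword \<Rightarrow>\<^sub>0 complex)"
  obtains u v where "u \<in> Poly_Mapping.keys f" "v \<in> Poly_Mapping.keys g" "w = u + v"
  using assms keys_mult[of f g] by blast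

lemma ring_free_alg: "ring (free_alg X)"
proof (rule ringI)
  show "abelian_group (free_alg X)"
  proof (rule abelian_groupI)
    fix f assume "f \<in> carrier (free_alg X)"
    then show "\<exists>g\<in>carrier (free_alg X). g \<oplus>\<^bsub>free_alg X\<^esub> f = \<zero>\<^bsub>free_alg X\<^esub>"
      by (intro bexI[of _ "- f"]) (auto simp: free_alg_def)
  qed (use keys_add in \<open>fastforce simp: free_alg_def add_ac\<close>)+
  show "monoid (free_alg X)"
    by (rule monoidI) (auto simp: free_alg_def mult.assoc elim!: keys_times_letters; fastforce)+
qed (auto simp: free_alg_def algebra_simps)

lemma const_in_free_alg: "const c \<in> carrier (free_alg X)"
  by (simp add: free_alg_def const_def)

lemma gen_in_free_alg: "a \<in> A \<Longrightarrow> b \<in> A \<Longrightarrow> gen a b \<in> carrier (free_alg (A \<times> A))"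
  by (simp add: free_alg_def gen_def)

lemma koszul_sign_const: "koszul_sign a b c d = 1 \<or> koszul_sign a b c d = - 1"
  unfolding koszul_sign_def by (metis minus_one_power_iff)

lemma gl_relations_subset: "gl_relations A \<subseteq> carrier (free_alg (A \<times> A))"
proof -
  interpret ring "free_alg (A \<times> A)" by (rule ring_free_alg)
  let ?C = "carrier (free_alg (A \<times> A))"
  have mult: "x * y \<in> ?C" if "x \<in> ?C" "y \<in> ?C" for x y
    using m_closed[OF that] by (simp add: free_alg_def)
  have minus: "- x \<in> ?C" if "x \<in> ?C" for x
    using that by (simp add: free_alg_def)
  have diff: "x - y \<in> ?C" if "x \<in> ?C" "y \<in> ?C" for x y
    using add.m_closed[OF that(1) minus[OF that(2)]] by (simp add: free_alg_def)
  have scalar: "koszul_sign a b c d \<in> ?C" "of_bool P \<in> ?C" for a b c d P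
    using koszul_sign_const[of a b c d] by (auto simp: free_alg_def)
  show ?thesis
    unfolding gl_relations_def gl_bracket_def
    by (intro subsetI; elim CollectE exE conjE; hypsubst)
       (intro diff mult scalar gen_in_free_alg; assumption)
qed

lemma ideal_gl_ideal: "ideal (gl_ideal A) (free_alg (A \<times> A))"
  unfolding gl_ideal_def by (intro ring.genideal_ideal ring_free_alg gl_relations_subset)

lemma ring_U: "ring (U A)"
  unfolding U_def by (rule ideal.quotient_is_ring[OF ideal_gl_ideal])

lemma cls_ring_hom: "cls A \<in> ring_hom (free_alg (A \<times> A)) (U A)"
  using ideal.rcos_ring_hom[OF ideal_gl_ideal] by (simp add: U_def cls_def[abs_def])


section \<open>The center and the Capelli monomorphisms\<close>

definition center :: "('a, 'b) ring_scheme \<Rightarrow> 'a set" where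
  "center R = {z \<in> carrier R. \<forall>x\<in>carrier R. z \<otimes>\<^bsub>R\<^esub> x = x \<otimes>\<^bsub>R\<^esub> z}"

definition zeta :: "nat \<Rightarrow> tens set ring" where
  "zeta n = (U (proper n))\<lparr>carrier := center (U (proper n))\<rparr>"

definition zeta_filt :: "nat \<Rightarrow> nat \<Rightarrow> tens set set" where
  "zeta_filt n m = carrier (zeta n) \<inter> U_filt (proper n) m"

definition cdet :: "nat \<Rightarrow> (nat \<Rightarrow> nat \<Rightarrow> 'a::ring_1) \<Rightarrow> 'a" where
  "cdet k M =
     (\<Sum>\<sigma> | \<sigma> permutes {1..k}. of_int (sign \<sigma>) * prod_list (map (\<lambda>j. M (\<sigma> j) j) [1..<Suc k]))"

text \<open>The list \<open>is\<close> runs over the sequences \<open>1 \<le> i\<^sub>1 < \<dots> < i\<^sub>k \<le> n\<close>; lists are indexed from 0.\<close>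

definition capelli_H :: "nat \<Rightarrow> nat \<Rightarrow> tens set" where
  "capelli_H n k = cls (proper n)
     (\<Sum>is | length is = k \<and> sorted_wrt (<) is \<and> set is \<subseteq> {1..n}.
        cdet k (\<lambda>a b. gen (Prop (is ! (a - 1))) (Prop (is ! (b - 1)))
                      + of_bool (a = b) * of_nat (k - a)))"

text \<open>The algebra map \<open>\<zeta>(n) \<rightarrow> \<zeta>(n+1)\<close>; by Capelli's theorem exactly one function satisfies the
  description.\<close>

definition capelli_mono :: "nat \<Rightarrow> tens set \<Rightarrow> tens set" where
  "capelli_mono n = (THE \<phi>.
     \<phi> \<in> extensional (carrier (zeta n)) \<and>
     \<phi> \<in> ring_hom (zeta n) (zeta (n + 1)) \<and>
     (\<forall>c. \<forall>x\<in>carrier (zeta n). \<phi> (smul (proper n) c x) = smul (proper (n + 1)) c (\<phi> x)) \<and>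
     (\<forall>k\<in>{1..n}. \<phi> (capelli_H n k) = capelli_H (n + 1) k))"


section \<open>The virtual method\<close>

text \<open>A word \<open>[(a\<^sub>M, b\<^sub>M), \<dots>, (a\<^sub>1, b\<^sub>1)]\<close> stands for the product
  \<open>e\<^bsub>a\<^sub>M,b\<^sub>M\<^esub> \<cdots> e\<^bsub>a\<^sub>1,b\<^sub>1\<^esub>\<close>, so the indices \<open>j \<le> i\<close> are those of a suffix of the list.\<close>

definition irregular :: "(symb \<times> symb) list \<Rightarrow> bool" where
  "irregular w \<longleftrightarrow>
     (\<exists>u a b v \<gamma>. w = u @ (a, b) # v \<and> virtual \<gamma> \<and>
        count_list (map snd ((a, b) # v)) \<gamma> > count_list (map fst v) \<gamma>)"

definition left_ideal_gen :: "('a, 'b) ring_scheme \<Rightarrow> 'a set \<Rightarrow> 'a set" where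
  "left_ideal_gen R S =
     \<Inter>{J. additive_subgroup J R \<and> (\<forall>r\<in>carrier R. \<forall>x\<in>J. r \<otimes>\<^bsub>R\<^esub> x \<in> J) \<and> S \<subseteq> J}"

definition Irr :: "nat \<Rightarrow> nat \<Rightarrow> nat \<Rightarrow> tens set set" where
  "Irr m0 m1 n = left_ideal_gen (U (alphabet m0 m1 n))
     {cls (alphabet m0 m1 n) (prod_list (map (\<lambda>(a, b). gen a b) w)) | w.
        set w \<subseteq> alphabet m0 m1 n \<times> alphabet m0 m1 n \<and> irregular w}"

text \<open>The embedding of \<open>U(gl(n))\<close> into \<open>U(gl(m\<^sub>0|m\<^sub>1+n))\<close> induced by the inclusion of the Lie
  algebras: it maps the coset of \<open>f\<close> to the (larger) coset of \<open>f\<close>.\<close>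

definition U_incl :: "nat \<Rightarrow> nat \<Rightarrow> nat \<Rightarrow> tens set \<Rightarrow> tens set" where
  "U_incl m0 m1 n x = the_elem (cls (alphabet m0 m1 n) ` x)"

text \<open>The projection \<open>\<pp>\<close> of \<open>Virt(m\<^sub>0+m\<^sub>1,n) = U(gl(n)) \<oplus> Irr\<close> onto the first summand; it is
  meaningful only on elements \<open>x\<close> of this direct sum.\<close>

definition virt_proj :: "nat \<Rightarrow> nat \<Rightarrow> nat \<Rightarrow> tens set \<Rightarrow> tens set" where
  "virt_proj m0 m1 n x = (THE y. y \<in> carrier (U (proper n)) \<and>
     (\<exists>z\<in>Irr m0 m1 n. x = U_incl m0 m1 n y \<oplus>\<^bsub>U (alphabet m0 m1 n)\<^esub> z))"

abbreviation \<pp> :: "nat \<Rightarrow> nat \<Rightarrow> nat \<Rightarrow> tens \<Rightarrow> tens set" where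
  "\<pp> m0 m1 n f \<equiv> virt_proj m0 m1 n (cls (alphabet m0 m1 n) f)"


section \<open>Partitions and tableaux\<close>

definition is_partition :: "nat list \<Rightarrow> bool" where
  "is_partition lam \<longleftrightarrow> sorted_wrt (\<ge>) lam \<and> 0 \<notin> set lam"

definition conjugate :: "nat list \<Rightarrow> nat list" where
  "conjugate lam =
     map (\<lambda>j. length (filter (\<lambda>r. j < r) lam)) [0..<(if lam = [] then 0 else hd lam)]"

definition hook_product :: "nat list \<Rightarrow> nat" where
  "hook_product lam = (\<Prod>i<length lam. \<Prod>j<lam ! i.
     (lam ! i - Suc j) + (conjugate lam ! j - Suc i) + 1)"

text \<open>A tableau is the list of its rows.\<close>

definition tableaux :: "nat list \<Rightarrow> nat \<Rightarrow> nat list list set" where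
  "tableaux lam n = {S. map length S = lam \<and> set (concat S) \<subseteq> {1..n}}"

definition column :: "'a list list \<Rightarrow> nat \<Rightarrow> 'a list" where
  "column S j = map (\<lambda>r. r ! j) (filter (\<lambda>r. j < length r) S)"

definition row_strict_tableaux :: "nat list \<Rightarrow> nat \<Rightarrow> nat list list set" where
  "row_strict_tableaux lam n = {S \<in> tableaux lam n. \<forall>r\<in>set S. sorted_wrt (<) r}"

definition column_weak_tableaux :: "nat list \<Rightarrow> nat \<Rightarrow> nat list list set" where
  "column_weak_tableaux lam n = {S \<in> tableaux lam n. \<forall>j. sorted_wrt (\<le>) (column S j)}"

definition col_mult_fact :: "nat list list \<Rightarrow> nat" where
  "col_mult_fact S = (\<Prod>j<length (conjugate (map length S)). \<Prod>s\<in>set (column S j).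
     fact (count_list (column S j) s))"

definition prop_tab :: "nat list list \<Rightarrow> symb list list" where
  "prop_tab S = map (map Prop) S"

definition C_tab :: "nat list \<Rightarrow> symb list list" where
  "C_tab lam = map (\<lambda>i. replicate (lam ! i) (Alpha (Suc i))) [0..<length lam]"

definition D_tab :: "nat list \<Rightarrow> symb list list" where
  "D_tab lam = map (\<lambda>r. map (\<lambda>j. Beta (Suc j)) [0..<r]) lam"

definition tab_prod :: "symb list list \<Rightarrow> symb list list \<Rightarrow> tens" where
  "tab_prod S T = prod_list (map2 gen (concat S) (concat T))"


section \<open>The central elements\<close>

text \<open>The parameters \<open>m0\<close>, \<open>m1\<close> (and the choice of \<open>\<beta>\<close>, given by its index \<open>b\<close>) are those of the
  superalgebra \<open>gl(m\<^sub>0|m\<^sub>1+n)\<close> in which the virtual monomials are formed. Multi-indices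
  \<open>(h\<^sub>1, \<dots>, h\<^sub>n)\<close> are functions on \<open>{1..n}\<close>. For \<open>lam = []\<close> the only tableau is \<open>[]\<close> and all
  products are empty, which gives the value 1.\<close>

definition elt_I :: "nat \<Rightarrow> nat \<Rightarrow> nat \<Rightarrow> nat \<Rightarrow> nat \<Rightarrow> tens set" where
  "elt_I m0 m1 b k n =
     (\<Oplus>\<^bsub>U (proper n)\<^esub>h\<in>{h \<in> {1..n} \<rightarrow>\<^sub>E UNIV. (\<Sum>i=1..n. h i) = k}.
        smul (proper n) (1 / (\<Prod>i=1..n. fact (h i)))
          (\<pp> m0 m1 n
            (prod_list (map (\<lambda>i. gen (Prop i) (Beta b) ^ h i) (rev [1..<Suc n])) *
             prod_list (map (\<lambda>i. gen (Beta b) (Prop i) ^ h i) [1..<Suc n]))))"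

definition elt_K :: "nat \<Rightarrow> nat \<Rightarrow> nat list \<Rightarrow> nat \<Rightarrow> tens set" where
  "elt_K m0 m1 lam n =
     (\<Oplus>\<^bsub>U (proper n)\<^esub>S\<in>row_strict_tableaux lam n.
        \<pp> m0 m1 n (tab_prod (prop_tab S) (C_tab lam) * tab_prod (C_tab lam) (prop_tab S)))"

definition elt_J :: "nat \<Rightarrow> nat \<Rightarrow> nat list \<Rightarrow> nat \<Rightarrow> tens set" where
  "elt_J m0 m1 lam n =
     (\<Oplus>\<^bsub>U (proper n)\<^esub>S\<in>column_weak_tableaux (conjugate lam) n.
        smul (proper n) (1 / of_nat (col_mult_fact S))
          (\<pp> m0 m1 n (tab_prod (prop_tab S) (D_tab (conjugate lam)) *
                      tab_prod (D_tab (conjugate lam)) (prop_tab S))))"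

definition elt_S :: "nat \<Rightarrow> nat \<Rightarrow> nat list \<Rightarrow> nat \<Rightarrow> tens set" where
  "elt_S m0 m1 lam n =
     smul (proper n) (1 / of_nat (hook_product lam))
       (\<Oplus>\<^bsub>U (proper n)\<^esub>S\<in>row_strict_tableaux lam n.
          \<pp> m0 m1 n (tab_prod (prop_tab S) (C_tab lam) * tab_prod (C_tab lam) (D_tab lam) *
                      tab_prod (D_tab lam) (C_tab lam) * tab_prod (C_tab lam) (prop_tab S)))"

end

theory Submission
imports Defs "HOL-Analysis.Analysis" "Jordan_Normal_Form.Determinant" "HOL-Combinatorics.Multiset_Permutations"
begin

text \<open>
  The enveloping superalgebra acts on series in supercommuting variables \<open>(a|j)\<close>, \<open>j\<close> proper, where
  \<open>e\<^bsub>a,b\<^esub>\<close> acts by the polarization replacing the row symbol \<open>b\<close> by \<open>a\<close> plus, if \<open>b\<close> is proper,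
  multiplication by \<open>(a|b)\<close>. Let \<open>vac n f\<close> be the result of applying \<open>f\<close> to the series 1. Irregular monomials
  annihilate 1, so the virtual projection does not change \<open>vac\<close>; on \<open>U(gl(n))\<close> the map \<open>vac n\<close> is injective, by
  the Poincare-Birkhoff-Witt theorem; and an element of \<open>U(gl(n))\<close> is central if and only if row and column
  polarizations agree on its image.

  The top component of the image of a central element is a conjugation invariant polynomial of an \<open>n \<times> n\<close>
  matrix. Such a polynomial is determined by its values on companion matrices, where the symbols of the
  Capelli elements are the coordinates up to sign. Hence a central element of degree \<open>m\<close> is a polynomial of
  weight at most \<open>m\<close> in the Capelli elements, and these are algebraically independent.

  On \<open>U(gl(n+1))\<close> the map \<open>vac n\<close> kills the monomials ending in \<open>e\<^bsub>i,n+1\<^esub>\<close>, and so plays the role of the Olshanski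
  projection. It maps \<open>H\<^sub>k(n+1)\<close> to the same image as \<open>H\<^sub>k(n)\<close>, and therefore inverts the Capelli monomorphism
  in degrees at most \<open>n\<close>. In each of the four families the summands of the element for \<open>n + 1\<close> that involve
  the symbol \<open>n + 1\<close> are killed, and the others are the summands of the element for \<open>n\<close>.
\<close>

section \<open>Substitution homomorphisms\<close>

text \<open>The supercommutative algebra is realized inside the signed shuffle algebra, whose
  elements are plain functions on words. The operators are then recursions on words, no quotient has
  to be formed, and identities between them are checked letter by letter; the factors
  \<open>fact m\<close> below measure the difference between shuffle and ordinary products.
  \<open>virt_proj\<close> and \<open>capelli_mono\<close> are definite descriptions, so each calls
  for existence and uniqueness. For the first, existence is a rewriting of balanced words and
  uniqueness is injectivity of \<open>vac n\<close>; for the second, existence rests on independence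
  of the Capelli elements and uniqueness on their generating the center. One tensor has a vector
  \<open>vac n'\<close> for every n', and this links consecutive sizes: elements of U(gl(n+1)) are
  tested for centrality with \<open>vac (n + 1)\<close> and compared with elements of U(gl(n)) by
  \<open>vac n\<close>. The degree bound keeps out H_{n+1}(n+1), the one generator that is not in
  the image of the monomorphism.\<close>

definition word :: "'a list \<Rightarrow> ('a fword \<Rightarrow>\<^sub>0 complex)" where
  "word w = Poly_Mapping.single (FWord w) 1"

lemma word_Nil [simp]: "word [] = 1"
  by (simp add: word_def zero_fword_def[symmetric] single_one)

lemma word_append: "word (u @ v) = word u * word v"
  by (simp add: word_def mult_single plus_fword_def)

lemma word_Cons: "word (x # w) = word [x] * word w"
  using word_append[of "[x]" w] by simp

lemma gen_word: "gen a b = word [(a, b)]"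
  by (simp add: gen_def word_def)

lemma const_mult: "const c * Poly_Mapping.single w d = Poly_Mapping.single w (c * d)"
  by (simp add: const_def mult_single)

lemma single_eq_const_word: "Poly_Mapping.single w c = const c * word (letters w)"
  by (simp add: const_mult word_def)

lemma tens_expand: "f = (\<Sum>w\<in>Poly_Mapping.keys f. const (Poly_Mapping.lookup f w) * word (letters w))"
proof -
  have "f = (\<Sum>w\<in>Poly_Mapping.keys f. Poly_Mapping.single w (Poly_Mapping.lookup f w))"
    by (rule poly_mapping_eqI)
       (auto simp: lookup_sum lookup_single when_def in_keys_iff sum.delta)
  then show ?thesis by (simp only: single_eq_const_word)
qed

lemma tens_induct [case_names zero add]:
  assumes "P 0" "\<And>c w f. P f \<Longrightarrow> P (const c * word w + f)"
  shows "P f"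
proof -
  have "P (\<Sum>w\<in>A. const (Poly_Mapping.lookup f w) * word (letters w))" if "finite A" for A
    using that by (induction A) (auto intro: assms)
  then show ?thesis using tens_expand[of f] by (metis finite_keys)
qed

lemma const_commute: "const c * f = f * const c"
proof (induction f rule: tens_induct)
  case (add d w f)
  have "const c * (const d * word w) = const d * word w * const c"
    by (simp add: word_def const_def mult_single mult.commute)
  then show ?case using add by (simp add: distrib_left distrib_right)
qed simp

lemma const_hom: "const (c + d) = const c + const d" "const (c * d) = const c * const d" "const 1 = 1"
  "const 0 = 0" "const (- c) = - const c"
  by (simp_all add: const_def single_add mult_single single_one single_uminus)

lemma const_sum: "const (sum g I) = (\<Sum>i\<in>I. const (g i))"
  by (induction I rule: infinite_finite_induct) (auto simp: const_hom)

lemma word_mult_expand: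
  "word [x] * f = (\<Sum>w\<in>Poly_Mapping.keys f. const (Poly_Mapping.lookup f w) * word (x # letters w))"
proof -
  have "word [x] * (const c * word w) = const c * word (x # w)" for c w
    by (metis const_commute mult.assoc word_Cons)
  then have "word [x] * (\<Sum>w\<in>Poly_Mapping.keys f. const (Poly_Mapping.lookup f w) * word (letters w)) =
      (\<Sum>w\<in>Poly_Mapping.keys f. const (Poly_Mapping.lookup f w) * word (x # letters w))"
    by (simp only: sum_distrib_left)
  then show ?thesis by (simp only: tens_expand[symmetric])
qed

text \<open>The structure map of a complex algebra on the target, passed as an argument because the
  class \<open>ring_1\<close> carries no scalars. The targets are tensors, operators and complex
  numbers.\<close>

definition scalar_emb :: "(complex \<Rightarrow> 'r::ring_1) \<Rightarrow> bool" where
  "scalar_emb e \<longleftrightarrow> e 1 = 1 \<and> (\<forall>c d. e (c + d) = e c + e d) \<and> (\<forall>c d. e (c * d) = e c * e d) \<and>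
     (\<forall>c x. e c * x = x * e c)"

text \<open>The homomorphism that the universal property of the free algebra attaches to the
  assignment \<open>g\<close>.\<close>

definition subst :: "(complex \<Rightarrow> 'r::ring_1) \<Rightarrow> ('a \<Rightarrow> 'r) \<Rightarrow> ('a fword \<Rightarrow>\<^sub>0 complex) \<Rightarrow> 'r" where
  "subst e g f = (\<Sum>w\<in>Poly_Mapping.keys f. e (Poly_Mapping.lookup f w) * prod_list (map g (letters w)))"

lemma scalar_embD:
  assumes "scalar_emb e"
  shows "e 1 = 1" "e (c + d) = e c + e d" "e (c * d) = e c * e d" "e c * x = x * e c"
  using assms unfolding scalar_emb_def by blast+

lemma scalar_emb_zero: "scalar_emb e \<Longrightarrow> e 0 = 0"
  using scalar_embD(2)[of e 0 0] by simp

lemma subst_superset: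
  assumes "scalar_emb e" "finite A" "Poly_Mapping.keys f \<subseteq> A"
  shows "subst e g f = (\<Sum>w\<in>A. e (Poly_Mapping.lookup f w) * prod_list (map g (letters w)))"
  unfolding subst_def
  by (rule sum.mono_neutral_left) (use assms in \<open>auto simp: in_keys_iff scalar_emb_zero\<close>)

lemma subst_zero [simp]: "subst e g 0 = 0"
  by (simp add: subst_def)

lemma subst_add:
  assumes "scalar_emb e"
  shows "subst e g (f + h) = subst e g f + subst e g h"
proof -
  let ?A = "Poly_Mapping.keys f \<union> Poly_Mapping.keys h"
  have "Poly_Mapping.keys (f + h) \<subseteq> ?A" by (rule keys_add)
  then show ?thesis
    using assms by (simp add: subst_superset[OF assms, of ?A] lookup_add scalar_embD(2)
        distrib_right sum.distrib)
qed

lemma subst_const_word: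
  assumes "scalar_emb e"
  shows "subst e g (const c * word w) = e c * prod_list (map g w)"
proof -
  have "const c * word w = Poly_Mapping.single (FWord w) c" by (simp add: single_eq_const_word)
  then show ?thesis
    using assms by (simp add: subst_superset[OF assms, of "{FWord w}"])
qed

lemma subst_word: "scalar_emb e \<Longrightarrow> subst e g (word w) = prod_list (map g w)"
  using subst_const_word[of e g 1 w] by (simp add: const_def scalar_embD(1))

lemma subst_const: "scalar_emb e \<Longrightarrow> subst e g (const c) = e c"
  using subst_const_word[of e g c "[]"] by simp

lemma subst_one: "scalar_emb e \<Longrightarrow> subst e g 1 = 1"
  using subst_word[of e g "[]"] by simp

lemma scalar_emb_const: "scalar_emb const"
  unfolding scalar_emb_def by (intro conjI allI const_hom const_commute)

lemma scalar_emb_id: "scalar_emb (\<lambda>c::complex. c)"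
  by (simp add: scalar_emb_def)

lemma subst_mult:
  assumes "scalar_emb e"
  shows "subst e g (f * h) = subst e g f * subst e g h"
proof (induction f rule: tens_induct)
  case (add c w f)
  have "subst e g (const c * word w * h) = subst e g (const c * word w) * subst e g h"
  proof (induction h rule: tens_induct)
    case (add d v h)
    have "const c * word w * (const d * word v) = const c * (word w * const d) * word v"
      by (simp only: mult.assoc)
    also have "\<dots> = const c * (const d * word w) * word v" by (simp only: const_commute[symmetric])
    finally have "const c * word w * (const d * word v) = const (c * d) * word (w @ v)"
      by (simp only: const_hom(2) word_append mult.assoc)
    moreover have "e c * prod_list (map g w) * (e d * prod_list (map g v)) =
        e (c * d) * prod_list (map g (w @ v))"
    proof -
      have "e c * prod_list (map g w) * (e d * prod_list (map g v)) =
          e c * (prod_list (map g w) * e d) * prod_list (map g v)"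
        by (simp only: mult.assoc)
      also have "\<dots> = e c * (e d * prod_list (map g w)) * prod_list (map g v)"
        by (simp only: scalar_embD(4)[OF assms])
      finally show ?thesis by (simp only: scalar_embD(3)[OF assms] map_append prod_list.append mult.assoc)
    qed
    ultimately show ?case
      using add by (simp add: distrib_left subst_add[OF assms] subst_const_word[OF assms])
  qed simp
  then show ?case using add by (simp add: distrib_right subst_add[OF assms])
qed simp

lemma subst_uminus: "scalar_emb e \<Longrightarrow> subst e g (- f) = - subst e g f"
  using subst_add[of e g f "- f"] minus_unique[of "subst e g f" "subst e g (- f)"] by simp

lemma subst_diff: "scalar_emb e \<Longrightarrow> subst e g (f - h) = subst e g f - subst e g h"
  using subst_add[of e g f "- h"] by (simp only: subst_uminus diff_conv_add_uminus)

lemma subst_sum: "scalar_emb e \<Longrightarrow> subst e g (\<Sum>i\<in>I. f i) = (\<Sum>i\<in>I. subst e g (f i))"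
  by (induction I rule: infinite_finite_induct) (auto simp: subst_add)

lemma subst_prod_list: "scalar_emb e \<Longrightarrow> subst e g (prod_list fs) = prod_list (map (subst e g) fs)"
  by (induction fs) (auto simp: subst_mult subst_one)

section \<open>Linear operators on functions of words\<close>

type_synonym 'a vec = "'a list \<Rightarrow> complex"

definition is_linear :: "('a vec \<Rightarrow> 'a vec) \<Rightarrow> bool" where
  "is_linear T \<longleftrightarrow> (\<forall>u v. T (\<lambda>w. u w + v w) = (\<lambda>w. T u w + T v w)) \<and>
     (\<forall>c v. T (\<lambda>w. c * v w) = (\<lambda>w. c * T v w))"

text \<open>Operators are made a type to obtain an instance of \<open>ring_1\<close>, so that
  \<open>subst\<close> can evaluate tensors in them.\<close>

typedef 'a lop = "{T :: 'a vec \<Rightarrow> 'a vec. is_linear T}"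
  morphisms app Lop
  by (rule exI[of _ "\<lambda>v. v"]) (simp add: is_linear_def)

setup_lifting type_definition_lop

instantiation lop :: (type) ring_1
begin
lift_definition zero_lop :: "'a lop" is "\<lambda>v w. 0" by (simp add: is_linear_def)
lift_definition one_lop :: "'a lop" is "\<lambda>v. v" by (simp add: is_linear_def)
lift_definition plus_lop :: "'a lop \<Rightarrow> 'a lop \<Rightarrow> 'a lop" is "\<lambda>S T v w. S v w + T v w"
  by (auto simp: is_linear_def algebra_simps)
lift_definition minus_lop :: "'a lop \<Rightarrow> 'a lop \<Rightarrow> 'a lop" is "\<lambda>S T v w. S v w - T v w"
  by (auto simp: is_linear_def algebra_simps)
lift_definition uminus_lop :: "'a lop \<Rightarrow> 'a lop" is "\<lambda>T v w. - T v w"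
  by (auto simp: is_linear_def algebra_simps)
lift_definition times_lop :: "'a lop \<Rightarrow> 'a lop \<Rightarrow> 'a lop" is "\<lambda>S T v. S (T v)"
  by (auto simp: is_linear_def)
instance
proof
  have "v = (\<lambda>w. 0)" if "\<And>w. v w = 0" for v :: "'a vec" using that by auto
  show "(0::'a lop) \<noteq> 1"
    by transfer (metis one_neq_zero)
qed (transfer; auto simp: is_linear_def algebra_simps fun_eq_iff; fail)+
end

lemma app_linear: "app T (\<lambda>w. u w + v w) = (\<lambda>w. app T u w + app T v w)"
  "app T (\<lambda>w. c * v w) = (\<lambda>w. c * app T v w)"
  using app[of T] by (auto simp: is_linear_def)

lemma app_zero: "app T (\<lambda>w. 0) = (\<lambda>w. 0)"
  using app_linear(2)[of T 0 "\<lambda>w. 0"] by simp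

lemma app_sum: "app T (\<lambda>w. \<Sum>i\<in>I. v i w) = (\<lambda>w. \<Sum>i\<in>I. app T (v i) w)"
  by (induction I rule: infinite_finite_induct) (auto simp: app_zero app_linear)

lemma lop_eqI: "(\<And>v w. app S v w = app T v w) \<Longrightarrow> S = T"
  by (metis app_inject ext)

lemma app_simps [simp]: "app 0 v = (\<lambda>w. 0)" "app 1 v = v" "app (S + T) v = (\<lambda>w. app S v w + app T v w)"
  "app (S - T) v = (\<lambda>w. app S v w - app T v w)" "app (- T) v = (\<lambda>w. - app T v w)"
  "app (S * T) v = app S (app T v)"
  by (transfer; simp)+

lift_definition scal :: "complex \<Rightarrow> 'a lop" is "\<lambda>c v w. c * v w"
  by (auto simp: is_linear_def algebra_simps)

lemma app_scal [simp]: "app (scal c) v = (\<lambda>w. c * v w)"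
  by transfer simp

lemma app_sum_op: "app (\<Sum>i\<in>I. T i) v = (\<lambda>w. \<Sum>i\<in>I. app (T i) v w)"
  by (induction I rule: infinite_finite_induct) auto

lemma scalar_emb_scal: "scalar_emb scal"
  by (auto simp: scalar_emb_def intro!: lop_eqI simp: app_linear algebra_simps)

section \<open>A module over the enveloping algebra\<close>

type_synonym letter = "symb \<times> symb"

text \<open>
  A function on words of letters \<open>(a, j)\<close> lists the coefficients of a series in supercommuting variables
  \<open>(a|j)\<close>. On these series \<open>Dfun a b\<close> is the polarization replacing the row symbol \<open>b\<close> by \<open>a\<close>, \<open>Rfun i j\<close> the
  one replacing the column symbol \<open>i\<close> by \<open>j\<close>, and \<open>Sfun x\<close> is multiplication by the variable \<open>x\<close>, that is,
  a signed shuffle. Column symbols are proper, hence the parity of a letter.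
\<close>

definition letter_par :: "letter \<Rightarrow> nat" where
  "letter_par x = parity (fst x) + 1"

definition ksign :: "nat \<Rightarrow> nat \<Rightarrow> complex" where
  "ksign m n = (-1) ^ (m * n)"

text \<open>The recursion runs over the word at which a coefficient is read: it collects the
  coefficients of the words in which one letter with row \<open>a\<close> is changed back to row
  \<open>b\<close>. The sign comes from moving the operator past the letters in front.\<close>

fun Dfun :: "symb \<Rightarrow> symb \<Rightarrow> letter vec \<Rightarrow> letter vec" where
  "Dfun a b v [] = 0"
| "Dfun a b v (y # w) = of_bool (fst y = a) * v ((b, snd y) # w)
     + ksign (parity a + parity b) (letter_par y) * Dfun a b (\<lambda>u. v (y # u)) w"

fun Sfun :: "letter \<Rightarrow> letter vec \<Rightarrow> letter vec" where
  "Sfun x v [] = 0"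
| "Sfun x v (y # w) = of_bool (x = y) * v w
     + ksign (letter_par x) (letter_par y) * Sfun x (\<lambda>u. v (y # u)) w"

fun Rfun :: "symb \<Rightarrow> symb \<Rightarrow> letter vec \<Rightarrow> letter vec" where
  "Rfun i j v [] = 0"
| "Rfun i j v (y # w) = of_bool (snd y = j) * v ((fst y, i) # w) + Rfun i j (\<lambda>u. v (y # u)) w"

lemma linear_Dfun: "is_linear (Dfun a b)"
proof -
  have "Dfun a b (\<lambda>w. u w + v w) w = Dfun a b u w + Dfun a b v w" for u v w
    by (induction w arbitrary: u v) (auto simp: algebra_simps)
  moreover have "Dfun a b (\<lambda>w. c * v w) w = c * Dfun a b v w" for c v w
    by (induction w arbitrary: v) (auto simp: algebra_simps)
  ultimately show ?thesis by (simp add: is_linear_def fun_eq_iff)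
qed

lemma linear_Sfun: "is_linear (Sfun x)"
proof -
  have "Sfun x (\<lambda>w. u w + v w) w = Sfun x u w + Sfun x v w" for u v w
    by (induction w arbitrary: u v) (auto simp: algebra_simps)
  moreover have "Sfun x (\<lambda>w. c * v w) w = c * Sfun x v w" for c v w
    by (induction w arbitrary: v) (auto simp: algebra_simps)
  ultimately show ?thesis by (simp add: is_linear_def fun_eq_iff)
qed

lemma linear_Rfun: "is_linear (Rfun i j)"
proof -
  have "Rfun i j (\<lambda>w. u w + v w) w = Rfun i j u w + Rfun i j v w" for u v w
    by (induction w arbitrary: u v) (auto simp: algebra_simps)
  moreover have "Rfun i j (\<lambda>w. c * v w) w = c * Rfun i j v w" for c v w
    by (induction w arbitrary: v) (auto simp: algebra_simps)
  ultimately show ?thesis by (simp add: is_linear_def fun_eq_iff)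
qed

lift_definition DD :: "symb \<Rightarrow> symb \<Rightarrow> letter lop" is Dfun by (rule linear_Dfun)
lift_definition SS :: "letter \<Rightarrow> letter lop" is Sfun by (rule linear_Sfun)
lift_definition RR :: "symb \<Rightarrow> symb \<Rightarrow> letter lop" is Rfun by (rule linear_Rfun)

definition sg :: "nat \<Rightarrow> nat \<Rightarrow> letter lop" where "sg m n = scal (ksign m n)"

lemma sg_eq: "sg m n = (-1) ^ (m * n)"
proof -
  have "scal ((-1) ^ k) = ((-1) ^ k :: letter lop)" for k
  proof (induction k)
    case 0
    show ?case by (rule lop_eqI) simp
  next
    case (Suc k)
    have "scal ((-1) ^ Suc k) = - scal ((-1) ^ k)" by (rule lop_eqI) simp
    then show ?case using Suc by (metis power_Suc mult_minus1)
  qed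
  then show ?thesis by (simp add: sg_def ksign_def)
qed

lemma Dfun_linear:
  "Dfun a b (\<lambda>u. f u + g u) w = Dfun a b f w + Dfun a b g w"
  "Dfun a b (\<lambda>u. c * f u) w = c * Dfun a b f w"
  "Dfun a b (\<lambda>u. 0) w = 0"
  using app_linear[of "DD a b"] app_zero[of "DD a b"] by (simp_all add: DD.rep_eq fun_eq_iff)

lemma Sfun_linear:
  "Sfun x (\<lambda>u. f u + g u) w = Sfun x f w + Sfun x g w"
  "Sfun x (\<lambda>u. c * f u) w = c * Sfun x f w"
  "Sfun x (\<lambda>u. 0) w = 0"
  using app_linear[of "SS x"] app_zero[of "SS x"] by (simp_all add: SS.rep_eq fun_eq_iff)

lemma Rfun_linear:
  "Rfun i j (\<lambda>u. f u + g u) w = Rfun i j f w + Rfun i j g w"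
  "Rfun i j (\<lambda>u. c * f u) w = c * Rfun i j f w"
  "Rfun i j (\<lambda>u. 0) w = 0"
  using app_linear[of "RR i j"] app_zero[of "RR i j"] by (simp_all add: RR.rep_eq fun_eq_iff)

lemma ksign_commute: "ksign m n = ksign n m"
  by (simp add: ksign_def mult.commute)

lemma letter_par_pair: "letter_par (a, b) = parity a + 1"
  by (simp add: letter_par_def)

text \<open>After splitting off the first letter, the terms outside the induction hypothesis are
  those in which that letter is changed once or twice. The sign identities 1 to 4 compare the parity
  of this letter before and after the change.\<close>

lemma Dfun_Dfun: "Dfun a b (Dfun c d v) w =
    ksign (parity a + parity b) (parity c + parity d) * Dfun c d (Dfun a b v) w
    + of_bool (b = c) * Dfun a d v w
    - ksign (parity a + parity b) (parity c + parity d) * of_bool (a = d) * Dfun c b v w"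
proof (induction w arbitrary: v)
  case (Cons y w)
  obtain p j where y: "y = (p, j)" by (cases y)
  define s where "s = ksign (parity a + parity b) (parity c + parity d)"
  define sy where "sy = ksign (parity a + parity b) (letter_par y)"
  define ty where "ty = ksign (parity c + parity d) (letter_par y)"
  define e1 where "e1 = ksign (parity c + parity d) (letter_par (b, j))"
  define e2 where "e2 = ksign (parity a + parity b) (letter_par (d, j))"
  define e3 where "e3 = ksign (parity a + parity d) (letter_par y)"
  define e4 where "e4 = ksign (parity c + parity b) (letter_par y)"
  note defs = s_def sy_def ty_def e1_def e2_def e3_def e4_def y letter_par_pair
  have 1: "p = a \<longrightarrow> e1 = s * ty"
    by (auto simp: defs ksign_def minus_one_power_iff)
  have 2: "p = c \<longrightarrow> sy = s * e2"
    by (auto simp: defs ksign_def minus_one_power_iff)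
  have 3: "b = c \<longrightarrow> e3 = sy * ty"
    by (auto simp: defs ksign_def minus_one_power_iff)
  have 4: "a = d \<longrightarrow> e4 = sy * ty"
    by (auto simp: defs ksign_def minus_one_power_iff)
  let ?v = "\<lambda>q u. v ((q, j) # u)"
  have "Dfun a b (Dfun c d v) (y # w) =
      of_bool (p = a) * (of_bool (b = c) * v ((d, j) # w) + e1 * Dfun c d (?v b) w)
      + sy * (of_bool (p = c) * Dfun a b (?v d) w + ty * Dfun a b (Dfun c d (?v p)) w)"
    by (simp add: y e1_def sy_def ty_def Dfun_linear)
  also have "Dfun a b (Dfun c d (?v p)) w = s * Dfun c d (Dfun a b (?v p)) w
      + of_bool (b = c) * Dfun a d (?v p) w - s * of_bool (a = d) * Dfun c b (?v p) w"
    unfolding s_def by (rule Cons.IH)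
  also have "of_bool (p = a) * (of_bool (b = c) * v ((d, j) # w) + e1 * Dfun c d (?v b) w)
      + sy * (of_bool (p = c) * Dfun a b (?v d) w + ty * (s * Dfun c d (Dfun a b (?v p)) w
      + of_bool (b = c) * Dfun a d (?v p) w - s * of_bool (a = d) * Dfun c b (?v p) w)) =
      s * (of_bool (p = c) * (of_bool (d = a) * v ((b, j) # w) + e2 * Dfun a b (?v d) w)
         + ty * (of_bool (p = a) * Dfun c d (?v b) w + sy * Dfun c d (Dfun a b (?v p)) w))
      + of_bool (b = c) * (of_bool (p = a) * v ((d, j) # w) + e3 * Dfun a d (?v p) w)
      - s * of_bool (a = d) * (of_bool (p = c) * v ((b, j) # w) + e4 * Dfun c b (?v p) w)"
    using 1 2 3 4
    by (cases "p = a"; cases "p = c"; cases "b = c"; cases "a = d"; simp add: algebra_simps)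
  also have "\<dots> = s * Dfun c d (Dfun a b v) (y # w) + of_bool (b = c) * Dfun a d v (y # w)
      - s * of_bool (a = d) * Dfun c b v (y # w)"
    by (simp add: y e2_def e3_def e4_def sy_def ty_def Dfun_linear)
  finally show ?case by (simp only: s_def)
qed simp

text \<open>Polarization is a superderivation of the signed shuffle product; the second summand is
  its value on the variable \<open>x\<close> itself.\<close>

lemma Dfun_Sfun: "Dfun a b (Sfun x v) w =
    ksign (parity a + parity b) (letter_par x) * Sfun x (Dfun a b v) w
    + of_bool (b = fst x) * Sfun (a, snd x) v w"
proof (induction w arbitrary: v)
  case (Cons y w)
  obtain p j where y: "y = (p, j)" by (cases y)
  obtain q l where x: "x = (q, l)" by (cases x)
  define s where "s = ksign (parity a + parity b) (letter_par x)"
  define sy where "sy = ksign (parity a + parity b) (letter_par y)"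
  define ty where "ty = ksign (letter_par x) (letter_par y)"
  define e1 where "e1 = ksign (letter_par x) (letter_par (b, j))"
  define e2 where "e2 = ksign (letter_par (a, l)) (letter_par y)"
  note defs = s_def sy_def ty_def e1_def e2_def y x letter_par_pair
  have 1: "p = a \<longrightarrow> e1 = s * ty"
    by (auto simp: defs ksign_def minus_one_power_iff)
  have 2: "p = q \<and> j = l \<longrightarrow> s = sy"
    by (auto simp: defs)
  have 3: "b = q \<longrightarrow> e2 = sy * ty"
    by (auto simp: defs ksign_def minus_one_power_iff)
  let ?v = "\<lambda>q u. v ((q, j) # u)"
  have "Dfun a b (Sfun x v) (y # w) =
      of_bool (p = a) * (of_bool (q = b \<and> l = j) * v w + e1 * Sfun x (?v b) w)
      + sy * (of_bool (p = q \<and> j = l) * Dfun a b v w + ty * Dfun a b (Sfun x (?v p)) w)"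
    by (auto simp add: y x e1_def sy_def ty_def Dfun_linear)
  also have "Dfun a b (Sfun x (?v p)) w = s * Sfun x (Dfun a b (?v p)) w
      + of_bool (b = q) * Sfun (a, l) (?v p) w"
    using Cons.IH[of "?v p"] by (simp add: s_def x)
  also have "of_bool (p = a) * (of_bool (q = b \<and> l = j) * v w + e1 * Sfun x (?v b) w)
      + sy * (of_bool (p = q \<and> j = l) * Dfun a b v w + ty * (s * Sfun x (Dfun a b (?v p)) w
      + of_bool (b = q) * Sfun (a, l) (?v p) w)) =
      s * (of_bool (p = q \<and> j = l) * Dfun a b v w
          + ty * (of_bool (p = a) * Sfun x (?v b) w + sy * Sfun x (Dfun a b (?v p)) w))
      + of_bool (b = q) * (of_bool (p = a \<and> l = j) * v w + e2 * Sfun (a, l) (?v p) w)"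
    using 1 2 3
    by (cases "p = a"; cases "p = q"; cases "b = q"; cases "j = l"; simp add: x algebra_simps)
  also have "\<dots> = s * Sfun x (Dfun a b v) (y # w) + of_bool (b = fst x) * Sfun (a, snd x) v (y # w)"
    by (auto simp add: y x e2_def sy_def ty_def Sfun_linear)
  finally show ?case by (simp only: s_def)
qed simp

lemma Sfun_Sfun: "Sfun x (Sfun z v) w = ksign (letter_par x) (letter_par z) * Sfun z (Sfun x v) w"
proof (induction w arbitrary: v)
  case (Cons y w)
  define s where "s = ksign (letter_par x) (letter_par z)"
  define sx where "sx = ksign (letter_par x) (letter_par y)"
  define sz where "sz = ksign (letter_par z) (letter_par y)"
  have 1: "x = y \<longrightarrow> s * (sz * c) = c" for c
    by (auto simp: s_def sz_def ksign_def minus_one_power_iff)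
  have 2: "z = y \<longrightarrow> s = sx"
    by (auto simp: s_def sx_def)
  let ?v = "\<lambda>u. v (y # u)"
  have "Sfun x (Sfun z v) (y # w) = of_bool (x = y) * Sfun z v w
      + sx * (of_bool (z = y) * Sfun x v w + sz * Sfun x (Sfun z ?v) w)"
    by (simp add: sx_def sz_def Sfun_linear)
  also have "Sfun x (Sfun z ?v) w = s * Sfun z (Sfun x ?v) w"
    unfolding s_def by (rule Cons.IH)
  also have "of_bool (x = y) * Sfun z v w
      + sx * (of_bool (z = y) * Sfun x v w + sz * (s * Sfun z (Sfun x ?v) w)) =
      s * (of_bool (z = y) * Sfun x v w + sz * (of_bool (x = y) * Sfun z v w + sx * Sfun z (Sfun x ?v) w))"
    using 1 2 by (cases "x = y"; cases "z = y"; simp add: algebra_simps)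
  also have "\<dots> = s * Sfun z (Sfun x v) (y # w)"
    by (simp add: sx_def sz_def Sfun_linear)
  finally show ?case by (simp only: s_def)
qed simp

text \<open>The two polarizations change different coordinates of a letter, and no sign arises
  because \<open>Rfun\<close> keeps the row symbols and with them the parities of all
  letters.\<close>

lemma Rfun_Dfun: "Rfun i j (Dfun a b v) w = Dfun a b (Rfun i j v) w"
proof (induction w arbitrary: v)
  case (Cons y w)
  show ?case
    using Cons.IH[of "\<lambda>u. v (y # u)"] Cons.IH[of "\<lambda>u. v ((fst y, i) # u)"]
    by (cases "fst y = a"; cases "snd y = j") (auto simp: Dfun_linear Rfun_linear letter_par_def distrib_left)
qed simp

lemma Rfun_Sfun: "Rfun i j (Sfun x v) w = Sfun x (Rfun i j v) w + of_bool (i = snd x) * Sfun (fst x, j) v w"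
proof (induction w arbitrary: v)
  case (Cons y w)
  show ?case
    using Cons.IH[of "\<lambda>u. v (y # u)"]
    by (cases x; cases y) (auto simp: Sfun_linear Rfun_linear letter_par_def distrib_left)
qed simp

lemma DD_DD: "DD a b * DD c d = sg (parity a + parity b) (parity c + parity d) * DD c d * DD a b
    + of_bool (b = c) * DD a d - sg (parity a + parity b) (parity c + parity d) * of_bool (a = d) * DD c b"
proof (rule lop_eqI)
  fix v w
  show "app (DD a b * DD c d) v w = app (sg (parity a + parity b) (parity c + parity d) * DD c d * DD a b
    + of_bool (b = c) * DD a d - sg (parity a + parity b) (parity c + parity d) * of_bool (a = d) * DD c b) v w"
    using Dfun_Dfun[of a b c d v w]
    by (cases "b = c"; cases "a = d") (simp_all add: sg_def DD.rep_eq)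
qed

lemma DD_SS: "DD a b * SS x = sg (parity a + parity b) (letter_par x) * SS x * DD a b
    + of_bool (b = fst x) * SS (a, snd x)"
proof (rule lop_eqI)
  fix v w
  show "app (DD a b * SS x) v w = app (sg (parity a + parity b) (letter_par x) * SS x * DD a b
    + of_bool (b = fst x) * SS (a, snd x)) v w"
    using Dfun_Sfun[of a b x v w]
    by (cases "b = fst x") (simp_all add: sg_def DD.rep_eq SS.rep_eq)
qed

lemma SS_SS: "SS x * SS z = sg (letter_par x) (letter_par z) * SS z * SS x"
proof (rule lop_eqI)
  fix v w
  show "app (SS x * SS z) v w = app (sg (letter_par x) (letter_par z) * SS z * SS x) v w"
    using Sfun_Sfun[of x z v w] by (simp add: sg_def SS.rep_eq)
qed

lemma RR_DD: "RR i j * DD a b = DD a b * RR i j"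
  by (rule lop_eqI) (simp add: DD.rep_eq RR.rep_eq Rfun_Dfun)

lemma RR_SS: "RR i j * SS x = SS x * RR i j + of_bool (i = snd x) * SS (fst x, j)"
proof (rule lop_eqI)
  fix v w
  show "app (RR i j * SS x) v w = app (SS x * RR i j + of_bool (i = snd x) * SS (fst x, j)) v w"
    using Rfun_Sfun[of i j x v w]
    by (cases "i = snd x") (simp_all add: RR.rep_eq SS.rep_eq)
qed

definition AA :: "nat \<Rightarrow> symb \<Rightarrow> symb \<Rightarrow> letter lop" where
  "AA n a b = DD a b + of_bool (b \<in> proper n) * SS (a, b)"

definition act :: "nat \<Rightarrow> tens \<Rightarrow> letter lop" where
  "act n = subst scal (\<lambda>(a, b). AA n a b)"

definition vac0 :: "letter vec" where
  "vac0 w = of_bool (w = [])"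

definition vac :: "nat \<Rightarrow> tens \<Rightarrow> letter vec" where
  "vac n f = app (act n f) vac0"

lemma sg_even: "even m \<or> even n \<Longrightarrow> sg m n = 1"
  by (auto simp: sg_eq minus_one_power_iff)

lemma sg_square: "sg m n * sg m n = 1" "sg m n * (sg m n * T) = T"
  by (auto simp: sg_eq minus_one_power_iff)

lemma sg_sym: "sg m n = sg n m"
  by (simp add: sg_def ksign_commute)

lemma proper_parity: "b \<in> proper n \<Longrightarrow> parity b = 1"
  by (auto simp: proper_def)

lemma sg_cases: "sg m n = 1 \<or> sg m n = - 1"
  by (auto simp: sg_eq minus_one_power_iff)

text \<open>For proper \<open>b\<close>, multiplication by the variable (a|b) has the parity of
  e_{a,b}. Hence all products of polarizations and multiplications are exchanged with one common
  sign \<open>s\<close>, and the bracket terms from \<open>DD_SS\<close> complete those from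
  \<open>DD_DD\<close> to operators \<open>AA\<close>.\<close>

lemma AA_AA: "AA n a b * AA n c d = sg (parity a + parity b) (parity c + parity d) * AA n c d * AA n a b
    + of_bool (b = c) * AA n a d - sg (parity a + parity b) (parity c + parity d) * of_bool (a = d) * AA n c b"
proof -
  define s where "s = sg (parity a + parity b) (parity c + parity d)"
  have DS: "DD a b * SS (c, d) = s * SS (c, d) * DD a b + of_bool (b = c) * SS (a, d)"
    if "d \<in> proper n"
    using DD_SS[of a b "(c, d)"] proper_parity[OF that] by (simp add: s_def letter_par_def)
  have SD: "SS (a, b) * DD c d = s * DD c d * SS (a, b) - s * of_bool (a = d) * SS (c, b)"
    if "b \<in> proper n"
  proof -
    have "DD c d * SS (a, b) = s * SS (a, b) * DD c d + of_bool (a = d) * SS (c, b)"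
      using DD_SS[of c d "(a, b)"] proper_parity[OF that]
      by (simp add: s_def letter_par_def sg_sym eq_commute)
    then have "s * (DD c d * SS (a, b)) = SS (a, b) * DD c d + s * (of_bool (a = d) * SS (c, b))"
      by (simp add: distrib_left mult.assoc s_def sg_square)
    then show ?thesis by (simp add: mult.assoc)
  qed
  have SS: "SS (a, b) * SS (c, d) = s * SS (c, d) * SS (a, b)" if "b \<in> proper n" "d \<in> proper n"
    using SS_SS[of "(a, b)" "(c, d)"] proper_parity[OF that(1)] proper_parity[OF that(2)]
    by (simp add: s_def letter_par_def)
  have DD: "DD a b * DD c d = s * DD c d * DD a b + of_bool (b = c) * DD a d - s * of_bool (a = d) * DD c b"
    unfolding s_def by (rule DD_DD)
  have "AA n a b * AA n c d = s * AA n c d * AA n a b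
    + of_bool (b = c) * AA n a d - s * of_bool (a = d) * AA n c b"
    using DS SD SS DD
    by (cases "b \<in> proper n"; cases "d \<in> proper n"; simp add: AA_def distrib_left distrib_right mult.assoc)
  then show ?thesis by (simp only: s_def)
qed

text \<open>The operator on the left is right multiplication by e_{i,j} as seen on vacuum vectors,
  see \<open>vac_mult_gen\<close>; the identity then expresses associativity.\<close>

lemma RR_AA:
  assumes "i \<in> proper n" "j \<in> proper n"
  shows "(RR i j + SS (i, j)) * AA n a b = AA n a b * (RR i j + SS (i, j))"
proof -
  have par: "letter_par (i, j) = 2"
    using proper_parity[OF assms(1)] by (simp add: letter_par_def)
  have 1: "DD a b * SS (i, j) = SS (i, j) * DD a b + of_bool (b = i) * SS (a, j)"
    using DD_SS[of a b "(i, j)"] by (simp add: par sg_even)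
  have 2: "SS (i, j) * SS (a, b) = SS (a, b) * SS (i, j)"
    using SS_SS[of "(i, j)" "(a, b)"] by (simp add: par sg_even)
  show ?thesis
    using assms RR_SS[of i j "(a, b)"] 1 2
    by (cases "b \<in> proper n"; cases "b = i")
       (auto simp add: AA_def distrib_left distrib_right RR_DD)
qed

lemma act_simps:
  "act n 0 = 0" "act n 1 = 1" "act n (f + g) = act n f + act n g" "act n (f - g) = act n f - act n g"
  "act n (- f) = - act n f" "act n (f * g) = act n f * act n g" "act n (gen a b) = AA n a b"
  "act n (const c) = scal c" "act n (sum F I) = (\<Sum>i\<in>I. act n (F i))"
  "act n (prod_list fs) = prod_list (map (act n) fs)"
  "act n (word w) = prod_list (map (\<lambda>(a, b). AA n a b) w)"
  unfolding act_def
  by (simp_all add: scalar_emb_scal subst_one subst_add subst_diff subst_uminus subst_mult gen_word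
      subst_word subst_const subst_sum subst_prod_list)

lemma act_of_bool: "act n (of_bool P) = of_bool P"
  by (cases P) (simp_all add: act_simps)

lemma act_power: "act n (f ^ k) = act n f ^ k"
  by (induction k) (simp_all add: act_simps)

lemma act_relation: "f \<in> gl_relations A \<Longrightarrow> act n f = 0"
proof -
  have "act n (koszul_sign a b c d) = sg (parity a + parity b) (parity c + parity d)" for a b c d
    by (simp add: koszul_sign_def act_power act_simps sg_eq)
  note ks = this
  assume "f \<in> gl_relations A"
  then obtain a b c d where f: "f = gen a b * gen c d - koszul_sign a b c d * (gen c d * gen a b) - gl_bracket a b c d"
    unfolding gl_relations_def by blast
  show "act n f = 0"
    using AA_AA[of n a b c d] by (simp add: f gl_bracket_def act_simps act_of_bool ks mult.assoc)
qed

section \<open>Ideals and cosets\<close>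

abbreviation fa :: "symb set \<Rightarrow> tens set" where
  "fa A \<equiv> carrier (free_alg (A \<times> A))"

lemma fa_iff: "f \<in> fa A \<longleftrightarrow> (\<forall>w\<in>Poly_Mapping.keys f. set (letters w) \<subseteq> A \<times> A)"
  by (simp add: free_alg_def)

lemma free_alg_ops [simp]: "x \<otimes>\<^bsub>free_alg X\<^esub> y = x * y" "x \<oplus>\<^bsub>free_alg X\<^esub> y = x + y"
  "\<one>\<^bsub>free_alg X\<^esub> = 1" "\<zero>\<^bsub>free_alg X\<^esub> = 0"
  by (simp_all add: free_alg_def)

lemma free_alg_closed:
  "0 \<in> carrier (free_alg X)" "1 \<in> carrier (free_alg X)" "const c \<in> carrier (free_alg X)"
  "f \<in> carrier (free_alg X) \<Longrightarrow> g \<in> carrier (free_alg X) \<Longrightarrow> f + g \<in> carrier (free_alg X)"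
  "f \<in> carrier (free_alg X) \<Longrightarrow> g \<in> carrier (free_alg X) \<Longrightarrow> f * g \<in> carrier (free_alg X)"
  "f \<in> carrier (free_alg X) \<Longrightarrow> g \<in> carrier (free_alg X) \<Longrightarrow> f - g \<in> carrier (free_alg X)"
  "f \<in> carrier (free_alg X) \<Longrightarrow> - f \<in> carrier (free_alg X)"
  "set w \<subseteq> X \<Longrightarrow> word w \<in> carrier (free_alg X)"
proof -
  interpret ring "free_alg X" by (rule ring_free_alg)
  show "0 \<in> carrier (free_alg X)" "1 \<in> carrier (free_alg X)"
    using zero_closed one_closed by simp_all
  show "const c \<in> carrier (free_alg X)" by (rule const_in_free_alg)
  show add: "f + g \<in> carrier (free_alg X)" if "f \<in> carrier (free_alg X)" "g \<in> carrier (free_alg X)" for f g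
    using add.m_closed[OF that] by simp
  show "f * g \<in> carrier (free_alg X)" if "f \<in> carrier (free_alg X)" "g \<in> carrier (free_alg X)" for f g
    using m_closed[OF that] by simp
  show um: "- f \<in> carrier (free_alg X)" if "f \<in> carrier (free_alg X)" for f
    using that by (simp add: free_alg_def)
  show "f - g \<in> carrier (free_alg X)" if "f \<in> carrier (free_alg X)" "g \<in> carrier (free_alg X)" for f g
    using add[OF that(1) um[OF that(2)]] by simp
  show "word w \<in> carrier (free_alg X)" if "set w \<subseteq> X"
    using that by (simp add: free_alg_def word_def)
qed

lemma free_alg_sum: "(\<And>i. i \<in> I \<Longrightarrow> F i \<in> carrier (free_alg X)) \<Longrightarrow> sum F I \<in> carrier (free_alg X)"
  by (induction I rule: infinite_finite_induct) (auto intro: free_alg_closed)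

lemma free_alg_prod_list: "(\<And>f. f \<in> set fs \<Longrightarrow> f \<in> carrier (free_alg X)) \<Longrightarrow> prod_list fs \<in> carrier (free_alg X)"
  by (induction fs) (auto intro: free_alg_closed)

lemma free_alg_mono: "X \<subseteq> Y \<Longrightarrow> carrier (free_alg X) \<subseteq> carrier (free_alg Y)"
  by (fastforce simp: free_alg_def)

lemma fa_mono: "A \<subseteq> B \<Longrightarrow> fa A \<subseteq> fa B"
  by (rule free_alg_mono) auto

lemma fa_gen: "a \<in> A \<Longrightarrow> b \<in> A \<Longrightarrow> gen a b \<in> fa A"
  by (rule gen_in_free_alg)

lemma gl_ideal_closed:
  "0 \<in> gl_ideal A"
  "f \<in> gl_ideal A \<Longrightarrow> f \<in> fa A"
  "f \<in> gl_ideal A \<Longrightarrow> g \<in> gl_ideal A \<Longrightarrow> f + g \<in> gl_ideal A"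
  "f \<in> gl_ideal A \<Longrightarrow> g \<in> gl_ideal A \<Longrightarrow> f - g \<in> gl_ideal A"
  "f \<in> gl_ideal A \<Longrightarrow> - f \<in> gl_ideal A"
  "f \<in> gl_ideal A \<Longrightarrow> g \<in> fa A \<Longrightarrow> g * f \<in> gl_ideal A"
  "f \<in> gl_ideal A \<Longrightarrow> g \<in> fa A \<Longrightarrow> f * g \<in> gl_ideal A"
proof -
  interpret ideal "gl_ideal A" "free_alg (A \<times> A)" by (rule ideal_gl_ideal)
  show "0 \<in> gl_ideal A" using additive_subgroup.zero_closed[OF is_additive_subgroup] by simp
  show "f \<in> gl_ideal A \<Longrightarrow> f \<in> fa A" by (rule Icarr)
  show add: "f \<in> gl_ideal A \<Longrightarrow> g \<in> gl_ideal A \<Longrightarrow> f + g \<in> gl_ideal A" for f g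
    using additive_subgroup.a_closed[OF is_additive_subgroup] by simp
  show "f \<in> gl_ideal A \<Longrightarrow> g \<in> fa A \<Longrightarrow> g * f \<in> gl_ideal A"
    using I_l_closed by simp
  show "f \<in> gl_ideal A \<Longrightarrow> g \<in> fa A \<Longrightarrow> f * g \<in> gl_ideal A"
    using I_r_closed by simp
  show um: "- f \<in> gl_ideal A" if "f \<in> gl_ideal A" for f
  proof -
    have "const (- 1) * f \<in> gl_ideal A"
      using I_l_closed[OF that free_alg_closed(3)] by simp
    then show ?thesis by (simp add: const_hom)
  qed
  show "f \<in> gl_ideal A \<Longrightarrow> g \<in> gl_ideal A \<Longrightarrow> f - g \<in> gl_ideal A"
    using add[of f "- g"] um[of g] by simp
qed

lemma gl_ideal_sum: "(\<And>i. i \<in> I \<Longrightarrow> F i \<in> gl_ideal A) \<Longrightarrow> sum F I \<in> gl_ideal A"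
  by (induction I rule: infinite_finite_induct) (auto intro: gl_ideal_closed)

lemma gl_relation_in_ideal: "gl_relations A \<subseteq> gl_ideal A"
  unfolding gl_ideal_def by (rule ring.genideal_self[OF ring_free_alg gl_relations_subset])

lemma gl_ideal_minimal:
  assumes "I \<subseteq> fa A" "gl_relations A \<subseteq> I" "0 \<in> I"
    "\<And>f g. f \<in> I \<Longrightarrow> g \<in> I \<Longrightarrow> f + g \<in> I"
    "\<And>f g. f \<in> I \<Longrightarrow> g \<in> fa A \<Longrightarrow> g * f \<in> I" "\<And>f g. f \<in> I \<Longrightarrow> g \<in> fa A \<Longrightarrow> f * g \<in> I"
  shows "gl_ideal A \<subseteq> I"
proof -
  interpret ring "free_alg (A \<times> A)" by (rule ring_free_alg)
  have "ideal I (free_alg (A \<times> A))"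
  proof (rule idealI)
    show "subgroup I (add_monoid (free_alg (A \<times> A)))"
    proof (rule group.subgroupI)
      show "inv\<^bsub>add_monoid (free_alg (A \<times> A))\<^esub> f \<in> I" if "f \<in> I" for f
      proof -
        have "const (- 1) * f \<in> I" by (rule assms(5)[OF that free_alg_closed(3)])
        then have um: "- f \<in> I" by (simp add: const_hom)
        have "\<ominus>\<^bsub>free_alg (A \<times> A)\<^esub> f = - f"
          by (rule minus_equality) (use that um assms(1) in auto)
        then show ?thesis using um by (simp add: a_inv_def)
      qed
    qed (use assms a_group in auto)
  qed (use assms ring_free_alg in auto)
  then show ?thesis unfolding gl_ideal_def using assms(2) by (rule genideal_minimal)
qed

lemma act_gl_ideal: "f \<in> gl_ideal A \<Longrightarrow> act n f = 0"
proof -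
  have "gl_ideal A \<subseteq> {f \<in> fa A. act n f = 0}"
    by (rule gl_ideal_minimal) (use gl_relations_subset in \<open>auto simp: act_simps act_relation intro: free_alg_closed\<close>)
  then show "f \<in> gl_ideal A \<Longrightarrow> act n f = 0" by auto
qed

lemma gl_ideal_mono: "A \<subseteq> B \<Longrightarrow> gl_ideal A \<subseteq> gl_ideal B"
proof -
  assume AB: "A \<subseteq> B"
  have "gl_relations A \<subseteq> gl_relations B" using AB unfolding gl_relations_def by blast
  then have "gl_ideal A \<subseteq> {f \<in> fa A. f \<in> gl_ideal B}"
    by (intro gl_ideal_minimal)
       (use gl_relations_subset[of A] gl_relation_in_ideal[of B] fa_mono[OF AB] in
         \<open>auto intro: free_alg_closed(1,4,5) gl_ideal_closed(1,3,6,7)\<close>)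
  then show ?thesis by auto
qed

lemma cls_iff: "f \<in> fa A \<Longrightarrow> g \<in> fa A \<Longrightarrow> cls A f = cls A g \<longleftrightarrow> f - g \<in> gl_ideal A"
proof -
  interpret ideal "gl_ideal A" "free_alg (A \<times> A)" by (rule ideal_gl_ideal)
  assume fg: "f \<in> fa A" "g \<in> fa A"
  have minus: "f \<ominus>\<^bsub>free_alg (A \<times> A)\<^esub> g = f - g"
  proof -
    have "\<ominus>\<^bsub>free_alg (A \<times> A)\<^esub> g = - g"
      by (rule minus_equality) (use fg free_alg_closed(7) in auto)
    then show ?thesis by (simp add: a_minus_def)
  qed
  show ?thesis
    using quotient_eq_iff_same_a_r_cos[OF ideal_axioms fg] fg
    unfolding cls_def minus by blast
qed

lemma U_carrier: "carrier (U A) = cls A ` fa A"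
  by (auto simp: U_def FactRing_def A_RCOSETS_def' cls_def)

lemma cls_ops:
  assumes "f \<in> fa A" "g \<in> fa A"
  shows "cls A (f + g) = cls A f \<oplus>\<^bsub>U A\<^esub> cls A g" "cls A (f * g) = cls A f \<otimes>\<^bsub>U A\<^esub> cls A g"
  using Ring.ring_hom_add[OF cls_ring_hom assms] Ring.ring_hom_mult[OF cls_ring_hom assms] by simp_all

lemma cls_one: "cls A 1 = \<one>\<^bsub>U A\<^esub>"
  using Ring.ring_hom_one[OF cls_ring_hom] by simp

lemma cls_zero: "cls A 0 = \<zero>\<^bsub>U A\<^esub>"
proof -
  interpret ring_hom_ring "free_alg (A \<times> A)" "U A" "cls A"
    by (intro ring_hom_ringI2 ring_free_alg ring_U cls_ring_hom)
  show ?thesis using hom_zero by simp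
qed

lemma cls_in_U: "f \<in> fa A \<Longrightarrow> cls A f \<in> carrier (U A)"
  by (auto simp: U_carrier)

lemma smul_cls: "f \<in> fa A \<Longrightarrow> smul A c (cls A f) = cls A (const c * f)"
  by (simp add: smul_def cls_ops free_alg_closed)

lemma finsum_cls:
  assumes "finite I" "\<And>i. i \<in> I \<Longrightarrow> F i \<in> fa A"
  shows "(\<Oplus>\<^bsub>U A\<^esub>i\<in>I. cls A (F i)) = cls A (\<Sum>i\<in>I. F i)"
proof -
  interpret ring "U A" by (rule ring_U)
  show ?thesis
    using assms
  proof (induction I)
    case (insert x I)
    then show ?case by (simp add: finsum_insert cls_in_U Pi_def cls_ops free_alg_sum)
  qed (simp add: cls_zero)
qed

section \<open>Content of vacuum vectors\<close>

abbreviation rowc :: "symb \<Rightarrow> letter list \<Rightarrow> nat" where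
  "rowc \<gamma> w \<equiv> count_list (map fst w) \<gamma>"

text \<open>Polarization changes exactly one row symbol, so the row content of a word in the support
  determines that of its source. That the source contains \<open>b\<close> is recorded because it
  makes e_{a,b} annihilate vectors in which \<open>b\<close> is absent.\<close>

lemma Dfun_content:
  assumes "Dfun a b f w \<noteq> 0"
  shows "\<exists>w'. f w' \<noteq> 0 \<and> length w' = length w \<and> b \<in> fst ` set w' \<and>
    rowc \<gamma> w' + of_bool (a = \<gamma>) = rowc \<gamma> w + of_bool (b = \<gamma>)"
  using assms
proof (induction w arbitrary: f)
  case (Cons y w)
  then consider "fst y = a" "f ((b, snd y) # w) \<noteq> 0" | "Dfun a b (\<lambda>u. f (y # u)) w \<noteq> 0"
    by (cases "fst y = a"; cases "Dfun a b (\<lambda>u. f (y # u)) w = 0") auto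
  then show ?case
  proof cases
    case 1
    then show ?thesis by (intro exI[of _ "(b, snd y) # w"]) auto
  next
    case 2
    from Cons.IH[OF this] obtain w' where "f (y # w') \<noteq> 0" "length w' = length w"
      "b \<in> fst ` set w'" "rowc \<gamma> w' + of_bool (a = \<gamma>) = rowc \<gamma> w + of_bool (b = \<gamma>)" by auto
    then show ?thesis by (intro exI[of _ "y # w'"]) auto
  qed
qed simp

lemma Sfun_content:
  assumes "Sfun x f w \<noteq> 0"
  shows "\<exists>w'. f w' \<noteq> 0 \<and> length w = Suc (length w') \<and> rowc \<gamma> w = rowc \<gamma> w' + of_bool (fst x = \<gamma>)"
  using assms
proof (induction w arbitrary: f)
  case (Cons y w)
  then consider "x = y" "f w \<noteq> 0" | "Sfun x (\<lambda>u. f (y # u)) w \<noteq> 0"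
    by (cases "x = y"; cases "Sfun x (\<lambda>u. f (y # u)) w = 0") auto
  then show ?case
  proof cases
    case 1
    then show ?thesis by (intro exI[of _ w]) auto
  next
    case 2
    from Cons.IH[OF this] obtain w' where "f (y # w') \<noteq> 0" "length w = Suc (length w')"
      "rowc \<gamma> w = rowc \<gamma> w' + of_bool (fst x = \<gamma>)" by auto
    then show ?thesis by (intro exI[of _ "y # w'"]) auto
  qed
qed simp

lemma app_AA: "app (AA n a b) v w = Dfun a b v w + of_bool (b \<in> proper n) * Sfun (a, b) v w"
  by (cases "b \<in> proper n") (simp_all add: AA_def DD.rep_eq SS.rep_eq)

lemma vac_mult: "vac n (f * g) = app (act n f) (vac n g)"
  by (simp add: vac_def act_simps)

lemma vac_simps: "vac n (f + g) = (\<lambda>w. vac n f w + vac n g w)" "vac n (f - g) = (\<lambda>w. vac n f w - vac n g w)"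
  "vac n 0 = (\<lambda>w. 0)" "vac n 1 = vac0" "vac n (const c * f) = (\<lambda>w. c * vac n f w)"
  "vac n (sum F I) = (\<lambda>w. \<Sum>i\<in>I. vac n (F i) w)" "vac n (- f) = (\<lambda>w. - vac n f w)"
  by (simp_all add: vac_def act_simps app_sum_op)

lemma vac_gen_mult: "vac n (gen a b * f) = app (AA n a b) (vac n f)"
  by (simp add: vac_mult act_simps)

lemma vac_word_Cons: "vac n (word ((a, b) # w)) = app (AA n a b) (vac n (word w))"
  using vac_gen_mult[of n a b "word w"] by (simp add: gen_word flip: word_Cons)

text \<open>Only multiplication lengthens words, and it requires a proper column symbol; every other
  contribution of e_{a,b} trades a row symbol \<open>b\<close> for \<open>a\<close>. The symbols
  \<open>Prop i\<close> with i > n fall under the hypothesis on \<gamma>, which later allows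
  \<open>vac n\<close> to be applied to U(gl(n+1)).\<close>

lemma vac_word_content:
  assumes "vac n (word u) w \<noteq> 0" "\<gamma> \<notin> proper n"
  shows "length w \<le> length u \<and> rowc \<gamma> w + count_list (map snd u) \<gamma> = count_list (map fst u) \<gamma>"
  using assms(1)
proof (induction u arbitrary: w)
  case Nil
  then show ?case by (auto simp: vac_simps vac0_def split: if_splits)
next
  case (Cons x u)
  obtain a b where x: "x = (a, b)" by (cases x)
  from Cons.prems consider "Dfun a b (vac n (word u)) w \<noteq> 0"
    | "b \<in> proper n" "Sfun (a, b) (vac n (word u)) w \<noteq> 0"
    by (cases "Dfun a b (vac n (word u)) w = 0"; cases "b \<in> proper n") (auto simp: x vac_word_Cons app_AA)
  then show ?case
  proof cases
    case 1
    from Dfun_content[OF this, of \<gamma>] show ?thesis using Cons.IH x by fastforce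
  next
    case 2
    from Sfun_content[OF this(2), of \<gamma>] 2(1) show ?thesis using Cons.IH x assms(2) by fastforce
  qed
qed

lemma word_Cons_gen: "word ((a, b) # w) = gen a b * word w"
  by (simp add: gen_word flip: word_Cons)

text \<open>By content, a word in the support before e_{a,b} acts contains \<gamma> as often as the
  rows of \<open>v\<close> exceed its columns. If b = \<gamma> this number is at most 0 although
  \<gamma> has to be present to be replaced; otherwise it is negative.\<close>

lemma vac_irregular:
  assumes "\<gamma> \<notin> proper n"
    "count_list (map snd ((a, b) # v)) \<gamma> > count_list (map fst v) \<gamma>"
  shows "vac n (word (u @ (a, b) # v)) = (\<lambda>w. 0)"
proof -
  have "vac n (word ((a, b) # v)) w = 0" for w
  proof (rule ccontr)
    assume "\<not> ?thesis"
    then consider "Dfun a b (vac n (word v)) w \<noteq> 0"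
      | "b \<in> proper n" "Sfun (a, b) (vac n (word v)) w \<noteq> 0"
      by (cases "Dfun a b (vac n (word v)) w = 0"; cases "b \<in> proper n") (auto simp: vac_word_Cons app_AA)
    then show False
    proof cases
      case 1
      from Dfun_content[OF this, of \<gamma>] obtain w' where w': "vac n (word v) w' \<noteq> 0" "b \<in> fst ` set w'"
        by auto
      have "rowc \<gamma> w' > 0" if "b = \<gamma>"
        using w'(2) that count_notin count_list_0_iff[of "map fst w'" \<gamma>] by auto
      with vac_word_content[OF w'(1) assms(1)] assms(2) show False by (auto split: if_splits)
    next
      case 2
      from Sfun_content[OF this(2), of \<gamma>] obtain w' where "vac n (word v) w' \<noteq> 0" by auto
      from vac_word_content[OF this assms(1)] assms 2(1) show False by (auto split: if_splits)
    qed
  qed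
  then have "vac n (word ((a, b) # v)) = (\<lambda>w. 0)" by auto
  then show ?thesis by (simp add: word_append vac_mult app_zero)
qed

section \<open>Polynomial functions vanishing identically\<close>

lemma poly_coeffs_zero:
  fixes a :: "nat \<Rightarrow> complex"
  assumes "\<And>t. (\<Sum>k\<le>K. a k * t ^ k) = 0" "k \<le> K"
  shows "a k = 0"
  using polyfun_eq_0[of a K] assms by auto

text \<open>With the other variables fixed, the sum is a polynomial in the value \<open>t\<close> at
  \<open>y\<close>. Each of its coefficients vanishes and is a relation between monomials in one
  variable less; \<open>strip\<close> removes \<open>y\<close> from a monomial.\<close>

lemma monomials_independent_mset:
  fixes c :: "'a multiset \<Rightarrow> complex"
  assumes "finite Y" "finite \<M>" "\<And>M. M \<in> \<M> \<Longrightarrow> set_mset M \<subseteq> Y"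
    "\<And>X :: 'a \<Rightarrow> complex. (\<Sum>M\<in>\<M>. c M * (\<Prod>y\<in>#M. X y)) = 0" "M \<in> \<M>"
  shows "c M = 0"
  using assms
proof (induction Y arbitrary: \<M> c M rule: finite_induct)
  case empty
  then have "\<M> = {{#}}" by auto
  with empty.prems(3) empty.prems(4) show ?case by simp
next
  case (insert y Y)
  define K where "K = Max ((\<lambda>M. count M y) ` \<M>)"
  have K: "count M y \<le> K" if "M \<in> \<M>" for M
    unfolding K_def using insert.prems(1) that by (intro Max_ge) auto
  define strip where "strip = (\<lambda>M. filter_mset (\<lambda>z. z \<noteq> y) M)"
  have decomp: "M = strip M + replicate_mset (count M y) y" for M
    by (rule multiset_eqI) (auto simp: strip_def)
  define k where "k = count M y"
  define \<N> where "\<N> = strip ` {M \<in> \<M>. count M y = k}"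
  have zero: "(\<Sum>N\<in>\<N>. c (N + replicate_mset k y) * (\<Prod>z\<in>#N. X z)) = 0" for X :: "'a \<Rightarrow> complex"
  proof -
    have prod: "(\<Prod>z\<in>#M. (X(y := t)) z) = t ^ count M y * (\<Prod>z\<in>#strip M. X z)" for M t
    proof -
      have "(\<Prod>z\<in>#M. (X(y := t)) z) =
          (\<Prod>z\<in>#strip M. (X(y := t)) z) * (\<Prod>z\<in>#replicate_mset (count M y) y. (X(y := t)) z)"
        by (subst (1) decomp) simp
      moreover have "image_mset (X(y := t)) (strip M) = image_mset X (strip M)"
        by (rule image_mset_cong) (auto simp: strip_def)
      moreover have "(\<Prod>z\<in>#replicate_mset (count M y) y. (X(y := t)) z) = t ^ count M y" by simp
      ultimately show ?thesis by (simp only: mult.commute)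
    qed
    define a where "a = (\<lambda>j. \<Sum>M | M \<in> \<M> \<and> count M y = j. c M * (\<Prod>z\<in>#strip M. X z))"
    have "(\<Sum>j\<le>K. a j * t ^ j) = 0" for t
    proof -
      have "(\<Sum>j\<le>K. a j * t ^ j) =
          (\<Sum>j\<le>K. \<Sum>M | M \<in> \<M> \<and> count M y = j. c M * (\<Prod>z\<in>#M. (X(y := t)) z))"
        unfolding a_def sum_distrib_right
        by (intro sum.cong refl) (simp add: prod del: fun_upd_apply)
      also have "\<dots> = (\<Sum>M\<in>\<M>. c M * (\<Prod>z\<in>#M. (X(y := t)) z))"
        by (rule sum.group) (use insert.prems(1) K in auto)
      finally show ?thesis using insert.prems(3) by simp
    qed
    then have "a k = 0" by (rule poly_coeffs_zero) (use K insert.prems(4) k_def in auto)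
    moreover have "a k = (\<Sum>N\<in>\<N>. c (N + replicate_mset k y) * (\<Prod>z\<in>#N. X z))"
    proof -
      have inj: "inj_on strip {M \<in> \<M>. count M y = k}"
        by (rule inj_onI) (metis (mono_tags, lifting) decomp mem_Collect_eq)
      show ?thesis
        unfolding \<N>_def a_def by (subst sum.reindex[OF inj]) (auto intro!: sum.cong simp: decomp[symmetric])
    qed
    ultimately show ?thesis by simp
  qed
  have "c (strip M + replicate_mset k y) = 0"
  proof (rule insert.IH[where c = "\<lambda>N. c (N + replicate_mset k y)", OF _ _ zero])
    show "finite \<N>" using insert.prems(1) by (simp add: \<N>_def)
    show "set_mset N \<subseteq> Y" if "N \<in> \<N>" for N
      using that insert.prems(2) by (fastforce simp: \<N>_def strip_def)
    show "strip M \<in> \<N>" using insert.prems(4) by (auto simp: \<N>_def k_def)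
  qed
  then show ?case using decomp[of M] by (simp add: k_def)
qed

text \<open>Words with equal multisets define the same monomial, so only the sums of their
  coefficients are determined. This is the bridge from words to commutative polynomials.\<close>

lemma monomials_independent:
  fixes c :: "'a list \<Rightarrow> complex"
  assumes "finite W" "\<And>X :: 'a \<Rightarrow> complex. (\<Sum>w\<in>W. c w * prod_list (map X w)) = 0"
  shows "(\<Sum>w | w \<in> W \<and> mset w = M. c w) = 0"
proof (cases "M \<in> mset ` W")
  case True
  define d where "d = (\<lambda>M. \<Sum>w | w \<in> W \<and> mset w = M. c w)"
  have "(\<Sum>M\<in>mset ` W. d M * (\<Prod>y\<in>#M. X y)) = 0" for X :: "'a \<Rightarrow> complex"
  proof -
    have "(\<Sum>M\<in>mset ` W. d M * (\<Prod>y\<in>#M. X y)) =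
        (\<Sum>M\<in>mset ` W. \<Sum>w | w \<in> W \<and> mset w = M. c w * prod_list (map X w))"
      unfolding d_def sum_distrib_right
      by (intro sum.cong refl) (auto simp: prod_mset_prod_list mset_map[symmetric] simp del: mset_map)
    also have "\<dots> = (\<Sum>w\<in>W. c w * prod_list (map X w))"
      by (rule sum.group) (use assms(1) in auto)
    finally show ?thesis using assms(2) by simp
  qed
  then have "d M = 0"
    by (intro monomials_independent_mset[of "\<Union> (set ` W)" "mset ` W" d]) (use assms(1) True in auto)
  then show ?thesis by (simp add: d_def)
next
  case False
  then have "{w. w \<in> W \<and> mset w = M} = {}" by auto
  then show ?thesis by (simp only: sum.empty)
qed

section \<open>Filtration, symbols and the Poincare-Birkhoff-Witt theorem\<close>

definition FD :: "symb set \<Rightarrow> nat \<Rightarrow> tens set" where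
  "FD A m = {f \<in> fa A. \<forall>w\<in>Poly_Mapping.keys f. length (letters w) \<le> m}"

lemma FD_fa: "f \<in> FD A m \<Longrightarrow> f \<in> fa A"
  by (simp add: FD_def)

lemma FD_mono: "m \<le> m' \<Longrightarrow> FD A m \<subseteq> FD A m'"
  by (auto simp: FD_def)

lemma FD_add: "f \<in> FD A m \<Longrightarrow> g \<in> FD A m \<Longrightarrow> f + g \<in> FD A m"
  using keys_add[of f g] by (auto simp: FD_def free_alg_closed)

lemma FD_uminus: "f \<in> FD A m \<Longrightarrow> - f \<in> FD A m"
  by (auto simp: FD_def free_alg_closed)

lemma FD_diff: "f \<in> FD A m \<Longrightarrow> g \<in> FD A m \<Longrightarrow> f - g \<in> FD A m"
  using FD_add[of f A m "- g"] FD_uminus[of g] by simp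

lemma FD_mult: "f \<in> FD A m \<Longrightarrow> g \<in> FD A m' \<Longrightarrow> f * g \<in> FD A (m + m')"
  using keys_mult[of f g] by (fastforce simp: FD_def free_alg_closed intro: add_mono)

lemma FD_zero: "0 \<in> FD A m"
  by (auto simp: FD_def free_alg_closed)

lemma FD_const: "const c \<in> FD A m"
  using free_alg_closed(3)[of c] by (auto simp: FD_def const_def)

lemma FD_const_mult: "f \<in> FD A m \<Longrightarrow> const c * f \<in> FD A m"
  using FD_mult[OF FD_const[of c A 0], of f m] by simp

lemma FD_word: "set w \<subseteq> A \<times> A \<Longrightarrow> length w \<le> m \<Longrightarrow> word w \<in> FD A m"
  using free_alg_closed(8)[of w] by (auto simp: FD_def word_def)

lemma FD_sum: "(\<And>i. i \<in> I \<Longrightarrow> F i \<in> FD A m) \<Longrightarrow> sum F I \<in> FD A m"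
  by (induction I rule: infinite_finite_induct) (auto intro: FD_add FD_zero)

lemma U_filt_FD: "U_filt A m = cls A ` FD A m"
  by (simp add: U_filt_def FD_def)

text \<open>The class of \<open>f\<close> lies in step \<open>m\<close> of the filtration; stating
  this for tensors keeps calculations on the level of representatives.\<close>

definition lower :: "symb set \<Rightarrow> nat \<Rightarrow> tens \<Rightarrow> bool" where
  "lower A m f \<longleftrightarrow> (\<exists>g\<in>FD A m. f - g \<in> gl_ideal A)"

lemma lower_add: "lower A m f \<Longrightarrow> lower A m f' \<Longrightarrow> lower A m (f + f')"
proof -
  assume "lower A m f" "lower A m f'"
  then obtain g g' where "g \<in> FD A m" "g' \<in> FD A m" "f - g \<in> gl_ideal A" "f' - g' \<in> gl_ideal A"
    by (auto simp: lower_def)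
  moreover have "f + f' - (g + g') = (f - g) + (f' - g')" by simp
  ultimately show ?thesis
    unfolding lower_def by (metis FD_add gl_ideal_closed(3))
qed

lemma lower_const_mult: "lower A m f \<Longrightarrow> lower A m (const c * f)"
proof -
  assume "lower A m f"
  then obtain g where "g \<in> FD A m" "f - g \<in> gl_ideal A"
    by (auto simp: lower_def)
  moreover have "const c * f - const c * g = const c * (f - g)" by (simp add: right_diff_distrib)
  ultimately show ?thesis
    unfolding lower_def by (metis FD_const_mult gl_ideal_closed(6) free_alg_closed(3))
qed

lemma lower_FD: "f \<in> FD A m \<Longrightarrow> lower A m f"
  unfolding lower_def by (rule bexI[of _ f]) (simp_all add: gl_ideal_closed(1))

lemma lower_sum: "(\<And>i. i \<in> I \<Longrightarrow> lower A m (F i)) \<Longrightarrow> lower A m (sum F I)"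
  by (induction I rule: infinite_finite_induct) (auto intro: lower_add lower_FD FD_zero)

lemma lower_mult_left:
  assumes "lower A m f" "g \<in> FD A k"
  shows "lower A (k + m) (g * f)"
proof -
  obtain h where h: "h \<in> FD A m" "f - h \<in> gl_ideal A" using assms(1) by (auto simp: lower_def)
  have "g * f - g * h = g * (f - h)" by (simp add: right_diff_distrib)
  then show ?thesis
    unfolding lower_def by (metis FD_mult h assms(2) gl_ideal_closed(6) FD_fa)
qed

lemma lower_trans_diff: "lower A m (f - g) \<Longrightarrow> lower A m (g - h) \<Longrightarrow> lower A m (f - h)"
  using lower_add[of A m "f - g" "g - h"] by simp

text \<open>The words differ, modulo the relations, by a commutator of two even generators, which is
  linear and so one letter shorter.\<close>

lemma word_swap_lower:
  assumes "set (u @ [x, y] @ v) \<subseteq> proper n \<times> proper n"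
  shows "lower (proper n) (Suc (length u + length v)) (word (u @ [x, y] @ v) - word (u @ [y, x] @ v))"
proof -
  obtain a b c d where xy: "x = (a, b)" "y = (c, d)" by (cases x; cases y)
  have abcd: "a \<in> proper n" "b \<in> proper n" "c \<in> proper n" "d \<in> proper n"
    and uv: "set u \<subseteq> proper n \<times> proper n" "set v \<subseteq> proper n \<times> proper n"
    using assms by (auto simp: xy)
  have ks: "koszul_sign a b c d = 1"
    using abcd by (simp add: koszul_sign_def proper_parity)
  define r where "r = gen a b * gen c d - koszul_sign a b c d * (gen c d * gen a b) - gl_bracket a b c d"
  have "r \<in> gl_ideal (proper n)"
    using gl_relation_in_ideal[of "proper n"] abcd by (force simp: r_def gl_relations_def)
  then have ideal: "word u * r * word v \<in> gl_ideal (proper n)"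
    by (intro gl_ideal_closed free_alg_closed uv)
  have FDgen: "gen p q \<in> FD (proper n) 1" if "p \<in> proper n" "q \<in> proper n" for p q
    using that by (auto simp: gen_word intro!: FD_word)
  have "gl_bracket a b c d \<in> FD (proper n) 1"
    unfolding gl_bracket_def ks
    by (cases "b = c"; cases "a = d") (use FDgen abcd in \<open>auto intro!: FD_diff FD_zero FD_uminus\<close>)
  then have "word u * gl_bracket a b c d * word v \<in> FD (proper n) (length u + 1 + length v)"
    by (intro FD_mult FD_word uv order.refl)
  moreover have "word (u @ [x, y] @ v) - word (u @ [y, x] @ v) - word u * gl_bracket a b c d * word v
      = word u * r * word v"
    by (simp add: r_def ks xy gen_word word_append[symmetric] algebra_simps)
  ultimately show ?thesis
    unfolding lower_def using ideal
    by (intro bexI[of _ "word u * gl_bracket a b c d * word v"]) simp_all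
qed

lemma word_move_front_lower:
  assumes "set (p @ x # q) \<subseteq> proper n \<times> proper n"
  shows "lower (proper n) (length (p @ q)) (word (p @ x # q) - word (x # p @ q))"
  using assms
proof (induction p arbitrary: q rule: rev_induct)
  case Nil
  then show ?case by (auto intro!: lower_FD FD_zero)
next
  case (snoc y p)
  have "lower (proper n) (Suc (length p + length q)) (word (p @ [y, x] @ q) - word (p @ [x, y] @ q))"
    by (rule word_swap_lower) (use snoc.prems in auto)
  moreover have "lower (proper n) (length (p @ y # q)) (word (p @ x # y # q) - word (x # p @ y # q))"
    using snoc.prems by (intro snoc.IH) auto
  ultimately show ?case
    using lower_trans_diff[of "proper n" "Suc (length p + length q)" "word (p @ [y, x] @ q)"
        "word (p @ [x, y] @ q)" "word (x # p @ y # q)"] by simp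
qed

lemma word_perm_lower:
  assumes "mset w = mset w'" "set w \<subseteq> proper n \<times> proper n"
  shows "lower (proper n) (length w - 1) (word w - word w')"
  using assms
proof (induction w arbitrary: w')
  case Nil
  then show ?case by (auto intro!: lower_FD FD_zero)
next
  case (Cons x u)
  have "x \<in> set w'" using Cons.prems(1) by (metis list.set_intros(1) set_mset_mset)
  then obtain p q where w': "w' = p @ x # q" by (meson split_list)
  have mset: "mset u = mset (p @ q)" using Cons.prems(1) w' by simp
  have len: "length (p @ q) = length u" by (metis mset size_mset)
  have set: "set (p @ x # q) \<subseteq> proper n \<times> proper n"
    using Cons.prems by (metis set_mset_mset w')
  have "lower (proper n) (length (p @ q)) (word (p @ x # q) - word (x # p @ q))"
    by (rule word_move_front_lower[OF set])
  then have 1: "lower (proper n) (length u) (const (-1) * (word (p @ x # q) - word (x # p @ q)))"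
    unfolding len by (rule lower_const_mult)
  have 2: "lower (proper n) (length u) (word (x # u) - word (x # p @ q))"
  proof (cases "u = []")
    case True
    then show ?thesis using len by (auto intro!: lower_FD FD_zero)
  next
    case False
    have "word [x] \<in> FD (proper n) 1" using Cons.prems by (intro FD_word) auto
    moreover have "lower (proper n) (length u - 1) (word u - word (p @ q))"
      using Cons.prems mset by (intro Cons.IH) auto
    ultimately have "lower (proper n) (1 + (length u - 1)) (word [x] * (word u - word (p @ q)))"
      by (intro lower_mult_left)
    then show ?thesis using False
      by (simp add: right_diff_distrib flip: word_Cons)
  qed
  have eq: "word (x # u) - word w' = (word (x # u) - word (x # p @ q)) + const (-1) * (word (p @ x # q) - word (x # p @ q))"
    by (simp add: const_hom w')
  show ?case using lower_add[OF 2 1] by (simp only: eq list.size diff_Suc_1 add_Suc_right add_0_right)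
qed

text \<open>The principal symbol of a tensor of degree at most \<open>m\<close>, as a function on
  matrices.\<close>

definition symbol :: "nat \<Rightarrow> tens \<Rightarrow> (letter \<Rightarrow> complex) \<Rightarrow> complex" where
  "symbol m f X = (\<Sum>w | w \<in> Poly_Mapping.keys f \<and> length (letters w) = m.
     Poly_Mapping.lookup f w * prod_list (map X (letters w)))"

text \<open>A vanishing symbol means that the top coefficients add up to zero over each multiset of
  letters. So subtracting from every top word one fixed rearrangement \<open>rep\<close> of it
  leaves the top part unchanged, and each such difference has lower degree. Degree 0 is separate
  because \<open>m - 1\<close> would not drop.\<close>

lemma symbol_zero_lower:
  assumes f: "f \<in> FD (proper n) m" and zero: "\<And>X. symbol m f X = 0"
  shows "if m = 0 then f = 0 else lower (proper n) (m - 1) f"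
proof -
  define W where "W = {w \<in> Poly_Mapping.keys f. length (letters w) = m}"
  have fin: "finite W" by (simp add: W_def)
  define c where "c = (\<lambda>w. Poly_Mapping.lookup f (FWord w))"
  have inj: "inj_on letters W" by (rule inj_onI) (metis fword.expand)
  have cl: "c (letters w) = Poly_Mapping.lookup f w" for w by (simp add: c_def)
  have "(\<Sum>w\<in>letters ` W. c w * prod_list (map X w)) = 0" for X :: "letter \<Rightarrow> complex"
    using zero[of X] by (subst sum.reindex[OF inj]) (simp add: symbol_def W_def cl)
  then have cls0: "(\<Sum>w | w \<in> letters ` W \<and> mset w = M. c w) = 0" for M
    by (intro monomials_independent) (use fin in auto)
  define rep where "rep = (\<lambda>M :: letter multiset. SOME w. mset w = M)"
  have rep: "mset (rep M) = M" for M
    unfolding rep_def by (rule someI_ex) (rule ex_mset)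
  define top where "top = (\<Sum>w\<in>letters ` W. const (c w) * word w)"
  have "(\<Sum>w\<in>letters ` W. const (c w) * word (rep (mset w))) =
      (\<Sum>M\<in>mset ` letters ` W. \<Sum>w | w \<in> letters ` W \<and> mset w = M. const (c w) * word (rep (mset w)))"
    by (rule sum.group[symmetric]) (use fin in auto)
  also have "\<dots> = (\<Sum>M\<in>mset ` letters ` W. const (\<Sum>w | w \<in> letters ` W \<and> mset w = M. c w) * word (rep M))"
  proof (intro sum.cong refl)
    fix M
    show "(\<Sum>w | w \<in> letters ` W \<and> mset w = M. const (c w) * word (rep (mset w))) =
        const (\<Sum>w | w \<in> letters ` W \<and> mset w = M. c w) * word (rep M)"
      by (simp add: sum_distrib_right const_sum)
  qed
  also have "\<dots> = 0" by (simp add: cls0 const_hom)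
  finally have top_eq: "top = (\<Sum>w\<in>letters ` W. const (c w) * (word w - word (rep (mset w))))"
    by (simp add: top_def right_diff_distrib sum_subtractf)
  have letW: "set w \<subseteq> proper n \<times> proper n" "length w = m" if "w \<in> letters ` W" for w
    using that f by (auto simp: W_def FD_def fa_iff)
  have top_low: "lower (proper n) (m - 1) top"
    unfolding top_eq
  proof (intro lower_sum lower_const_mult)
    fix w assume w: "w \<in> letters ` W"
    show "lower (proper n) (m - 1) (word w - word (rep (mset w)))"
      using word_perm_lower[of w "rep (mset w)" n] letW[OF w] by (simp add: rep)
  qed
  define rest where "rest = (\<Sum>w | w \<in> Poly_Mapping.keys f \<and> length (letters w) \<noteq> m.
      const (Poly_Mapping.lookup f w) * word (letters w))"
  have "f = (\<Sum>w\<in>W. const (Poly_Mapping.lookup f w) * word (letters w)) + rest"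
  proof -
    have "f = (\<Sum>w\<in>Poly_Mapping.keys f. const (Poly_Mapping.lookup f w) * word (letters w))"
      by (rule tens_expand)
    also have "Poly_Mapping.keys f = W \<union> {w \<in> Poly_Mapping.keys f. length (letters w) \<noteq> m}"
      by (auto simp: W_def)
    also have "(\<Sum>w\<in>\<dots>. const (Poly_Mapping.lookup f w) * word (letters w)) =
        (\<Sum>w\<in>W. const (Poly_Mapping.lookup f w) * word (letters w)) + rest"
      unfolding rest_def by (rule sum.union_disjoint) (auto simp: W_def)
    finally show ?thesis .
  qed
  also have "(\<Sum>w\<in>W. const (Poly_Mapping.lookup f w) * word (letters w)) = top"
    unfolding top_def by (subst sum.reindex[OF inj]) (simp add: cl)
  finally have f_eq: "f = top + rest" .
  show ?thesis
  proof (cases "m = 0")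
    case True
    have "W \<subseteq> {0}" using True by (auto simp: W_def) (metis fword.expand letters_zero)
    then have "top = 0"
      using cls0[of "{#}"] True letW by (auto simp: top_def subset_singleton_iff const_hom)
    moreover have "rest = 0" using f True by (auto simp: rest_def FD_def intro!: sum.neutral)
    ultimately show ?thesis using f_eq True by simp
  next
    case False
    have "lower (proper n) (m - 1) rest"
    proof -
      have "rest \<in> FD (proper n) (m - 1)"
        unfolding rest_def
      proof (intro FD_sum FD_const_mult FD_word)
        fix w assume w: "w \<in> {w \<in> Poly_Mapping.keys f. length (letters w) \<noteq> m}"
        show "set (letters w) \<subseteq> proper n \<times> proper n" using w f by (auto simp: FD_def fa_iff)
        have "length (letters w) \<le> m" "length (letters w) \<noteq> m" using w f by (auto simp: FD_def)
        then show "length (letters w) \<le> m - 1" by simp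
      qed
      then show ?thesis by (rule lower_FD)
    qed
    then show ?thesis using False top_low f_eq lower_add by auto
  qed
qed

text \<open>The component of degree \<open>m\<close> as a polynomial function of the matrix X:
  coefficients times monomials, over all words of length \<open>m\<close> in proper letters. The
  recursion follows those of \<open>Sfun\<close>, \<open>Dfun\<close> and
  \<open>Rfun\<close>.\<close>

fun pol :: "nat \<Rightarrow> nat \<Rightarrow> letter vec \<Rightarrow> (letter \<Rightarrow> complex) \<Rightarrow> complex" where
  "pol n 0 v X = v []"
| "pol n (Suc m) v X = (\<Sum>x\<in>proper n \<times> proper n. X x * pol n m (\<lambda>u. v (x # u)) X)"

lemma finite_proper [simp]: "finite (proper n)"
  by (simp add: proper_def)

lemma pol_linear:
  "pol n m (\<lambda>u. f u + g u) X = pol n m f X + pol n m g X"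
  "pol n m (\<lambda>u. c * f u) X = c * pol n m f X"
  by (induction m arbitrary: f g) (auto simp: distrib_left sum.distrib sum_distrib_left mult_ac)

lemma pol_zero: "(\<And>w. length w = m \<Longrightarrow> v w = 0) \<Longrightarrow> pol n m v X = 0"
  by (induction m arbitrary: v) auto

lemma pol_sum: "pol n m (\<lambda>u. \<Sum>i\<in>I. f i u) X = (\<Sum>i\<in>I. pol n m (f i) X)"
  by (induction I rule: infinite_finite_induct) (auto simp: pol_zero pol_linear)

lemma letter_par_proper: "y \<in> proper n \<times> proper n' \<Longrightarrow> letter_par y = 2"
  by (auto simp: letter_par_def proper_parity)

lemma ksign_even: "even m \<or> even k \<Longrightarrow> ksign m k = 1"
  by (auto simp: ksign_def minus_one_power_iff)

text \<open>The shuffle product inserts \<open>x\<close> at each of the m + 1 places of a word of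
  length \<open>m\<close>, and all the resulting words have the same monomial; no signs occur since
  proper letters are even.\<close>

lemma pol_Sfun:
  assumes "x \<in> proper n \<times> proper n"
  shows "pol n (Suc m) (Sfun x v) X = of_nat (Suc m) * X x * pol n m v X"
proof (induction m arbitrary: v)
  case 0
  have "pol n (Suc 0) (Sfun x v) X = (\<Sum>y\<in>proper n \<times> proper n. X y * (of_bool (x = y) * v []))" by simp
  also have "\<dots> = (\<Sum>y\<in>proper n \<times> proper n. if x = y then X y * v [] else 0)"
    by (intro sum.cong refl) auto
  also have "\<dots> = X x * v []" using assms by simp
  finally show ?case by simp
next
  case (Suc m)
  have "pol n (Suc (Suc m)) (Sfun x v) X =
    (\<Sum>y\<in>proper n \<times> proper n. X y * pol n (Suc m) (\<lambda>u. of_bool (x = y) * v u + 1 * Sfun x (\<lambda>u. v (y # u)) u) X)"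
    unfolding pol.simps(2)[of n "Suc m"]
    by (intro sum.cong refl) (simp add: letter_par_proper ksign_even)
  also have "\<dots> = (\<Sum>y\<in>proper n \<times> proper n. (if x = y then X y * pol n (Suc m) v X else 0)) +
     (\<Sum>y\<in>proper n \<times> proper n. X y * pol n (Suc m) (Sfun x (\<lambda>u. v (y # u))) X)"
    unfolding pol_linear sum.distrib[symmetric] by (intro sum.cong refl) (auto simp: distrib_left)
  also have "(\<Sum>y\<in>proper n \<times> proper n. (if x = y then X y * pol n (Suc m) v X else 0)) = X x * pol n (Suc m) v X"
    using assms by simp
  also have "(\<Sum>y\<in>proper n \<times> proper n. X y * pol n (Suc m) (Sfun x (\<lambda>u. v (y # u))) X) =
     of_nat (Suc m) * X x * pol n (Suc m) v X"
    by (simp only: Suc.IH) (simp add: sum_distrib_left mult_ac)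
  finally show ?case by (simp add: algebra_simps)
qed

lemma vac_word_length: "vac n (word u) w \<noteq> 0 \<Longrightarrow> length w \<le> length u"
  using vac_word_content[of n u w "Alpha 0"] by (auto simp: proper_def)

text \<open>Polarization keeps the length of words, so in top degree only the multiplications
  contribute. The successive insertions produce \<open>fact m\<close>.\<close>

lemma pol_vac_word:
  assumes "set w \<subseteq> proper n \<times> proper n" "length w \<le> m"
  shows "pol n m (vac n (word w)) X = of_bool (length w = m) * fact m * prod_list (map X w)"
  using assms
proof (induction w arbitrary: m)
  case Nil
  show ?case
  proof (cases m)
    case 0
    then show ?thesis by (simp add: vac_simps vac0_def)
  next
    case (Suc k)
    then have "pol n m vac0 X = 0" by (intro pol_zero) (auto simp: vac0_def)
    then show ?thesis using Suc by (simp add: vac_simps)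
  qed
next
  case (Cons x w)
  obtain a b where x: "x = (a, b)" by (cases x)
  then have xin: "x \<in> proper n \<times> proper n" using Cons.prems by auto
  show ?case
  proof (cases "length (x # w) = m")
    case True
    then obtain k where m: "m = Suc k" "length w = k" by auto
    have D0: "Dfun a b (vac n (word w)) u = 0" if "length u = m" for u
    proof (rule ccontr)
      assume "Dfun a b (vac n (word w)) u \<noteq> 0"
      from Dfun_content[OF this] obtain u' where "vac n (word w) u' \<noteq> 0" "length u' = length u" by auto
      then show False using vac_word_length[of n w u'] that m by auto
    qed
    have "vac n (word (x # w)) = (\<lambda>u. Dfun a b (vac n (word w)) u + 1 * Sfun x (vac n (word w)) u)"
      using xin x by (auto simp: vac_word_Cons app_AA fun_eq_iff)
    then have "pol n m (vac n (word (x # w))) X = pol n m (Sfun x (vac n (word w))) X"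
      using pol_zero[of m "Dfun a b (vac n (word w))"] D0 by (simp only: pol_linear) simp
    also have "\<dots> = of_nat (Suc k) * X x * pol n k (vac n (word w)) X"
      unfolding m(1) by (rule pol_Sfun[OF xin])
    also have "pol n k (vac n (word w)) X = fact k * prod_list (map X w)"
      using Cons.IH[of k] Cons.prems m by simp
    finally show ?thesis using m by (simp add: algebra_simps)
  next
    case False
    have "pol n m (vac n (word (x # w))) X = 0"
      by (rule pol_zero) (use False Cons.prems vac_word_length[of n "x # w"] in force)
    then show ?thesis using False by simp
  qed
qed

lemma vac_expand: "vac n f = (\<lambda>u. \<Sum>w\<in>Poly_Mapping.keys f. Poly_Mapping.lookup f w * vac n (word (letters w)) u)"
  by (subst (1) tens_expand) (simp add: vac_simps)

lemma pol_vac: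
  assumes "f \<in> FD (proper n) m"
  shows "pol n m (vac n f) X = fact m * symbol m f X"
proof -
  have "pol n m (vac n f) X =
    (\<Sum>w\<in>Poly_Mapping.keys f. Poly_Mapping.lookup f w *
      (of_bool (length (letters w) = m) * fact m * prod_list (map X (letters w))))"
    unfolding vac_expand[of n f] pol_sum pol_linear
    by (intro sum.cong refl) (use assms in \<open>simp add: FD_def fa_iff pol_vac_word\<close>)
  also have "\<dots> = (\<Sum>w\<in>Poly_Mapping.keys f. fact m * (if length (letters w) = m then
      Poly_Mapping.lookup f w * prod_list (map X (letters w)) else 0))"
    by (intro sum.cong refl) auto
  also have "\<dots> = fact m * symbol m f X"
    by (simp add: symbol_def sum_distrib_left sum.inter_filter)
  finally show ?thesis .
qed

text \<open>Descent on the degree: if the vacuum vector vanishes, so does the principal symbol, and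
  \<open>f\<close> can be replaced modulo the relations by a tensor of lower degree with the same
  vacuum vector.\<close>

theorem vac_injective:
  assumes "f \<in> fa (proper n)" "vac n f = (\<lambda>w. 0)"
  shows "f \<in> gl_ideal (proper n)"
proof -
  have *: "f \<in> gl_ideal (proper n)" if "f \<in> FD (proper n) m" "vac n f = (\<lambda>w. 0)" for f m
    using that
  proof (induction m arbitrary: f)
    case 0
    have "symbol 0 f X = 0" for X using pol_vac[OF 0(1), of X] 0(2) by simp
    then show ?case using symbol_zero_lower[OF 0(1)] by (simp add: gl_ideal_closed(1))
  next
    case (Suc m)
    have "symbol (Suc m) f X = 0" for X
    proof -
      have "pol n (Suc m) (vac n f) X = 0" by (rule pol_zero) (simp add: Suc.prems(2))
      then show ?thesis using pol_vac[OF Suc.prems(1), of X] by (simp del: fact_Suc pol.simps)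
    qed
    then have "lower (proper n) m f" using symbol_zero_lower[OF Suc.prems(1)] by simp
    then obtain g where g: "g \<in> FD (proper n) m" "f - g \<in> gl_ideal (proper n)"
      by (auto simp: lower_def)
    have "act n (f - g) = 0" using g(2) by (rule act_gl_ideal)
    then have "vac n (f - g) = (\<lambda>w. 0)" by (simp add: vac_def)
    then have "vac n g = (\<lambda>w. 0)" using Suc.prems(2) by (simp add: vac_simps fun_eq_iff)
    then have "g \<in> gl_ideal (proper n)" using g(1) Suc.IH by blast
    then show ?case using gl_ideal_closed(3)[OF g(2)] by fastforce
  qed
  define m where "m = Max (insert 0 ((\<lambda>w. length (letters w)) ` Poly_Mapping.keys f))"
  have "f \<in> FD (proper n) m"
    using assms(1) by (auto simp: FD_def m_def intro: Max_ge)
  then show ?thesis using * assms(2) by blast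
qed

lemma vac_gl_ideal: "f \<in> gl_ideal A \<Longrightarrow> vac n f = (\<lambda>w. 0)"
  by (simp add: vac_def act_gl_ideal)

lemma cls_eq_iff_vac:
  assumes "f \<in> fa (proper n)" "g \<in> fa (proper n)"
  shows "cls (proper n) f = cls (proper n) g \<longleftrightarrow> vac n f = vac n g"
  using assms cls_iff[OF assms] vac_injective[of "f - g" n] vac_gl_ideal[of "f - g" "proper n" n]
    free_alg_closed(6)[OF assms]
  by (auto simp: vac_simps fun_eq_iff)

section \<open>Central elements\<close>

lemma act_RR:
  assumes "i \<in> proper n" "j \<in> proper n"
  shows "(RR i j + SS (i, j)) * act n f = act n f * (RR i j + SS (i, j))"
proof -
  define R where "R = RR i j + SS (i, j)"
  have R: "R * AA n a b = AA n a b * R" for a b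
    unfolding R_def by (rule RR_AA[OF assms])
  have w: "R * act n (word w) = act n (word w) * R" for w
  proof (induction w)
    case (Cons x w)
    obtain a b where x: "x = (a, b)" by (cases x)
    have "act n (word (x # w)) = AA n a b * act n (word w)" by (simp add: act_simps x)
    then show ?case by (metis Cons R mult.assoc)
  qed (simp add: act_simps)
  have sc: "R * scal c = scal c * R" for c by (rule scalar_embD(4)[OF scalar_emb_scal, symmetric])
  have "R * act n f = act n f * R"
  proof (induction f rule: tens_induct)
    case (add c w f)
    have "R * (scal c * act n (word w)) = scal c * act n (word w) * R"
      by (metis w sc mult.assoc)
    then show ?case
      using add by (simp add: act_simps(3,6,8) distrib_left distrib_right)
  qed (simp add: act_simps)
  then show ?thesis by (simp only: R_def)
qed

lemma Dfun_vac0: "Dfun a b vac0 w = 0"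
  using Dfun_content[of a b vac0 w] by (force simp: vac0_def split: if_splits)

lemma Rfun_vac0: "Rfun i j vac0 w = 0"
proof -
  have "Rfun i j v w = 0" if "\<And>u. u \<noteq> [] \<Longrightarrow> v u = 0" for v
    using that by (induction w arbitrary: v) auto
  then show ?thesis by (auto simp: vac0_def)
qed

lemma vac_gen: "b \<in> proper n \<Longrightarrow> vac n (gen a b) = app (SS (a, b)) vac0"
  using vac_gen_mult[of n a b 1] by (auto simp: vac_simps app_AA Dfun_vac0 SS.rep_eq fun_eq_iff)

text \<open>On the vacuum both polarizations vanish, so e_{i,j} acts there as
  \<open>RR i j + SS (i, j)\<close>. That operator commutes with the action of \<open>f\<close> and
  can be pulled to the front.\<close>

lemma vac_mult_gen:
  assumes "i \<in> proper n" "j \<in> proper n"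
  shows "vac n (f * gen i j) = app (RR i j + SS (i, j)) (vac n f)"
proof -
  have "vac n (f * gen i j) = app (act n f) (app (RR i j + SS (i, j)) vac0)"
    using assms by (simp add: vac_mult vac_gen RR.rep_eq Rfun_vac0)
  also have "\<dots> = app ((RR i j + SS (i, j)) * act n f) vac0"
    by (simp only: act_RR[OF assms] app_simps)
  finally show ?thesis by (simp add: vac_def)
qed

lemma commute_gens_central:
  assumes f: "f \<in> fa A"
    and comm: "\<And>a b. a \<in> A \<Longrightarrow> b \<in> A \<Longrightarrow> gen a b * f - f * gen a b \<in> gl_ideal A"
  shows "cls A f \<in> center (U A)"
proof -
  have word: "word w * f - f * word w \<in> gl_ideal A" if "set w \<subseteq> A \<times> A" for w
    using that
  proof (induction w)
    case (Cons x w)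
    obtain a b where x: "x = (a, b)" by (cases x)
    have "word (x # w) * f - f * word (x # w) =
        gen a b * (word w * f - f * word w) + (gen a b * f - f * gen a b) * word w"
      by (simp add: x word_Cons_gen algebra_simps)
    moreover have "gen a b * (word w * f - f * word w) \<in> gl_ideal A"
      using Cons x by (intro gl_ideal_closed(6) fa_gen) auto
    moreover have "(gen a b * f - f * gen a b) * word w \<in> gl_ideal A"
      using Cons.prems x comm by (intro gl_ideal_closed(7) free_alg_closed(8)) auto
    ultimately show ?case by (simp only: gl_ideal_closed(3))
  qed (simp add: gl_ideal_closed(1))
  have "g * f - f * g \<in> gl_ideal A" if g: "g \<in> fa A" for g
  proof -
    have "g * f - f * g = (\<Sum>w\<in>Poly_Mapping.keys g. const (Poly_Mapping.lookup g w) * (word (letters w) * f - f * word (letters w)))"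
      (is "?l = ?r")
    proof -
      have "?r = (\<Sum>w\<in>Poly_Mapping.keys g. const (Poly_Mapping.lookup g w) * word (letters w) * f)
        - (\<Sum>w\<in>Poly_Mapping.keys g. f * (const (Poly_Mapping.lookup g w) * word (letters w)))"
        unfolding sum_subtractf[symmetric]
      proof (intro sum.cong refl)
        fix w
        have "const c * (f * W) = f * (const c * W)" for c W
          by (metis const_commute mult.assoc)
        then show "const (Poly_Mapping.lookup g w) * (word (letters w) * f - f * word (letters w)) =
          const (Poly_Mapping.lookup g w) * word (letters w) * f - f * (const (Poly_Mapping.lookup g w) * word (letters w))"
          by (simp add: right_diff_distrib mult.assoc)
      qed
      also have "\<dots> = ?l"
        by (simp only: sum_distrib_left[symmetric] sum_distrib_right[symmetric] tens_expand[symmetric])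
      finally show ?thesis by simp
    qed
    then show ?thesis
      using g by (auto simp: fa_iff intro!: gl_ideal_sum gl_ideal_closed(6) word free_alg_closed(3))
  qed
  then have "cls A (f * g) = cls A (g * f)" if "g \<in> fa A" for g
    using that f by (subst eq_commute) (simp add: cls_iff free_alg_closed)
  then show ?thesis
    using f by (auto simp: center_def U_carrier cls_ops[symmetric])
qed

text \<open>Left and right multiplication by e_{i,j} have the summand \<open>SS (i, j)\<close> in
  common; their difference on vacuum vectors is that of the two polarizations, and
  \<open>vac n\<close> is injective.\<close>

lemma central_iff:
  assumes f: "f \<in> fa (proper n)"
  shows "cls (proper n) f \<in> center (U (proper n)) \<longleftrightarrow>
    (\<forall>i\<in>proper n. \<forall>j\<in>proper n. app (DD i j) (vac n f) = app (RR i j) (vac n f))"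
proof -
  have key: "gen i j * f - f * gen i j \<in> gl_ideal (proper n) \<longleftrightarrow>
      app (DD i j) (vac n f) = app (RR i j) (vac n f)" if ij: "i \<in> proper n" "j \<in> proper n" for i j
  proof -
    have "gen i j * f - f * gen i j \<in> gl_ideal (proper n) \<longleftrightarrow> vac n (gen i j * f - f * gen i j) = (\<lambda>w. 0)"
    proof
      assume "vac n (gen i j * f - f * gen i j) = (\<lambda>w. 0)"
      moreover have "gen i j * f - f * gen i j \<in> fa (proper n)"
        by (intro free_alg_closed(5,6) fa_gen f ij)
      ultimately show "gen i j * f - f * gen i j \<in> gl_ideal (proper n)" by (simp only: vac_injective)
    qed (rule vac_gl_ideal)
    also have "\<dots> \<longleftrightarrow> app (DD i j) (vac n f) = app (RR i j) (vac n f)"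
      using ij by (simp add: vac_simps vac_gen_mult vac_mult_gen AA_def fun_eq_iff)
    finally show ?thesis .
  qed
  show ?thesis
  proof
    assume c: "cls (proper n) f \<in> center (U (proper n))"
    show "\<forall>i\<in>proper n. \<forall>j\<in>proper n. app (DD i j) (vac n f) = app (RR i j) (vac n f)"
    proof (intro ballI)
      fix i j assume ij: "i \<in> proper n" "j \<in> proper n"
      have "cls (proper n) (gen i j * f) = cls (proper n) (f * gen i j)"
        using c ij f by (simp add: center_def cls_ops fa_gen cls_in_U)
      then show "app (DD i j) (vac n f) = app (RR i j) (vac n f)"
        using key[OF ij] f ij by (simp add: cls_iff free_alg_closed fa_gen)
    qed
  qed (use key commute_gens_central[OF f] in blast)
qed

section \<open>The virtual projection\<close>

lemma proper_alphabet: "proper n \<subseteq> alphabet m0 m1 n"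
  by (auto simp: proper_def alphabet_def)

lemma virtual_iff: "b \<in> alphabet m0 m1 n \<Longrightarrow> virtual b \<longleftrightarrow> b \<notin> proper n"
  by (auto simp: proper_def alphabet_def virtual_def)

lemma virtual_not_proper: "virtual b \<Longrightarrow> b \<notin> proper n"
  by (auto simp: proper_def virtual_def)

lemma Irr_closed:
  "\<zero>\<^bsub>U (alphabet m0 m1 n)\<^esub> \<in> Irr m0 m1 n"
  "x \<in> Irr m0 m1 n \<Longrightarrow> y \<in> Irr m0 m1 n \<Longrightarrow> x \<oplus>\<^bsub>U (alphabet m0 m1 n)\<^esub> y \<in> Irr m0 m1 n"
  "x \<in> Irr m0 m1 n \<Longrightarrow> r \<in> carrier (U (alphabet m0 m1 n)) \<Longrightarrow> r \<otimes>\<^bsub>U (alphabet m0 m1 n)\<^esub> x \<in> Irr m0 m1 n"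
  unfolding Irr_def left_ideal_gen_def
  by (auto intro: additive_subgroup.zero_closed additive_subgroup.a_closed)

lemma prod_list_gen: "prod_list (map (\<lambda>(a, b). gen a b) w) = word w"
  by (induction w) (auto simp: word_Cons_gen)

lemma prod_list_gen': "prod_list (map2 gen u v) = word (zip u v)"
  using prod_list_gen[of "zip u v"] by simp

lemma irregular_in_Irr:
  assumes "set w \<subseteq> alphabet m0 m1 n \<times> alphabet m0 m1 n" "irregular w"
  shows "cls (alphabet m0 m1 n) (word w) \<in> Irr m0 m1 n"
  using assms unfolding Irr_def left_ideal_gen_def prod_list_gen by blast

text \<open>The classes that have a representative killed by every \<open>vac n'\<close> form a left
  ideal containing the irregular products, since a virtual symbol is proper for no n'. Having all n'
  at once allows the projection for n + 1 to be studied with \<open>vac n\<close>.\<close>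

lemma Irr_vac:
  assumes "z \<in> Irr m0 m1 n"
  shows "\<exists>g\<in>fa (alphabet m0 m1 n). z = cls (alphabet m0 m1 n) g \<and> (\<forall>n'. vac n' g = (\<lambda>w. 0))"
proof -
  let ?A = "alphabet m0 m1 n"
  let ?K = "cls ?A ` {g \<in> fa ?A. \<forall>n'. vac n' g = (\<lambda>w. 0)}"
  interpret ring "U ?A" by (rule ring_U)
  have "additive_subgroup ?K (U ?A)"
  proof (rule additive_subgroup.intro, rule group.subgroupI)
    show "group (add_monoid (U ?A))" by (rule a_group)
    show "?K \<subseteq> carrier (add_monoid (U ?A))" by (auto simp: cls_in_U)
    have "cls ?A 0 \<in> ?K" by (auto simp: vac_simps free_alg_closed)
    then show "?K \<noteq> {}" by blast
    show "inv\<^bsub>add_monoid (U ?A)\<^esub> a \<in> ?K" if a: "a \<in> ?K" for a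
    proof -
      obtain g where g: "g \<in> fa ?A" "\<forall>n'. vac n' g = (\<lambda>w. 0)" "a = cls ?A g" using a by auto
      have "\<ominus>\<^bsub>U ?A\<^esub> a = cls ?A (- g)"
        by (rule minus_equality)
           (use g in \<open>simp_all add: cls_ops[symmetric] free_alg_closed cls_zero cls_in_U\<close>)
      moreover have "cls ?A (- g) \<in> ?K" using g by (auto simp: vac_simps free_alg_closed)
      ultimately show ?thesis by (simp add: a_inv_def)
    qed
    show "a \<otimes>\<^bsub>add_monoid (U ?A)\<^esub> b \<in> ?K" if ab: "a \<in> ?K" "b \<in> ?K" for a b
    proof -
      obtain g where g: "g \<in> fa ?A" "\<forall>n'. vac n' g = (\<lambda>w. 0)" "a = cls ?A g" using ab by auto
      obtain h where h: "h \<in> fa ?A" "\<forall>n'. vac n' h = (\<lambda>w. 0)" "b = cls ?A h" using ab by auto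
      have "cls ?A (g + h) \<in> ?K" using g h by (auto simp: vac_simps free_alg_closed)
      then show ?thesis using g h by (simp add: cls_ops)
    qed
  qed
  moreover have "r \<otimes>\<^bsub>U ?A\<^esub> x \<in> ?K" if r: "r \<in> carrier (U ?A)" and x: "x \<in> ?K" for r x
  proof -
    obtain g where g: "g \<in> fa ?A" "\<forall>n'. vac n' g = (\<lambda>w. 0)" "x = cls ?A g" using x by auto
    obtain h where h: "h \<in> fa ?A" "r = cls ?A h" using r by (auto simp: U_carrier)
    have "cls ?A (h * g) \<in> ?K" using g h by (auto simp: vac_mult app_zero free_alg_closed)
    then show ?thesis using g h by (simp add: cls_ops)
  qed
  moreover have "cls ?A (prod_list (map (\<lambda>(a, b). gen a b) w)) \<in> ?K"
    if w: "set w \<subseteq> ?A \<times> ?A" "irregular w" for w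
  proof -
    obtain u a b v \<gamma> where w': "w = u @ (a, b) # v" "virtual \<gamma>"
      "count_list (map snd ((a, b) # v)) \<gamma> > count_list (map fst v) \<gamma>"
      using w(2) unfolding irregular_def by blast
    have "vac n' (word w) = (\<lambda>w. 0)" for n'
      unfolding w'(1) by (rule vac_irregular[OF virtual_not_proper w'(3)]) (rule w')
    then show ?thesis unfolding prod_list_gen using free_alg_closed(8)[OF w(1)] by auto
  qed
  ultimately have "Irr m0 m1 n \<subseteq> ?K"
    unfolding Irr_def left_ideal_gen_def by (intro Inter_lower CollectI conjI ballI) auto
  then show ?thesis using assms by auto
qed

lemma U_incl_cls:
  assumes "f \<in> fa (proper n)"
  shows "U_incl m0 m1 n (cls (proper n) f) = cls (alphabet m0 m1 n) f"
proof -
  let ?A = "alphabet m0 m1 n"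
  have fA: "f \<in> fa ?A" using assms fa_mono[OF proper_alphabet] by blast
  have mem: "cls (proper n) f = (\<lambda>h. h + f) ` gl_ideal (proper n)"
    by (auto simp: cls_def a_r_coset_def')
  have "cls ?A (h + f) = cls ?A f" if "h \<in> gl_ideal (proper n)" for h
  proof -
    have "h \<in> gl_ideal ?A" using that gl_ideal_mono[OF proper_alphabet] by blast
    then show ?thesis using fA gl_ideal_closed(2) by (simp add: cls_iff free_alg_closed)
  qed
  then have "cls ?A ` cls (proper n) f = {cls ?A f}"
    unfolding mem using gl_ideal_closed(1) by (auto simp: image_iff)
  then show ?thesis by (simp add: U_incl_def)
qed

text \<open>Every candidate for the projection of \<open>x\<close> has the vacuum vector of
  \<open>x\<close>, and \<open>vac n\<close> is injective on U(gl(n)); this makes the description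
  definite.\<close>

lemma virt_proj_eq:
  assumes x: "x \<in> fa (alphabet m0 m1 n)" and y: "y \<in> fa (proper n)"
    and irr: "cls (alphabet m0 m1 n) (x - y) \<in> Irr m0 m1 n"
  shows "virt_proj m0 m1 n (cls (alphabet m0 m1 n) x) = cls (proper n) y"
    and "vac n' y = vac n' x"
proof -
  let ?A = "alphabet m0 m1 n"
  have sub: "fa (proper n) \<subseteq> fa ?A" by (rule fa_mono[OF proper_alphabet])
  have vac_eq: "vac n' f = vac n' g"
    if fg: "f \<in> fa ?A" "g \<in> fa ?A" and z: "z \<in> Irr m0 m1 n" "cls ?A f = cls ?A g \<oplus>\<^bsub>U ?A\<^esub> z" for f g z n'
  proof -
    obtain h where h: "h \<in> fa ?A" "z = cls ?A h" "\<forall>n'. vac n' h = (\<lambda>w. 0)"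
      using Irr_vac[OF z(1)] by blast
    have "cls ?A f = cls ?A (g + h)" using z(2) h fg by (simp add: cls_ops)
    then have "f - (g + h) \<in> gl_ideal ?A" using fg h by (simp add: cls_iff free_alg_closed)
    from vac_gl_ideal[OF this, of n'] h(3) show ?thesis by (simp add: vac_simps fun_eq_iff)
  qed
  have dec: "cls ?A x = cls ?A y \<oplus>\<^bsub>U ?A\<^esub> cls ?A (x - y)"
    using x y sub by (subst cls_ops[symmetric]) (auto simp: free_alg_closed)
  show "vac n' y = vac n' x"
    using vac_eq[OF _ _ irr dec] x y sub by auto
  show "virt_proj m0 m1 n (cls ?A x) = cls (proper n) y"
    unfolding virt_proj_def
  proof (rule the_equality)
    show "cls (proper n) y \<in> carrier (U (proper n)) \<and>
      (\<exists>z\<in>Irr m0 m1 n. cls ?A x = U_incl m0 m1 n (cls (proper n) y) \<oplus>\<^bsub>U ?A\<^esub> z)"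
      using irr dec y by (auto simp: U_incl_cls cls_in_U)
  next
    fix y' assume "y' \<in> carrier (U (proper n)) \<and>
      (\<exists>z\<in>Irr m0 m1 n. cls ?A x = U_incl m0 m1 n y' \<oplus>\<^bsub>U ?A\<^esub> z)"
    then obtain f z where f: "f \<in> fa (proper n)" "y' = cls (proper n) f"
      and z: "z \<in> Irr m0 m1 n" "cls ?A x = cls ?A f \<oplus>\<^bsub>U ?A\<^esub> z"
      by (auto simp: U_carrier U_incl_cls)
    have "vac n x = vac n f" using vac_eq[OF _ _ z] x f sub by auto
    moreover have "vac n x = vac n y" using vac_eq[OF _ _ irr dec] x y sub by auto
    ultimately show "y' = cls (proper n) y" using f y by (simp add: cls_eq_iff_vac)
  qed
qed

text \<open>The weight of a product under the adjoint action of e_{\<gamma>,\<gamma>}; the relations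
  of the superalgebra preserve it.\<close>

definition wt :: "letter list \<Rightarrow> symb \<Rightarrow> int" where
  "wt w \<gamma> = int (count_list (map fst w) \<gamma>) - int (count_list (map snd w) \<gamma>)"

lemma wt_simps [simp]: "wt [] \<gamma> = 0" "wt ((a, b) # w) \<gamma> = of_bool (a = \<gamma>) - of_bool (b = \<gamma>) + wt w \<gamma>"
  by (auto simp: wt_def)

text \<open>
  A letter \<open>e\<^bsub>a,\<gamma>\<^esub>\<close> with \<open>\<gamma>\<close> virtual can be commuted to the right end of a word, where it makes the word
  irregular; the commutators have fewer letters. What remains has proper column symbols only, and if it is
  balanced then its row symbols are proper as well.
\<close>

definition good :: "symb set \<Rightarrow> nat \<Rightarrow> nat \<Rightarrow> (symb \<Rightarrow> int) \<Rightarrow> tens set" where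
  "good A n d \<omega> = {f. \<forall>w\<in>Poly_Mapping.keys f. set (letters w) \<subseteq> A \<times> proper n \<and>
     length (letters w) \<le> d \<and> (\<forall>\<gamma>. virtual \<gamma> \<longrightarrow> wt (letters w) \<gamma> = \<omega> \<gamma>)}"

lemma good_add: "f \<in> good A n d \<omega> \<Longrightarrow> g \<in> good A n d \<omega> \<Longrightarrow> f + g \<in> good A n d \<omega>"
  using keys_add[of f g] unfolding good_def by blast

lemma good_const_word:
  "set w \<subseteq> A \<times> proper n \<Longrightarrow> length w \<le> d \<Longrightarrow> (\<And>\<gamma>. virtual \<gamma> \<Longrightarrow> wt w \<gamma> = \<omega> \<gamma>) \<Longrightarrow>
    const c * word w \<in> good A n d \<omega>"
  by (auto simp: good_def word_def const_mult split: if_splits)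

lemma good_zero: "0 \<in> good A n d \<omega>"
  by (simp add: good_def)

lemma good_sum: "(\<And>i. i \<in> I \<Longrightarrow> F i \<in> good A n d \<omega>) \<Longrightarrow> sum F I \<in> good A n d \<omega>"
  by (induction I rule: infinite_finite_induct) (auto intro: good_add good_zero)

lemma good_const_mult:
  assumes "f \<in> good A n d \<omega>"
  shows "const c * f \<in> good A n d \<omega>"
proof -
  have "const c * f = (\<Sum>w\<in>Poly_Mapping.keys f. const (c * Poly_Mapping.lookup f w) * word (letters w))"
    by (subst tens_expand) (simp add: sum_distrib_left const_hom mult.assoc)
  also have "\<dots> \<in> good A n d \<omega>"
    using assms by (intro good_sum good_const_word) (auto simp: good_def)
  finally show ?thesis .
qed

lemma good_gen_mult:
  assumes "f \<in> good A n d \<omega>" "a \<in> A" "b \<in> proper n"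
    and "\<And>\<gamma>. virtual \<gamma> \<Longrightarrow> \<omega>' \<gamma> = of_bool (a = \<gamma>) + \<omega> \<gamma>"
  shows "gen a b * f \<in> good A n (Suc d) \<omega>'"
proof -
  have "gen a b * f = (\<Sum>w\<in>Poly_Mapping.keys f. const (Poly_Mapping.lookup f w) * word ((a, b) # letters w))"
    by (simp only: gen_word word_mult_expand)
  also have "\<dots> \<in> good A n (Suc d) \<omega>'"
    using assms virtual_not_proper by (intro good_sum good_const_word) (auto simp: good_def)
  finally show ?thesis .
qed

lemma koszul_sign_eq_const: "\<exists>c. koszul_sign a b c' d' = const c"
  using koszul_sign_const[of a b c' d'] by (metis const_hom(3,5))

definition irr_part :: "nat \<Rightarrow> nat \<Rightarrow> nat \<Rightarrow> tens set" where
  "irr_part m0 m1 n = {f \<in> fa (alphabet m0 m1 n). cls (alphabet m0 m1 n) f \<in> Irr m0 m1 n}"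

lemma irr_part_add: "f \<in> irr_part m0 m1 n \<Longrightarrow> g \<in> irr_part m0 m1 n \<Longrightarrow> f + g \<in> irr_part m0 m1 n"
  by (auto simp: irr_part_def free_alg_closed cls_ops Irr_closed)

lemma irr_part_mult: "f \<in> irr_part m0 m1 n \<Longrightarrow> g \<in> fa (alphabet m0 m1 n) \<Longrightarrow> g * f \<in> irr_part m0 m1 n"
  by (auto simp: irr_part_def free_alg_closed cls_ops Irr_closed cls_in_U)

lemma irr_part_gl_ideal: "f \<in> gl_ideal (alphabet m0 m1 n) \<Longrightarrow> f \<in> irr_part m0 m1 n"
proof -
  assume f: "f \<in> gl_ideal (alphabet m0 m1 n)"
  then have "cls (alphabet m0 m1 n) f = cls (alphabet m0 m1 n) 0"
    using gl_ideal_closed(2) by (simp add: cls_iff free_alg_closed)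
  then show ?thesis
    using f gl_ideal_closed(2) Irr_closed(1) by (auto simp: irr_part_def cls_zero)
qed

lemma irr_part_zero: "0 \<in> irr_part m0 m1 n"
  by (rule irr_part_gl_ideal) (rule gl_ideal_closed)

lemma irr_part_sum: "(\<And>i. i \<in> I \<Longrightarrow> F i \<in> irr_part m0 m1 n) \<Longrightarrow> sum F I \<in> irr_part m0 m1 n"
  by (induction I rule: infinite_finite_induct) (auto intro: irr_part_add irr_part_zero)

lemma devirtualize_step:
  assumes "set u \<subseteq> alphabet m0 m1 n \<times> proper n" "a \<in> alphabet m0 m1 n"
    "\<gamma> \<in> alphabet m0 m1 n" "virtual \<gamma>"
  shows "\<exists>g\<in>good (alphabet m0 m1 n) n (length u) (wt ((a, \<gamma>) # u)). word ((a, \<gamma>) # u) - g \<in> irr_part m0 m1 n"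
  using assms
proof (induction u arbitrary: a)
  case Nil
  have "irregular [(a, \<gamma>)]"
    unfolding irregular_def using Nil.prems(4)
    by (intro exI[of _ "[]"] exI[of _ a] exI[of _ \<gamma>]) simp
  then have "word [(a, \<gamma>)] \<in> irr_part m0 m1 n"
    unfolding irr_part_def using Nil.prems by (auto intro!: irregular_in_Irr free_alg_closed)
  then show ?case using good_zero by (intro bexI[of _ 0]) simp_all
next
  case (Cons x u)
  let ?A = "alphabet m0 m1 n"
  obtain c d where x: "x = (c, d)" by (cases x)
  have cd: "c \<in> ?A" "d \<in> proper n" "d \<in> ?A" and u: "set u \<subseteq> ?A \<times> proper n"
    using Cons.prems proper_alphabet[of n m0 m1] by (auto simp: x)
  obtain g1 where g1: "g1 \<in> good ?A n (length u) (wt ((a, \<gamma>) # u))" "word ((a, \<gamma>) # u) - g1 \<in> irr_part m0 m1 n"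
    using Cons.IH[OF u Cons.prems(2-4)] by blast
  obtain g2 where g2: "g2 \<in> good ?A n (length u) (wt ((c, \<gamma>) # u))" "word ((c, \<gamma>) # u) - g2 \<in> irr_part m0 m1 n"
    using Cons.IH[OF u cd(1) Cons.prems(3,4)] by blast
  obtain k where ks: "koszul_sign a \<gamma> c d = const k" using koszul_sign_eq_const by blast
  \<comment> \<open>The three terms that the relation gives for e_{a,\<gamma>} e_{c,d}: the
    exchanged product, and the two bracket terms e_{a,d} and e_{c,\<gamma>}. The last one still has
    column symbol \<gamma> but row symbol c, which is why the induction leaves \<open>a\<close>
    arbitrary.\<close>
  define h1 where "h1 = const k * (gen c d * g1)"
  define h2 :: tens where "h2 = of_bool (\<gamma> = c) * word ((a, d) # u)"
  define h3 where "h3 = const (- k) * (of_bool (a = d) * g2)"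
  have "d \<noteq> \<gamma>" using cd Cons.prems virtual_not_proper by auto
  have "h1 \<in> good ?A n (Suc (length u)) (wt ((a, \<gamma>) # x # u))"
    unfolding h1_def
    using cd virtual_not_proper by (intro good_const_mult good_gen_mult[OF g1(1)]) (auto simp: x)
  moreover have "h2 \<in> good ?A n (Suc (length u)) (wt ((a, \<gamma>) # x # u))"
  proof (cases "\<gamma> = c")
    case True
    have "const 1 * word ((a, d) # u) \<in> good ?A n (Suc (length u)) (wt ((a, \<gamma>) # x # u))"
      using True Cons.prems cd u by (intro good_const_word) (auto simp: x)
    then show ?thesis using True by (simp add: h2_def const_hom)
  qed (simp add: h2_def good_zero)
  moreover have "h3 \<in> good ?A n (Suc (length u)) (wt ((a, \<gamma>) # x # u))"
  proof (cases "a = d")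
    case True
    have "g2 \<in> good ?A n (Suc (length u)) (wt ((a, \<gamma>) # x # u))"
      using g2(1) True cd virtual_not_proper by (auto simp: good_def x)
    then show ?thesis using True by (simp add: h3_def good_const_mult)
  qed (simp add: h3_def good_zero)
  ultimately have good: "h1 + h2 + h3 \<in> good ?A n (length (x # u)) (wt ((a, \<gamma>) # x # u))"
    by (simp add: good_add)
  define r where "r = gen a \<gamma> * gen c d - koszul_sign a \<gamma> c d * (gen c d * gen a \<gamma>) - gl_bracket a \<gamma> c d"
  have ufa: "word u \<in> fa ?A" using u proper_alphabet[of n m0 m1] by (intro free_alg_closed) auto
  have "r \<in> gl_ideal ?A"
    using gl_relation_in_ideal[of ?A] cd Cons.prems by (force simp: r_def gl_relations_def)
  then have r: "r * word u \<in> irr_part m0 m1 n"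
    by (intro irr_part_gl_ideal gl_ideal_closed ufa)
  have e1: "const k * (gen c d * (word ((a, \<gamma>) # u) - g1)) \<in> irr_part m0 m1 n"
    using cd by (intro irr_part_mult g1 free_alg_closed fa_gen)
  have e3: "const (- k) * (of_bool (a = d) * (word ((c, \<gamma>) # u) - g2)) \<in> irr_part m0 m1 n"
    by (intro irr_part_mult g2 free_alg_closed) (cases "a = d"; simp add: free_alg_closed)
  have "word ((a, \<gamma>) # x # u) - (h1 + h2 + h3) = r * word u + const k * (gen c d * (word ((a, \<gamma>) # u) - g1))
      + const (- k) * (of_bool (a = d) * (word ((c, \<gamma>) # u) - g2))"
    unfolding h1_def h2_def h3_def r_def gl_bracket_def ks x word_Cons_gen
    by (cases "\<gamma> = c"; cases "a = d") (simp_all add: algebra_simps const_hom)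
  then show ?case
    using good r e1 e3 by (intro bexI[of _ "h1 + h2 + h3"]) (simp_all add: irr_part_add del: wt_simps)
qed

text \<open>A letter with a virtual column symbol disappears by \<open>devirtualize_step\<close>
  without lengthening the rest, so only letters with proper column symbols count for the degree. For
  the words used later this halves the naive bound.\<close>

lemma devirtualize:
  assumes "set w \<subseteq> alphabet m0 m1 n \<times> alphabet m0 m1 n"
  shows "\<exists>g\<in>good (alphabet m0 m1 n) n (length (filter (\<lambda>l. snd l \<in> proper n) w)) (wt w).
    word w - g \<in> irr_part m0 m1 n"
  using assms
proof (induction w)
  case Nil
  have "const 1 * word [] \<in> good (alphabet m0 m1 n) n 0 (wt [])" by (intro good_const_word) auto
  then show ?case by (intro bexI[of _ 1]) (simp_all add: const_hom irr_part_zero del: wt_simps)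
next
  case (Cons x w)
  let ?A = "alphabet m0 m1 n"
  let ?d = "\<lambda>w. length (filter (\<lambda>l. snd l \<in> proper n) w)"
  obtain a b where x: "x = (a, b)" by (cases x)
  have ab: "a \<in> ?A" "b \<in> ?A" using Cons.prems by (auto simp: x)
  obtain g where g: "g \<in> good ?A n (?d w) (wt w)" "word w - g \<in> irr_part m0 m1 n"
    using Cons by auto
  have step: "gen a b * (word w - g) \<in> irr_part m0 m1 n"
    by (intro irr_part_mult g fa_gen ab)
  show ?case
  proof (cases "b \<in> proper n")
    case True
    have "gen a b * g \<in> good ?A n (?d (x # w)) (wt (x # w))"
      using good_gen_mult[OF g(1) ab(1) True, of "wt (x # w)"] True virtual_not_proper by (auto simp: x)
    moreover have "word (x # w) - gen a b * g = gen a b * (word w - g)"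
      by (simp add: x word_Cons_gen right_diff_distrib)
    ultimately show ?thesis using step by (intro bexI[of _ "gen a b * g"]) simp_all
  next
    case False
    then have virt: "virtual b" using ab virtual_iff by blast
    have "\<exists>h\<in>good ?A n (?d w) (wt (x # w)). word (x # letters v) - h \<in> irr_part m0 m1 n"
      if v: "v \<in> Poly_Mapping.keys g" for v
    proof -
      have v': "set (letters v) \<subseteq> ?A \<times> proper n" "length (letters v) \<le> ?d w"
        "\<And>\<gamma>. virtual \<gamma> \<Longrightarrow> wt (letters v) \<gamma> = wt w \<gamma>"
        using v g(1) by (auto simp: good_def)
      obtain h where h: "h \<in> good ?A n (length (letters v)) (wt ((a, b) # letters v))"
        "word ((a, b) # letters v) - h \<in> irr_part m0 m1 n"
        using devirtualize_step[OF v'(1) ab virt] by blast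
      have "h \<in> good ?A n (?d w) (wt (x # w))"
        using h(1) v' by (force simp: good_def x)
      then show ?thesis using h(2) x by blast
    qed
    then obtain h where h: "\<And>v. v \<in> Poly_Mapping.keys g \<Longrightarrow> h v \<in> good ?A n (?d w) (wt (x # w)) \<and>
        word (x # letters v) - h v \<in> irr_part m0 m1 n"
      by metis
    define H where "H = (\<Sum>v\<in>Poly_Mapping.keys g. const (Poly_Mapping.lookup g v) * h v)"
    have H: "H \<in> good ?A n (?d (x # w)) (wt (x # w))"
      unfolding H_def using h False by (auto intro!: good_sum good_const_mult simp: x)
    have "gen a b * g - H = (\<Sum>v\<in>Poly_Mapping.keys g. const (Poly_Mapping.lookup g v) * (word (x # letters v) - h v))"
    proof -
      have "gen a b * g = (\<Sum>v\<in>Poly_Mapping.keys g. const (Poly_Mapping.lookup g v) * word (x # letters v))"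
        by (simp only: gen_word x word_mult_expand)
      then show ?thesis by (simp add: H_def right_diff_distrib sum_subtractf)
    qed
    also have "\<dots> \<in> irr_part m0 m1 n"
      using h by (intro irr_part_sum irr_part_mult free_alg_closed) auto
    finally have "gen a b * (word w - g) + (gen a b * g - H) \<in> irr_part m0 m1 n"
      by (intro irr_part_add step)
    then have "word (x # w) - H \<in> irr_part m0 m1 n"
      by (simp add: x word_Cons_gen right_diff_distrib)
    then show ?thesis using H by blast
  qed
qed

text \<open>Balance means weight zero at every virtual symbol. In the words left by
  \<open>devirtualize\<close> the column symbols are proper, so a virtual row symbol would give
  positive weight.\<close>

lemma virt_proj_word:
  assumes w: "set w \<subseteq> alphabet m0 m1 n \<times> alphabet m0 m1 n"
    and balanced: "\<And>\<gamma>. virtual \<gamma> \<Longrightarrow> count_list (map fst w) \<gamma> = count_list (map snd w) \<gamma>"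
  shows "\<exists>y\<in>FD (proper n) (length (filter (\<lambda>l. snd l \<in> proper n) w)).
    virt_proj m0 m1 n (cls (alphabet m0 m1 n) (word w)) = cls (proper n) y \<and> (\<forall>n'. vac n' y = vac n' (word w))"
proof -
  let ?A = "alphabet m0 m1 n"
  obtain g where g: "g \<in> good ?A n (length (filter (\<lambda>l. snd l \<in> proper n) w)) (wt w)"
    "word w - g \<in> irr_part m0 m1 n"
    using devirtualize[OF w] by blast
  have "set (letters v) \<subseteq> proper n \<times> proper n" if v: "v \<in> Poly_Mapping.keys g" for v
  proof
    fix l assume l: "l \<in> set (letters v)"
    have sub: "set (letters v) \<subseteq> ?A \<times> proper n" using g(1) v by (auto simp: good_def)
    have "fst l \<in> proper n"
    proof (rule ccontr)
      assume np: "fst l \<notin> proper n"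
      then have virt: "virtual (fst l)" using l sub virtual_iff[of "fst l"] by auto
      have "fst l \<notin> set (map snd (letters v))" using sub np by auto
      then have "count_list (map snd (letters v)) (fst l) = 0" by (rule count_notin)
      moreover have "wt (letters v) (fst l) = 0"
        using g(1) v virt balanced by (auto simp: good_def wt_def)
      ultimately have "count_list (map fst (letters v)) (fst l) = 0" by (simp add: wt_def)
      then show False using l by (simp add: count_list_0_iff)
    qed
    then show "l \<in> proper n \<times> proper n" using l sub by (cases l) auto
  qed
  then have y: "g \<in> FD (proper n) (length (filter (\<lambda>l. snd l \<in> proper n) w))"
    using g(1) by (auto simp: FD_def fa_iff good_def)
  show ?thesis
    using virt_proj_eq[of "word w" m0 m1 n g] free_alg_closed(8)[OF w] FD_fa[OF y] g(2) y
    by (auto simp: irr_part_def)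
qed

section \<open>Invariant polynomial functions on matrices\<close>

text \<open>The differential of \<open>pol n m v\<close> at X in direction Y, by the product rule
  applied to the recursion.\<close>

fun dpol :: "nat \<Rightarrow> nat \<Rightarrow> letter vec \<Rightarrow> (letter \<Rightarrow> complex) \<Rightarrow> (letter \<Rightarrow> complex) \<Rightarrow> complex" where
  "dpol n 0 v X Y = 0"
| "dpol n (Suc m) v X Y = (\<Sum>x\<in>proper n \<times> proper n.
     Y x * pol n m (\<lambda>u. v (x # u)) X + X x * dpol n m (\<lambda>u. v (x # u)) X Y)"

lemma pol_deriv:
  assumes "\<And>x. x \<in> proper n \<times> proper n \<Longrightarrow> ((\<lambda>s. Z s x) has_field_derivative Z' x) (at s)"
  shows "((\<lambda>s. pol n m v (Z s)) has_field_derivative dpol n m v (Z s) Z') (at s)"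
proof (induction m arbitrary: v)
  case (Suc m)
  show ?case
    unfolding pol.simps dpol.simps
    by (intro DERIV_sum) (auto intro!: derivative_eq_intros assms Suc)
qed simp

lemma dpol_sum:
  "dpol n m v X (\<lambda>x. \<Sum>k\<in>K. c k * Y k x) = (\<Sum>k\<in>K. c k * dpol n m v X (Y k))"
proof (induction m arbitrary: v)
  case (Suc m)
  have "dpol n (Suc m) v X (\<lambda>x. \<Sum>k\<in>K. c k * Y k x) =
     (\<Sum>x\<in>proper n \<times> proper n. \<Sum>k\<in>K. c k * (Y k x * pol n m (\<lambda>u. v (x # u)) X
        + X x * dpol n m (\<lambda>u. v (x # u)) X (Y k)))"
    by (auto intro!: sum.cong simp: Suc sum_distrib_left sum_distrib_right sum.distrib algebra_simps)
  also have "\<dots> = (\<Sum>k\<in>K. c k * dpol n (Suc m) v X (Y k))"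
    by (subst sum.swap) (simp add: sum_distrib_left)
  finally show ?case .
qed simp

lemma dpol_diff:
  "dpol n m v X (\<lambda>x. Y x - Y' x) = dpol n m v X Y - dpol n m v X Y'"
proof (induction m arbitrary: v)
  case (Suc m)
  show ?case
    unfolding dpol.simps Suc sum_subtractf[symmetric]
    by (intro sum.cong refl) (simp add: algebra_simps)
qed simp

lemma dpol_cong:
  "(\<And>x. x \<in> proper n \<times> proper n \<Longrightarrow> Y x = Y' x) \<Longrightarrow> dpol n m v X Y = dpol n m v X Y'"
  by (induction m arbitrary: v) (auto intro!: sum.cong)

text \<open>The direction is E X, with E the matrix unit at (j, i): row i of X put in the place of
  row j. For column polarization the direction is X E with the same matrix unit, so equality of the
  two means vanishing along E X - X E.\<close>

lemma pol_Dfun: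
  assumes "i \<in> proper n" "j \<in> proper n"
  shows "pol n m (Dfun i j v) X = dpol n m v X (\<lambda>x. if fst x = j then X (i, snd x) else 0)"
proof (induction m arbitrary: v)
  case (Suc m)
  let ?Y = "\<lambda>x. if fst x = j then X (i, snd x) else 0"
  have "pol n (Suc m) (Dfun i j v) X = (\<Sum>x\<in>proper n \<times> proper n. X x *
      pol n m (\<lambda>u. of_bool (fst x = i) * v ((j, snd x) # u) + 1 * Dfun i j (\<lambda>u. v (x # u)) u) X)"
    unfolding pol.simps by (intro sum.cong refl) (simp add: letter_par_proper ksign_even)
  also have "\<dots> = (\<Sum>x\<in>proper n \<times> proper n. X x * (of_bool (fst x = i) * pol n m (\<lambda>u. v ((j, snd x) # u)) X))
      + (\<Sum>x\<in>proper n \<times> proper n. X x * dpol n m (\<lambda>u. v (x # u)) X ?Y)"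
    by (simp only: pol_linear Suc.IH distrib_left sum.distrib mult_1)
  also have "(\<Sum>x\<in>proper n \<times> proper n. X x * (of_bool (fst x = i) * pol n m (\<lambda>u. v ((j, snd x) # u)) X)) =
      (\<Sum>k\<in>proper n. X (i, k) * pol n m (\<lambda>u. v ((j, k) # u)) X)"
  proof -
    have "(\<Sum>x\<in>proper n \<times> proper n. X x * (of_bool (fst x = i) * pol n m (\<lambda>u. v ((j, snd x) # u)) X)) =
      (\<Sum>p\<in>proper n. \<Sum>k\<in>proper n. if p = i then X (p, k) * pol n m (\<lambda>u. v ((j, k) # u)) X else 0)"
      unfolding sum.cartesian_product by (intro sum.cong refl) auto
    also have "\<dots> = (\<Sum>p\<in>proper n. if p = i then \<Sum>k\<in>proper n. X (p, k) * pol n m (\<lambda>u. v ((j, k) # u)) X else 0)"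
      by (intro sum.cong refl) auto
    finally show ?thesis using assms by simp
  qed
  also have "\<dots> = (\<Sum>x\<in>proper n \<times> proper n. ?Y x * pol n m (\<lambda>u. v (x # u)) X)"
  proof -
    have "(\<Sum>x\<in>proper n \<times> proper n. ?Y x * pol n m (\<lambda>u. v (x # u)) X) =
      (\<Sum>p\<in>proper n. \<Sum>k\<in>proper n. if p = j then X (i, k) * pol n m (\<lambda>u. v ((p, k) # u)) X else 0)"
      unfolding sum.cartesian_product by (intro sum.cong refl) auto
    also have "\<dots> = (\<Sum>p\<in>proper n. if p = j then \<Sum>k\<in>proper n. X (i, k) * pol n m (\<lambda>u. v ((p, k) # u)) X else 0)"
      by (intro sum.cong refl) auto
    finally show ?thesis using assms by simp
  qed
  finally show ?case by (simp add: sum.distrib)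
qed simp

lemma pol_Rfun:
  assumes "i \<in> proper n" "j \<in> proper n"
  shows "pol n m (Rfun i j v) X = dpol n m v X (\<lambda>x. if snd x = i then X (fst x, j) else 0)"
proof (induction m arbitrary: v)
  case (Suc m)
  let ?Y = "\<lambda>x. if snd x = i then X (fst x, j) else 0"
  have "pol n (Suc m) (Rfun i j v) X = (\<Sum>x\<in>proper n \<times> proper n. X x *
      pol n m (\<lambda>u. of_bool (snd x = j) * v ((fst x, i) # u) + 1 * Rfun i j (\<lambda>u. v (x # u)) u) X)"
    unfolding pol.simps by (intro sum.cong refl) simp
  also have "\<dots> = (\<Sum>x\<in>proper n \<times> proper n. X x * (of_bool (snd x = j) * pol n m (\<lambda>u. v ((fst x, i) # u)) X))
      + (\<Sum>x\<in>proper n \<times> proper n. X x * dpol n m (\<lambda>u. v (x # u)) X ?Y)"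
    by (simp only: pol_linear Suc.IH distrib_left sum.distrib mult_1)
  also have "(\<Sum>x\<in>proper n \<times> proper n. X x * (of_bool (snd x = j) * pol n m (\<lambda>u. v ((fst x, i) # u)) X)) =
      (\<Sum>p\<in>proper n. X (p, j) * pol n m (\<lambda>u. v ((p, i) # u)) X)"
  proof -
    have "(\<Sum>x\<in>proper n \<times> proper n. X x * (of_bool (snd x = j) * pol n m (\<lambda>u. v ((fst x, i) # u)) X)) =
      (\<Sum>p\<in>proper n. \<Sum>k\<in>proper n. if k = j then X (p, k) * pol n m (\<lambda>u. v ((p, i) # u)) X else 0)"
      unfolding sum.cartesian_product by (intro sum.cong refl) auto
    then show ?thesis using assms by simp
  qed
  also have "\<dots> = (\<Sum>x\<in>proper n \<times> proper n. ?Y x * pol n m (\<lambda>u. v (x # u)) X)"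
  proof -
    have "(\<Sum>x\<in>proper n \<times> proper n. ?Y x * pol n m (\<lambda>u. v (x # u)) X) =
      (\<Sum>p\<in>proper n. \<Sum>k\<in>proper n. if k = i then X (p, j) * pol n m (\<lambda>u. v ((p, k) # u)) X else 0)"
      unfolding sum.cartesian_product by (intro sum.cong refl) auto
    then show ?thesis using assms by simp
  qed
  finally show ?case by (simp add: sum.distrib)
qed simp

definition inv_vec :: "nat \<Rightarrow> letter vec \<Rightarrow> bool" where
  "inv_vec n v \<longleftrightarrow> (\<forall>i\<in>proper n. \<forall>j\<in>proper n. Dfun i j v = Rfun i j v)"

text \<open>Linearity in the direction passes from matrix units to an arbitrary B. The directions B
  X - X B are tangent to the conjugation orbit of X.\<close>

lemma inv_vec_dpol:
  assumes "inv_vec n v"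
  shows "dpol n m v X (\<lambda>(p, q). \<Sum>k\<in>proper n. B (p, k) * X (k, q) - X (p, k) * B (k, q)) = 0"
proof -
  let ?D = "\<lambda>(p, k) x. if fst x = p then X (k, snd x) else 0"
  let ?R = "\<lambda>(p, k) x. if snd x = k then X (fst x, p) else 0"
  have "dpol n m v X (\<lambda>(p, q). \<Sum>k\<in>proper n. B (p, k) * X (k, q) - X (p, k) * B (k, q)) =
     dpol n m v X (\<lambda>x. (\<Sum>l\<in>proper n \<times> proper n. B l * ?D l x) - (\<Sum>l\<in>proper n \<times> proper n. B l * ?R l x))"
  proof (rule dpol_cong)
    fix x assume "x \<in> proper n \<times> proper n"
    then obtain p q where x: "x = (p, q)" "p \<in> proper n" "q \<in> proper n" by auto
    have "(\<Sum>l\<in>proper n \<times> proper n. B l * ?D l x) =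
       (\<Sum>p'\<in>proper n. \<Sum>k\<in>proper n. if p' = p then B (p', k) * X (k, q) else 0)"
      unfolding sum.cartesian_product by (intro sum.cong refl) (auto simp: x)
    also have "\<dots> = (\<Sum>p'\<in>proper n. if p' = p then \<Sum>k\<in>proper n. B (p', k) * X (k, q) else 0)"
      by (intro sum.cong refl) auto
    finally have 1: "(\<Sum>l\<in>proper n \<times> proper n. B l * ?D l x) = (\<Sum>k\<in>proper n. B (p, k) * X (k, q))"
      using x by simp
    have "(\<Sum>l\<in>proper n \<times> proper n. B l * ?R l x) =
       (\<Sum>k\<in>proper n. \<Sum>q'\<in>proper n. if q' = q then X (p, k) * B (k, q') else 0)"
      unfolding sum.cartesian_product by (intro sum.cong refl) (auto simp: x)
    then have 2: "(\<Sum>l\<in>proper n \<times> proper n. B l * ?R l x) = (\<Sum>k\<in>proper n. X (p, k) * B (k, q))"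
      using x by simp
    show "(case x of (p, q) \<Rightarrow> \<Sum>k\<in>proper n. B (p, k) * X (k, q) - X (p, k) * B (k, q)) =
      (\<Sum>l\<in>proper n \<times> proper n. B l * ?D l x) - (\<Sum>l\<in>proper n \<times> proper n. B l * ?R l x)"
      unfolding 1 2 by (simp add: x sum_subtractf)
  qed
  also have "\<dots> = (\<Sum>l\<in>proper n \<times> proper n. B l * dpol n m v X (?D l)) - (\<Sum>l\<in>proper n \<times> proper n. B l * dpol n m v X (?R l))"
    by (simp only: dpol_diff dpol_sum)
  also have "\<dots> = 0"
  proof -
    have "dpol n m v X (?D l) = dpol n m v X (?R l)" if l: "l \<in> proper n \<times> proper n" for l
    proof -
      obtain p k where l': "l = (p, k)" "p \<in> proper n" "k \<in> proper n" using l by auto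
      have "dpol n m v X (?D l) = pol n m (Dfun k p v) X" using pol_Dfun[OF l'(3,2)] by (simp add: l'(1))
      also have "\<dots> = pol n m (Rfun k p v) X" using assms l' by (simp add: inv_vec_def)
      also have "\<dots> = dpol n m v X (?R l)" using pol_Rfun[OF l'(3,2)] by (simp add: l'(1))
      finally show ?thesis .
    qed
    then show ?thesis by simp
  qed
  finally show ?thesis .
qed

definition mfun :: "complex mat \<Rightarrow> letter \<Rightarrow> complex" where
  "mfun M l = (case l of (Prop i, Prop j) \<Rightarrow> M $$ (i - 1, j - 1) | _ \<Rightarrow> 0)"

lemma proper_sum: "(\<Sum>k\<in>proper n. f k) = (\<Sum>k<n. f (Prop (Suc k)))"
proof -
  have "proper n = (\<lambda>k. Prop (Suc k)) ` {..<n}"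
    by (auto simp: proper_def image_iff) (metis Suc_pred' lessThan_iff less_eq_Suc_le Suc_le_lessD)
  moreover have "inj_on (\<lambda>k. Prop (Suc k)) {..<n}" by (auto simp: inj_on_def)
  ultimately show ?thesis by (simp add: sum.reindex)
qed

lemma mfun_simps [simp]: "mfun M (Prop (Suc i), Prop (Suc j)) = M $$ (i, j)"
  by (simp add: mfun_def)

lemma inv_vec_dpol_mat:
  assumes "inv_vec n v" "B \<in> carrier_mat n n" "X \<in> carrier_mat n n"
  shows "dpol n m v (mfun X) (mfun (B * X - X * B)) = 0"
proof -
  have "dpol n m v (mfun X) (mfun (B * X - X * B)) =
     dpol n m v (mfun X) (\<lambda>(p, q). \<Sum>k\<in>proper n. mfun B (p, k) * mfun X (k, q) - mfun X (p, k) * mfun B (k, q))"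
  proof (rule dpol_cong)
    fix x assume "x \<in> proper n \<times> proper n"
    then obtain i j where x: "x = (Prop (Suc i), Prop (Suc j))" "i < n" "j < n"
      by (auto simp: proper_def) (metis Suc_pred' less_eq_Suc_le Suc_le_lessD)
    show "mfun (B * X - X * B) x = (case x of (p, q) \<Rightarrow> \<Sum>k\<in>proper n. mfun B (p, k) * mfun X (k, q) - mfun X (p, k) * mfun B (k, q))"
      using assms x by (simp add: proper_sum scalar_prod_def sum_subtractf lessThan_atLeast0)
  qed
  then show ?thesis using inv_vec_dpol[OF assms(1)] by simp
qed

section \<open>Polynomial dependence on one complex parameter\<close>

definition polyfun :: "(complex \<Rightarrow> complex) \<Rightarrow> bool" where
  "polyfun f \<longleftrightarrow> (\<exists>p. \<forall>t. f t = poly p t)"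

lemma polyfun_const [intro]: "polyfun (\<lambda>t. c)"
  unfolding polyfun_def by (rule exI[of _ "[:c:]"]) simp

lemma polyfun_id [intro]: "polyfun (\<lambda>t. t)"
  unfolding polyfun_def by (rule exI[of _ "[:0, 1:]"]) simp

lemma polyfun_add [intro]: "polyfun f \<Longrightarrow> polyfun g \<Longrightarrow> polyfun (\<lambda>t. f t + g t)"
  unfolding polyfun_def by (metis poly_add)

lemma polyfun_diff [intro]: "polyfun f \<Longrightarrow> polyfun g \<Longrightarrow> polyfun (\<lambda>t. f t - g t)"
  unfolding polyfun_def by (metis poly_diff)

lemma polyfun_mult [intro]: "polyfun f \<Longrightarrow> polyfun g \<Longrightarrow> polyfun (\<lambda>t. f t * g t)"
  unfolding polyfun_def by (metis poly_mult)

lemma polyfun_sum: "(\<And>i. i \<in> I \<Longrightarrow> polyfun (f i)) \<Longrightarrow> polyfun (\<lambda>t. \<Sum>i\<in>I. f i t)"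
  by (induction I rule: infinite_finite_induct) auto

lemma polyfun_prod: "(\<And>i. i \<in> I \<Longrightarrow> polyfun (f i)) \<Longrightarrow> polyfun (\<lambda>t. \<Prod>i\<in>I. f i t)"
  by (induction I rule: infinite_finite_induct) auto

lemma polyfun_prod_list: "(\<And>x. x \<in> set xs \<Longrightarrow> polyfun (f x)) \<Longrightarrow> polyfun (\<lambda>t. prod_list (map (\<lambda>x. f x t) xs))"
  by (induction xs) auto

lemma polyfun_finite_zeros: "polyfun f \<Longrightarrow> f a \<noteq> 0 \<Longrightarrow> finite {t. f t = 0}"
proof -
  assume "polyfun f" "f a \<noteq> 0"
  then obtain p where p: "\<And>t. f t = poly p t" by (auto simp: polyfun_def)
  then have "p \<noteq> 0" using \<open>f a \<noteq> 0\<close> by auto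
  then show ?thesis using poly_roots_finite p by simp
qed

lemma polyfun_eq_0:
  assumes "polyfun f" "finite T" "\<And>t. t \<notin> T \<Longrightarrow> f t = 0"
  shows "f t = 0"
proof (rule ccontr)
  assume "f t \<noteq> 0"
  then have "finite {t. f t = 0}" by (rule polyfun_finite_zeros[OF assms(1)])
  moreover have "UNIV = T \<union> {t. f t = 0}" using assms(3) by auto
  ultimately show False using assms(2) infinite_UNIV_char_0 by (metis finite_UnI)
qed

lemma polyfun_differentiable: "polyfun f \<Longrightarrow> f field_differentiable (at s)"
proof -
  assume "polyfun f"
  then obtain p where "f = poly p" by (auto simp: polyfun_def)
  then show ?thesis using poly_DERIV[of p s] field_differentiable_def by blast
qed

lemma polyfun_det:
  assumes "\<And>s. M s \<in> carrier_mat n n" "\<And>i j. i < n \<Longrightarrow> j < n \<Longrightarrow> polyfun (\<lambda>s. M s $$ (i, j))"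
  shows "polyfun (\<lambda>s. det (M s))"
  unfolding det_def'[OF assms(1)]
  by (intro polyfun_sum polyfun_mult polyfun_prod polyfun_const assms(2))
     (auto simp: permutes_in_image dest: permutes_in_image[where x = i for i])

lemma polyfun_adj_mat:
  assumes M: "\<And>s. M s \<in> carrier_mat n n" "\<And>i j. i < n \<Longrightarrow> j < n \<Longrightarrow> polyfun (\<lambda>s. M s $$ (i, j))"
    and ij: "i < n" "j < n"
  shows "polyfun (\<lambda>s. adj_mat (M s) $$ (i, j))"
proof -
  have "polyfun (\<lambda>s. det (mat_delete (M s) j i))"
  proof (rule polyfun_det)
    show "mat_delete (M s) j i \<in> carrier_mat (n - 1) (n - 1)" for s
      using M(1) by (rule mat_delete_carrier)
    show "polyfun (\<lambda>s. mat_delete (M s) j i $$ (a, b))" if "a < n - 1" "b < n - 1" for a b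
    proof -
      have "mat_delete (M s) j i $$ (a, b) = M s $$ (insert_index j a, insert_index i b)" for s
        using mat_delete_index[of "M s" "n - 1" j i a b] M(1)[of s] ij that by simp
      moreover have "insert_index j a < n" "insert_index i b < n"
        using that by (auto simp: insert_index_def)
      ultimately show ?thesis using M(2) by simp
    qed
  qed
  moreover have "adj_mat (M s) $$ (i, j) = (-1) ^ (j + i) * det (mat_delete (M s) j i)" for s
    using M(1)[of s] ij by (simp add: adj_mat_def cofactor_def)
  ultimately show ?thesis by (simp add: polyfun_mult polyfun_const)
qed

definition mat_deriv :: "nat \<Rightarrow> (complex \<Rightarrow> complex mat) \<Rightarrow> complex mat \<Rightarrow> complex \<Rightarrow> bool" where
  "mat_deriv n M M' s \<longleftrightarrow> (\<forall>i<n. \<forall>j<n. ((\<lambda>t. M t $$ (i, j)) has_field_derivative M' $$ (i, j)) (at s))"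

lemma mult_mat_entry:
  "A \<in> carrier_mat n n \<Longrightarrow> B \<in> carrier_mat n n \<Longrightarrow> i < n \<Longrightarrow> j < n \<Longrightarrow>
    (A * B) $$ (i, j) = (\<Sum>k<n. A $$ (i, k) * B $$ (k, j))"
  by (simp add: scalar_prod_def lessThan_atLeast0)

lemma mat_deriv_mult:
  assumes "mat_deriv n A A' s" "mat_deriv n B B' s"
    and c: "\<And>t. A t \<in> carrier_mat n n" "\<And>t. B t \<in> carrier_mat n n" "A' \<in> carrier_mat n n" "B' \<in> carrier_mat n n"
  shows "mat_deriv n (\<lambda>t. A t * B t) (A' * B s + A s * B') s"
  unfolding mat_deriv_def
proof (intro allI impI)
  fix i j assume ij: "i < n" "j < n"
  have "((\<lambda>t. \<Sum>k<n. A t $$ (i, k) * B t $$ (k, j)) has_field_derivative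
      (\<Sum>k<n. A' $$ (i, k) * B s $$ (k, j) + B' $$ (k, j) * A s $$ (i, k))) (at s)"
    using assms(1,2) ij unfolding mat_deriv_def by (intro DERIV_sum DERIV_mult) auto
  moreover have "(A' * B s + A s * B') $$ (i, j) =
      (\<Sum>k<n. A' $$ (i, k) * B s $$ (k, j) + B' $$ (k, j) * A s $$ (i, k))"
  proof -
    have "(A' * B s + A s * B') $$ (i, j) = (A' * B s) $$ (i, j) + (A s * B') $$ (i, j)"
      using ij c(1,2)[of s] c(3,4) by (intro index_add_mat) auto
    then show ?thesis
      by (simp only: mult_mat_entry[OF c(3,2) ij] mult_mat_entry[OF c(1,4) ij] sum.distrib mult.commute)
  qed
  ultimately show "((\<lambda>t. (A t * B t) $$ (i, j)) has_field_derivative (A' * B s + A s * B') $$ (i, j)) (at s)"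
    using mult_mat_entry[OF c(1,2) ij] by simp
qed

text \<open>
  Conjugation by \<open>1 + s (K - 1)\<close> joins \<open>C\<close> to its conjugate by \<open>K\<close>; this matrix is singular for finitely many
  complex \<open>s\<close> only, and invariance of \<open>v\<close> says that the derivative in \<open>s\<close> vanishes elsewhere.
\<close>

lemma inv_vec_conj:
  assumes v: "inv_vec n v" and C: "C \<in> carrier_mat n n"
    and K: "K \<in> carrier_mat n n" "K' \<in> carrier_mat n n" "K * K' = 1\<^sub>m n" "K' * K = 1\<^sub>m n"
  shows "pol n m v (mfun (K * C * K')) = pol n m v (mfun C)"
proof -
  let ?I = "1\<^sub>m n :: complex mat"
  define g where "g = (\<lambda>s. ?I + s \<cdot>\<^sub>m (K - ?I))"
  define g' where "g' = K - ?I"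
  \<comment> \<open>The inverse of \<open>g s\<close> is written with the adjugate, so that its
    entries are quotients of polynomials in \<open>s\<close>.\<close>
  define h where "h = (\<lambda>s. inverse (det (g s)) \<cdot>\<^sub>m adj_mat (g s))"
  have gc: "g s \<in> carrier_mat n n" for s using K(1) by (auto simp: g_def)
  have mc [simp]: "A * B \<in> carrier_mat n n" if "A \<in> carrier_mat n n" "B \<in> carrier_mat n n"
    for A B :: "complex mat" using that by simp
  have carr [simp]: "g s \<in> carrier_mat n n" "h s \<in> carrier_mat n n" "g' \<in> carrier_mat n n" for s
    using K(1) gc adj_mat(1)[OF gc[of s]] by (auto simp: h_def g'_def)
  have dims [simp]: "dim_row (g s) = n" "dim_col (g s) = n" "dim_row (h s) = n" "dim_col (h s) = n" for s
    using carrier_matD[OF carr(1)[of s]] carrier_matD[OF carr(2)[of s]] by blast+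
  have poly_g: "polyfun (\<lambda>s. g s $$ (i, j))" if "i < n" "j < n" for i j
  proof -
    have "g s $$ (i, j) = ?I $$ (i, j) + s * (K $$ (i, j) - ?I $$ (i, j))" for s
      using that K(1) by (simp add: g_def)
    then show ?thesis
      by (simp only:) (intro polyfun_add polyfun_mult polyfun_const polyfun_id)
  qed
  have poly_det: "polyfun (\<lambda>s. det (g s))"
    by (rule polyfun_det[OF carr(1) poly_g])
  define S where "S = - {s. det (g s) = 0}"
  have inv: "g s * h s = ?I" "h s * g s = ?I" if "s \<in> S" for s
  proof -
    have d: "det (g s) \<noteq> 0" using that by (simp add: S_def)
    have "g s * h s = inverse (det (g s)) \<cdot>\<^sub>m (g s * adj_mat (g s))"
      unfolding h_def by (rule mult_smult_distrib[OF carr(1) adj_mat(1)[OF carr(1)]])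
    then show "g s * h s = ?I"
      using d by (simp add: adj_mat(2)[OF carr(1)]) (rule eq_matI; simp)
    have "h s * g s = inverse (det (g s)) \<cdot>\<^sub>m (adj_mat (g s) * g s)"
      unfolding h_def by (rule mult_smult_assoc_mat[OF adj_mat(1)[OF carr(1)] carr(1)])
    then show "h s * g s = ?I"
      using d by (simp add: adj_mat(3)[OF carr(1)]) (rule eq_matI; simp)
  qed
  have g0: "g 0 = ?I" by (rule eq_matI) (use K(1) in \<open>auto simp: g_def\<close>)
  have g1: "g 1 = K" by (rule eq_matI) (use K(1) in \<open>auto simp: g_def\<close>)
  have "det K * det K' = 1" using det_mult[OF K(1,2)] K(3) by simp
  then have S01: "0 \<in> S" "1 \<in> S" by (auto simp: S_def g0 g1)
  have fin: "finite {s. det (g s) = 0}"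
    by (rule polyfun_finite_zeros[OF poly_det, of 0]) (simp add: g0)
  have openS: "open S" unfolding S_def using fin by (simp add: finite_imp_closed open_Compl)
  \<comment> \<open>Removing finitely many points does not disconnect the complex plane; on a real
    line it could, hence the complex parameter.\<close>
  have connS: "connected S"
    using connected_open_delete_finite[of "UNIV :: complex set" "{s. det (g s) = 0}"] fin
      convex_connected[OF convex_UNIV]
    by (simp add: S_def Compl_eq_Diff_UNIV)
  have Cd [simp]: "dim_row C = n" "dim_col C = n" and C' [simp]: "C \<in> carrier_mat n n"
    using C carrier_matD[OF C] by blast+
  define Z where "Z = (\<lambda>s. g s * C * h s)"
  have Zc: "Z s \<in> carrier_mat n n" for s using C by (simp add: Z_def)
  have deriv_pol: "((\<lambda>s. pol n m v (mfun (Z s))) has_field_derivative 0) (at s)" if s: "s \<in> S" for s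
  proof -
    define h' where "h' = mat n n (\<lambda>(i, j). deriv (\<lambda>t. h t $$ (i, j)) s)"
    have h'c [simp]: "h' \<in> carrier_mat n n" by (simp add: h'_def)
    have h'd [simp]: "dim_row h' = n" "dim_col h' = n" by (simp_all add: h'_def)
    have dg: "mat_deriv n g g' s"
      unfolding mat_deriv_def using K(1) by (auto simp: g_def g'_def intro!: derivative_eq_intros)
    have dh: "mat_deriv n h h' s"
      unfolding mat_deriv_def
    proof (intro allI impI)
      fix i j assume ij: "i < n" "j < n"
      have "h t $$ (i, j) = inverse (det (g t)) * adj_mat (g t) $$ (i, j)" for t
        using ij adj_mat(1)[OF carr(1)[of t]] by (simp add: h_def)
      moreover have "(\<lambda>t. inverse (det (g t)) * adj_mat (g t) $$ (i, j)) field_differentiable (at s)"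
        using s ij by (intro field_differentiable_mult field_differentiable_inverse polyfun_differentiable
          poly_det polyfun_adj_mat[OF carr(1) poly_g]) (auto simp: S_def)
      ultimately have "(\<lambda>t. h t $$ (i, j)) field_differentiable (at s)" by simp
      then show "((\<lambda>t. h t $$ (i, j)) has_field_derivative h' $$ (i, j)) (at s)"
        using ij by (simp add: h'_def field_differentiable_derivI)
    qed
    have dC: "mat_deriv n (\<lambda>t. C) (0\<^sub>m n n) s" by (auto simp: mat_deriv_def)
    \<comment> \<open>The product rule for the constant \<open>g t * h t\<close>; it expresses
      \<open>h'\<close> through \<open>g'\<close>.\<close>
    have zero: "g' * h s + g s * h' = 0\<^sub>m n n"
    proof (rule eq_matI)
      fix i j assume "i < dim_row (0\<^sub>m n n :: complex mat)" "j < dim_col (0\<^sub>m n n :: complex mat)"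
      then have ij: "i < n" "j < n" by auto
      have "((\<lambda>t. (g t * h t) $$ (i, j)) has_field_derivative (g' * h s + g s * h') $$ (i, j)) (at s)"
        using mat_deriv_mult[OF dg dh carr(1,2,3) h'c] ij by (simp add: mat_deriv_def)
      moreover have "((\<lambda>t. (g t * h t) $$ (i, j)) has_field_derivative 0) (at s)"
        by (rule has_field_derivative_transform_within_open[of "\<lambda>t. ?I $$ (i, j)", OF _ openS s])
           (use inv in auto)
      ultimately show "(g' * h s + g s * h') $$ (i, j) = 0\<^sub>m n n $$ (i, j)"
        using ij DERIV_unique by fastforce
    qed simp_all
    \<comment> \<open>The logarithmic derivative of the conjugating matrix; with it the derivative
      of \<open>Z\<close> is the commutator B Z - Z B.\<close>
    define B where "B = g' * h s"
    have Bc [simp]: "B \<in> carrier_mat n n" by (simp add: B_def)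
    have Bd [simp]: "dim_row B = n" "dim_col B = n" using carrier_matD[OF Bc] by blast+
    have "mat_deriv n (\<lambda>t. g t * C) (g' * C + g s * 0\<^sub>m n n) s"
      by (rule mat_deriv_mult[OF dg dC]) (use carr C in auto)
    moreover have "g' * C + g s * 0\<^sub>m n n = g' * C"
      using carr C by (simp add: right_mult_zero_mat[of _ n n])
    ultimately have "mat_deriv n (\<lambda>t. g t * C) (g' * C) s" by simp
    then have dZ: "mat_deriv n Z (g' * C * h s + g s * C * h') s"
      unfolding Z_def by (rule mat_deriv_mult[OF _ dh]) (use carr C h'c in auto)
    have 1: "B * Z s = g' * C * h s"
    proof -
      have "B * Z s = g' * ((h s * g s) * (C * h s))"
        using carr C by (simp add: B_def Z_def assoc_mult_mat[of _ n n _ n _ n])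
      then show ?thesis using carr C inv(2)[OF s] by (simp add: assoc_mult_mat[of _ n n _ n _ n])
    qed
    have 2: "Z s * B = - (g s * C * h')"
    proof -
      have "h s * (g' * h s + g s * h') = h s * (g' * h s) + h'"
      proof -
        have "h s * (g' * h s + g s * h') = h s * (g' * h s) + h s * (g s * h')"
          using carr h'c by (intro mult_add_distrib_mat[of _ n n _ n]) auto
        also have "h s * (g s * h') = (h s * g s) * h'"
          using carr h'c by (simp add: assoc_mult_mat[of _ n n _ n _ n])
        finally show ?thesis using inv(2)[OF s] h'c by simp
      qed
      moreover have "h s * (g' * h s + g s * h') = 0\<^sub>m n n"
        unfolding zero using carr by (simp add: right_mult_zero_mat[of _ n n])
      ultimately have sum0: "h s * B + h' = 0\<^sub>m n n" by (simp add: B_def)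
      have hB: "h s * B = - h'"
      proof (rule eq_matI)
        fix i j assume "i < dim_row (- h')" "j < dim_col (- h')"
        then have ij: "i < n" "j < n" using h'c by auto
        have "(h s * B + h') $$ (i, j) = 0" using sum0 ij by simp
        then show "(h s * B) $$ (i, j) = (- h') $$ (i, j)"
          using ij carr Bc h'c by (simp add: add_eq_0_iff2 del: index_mult_mat(1))
      qed simp_all
      have "Z s * B = (g s * C) * (h s * B)"
        using carr C Bc unfolding Z_def by (intro assoc_mult_mat[of _ n n _ n _ n]) auto
      then show ?thesis unfolding hB using carr C h'c by simp
    qed
    have Z': "g' * C * h s + g s * C * h' = B * Z s - Z s * B"
      unfolding 1 2 using carr C h'c by (intro eq_matI) auto
    have "((\<lambda>s. pol n m v (mfun (Z s))) has_field_derivative dpol n m v (mfun (Z s)) (mfun (B * Z s - Z s * B))) (at s)"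
    proof (rule pol_deriv)
      fix x assume "x \<in> proper n \<times> proper n"
      then obtain i j where x: "x = (Prop (Suc i), Prop (Suc j))" "i < n" "j < n"
        by (auto simp: proper_def) (metis Suc_pred' less_eq_Suc_le Suc_le_lessD)
      show "((\<lambda>s. mfun (Z s) x) has_field_derivative mfun (B * Z s - Z s * B) x) (at s)"
        using dZ x unfolding Z' mat_deriv_def by simp
    qed
    then show ?thesis using inv_vec_dpol_mat[OF v Bc Zc] by simp
  qed
  have "continuous_on S (\<lambda>s. pol n m v (mfun (Z s)))"
    using deriv_pol by (meson DERIV_isCont continuous_at_imp_continuous_on)
  then obtain c where c: "\<And>s. s \<in> S \<Longrightarrow> pol n m v (mfun (Z s)) = c"
    using DERIV_zero_connected_constant[OF connS openS finite.emptyI] deriv_pol by (metis Diff_empty)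
  have "h 0 = ?I" using inv(1)[OF S01(1)] carr(2)[of 0] by (simp add: g0)
  then have Z0: "Z 0 = C" using C by (simp add: Z_def g0)
  have "h 1 = (K' * K) * h 1" using K(4) carr(2)[of 1] by simp
  also have "\<dots> = K' * (K * h 1)" by (rule assoc_mult_mat[OF K(2) K(1) carr(2)])
  also have "\<dots> = K'" using inv(1)[OF S01(2)] K by (simp add: g1)
  finally have Z1: "Z 1 = K * C * K'" by (simp add: Z_def g1)
  show ?thesis using c[OF S01(1)] c[OF S01(2)] Z0 Z1 by simp
qed

section \<open>Companion matrices and cyclic vectors\<close>

definition companion :: "nat \<Rightarrow> (nat \<Rightarrow> complex) \<Rightarrow> complex mat" where
  "companion n a = mat n n (\<lambda>(i, j). if j = n - 1 then a i else of_bool (i = Suc j))"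

text \<open>The coordinates of X^j e for the first unit vector e.\<close>

fun krylov :: "nat \<Rightarrow> complex mat \<Rightarrow> nat \<Rightarrow> nat \<Rightarrow> complex" where
  "krylov n X 0 i = of_bool (i = 0)"
| "krylov n X (Suc j) i = (\<Sum>k<n. X $$ (i, k) * krylov n X j k)"

definition krylov_mat :: "nat \<Rightarrow> complex mat \<Rightarrow> complex mat" where
  "krylov_mat n X = mat n n (\<lambda>(i, j). krylov n X j i)"

lemma krylov_mat_carrier [simp]: "krylov_mat n X \<in> carrier_mat n n"
  by (simp add: krylov_mat_def)

lemma companion_carrier [simp]: "companion n a \<in> carrier_mat n n"
  by (simp add: companion_def)

text \<open>X maps each column of the Krylov matrix K to the next one. Therefore the columns of the
  product of the inverse of K, X and K are shifted unit vectors, except for the last, whose entries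
  are the parameters \<open>a\<close>.\<close>

lemma krylov_conj:
  assumes X: "X \<in> carrier_mat n n" and d: "det (krylov_mat n X) \<noteq> 0"
  obtains K K' a where "K \<in> carrier_mat n n" "K' \<in> carrier_mat n n" "K * K' = 1\<^sub>m n" "K' * K = 1\<^sub>m n"
    "X = K * companion n a * K'"
proof -
  let ?I = "1\<^sub>m n :: complex mat"
  define K where "K = krylov_mat n X"
  have K: "K \<in> carrier_mat n n" by (simp add: K_def)
  define K' where "K' = inverse (det K) \<cdot>\<^sub>m adj_mat K"
  have K': "K' \<in> carrier_mat n n" using adj_mat(1)[OF K] by (simp add: K'_def)
  have d': "det K \<noteq> 0" using d by (simp add: K_def)
  have "K * K' = inverse (det K) \<cdot>\<^sub>m (K * adj_mat K)"
    unfolding K'_def by (rule mult_smult_distrib[OF K adj_mat(1)[OF K]])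
  then have KK': "K * K' = ?I"
    using d' by (simp add: adj_mat(2)[OF K]) (rule eq_matI; simp)
  have "K' * K = inverse (det K) \<cdot>\<^sub>m (adj_mat K * K)"
    unfolding K'_def by (rule mult_smult_assoc_mat[OF adj_mat(1)[OF K] K])
  then have K'K: "K' * K = ?I"
    using d' by (simp add: adj_mat(3)[OF K]) (rule eq_matI; simp)
  define C where "C = K' * (X * K)"
  have C: "C \<in> carrier_mat n n" using K K' X by (simp add: C_def)
  have XK: "X * K \<in> carrier_mat n n" using K X by simp
  have "C = companion n (\<lambda>i. C $$ (i, n - 1))"
  proof (rule eq_matI)
    fix i j assume "i < dim_row (companion n (\<lambda>i. C $$ (i, n - 1)))" "j < dim_col (companion n (\<lambda>i. C $$ (i, n - 1)))"
    then have ij: "i < n" "j < n" by (auto simp: companion_def)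
    show "C $$ (i, j) = companion n (\<lambda>i. C $$ (i, n - 1)) $$ (i, j)"
    proof (cases "j = n - 1")
      case True
      then show ?thesis using ij by (simp add: companion_def)
    next
      case False
      then have j: "Suc j < n" using ij by simp
      have "(X * K) $$ (l, j) = K $$ (l, Suc j)" if "l < n" for l
      proof -
        have "(X * K) $$ (l, j) = (\<Sum>k<n. X $$ (l, k) * krylov n X j k)"
          unfolding mult_mat_entry[OF X K that ij(2)]
          by (intro sum.cong refl) (use ij in \<open>simp add: K_def krylov_mat_def\<close>)
        also have "\<dots> = K $$ (l, Suc j)" using j that by (simp add: K_def krylov_mat_def)
        finally show ?thesis .
      qed
      then have "C $$ (i, j) = (K' * K) $$ (i, Suc j)"
        unfolding C_def mult_mat_entry[OF K' XK ij] mult_mat_entry[OF K' K ij(1) j] by simp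
      also have "\<dots> = of_bool (i = Suc j)" unfolding K'K using ij j by simp
      finally show ?thesis using False ij by (simp add: companion_def)
    qed
  qed (use C in \<open>auto simp: companion_def\<close>)
  moreover have "X = K * C * K'"
  proof -
    have "K * C = (K * K') * (X * K)" unfolding C_def by (rule assoc_mult_mat[OF K K' XK, symmetric])
    also have "\<dots> = X * K" unfolding KK' by (rule left_mult_one_mat[OF XK])
    finally have "K * C * K' = X * (K * K')" using assoc_mult_mat[OF X K K'] by simp
    then show ?thesis using X by (simp add: KK')
  qed
  ultimately show ?thesis using that[OF K K' KK' K'K] by metis
qed

text \<open>The alternative \<open>i \<ge> n\<close> covers indices outside the matrix, where
  \<open>$$\<close> is not determined by the definition of the companion matrix.\<close>

lemma krylov_companion:
  assumes "j < n"
  shows "krylov n (companion n a) j i = of_bool (i = j) \<or> i \<ge> n"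
  using assms
proof (induction j arbitrary: i)
  case (Suc j)
  show ?case
  proof (cases "i < n")
    case True
    have "krylov n (companion n a) (Suc j) i = (\<Sum>k<n. if k = j then companion n a $$ (i, k) else 0)"
      unfolding krylov.simps
    proof (intro sum.cong refl)
      fix k assume "k \<in> {..<n}"
      then have "krylov n (companion n a) j k = of_bool (k = j)" using Suc by fastforce
      then show "companion n a $$ (i, k) * krylov n (companion n a) j k =
        (if k = j then companion n a $$ (i, k) else 0)" by simp
    qed
    also have "\<dots> = of_bool (i = Suc j)" using Suc.prems True by (simp add: companion_def)
    finally show ?thesis by simp
  qed simp
qed simp

lemma krylov_mat_companion: "krylov_mat n (companion n a) = 1\<^sub>m n"
proof (rule eq_matI)
  fix i j assume "i < dim_row (1\<^sub>m n :: complex mat)" "j < dim_col (1\<^sub>m n :: complex mat)"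
  then show "krylov_mat n (companion n a) $$ (i, j) = 1\<^sub>m n $$ (i, j)"
    using krylov_companion[of j n a i] by (auto simp: krylov_mat_def)
qed (auto simp: krylov_mat_def)

lemma polyfun_krylov:
  assumes "\<And>t. M t \<in> carrier_mat n n" "\<And>i j. i < n \<Longrightarrow> j < n \<Longrightarrow> polyfun (\<lambda>t. M t $$ (i, j))" "i < n"
  shows "polyfun (\<lambda>t. krylov n (M t) j i)"
  using assms(3)
proof (induction j arbitrary: i)
  case (Suc j)
  then show ?case
    unfolding krylov.simps by (intro polyfun_sum polyfun_mult assms(2)) auto
qed (simp add: polyfun_const)

definition conj_invariant :: "nat \<Rightarrow> ((letter \<Rightarrow> complex) \<Rightarrow> complex) \<Rightarrow> bool" where
  "conj_invariant n f \<longleftrightarrow> (\<forall>C\<in>carrier_mat n n. \<forall>K\<in>carrier_mat n n. \<forall>K'\<in>carrier_mat n n.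
     K * K' = 1\<^sub>m n \<longrightarrow> K' * K = 1\<^sub>m n \<longrightarrow> f (mfun (K * C * K')) = f (mfun C))"

text \<open>Polynomiality in the form in which the density argument of \<open>invariants_eqI\<close>
  uses it: on each affine line separately.\<close>

definition line_polynomial :: "nat \<Rightarrow> ((letter \<Rightarrow> complex) \<Rightarrow> complex) \<Rightarrow> bool" where
  "line_polynomial n f \<longleftrightarrow> (\<forall>X\<in>carrier_mat n n. \<forall>Y\<in>carrier_mat n n. polyfun (\<lambda>t. f (mfun (X + t \<cdot>\<^sub>m Y))))"

text \<open>A generic matrix is conjugate to a companion matrix, since \<open>X\<close> acts as a companion matrix in the
  basis \<open>e, X e, X\<^sup>2 e, \<dots>\<close> whenever these vectors are independent.\<close>

lemma invariants_eqI:
  assumes f: "conj_invariant n f" "line_polynomial n f" and h: "conj_invariant n h" "line_polynomial n h"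
    and eq: "\<And>a. f (mfun (companion n a)) = h (mfun (companion n a))"
    and X: "X \<in> carrier_mat n n"
  shows "f (mfun X) = h (mfun X)"
proof -
  have generic: "f (mfun M) = h (mfun M)" if M: "M \<in> carrier_mat n n" "det (krylov_mat n M) \<noteq> 0" for M
  proof -
    obtain K K' a where K: "K \<in> carrier_mat n n" "K' \<in> carrier_mat n n" "K * K' = 1\<^sub>m n" "K' * K = 1\<^sub>m n"
      "M = K * companion n a * K'" by (rule krylov_conj[OF M])
    have "f (mfun M) = f (mfun (companion n a))" "h (mfun M) = h (mfun (companion n a))"
      using f(1) h(1) K unfolding conj_invariant_def by (metis companion_carrier)+
    then show ?thesis using eq by simp
  qed
  \<comment> \<open>The line from X, at parameter 0, to a companion matrix, at parameter 1. There
    the Krylov matrix is the identity, so its determinant is a nonzero polynomial along the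
    line.\<close>
  define Y where "Y = companion n (\<lambda>_. 0) - X"
  have Y: "Y \<in> carrier_mat n n" using X by (simp add: Y_def minus_carrier_mat)
  define M where "M = (\<lambda>t. X + t \<cdot>\<^sub>m Y)"
  have M: "M t \<in> carrier_mat n n" for t using X Y by (simp add: M_def)
  have entry: "M t $$ (i, j) = X $$ (i, j) + t * Y $$ (i, j)" if "i < n" "j < n" for t i j
    using that X Y by (simp add: M_def)
  have polyM: "polyfun (\<lambda>t. M t $$ (i, j))" if "i < n" "j < n" for i j
    unfolding entry[OF that] by (intro polyfun_add polyfun_mult polyfun_const polyfun_id)
  have M1: "M 1 = companion n (\<lambda>_. 0)"
  proof (rule eq_matI)
    fix i j assume "i < dim_row (companion n (\<lambda>_. 0))" "j < dim_col (companion n (\<lambda>_. 0))"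
    then have ij: "i < n" "j < n" by (auto simp: companion_def)
    then show "M 1 $$ (i, j) = companion n (\<lambda>_. 0) $$ (i, j)"
      using X by (simp add: entry Y_def companion_def)
  qed (use carrier_matD[OF M[of 1]] in \<open>auto simp: companion_def\<close>)
  have M0: "M 0 = X" by (rule eq_matI) (use X Y in \<open>auto simp: M_def\<close>)
  have "polyfun (\<lambda>t. det (krylov_mat n (M t)))"
  proof (rule polyfun_det)
    fix i j assume "i < n" "j < n"
    then show "polyfun (\<lambda>t. krylov_mat n (M t) $$ (i, j))"
      using polyfun_krylov[OF M polyM, of i j] by (simp add: krylov_mat_def)
  qed simp
  then have "finite {t. det (krylov_mat n (M t)) = 0}"
    by (rule polyfun_finite_zeros[of _ 1]) (simp add: M1 krylov_mat_companion)
  moreover have "polyfun (\<lambda>t. f (mfun (M t)) - h (mfun (M t)))"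
    using f(2) h(2) X Y unfolding line_polynomial_def M_def by (intro polyfun_diff) auto
  ultimately have "f (mfun (M 0)) - h (mfun (M 0)) = 0"
    using polyfun_eq_0[of "\<lambda>t. f (mfun (M t)) - h (mfun (M t))" "{t. det (krylov_mat n (M t)) = 0}"]
      generic[OF M] by simp
  then show ?thesis by (simp add: M0)
qed

lemma conj_invariant_pol: "inv_vec n v \<Longrightarrow> conj_invariant n (pol n m v)"
  using inv_vec_conj unfolding conj_invariant_def by blast

lemma polyfun_pol:
  "(\<And>x. x \<in> proper n \<times> proper n \<Longrightarrow> polyfun (\<lambda>t. Z t x)) \<Longrightarrow> polyfun (\<lambda>t. pol n m v (Z t))"
  by (induction m arbitrary: v) (auto intro!: polyfun_sum)

lemma line_polynomial_pol: "line_polynomial n (pol n m v)"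
  unfolding line_polynomial_def
proof (intro ballI polyfun_pol)
  fix X Y :: "complex mat" and x :: letter
  assume XY: "X \<in> carrier_mat n n" "Y \<in> carrier_mat n n" and x: "x \<in> proper n \<times> proper n"
  obtain i j where x: "x = (Prop (Suc i), Prop (Suc j))" "i < n" "j < n"
    using x by (auto simp: proper_def) (metis Suc_pred' less_eq_Suc_le Suc_le_lessD)
  have "mfun (X + t \<cdot>\<^sub>m Y) x = X $$ (i, j) + t * Y $$ (i, j)" for t
    using XY x by simp
  then show "polyfun (\<lambda>t. mfun (X + t \<cdot>\<^sub>m Y) x)"
    by (simp only:) (intro polyfun_add polyfun_mult polyfun_const polyfun_id)
qed

section \<open>Grouping sequences by their multiset of entries\<close>

text \<open>Orbit counting for permutations of positions: \<open>R\<close> meets each orbit at most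
  once and meets every orbit on which \<open>f\<close> is nonzero.\<close>

lemma sum_by_mset:
  fixes f :: "'a list \<Rightarrow> complex"
  assumes fin: "finite L" and closed: "\<And>xs ys. xs \<in> L \<Longrightarrow> mset ys = mset xs \<Longrightarrow> ys \<in> L"
    and inv: "\<And>xs ys. xs \<in> L \<Longrightarrow> mset ys = mset xs \<Longrightarrow> f ys = f xs"
    and R: "R \<subseteq> L" "inj_on mset R"
    and zero: "\<And>xs. xs \<in> L \<Longrightarrow> mset xs \<notin> mset ` R \<Longrightarrow> f xs = 0"
  shows "(\<Sum>xs\<in>L. f xs) = (\<Sum>r\<in>R. of_nat (card (permutations_of_multiset (mset r))) * f r)"
proof -
  have "(\<Sum>xs\<in>L. f xs) = (\<Sum>M\<in>mset ` L. \<Sum>xs | xs \<in> L \<and> mset xs = M. f xs)"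
    by (rule sum.group[symmetric]) (use fin in auto)
  also have "\<dots> = (\<Sum>M\<in>mset ` R. \<Sum>xs | xs \<in> L \<and> mset xs = M. f xs)"
    by (rule sum.mono_neutral_right) (use fin R zero in \<open>auto intro!: sum.neutral\<close>)
  also have "\<dots> = (\<Sum>r\<in>R. \<Sum>xs | xs \<in> L \<and> mset xs = mset r. f xs)"
    by (rule sum.reindex_cong[OF R(2)]) auto
  also have "\<dots> = (\<Sum>r\<in>R. of_nat (card (permutations_of_multiset (mset r))) * f r)"
  proof (intro sum.cong refl)
    fix r assume r: "r \<in> R"
    then have rL: "r \<in> L" using R by auto
    have "{xs. xs \<in> L \<and> mset xs = mset r} = permutations_of_multiset (mset r)"
      using closed[OF rL] by (auto simp: permutations_of_multiset_def)
    moreover have "(\<Sum>xs\<in>permutations_of_multiset (mset r). f xs) = (\<Sum>xs\<in>permutations_of_multiset (mset r). f r)"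
      by (intro sum.cong refl inv[OF rL]) (simp add: permutations_of_multiset_def)
    ultimately show "(\<Sum>xs | xs \<in> L \<and> mset xs = mset r. f xs) = of_nat (card (permutations_of_multiset (mset r))) * f r"
      by simp
  qed
  finally show ?thesis .
qed

definition seqs :: "nat \<Rightarrow> nat \<Rightarrow> nat list set" where
  "seqs n k = {s. length s = k \<and> set s \<subseteq> {1..n}}"

lemma finite_seqs [simp]: "finite (seqs n k)"
  using finite_lists_length_eq[of "{1..n}" k] by (simp add: seqs_def conj_commute)

lemma seqs_length: "s \<in> seqs n k \<Longrightarrow> length s = k"
  by (simp add: seqs_def)

lemma seqs_nth: "s \<in> seqs n k \<Longrightarrow> p < k \<Longrightarrow> s ! p \<in> {1..n}"
  unfolding seqs_def using nth_mem by blast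

lemma seqs_update: "s \<in> seqs n k \<Longrightarrow> i \<in> {1..n} \<Longrightarrow> s[p := i] \<in> seqs n k"
  unfolding seqs_def using set_update_subset_insert[of s p i] by auto

text \<open>At a fixed position \<open>p\<close>, changing the entry is a bijection between the
  sequences with j there and those with i there. This cancellation underlies the invariance of the
  Capelli elements and of the virtual sums alike; the two arguments of \<open>F\<close> are the
  fillings of the two sides.\<close>

lemma seqs_reindex:
  fixes F :: "nat list \<Rightarrow> nat list \<Rightarrow> complex"
  assumes "i \<in> {1..n}" "j \<in> {1..n}"
  shows "(\<Sum>s\<in>seqs n k. \<Sum>p<k. of_bool (s ! p = j) * F (s[p := i]) s) =
    (\<Sum>s\<in>seqs n k. \<Sum>p<k. of_bool (s ! p = i) * F s (s[p := j]))"
proof -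
  have "(\<Sum>s\<in>seqs n k. of_bool (s ! p = j) * F (s[p := i]) s) =
      (\<Sum>s\<in>seqs n k. of_bool (s ! p = i) * F s (s[p := j]))" if p: "p < k" for p
  proof -
    have "(\<Sum>s\<in>seqs n k. of_bool (s ! p = j) * F (s[p := i]) s) =
      (\<Sum>s\<in>{s \<in> seqs n k. s ! p = j}. F (s[p := i]) s)"
      unfolding sum.inter_filter[OF finite_seqs] by (intro sum.cong) auto
    also have "\<dots> = (\<Sum>s\<in>{s \<in> seqs n k. s ! p = i}. F s (s[p := j]))"
      by (rule sum.reindex_bij_witness[of _ "\<lambda>s. s[p := j]" "\<lambda>s. s[p := i]"])
         (use assms p in \<open>auto intro: seqs_update simp: seqs_length\<close>)
    also have "\<dots> = (\<Sum>s\<in>seqs n k. of_bool (s ! p = i) * F s (s[p := j]))"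
      unfolding sum.inter_filter[OF finite_seqs] by (intro sum.cong) auto
    finally show ?thesis .
  qed
  then show ?thesis
    by (subst (1 2) sum.swap) simp
qed

section \<open>Capelli elements\<close>

abbreviation SSprod :: "('b \<Rightarrow> symb) \<Rightarrow> ('b \<Rightarrow> symb) \<Rightarrow> 'b list \<Rightarrow> letter lop" where
  "SSprod R C bs \<equiv> prod_list (map (\<lambda>x. SS (R x, C x)) bs)"

lemma of_bool_comm: "T * (of_bool P * T') = of_bool P * (T * T')" for T T' :: "'a :: ring_1"
  by (cases P) auto

text \<open>Leibniz rule without signs, all factors being even. Distinctness of \<open>bs\<close>
  makes \<open>R(x := a)\<close> change a single factor.\<close>

lemma DD_SSprod:
  assumes "a \<in> proper n" "b \<in> proper n" "distinct bs"
    "\<And>x. x \<in> set bs \<Longrightarrow> R x \<in> proper n" "\<And>x. x \<in> set bs \<Longrightarrow> C x \<in> proper n"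
  shows "DD a b * SSprod R C bs = SSprod R C bs * DD a b
    + (\<Sum>x\<in>set bs. of_bool (R x = b) * SSprod (R(x := a)) C bs)"
  using assms(3-5)
proof (induction bs)
  case (Cons y bs)
  have DS: "DD a b * SS (R y, C y) = SS (R y, C y) * DD a b + of_bool (R y = b) * SS (a, C y)"
    using DD_SS[of a b "(R y, C y)"] assms(1,2)
    by (simp add: sg_even proper_parity eq_commute)
  have "DD a b * SSprod R C (y # bs) = SS (R y, C y) * (DD a b * SSprod R C bs)
      + of_bool (R y = b) * (SS (a, C y) * SSprod R C bs)"
    using DS by (simp add: distrib_right flip: mult.assoc)
  also have "DD a b * SSprod R C bs = SSprod R C bs * DD a b
    + (\<Sum>x\<in>set bs. of_bool (R x = b) * SSprod (R(x := a)) C bs)"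
    using Cons by simp
  also have "SS (R y, C y) * (SSprod R C bs * DD a b
    + (\<Sum>x\<in>set bs. of_bool (R x = b) * SSprod (R(x := a)) C bs)) =
    SSprod R C (y # bs) * DD a b + (\<Sum>x\<in>set bs. of_bool (R x = b) * SSprod (R(x := a)) C (y # bs))"
  proof -
    have "(\<Sum>x\<in>set bs. SS (R y, C y) * (of_bool (R x = b) * SSprod (R(x := a)) C bs)) =
      (\<Sum>x\<in>set bs. of_bool (R x = b) * SSprod (R(x := a)) C (y # bs))"
      using Cons.prems by (intro sum.cong refl) (auto simp: of_bool_comm)
    then show ?thesis
      by (simp only: distrib_left sum_distrib_left list.map prod_list.Cons mult.assoc)
  qed
  also have "SS (a, C y) * SSprod R C bs = SSprod (R(y := a)) C (y # bs)"
  proof -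
    have "map (\<lambda>x. SS (R x, C x)) bs = map (\<lambda>x. SS ((R(y := a)) x, C x)) bs"
      using Cons.prems by (intro map_cong) auto
    then show ?thesis by (simp only: list.map prod_list.Cons fun_upd_same)
  qed
  finally show ?case
    using Cons.prems by (simp add: add_ac del: fun_upd_apply)
qed simp

lemma RR_SSprod:
  assumes "distinct bs"
  shows "RR i j * SSprod R C bs = SSprod R C bs * RR i j
    + (\<Sum>x\<in>set bs. of_bool (C x = i) * SSprod R (C(x := j)) bs)"
  using assms
proof (induction bs)
  case (Cons y bs)
  have DS: "RR i j * SS (R y, C y) = SS (R y, C y) * RR i j + of_bool (C y = i) * SS (R y, j)"
    using RR_SS[of i j "(R y, C y)"] by (simp add: eq_commute)
  have "RR i j * SSprod R C (y # bs) = SS (R y, C y) * (RR i j * SSprod R C bs)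
      + of_bool (C y = i) * (SS (R y, j) * SSprod R C bs)"
    using DS by (simp add: distrib_right flip: mult.assoc)
  also have "RR i j * SSprod R C bs = SSprod R C bs * RR i j
    + (\<Sum>x\<in>set bs. of_bool (C x = i) * SSprod R (C(x := j)) bs)"
    using Cons by simp
  also have "SS (R y, C y) * (SSprod R C bs * RR i j
    + (\<Sum>x\<in>set bs. of_bool (C x = i) * SSprod R (C(x := j)) bs)) =
    SSprod R C (y # bs) * RR i j + (\<Sum>x\<in>set bs. of_bool (C x = i) * SSprod R (C(x := j)) (y # bs))"
  proof -
    have "(\<Sum>x\<in>set bs. SS (R y, C y) * (of_bool (C x = i) * SSprod R (C(x := j)) bs)) =
      (\<Sum>x\<in>set bs. of_bool (C x = i) * SSprod R (C(x := j)) (y # bs))"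
      using Cons.prems by (intro sum.cong refl) (auto simp: of_bool_comm)
    then show ?thesis
      by (simp only: distrib_left sum_distrib_left list.map prod_list.Cons mult.assoc)
  qed
  also have "SS (R y, j) * SSprod R C bs = SSprod R (C(y := j)) (y # bs)"
  proof -
    have "map (\<lambda>x. SS (R x, C x)) bs = map (\<lambda>x. SS (R x, (C(y := j)) x)) bs"
      using Cons.prems by (intro map_cong) auto
    then show ?thesis by (simp only: list.map prod_list.Cons fun_upd_same)
  qed
  finally show ?case
    using Cons.prems by (simp add: add_ac del: fun_upd_apply)
qed simp

lemma SS_commute: "x \<in> proper n \<times> proper n \<Longrightarrow> y \<in> proper n \<times> proper n \<Longrightarrow> SS x * SS y = SS y * SS x"
  using SS_SS[of x y] by (simp add: letter_par_proper sg_even)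

lemma prod_list_perm:
  fixes f :: "'b \<Rightarrow> 'a :: monoid_mult"
  assumes "mset xs = mset ys" "\<And>x y. x \<in> set xs \<Longrightarrow> y \<in> set xs \<Longrightarrow> f x * f y = f y * f x"
  shows "prod_list (map f xs) = prod_list (map f ys)"
  using assms
proof (induction xs arbitrary: ys)
  case (Cons x xs)
  have "x \<in> set ys" using Cons.prems(1) by (metis list.set_intros(1) set_mset_mset)
  then obtain p q where ys: "ys = p @ x # q" by (meson split_list)
  have mset: "mset xs = mset (p @ q)" using Cons.prems(1) ys by simp
  note comm = Cons.prems(2)
  have sets: "set p \<subseteq> set xs" by (metis mset set_append set_mset_mset sup_ge1)
  have "prod_list (map f p) * f x = f x * prod_list (map f p)"
    using sets
  proof (induction p)
    case (Cons z p)
    have "prod_list (map f (z # p)) * f x = f z * (prod_list (map f p) * f x)" by (simp add: mult.assoc)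
    also have "\<dots> = (f z * f x) * prod_list (map f p)" using Cons by (simp add: mult.assoc)
    also have "f z * f x = f x * f z" using Cons.prems by (intro comm) auto
    finally show ?case by (simp add: mult.assoc)
  qed simp
  then have "prod_list (map f ys) = f x * prod_list (map f (p @ q))"
    by (simp add: ys flip: mult.assoc)
  then show ?case using Cons.IH[OF mset] Cons.prems(2) by simp
qed simp

lemma app_of_bool_mult: "app (T * (of_bool P * T')) v w = of_bool P * app (T * T') v w"
  by (cases P) (simp_all add: app_zero)

lemma app_mult_sum: "app (T * (\<Sum>x\<in>I. T' x)) v w = (\<Sum>x\<in>I. app (T * T' x) v w)"
  by (simp only: sum_distrib_left app_sum_op)

lemma app_of_nat: "app (T * (of_nat m * T')) v w = of_nat m * app (T * T') v w"
  by (induction m) (simp_all add: app_zero distrib_left distrib_right app_linear)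

text \<open>The diagonal shifts are there to cancel the polarizations. Working from the last column
  down, the polarization in column j turns, for every x > j with \<sigma> x = j, the term of
  \<sigma> into that of \<sigma> composed with the transposition of x and j. By antisymmetry each of
  these k - j contributions is minus the sum of the terms with \<sigma> j = j, which the shift k - j
  compensates. What remains is a determinant of commuting variables.\<close>

lemma vac_cdet:
  assumes inj: "inj_on r {1..k}" and r: "r ` {1..k} \<subseteq> proper n"
  shows "vac n (cdet k (\<lambda>a b. gen (r a) (r b) + of_bool (a = b) * of_nat (k - a))) w =
    (\<Sum>\<sigma> | \<sigma> permutes {1..k}. of_int (sign \<sigma>) * app (SSprod (\<lambda>b. r (\<sigma> b)) r [1..<Suc k]) vac0 w)"
proof -
  define E where "E = (\<lambda>\<sigma> b. AA n (r (\<sigma> b)) (r b) + of_bool (\<sigma> b = b) * of_nat (k - \<sigma> b))"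
  \<comment> \<open>\<open>T \<sigma> j\<close> interpolates between the two sides: columns below
    \<open>j\<close> carry the operators of the column determinant, columns from \<open>j\<close> on
    bare multiplications.\<close>
  define P where "P = (\<lambda>\<sigma> j. prod_list (map (E \<sigma>) [1..<j]))"
  define Q where "Q = (\<lambda>\<sigma> j. SSprod (\<lambda>b. r (\<sigma> b)) r [j..<Suc k])"
  define T where "T = (\<lambda>\<sigma> j. app (P \<sigma> j * Q \<sigma> j) vac0 w)"
  have act_nat: "act n (of_nat m) = of_nat m" for m
    by (induction m) (simp_all add: act_simps)
  have act_int: "act n (of_int z) = of_int z" for z
    by (cases z) (simp_all add: act_nat act_simps)
  have app_int: "app (of_int z * X) vac0 w = of_int z * app X vac0 w" for z X
  proof -
    have "app (of_nat m * X) vac0 w = of_nat m * app X vac0 w" for m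
      using app_of_nat[of 1 m X] by simp
    then show ?thesis by (cases z) (simp_all add: distrib_right left_diff_distrib)
  qed
  have lhs: "vac n (cdet k (\<lambda>a b. gen (r a) (r b) + of_bool (a = b) * of_nat (k - a))) w =
      (\<Sum>\<sigma> | \<sigma> permutes {1..k}. of_int (sign \<sigma>) * T \<sigma> (Suc k))"
    unfolding vac_def cdet_def
    by (simp only: act_simps app_sum_op act_int app_int map_map)
       (simp add: T_def P_def Q_def E_def comp_def act_simps act_of_bool act_nat)
  have step: "(\<Sum>\<sigma> | \<sigma> permutes {1..k}. of_int (sign \<sigma>) * T \<sigma> (Suc j)) =
      (\<Sum>\<sigma> | \<sigma> permutes {1..k}. of_int (sign \<sigma>) * T \<sigma> j)" if j: "j \<in> {1..k}" for j
  proof -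
    define v where "v = (\<lambda>\<sigma>. app (P \<sigma> j * Q \<sigma> (Suc j)) vac0 w)"
    have rin: "r (\<sigma> b) \<in> proper n" "r b \<in> proper n" if "\<sigma> permutes {1..k}" "b \<in> {1..k}" for \<sigma> b
      using r permutes_in_image[OF that(1)] that(2) by auto
    have diff: "T \<sigma> (Suc j) - T \<sigma> j = (\<Sum>x\<in>{Suc j..k}. of_bool (\<sigma> x = j) * v (\<sigma> \<circ> Transposition.transpose x j))
        + of_bool (\<sigma> j = j) * (of_nat (k - j) * v \<sigma>)" if \<sigma>: "\<sigma> permutes {1..k}" for \<sigma>
    proof -
      have Q: "Q \<sigma> j = SS (r (\<sigma> j), r j) * Q \<sigma> (Suc j)"
        using j unfolding Q_def by (subst upt_conv_Cons) auto
      have P: "P \<sigma> (Suc j) = P \<sigma> j * E \<sigma> j"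
        using j unfolding P_def by simp
      have "P \<sigma> (Suc j) * Q \<sigma> (Suc j) - P \<sigma> j * Q \<sigma> j = P \<sigma> j * (DD (r (\<sigma> j)) (r j) * Q \<sigma> (Suc j))
          + P \<sigma> j * (of_bool (\<sigma> j = j) * (of_nat (k - j) * Q \<sigma> (Suc j)))"
        using rin[OF \<sigma> j] unfolding P Q
        by (cases "\<sigma> j = j") (simp_all add: E_def AA_def algebra_simps)
      then have "T \<sigma> (Suc j) - T \<sigma> j = app (P \<sigma> j * (DD (r (\<sigma> j)) (r j) * Q \<sigma> (Suc j))) vac0 w
          + app (P \<sigma> j * (of_bool (\<sigma> j = j) * (of_nat (k - j) * Q \<sigma> (Suc j)))) vac0 w"
        unfolding T_def by (metis app_simps(3,4))
      also have "app (P \<sigma> j * (of_bool (\<sigma> j = j) * (of_nat (k - j) * Q \<sigma> (Suc j)))) vac0 w =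
          of_bool (\<sigma> j = j) * (of_nat (k - j) * v \<sigma>)"
        unfolding v_def by (simp only: app_of_bool_mult app_of_nat)
      also have "app (P \<sigma> j * (DD (r (\<sigma> j)) (r j) * Q \<sigma> (Suc j))) vac0 w =
          (\<Sum>x\<in>{Suc j..k}. of_bool (\<sigma> x = j) * v (\<sigma> \<circ> Transposition.transpose x j))"
      proof -
        have "DD (r (\<sigma> j)) (r j) * Q \<sigma> (Suc j) = Q \<sigma> (Suc j) * DD (r (\<sigma> j)) (r j) +
          (\<Sum>x\<in>set [Suc j..<Suc k]. of_bool (r (\<sigma> x) = r j) *
            SSprod ((\<lambda>b. r (\<sigma> b))(x := r (\<sigma> j))) r [Suc j..<Suc k])"
          unfolding Q_def by (rule DD_SSprod) (use rin[OF \<sigma>] j in auto)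
        moreover have "app (P \<sigma> j * (Q \<sigma> (Suc j) * DD (r (\<sigma> j)) (r j))) vac0 w = 0"
        proof -
          have "app (DD a b) vac0 = (\<lambda>w. 0)" for a b by (auto simp: DD.rep_eq Dfun_vac0)
          then show ?thesis by (simp add: app_zero)
        qed
        ultimately have "app (P \<sigma> j * (DD (r (\<sigma> j)) (r j) * Q \<sigma> (Suc j))) vac0 w =
          (\<Sum>x\<in>set [Suc j..<Suc k]. of_bool (r (\<sigma> x) = r j) *
            app (P \<sigma> j * SSprod ((\<lambda>b. r (\<sigma> b))(x := r (\<sigma> j))) r [Suc j..<Suc k]) vac0 w)"
          by (simp only: distrib_left app_simps(3) app_mult_sum app_of_bool_mult) simp
        also have "\<dots> = (\<Sum>x\<in>{Suc j..k}. of_bool (\<sigma> x = j) * v (\<sigma> \<circ> Transposition.transpose x j))"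
        proof (intro sum.cong)
          fix x assume x: "x \<in> {Suc j..k}"
          show "of_bool (r (\<sigma> x) = r j) * app (P \<sigma> j * SSprod ((\<lambda>b. r (\<sigma> b))(x := r (\<sigma> j))) r [Suc j..<Suc k]) vac0 w
            = of_bool (\<sigma> x = j) * v (\<sigma> \<circ> Transposition.transpose x j)"
          proof (cases "\<sigma> x = j")
            case False
            have "\<sigma> x \<in> {1..k}" using x permutes_in_image[OF \<sigma>, of x] by simp
            then have "r (\<sigma> x) \<noteq> r j" using inj False j by (auto dest: inj_onD)
            then show ?thesis using False by simp
          next
            case True
            have "P (\<sigma> \<circ> Transposition.transpose x j) j = P \<sigma> j"
              unfolding P_def E_def using x
              by (intro arg_cong[where f = prod_list] map_cong refl) (auto simp: Transposition.transpose_def)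
            moreover have "Q (\<sigma> \<circ> Transposition.transpose x j) (Suc j) = SSprod ((\<lambda>b. r (\<sigma> b))(x := r (\<sigma> j))) r [Suc j..<Suc k]"
              unfolding Q_def using x
              by (intro arg_cong[where f = prod_list] map_cong refl) (auto simp: Transposition.transpose_def)
            ultimately show ?thesis using True by (simp add: v_def)
          qed
        qed auto
        finally show ?thesis .
      qed
      finally show ?thesis .
    qed
    \<comment> \<open>Composition with the transposition permutes the summands and reverses the
      sign, and it carries the condition \<sigma> x = j to \<sigma> j = j.\<close>
    have swap: "(\<Sum>\<sigma> | \<sigma> permutes {1..k}. of_int (sign \<sigma>) * (of_bool (\<sigma> x = j) * v (\<sigma> \<circ> Transposition.transpose x j))) =
        - (\<Sum>\<sigma> | \<sigma> permutes {1..k}. of_int (sign \<sigma>) * (of_bool (\<sigma> j = j) * v \<sigma>))"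
      if x: "x \<in> {Suc j..k}" for x
    proof -
      have t: "Transposition.transpose x j permutes {1..k}" using x j by (intro permutes_swap_id) auto
      have "(\<Sum>\<sigma> | \<sigma> permutes {1..k}. of_int (sign \<sigma>) * (of_bool (\<sigma> x = j) * v (\<sigma> \<circ> Transposition.transpose x j))) =
        (\<Sum>\<sigma> | \<sigma> permutes {1..k}. of_int (sign (\<sigma> \<circ> Transposition.transpose x j)) *
           (of_bool ((\<sigma> \<circ> Transposition.transpose x j) x = j) * v (\<sigma> \<circ> Transposition.transpose x j \<circ> Transposition.transpose x j)))"
        by (rule sum_permutations_compose_right[OF t])
      also have "\<dots> = (\<Sum>\<sigma> | \<sigma> permutes {1..k}. - (of_int (sign \<sigma>) * (of_bool (\<sigma> j = j) * v \<sigma>)))"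
      proof (intro sum.cong refl)
        fix \<sigma> assume "\<sigma> \<in> {\<sigma>. \<sigma> permutes {1..k}}"
        then have "permutation \<sigma>" by (auto intro: permutation_permutes[THEN iffD2])
        then have "sign (\<sigma> \<circ> Transposition.transpose x j) = - sign \<sigma>"
          using x by (simp add: sign_compose permutation_swap_id sign_swap_id)
        moreover have "\<sigma> \<circ> Transposition.transpose x j \<circ> Transposition.transpose x j = \<sigma>" by (simp add: comp_assoc)
        ultimately show "of_int (sign (\<sigma> \<circ> Transposition.transpose x j)) *
           (of_bool ((\<sigma> \<circ> Transposition.transpose x j) x = j) * v (\<sigma> \<circ> Transposition.transpose x j \<circ> Transposition.transpose x j)) =
           - (of_int (sign \<sigma>) * (of_bool (\<sigma> j = j) * v \<sigma>))" by simp
      qed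
      finally show ?thesis by (simp add: sum_negf)
    qed
    let ?R = "\<Sum>\<sigma> | \<sigma> permutes {1..k}. of_int (sign \<sigma>) * (of_bool (\<sigma> j = j) * v \<sigma>)"
    have "(\<Sum>\<sigma> | \<sigma> permutes {1..k}. of_int (sign \<sigma>) * T \<sigma> (Suc j)) -
      (\<Sum>\<sigma> | \<sigma> permutes {1..k}. of_int (sign \<sigma>) * T \<sigma> j) =
      (\<Sum>\<sigma> | \<sigma> permutes {1..k}. of_int (sign \<sigma>) * (T \<sigma> (Suc j) - T \<sigma> j))"
      by (simp add: sum_subtractf right_diff_distrib)
    also have "\<dots> = (\<Sum>\<sigma> | \<sigma> permutes {1..k}. (\<Sum>x\<in>{Suc j..k}. of_int (sign \<sigma>) * (of_bool (\<sigma> x = j) * v (\<sigma> \<circ> Transposition.transpose x j)))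
        + of_nat (k - j) * (of_int (sign \<sigma>) * (of_bool (\<sigma> j = j) * v \<sigma>)))"
      by (intro sum.cong refl) (simp only: mem_Collect_eq diff distrib_left sum_distrib_left mult_ac)
    also have "\<dots> = (\<Sum>x\<in>{Suc j..k}. \<Sum>\<sigma> | \<sigma> permutes {1..k}. of_int (sign \<sigma>) * (of_bool (\<sigma> x = j) * v (\<sigma> \<circ> Transposition.transpose x j)))
        + of_nat (k - j) * ?R"
      unfolding sum.distrib by (intro arg_cong2[where f = "(+)"] sum.swap) (simp only: sum_distrib_left)
    also have "\<dots> = (\<Sum>x\<in>{Suc j..k}. - ?R) + of_nat (k - j) * ?R"
      using swap by (simp only: cong: sum.cong)
    also have "\<dots> = 0" by simp
    finally show ?thesis by simp
  qed
  have "(\<Sum>\<sigma> | \<sigma> permutes {1..k}. of_int (sign \<sigma>) * T \<sigma> (Suc m)) =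
      (\<Sum>\<sigma> | \<sigma> permutes {1..k}. of_int (sign \<sigma>) * T \<sigma> 1)" if "m \<le> k" for m
    using that
  proof (induction m)
    case (Suc m)
    then show ?case using step[of "Suc m"] by simp
  qed simp
  from this[of k] show ?thesis unfolding lhs by (simp add: T_def P_def Q_def)
qed

definition incs :: "nat \<Rightarrow> nat \<Rightarrow> nat list set" where
  "incs n k = {is. length is = k \<and> sorted_wrt (<) is \<and> set is \<subseteq> {1..n}}"

definition capelli_tens :: "nat \<Rightarrow> nat \<Rightarrow> tens" where
  "capelli_tens n k = (\<Sum>is\<in>incs n k. cdet k (\<lambda>a b. gen (Prop (is ! (a - 1))) (Prop (is ! (b - 1)))
     + of_bool (a = b) * of_nat (k - a)))"

lemma capelli_H_eq: "capelli_H n k = cls (proper n) (capelli_tens n k)"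
  by (simp add: capelli_H_def capelli_tens_def incs_def)

lemma incs_seqs: "incs n k \<subseteq> seqs n k"
  by (auto simp: incs_def seqs_def)

lemma finite_incs [simp]: "finite (incs n k)"
  using finite_subset[OF incs_seqs] by simp

lemma incs_distinct: "is \<in> incs n k \<Longrightarrow> distinct is"
  by (simp add: incs_def strict_sorted_iff)

text \<open>The principal minor on the rows and columns \<open>s\<close> of the generic matrix of
  variables, as a series; \<open>s\<close> may be unsorted or have repeated entries.\<close>

definition minor :: "nat \<Rightarrow> nat list \<Rightarrow> letter vec" where
  "minor k s w = (\<Sum>\<sigma> | \<sigma> permutes {1..k}. of_int (sign \<sigma>) *
     app (SSprod (\<lambda>b. Prop (s ! (\<sigma> b - 1))) (\<lambda>b. Prop (s ! (b - 1))) [1..<Suc k]) vac0 w)"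

lemma seqs_proper: "s \<in> seqs n k \<Longrightarrow> b \<in> {1..k} \<Longrightarrow> Prop (s ! (b - 1)) \<in> proper n"
  using seqs_nth[of s n k "b - 1"] by (auto simp: proper_def)

lemma vac_capelli: "vac n (capelli_tens n k) = (\<lambda>w. \<Sum>is\<in>incs n k. minor k is w)"
proof
  fix w
  have "vac n (cdet k (\<lambda>a b. gen (Prop (is ! (a - 1))) (Prop (is ! (b - 1)))
     + of_bool (a = b) * of_nat (k - a))) w = minor k is w" if "is": "is \<in> incs n k" for "is"
    unfolding minor_def
  proof (rule vac_cdet)
    show "inj_on (\<lambda>b. Prop (is ! (b - 1))) {1..k}"
      using incs_distinct[OF "is"] "is"
      by (auto simp: inj_on_def incs_def nth_eq_iff_index_eq)
    show "(\<lambda>b. Prop (is ! (b - 1))) ` {1..k} \<subseteq> proper n"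
      using seqs_proper "is" incs_seqs by blast
  qed
  then show "vac n (capelli_tens n k) w = (\<Sum>is\<in>incs n k. minor k is w)"
    by (simp add: capelli_tens_def vac_simps)
qed

text \<open>A simultaneous permutation \<tau> of rows and columns replaces \<sigma> by its conjugate
  under \<tau>, which has the same sign, and the variables commute.\<close>

lemma minor_mset:
  assumes xs: "xs \<in> seqs n k" and mset: "mset ys = mset xs"
  shows "minor k ys w = minor k xs w"
proof -
  have len: "length xs = k" "length ys = k" using xs mset by (auto simp: seqs_def dest: mset_eq_length)
  obtain \<pi> where \<pi>: "\<pi> permutes {..<length xs}" "permute_list \<pi> xs = ys"
    using mset by (metis mset_eq_permutation)
  define \<tau> where "\<tau> = (\<lambda>b. if b \<in> {1..k} then Suc (\<pi> (b - 1)) else b)"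
  have \<pi>in: "\<pi> p < k \<longleftrightarrow> p < k" for p using permutes_in_image[OF \<pi>(1), of p] len by simp
  have \<tau>: "\<tau> permutes {1..k}"
  proof (rule bij_imp_permutes)
    have "inj_on \<tau> {1..k}"
    proof (rule inj_onI)
      fix x y assume "x \<in> {1..k}" "y \<in> {1..k}" "\<tau> x = \<tau> y"
      moreover from this have "x - 1 = y - 1"
        using permutes_inj[OF \<pi>(1)] by (auto simp: \<tau>_def dest: injD)
      ultimately show "x = y" by (cases x; cases y) auto
    qed
    moreover have "\<tau> ` {1..k} \<subseteq> {1..k}"
    proof (rule image_subsetI)
      fix b assume b: "b \<in> {1..k}"
      then have "\<pi> (b - 1) < k" using \<pi>in[of "b - 1"] by (cases b) auto
      then show "\<tau> b \<in> {1..k}" using b by (simp add: \<tau>_def)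
    qed
    ultimately show "bij_betw \<tau> {1..k} {1..k}"
      by (simp add: bij_betw_def endo_inj_surj)
  qed (auto simp: \<tau>_def)
  let ?X = "\<lambda>b. Prop (xs ! (b - 1))"
  let ?G = "\<lambda>\<sigma>. app (SSprod (\<lambda>b. ?X (\<sigma> b)) ?X [1..<Suc k]) vac0 w"
  have ys: "ys ! (b - 1) = xs ! (\<tau> b - 1)" if "b \<in> {1..k}" for b
    using that \<pi> len by (auto simp: \<tau>_def permute_list_nth)
  have \<tau>in: "\<tau> b \<in> {1..k} \<longleftrightarrow> b \<in> {1..k}" for b by (rule permutes_in_image[OF \<tau>])
  have summand: "app (SSprod (\<lambda>b. Prop (ys ! (\<sigma> b - 1))) (\<lambda>b. Prop (ys ! (b - 1))) [1..<Suc k]) vac0 w =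
      ?G (\<tau> \<circ> \<sigma> \<circ> inv_into UNIV \<tau>)" if \<sigma>: "\<sigma> permutes {1..k}" for \<sigma>
  proof -
    let ?g = "\<lambda>b. SS (?X ((\<tau> \<circ> \<sigma> \<circ> inv_into UNIV \<tau>) b), ?X b)"
    have \<sigma>in: "\<sigma> b \<in> {1..k} \<longleftrightarrow> b \<in> {1..k}" for b by (rule permutes_in_image[OF \<sigma>])
    have "SSprod (\<lambda>b. Prop (ys ! (\<sigma> b - 1))) (\<lambda>b. Prop (ys ! (b - 1))) [1..<Suc k] =
      prod_list (map ?g (map \<tau> [1..<Suc k]))"
      unfolding map_map
    proof (intro arg_cong[where f = prod_list] map_cong refl)
      fix b assume "b \<in> set [1..<Suc k]"
      then have b: "b \<in> {1..k}" by auto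
      then show "SS (Prop (ys ! (\<sigma> b - 1)), Prop (ys ! (b - 1))) = (?g \<circ> \<tau>) b"
        using ys[OF b] ys[of "\<sigma> b"] \<sigma>in[of b] permutes_inverses(2)[OF \<tau>] by simp
    qed
    also have "\<dots> = prod_list (map ?g [1..<Suc k])"
    proof (rule prod_list_perm)
      have "set (map \<tau> [1..<Suc k]) = {1..k}"
        using permutes_image[OF \<tau>] by (simp add: atLeastLessThanSuc_atLeastAtMost del: upt_Suc)
      moreover have "distinct (map \<tau> [1..<Suc k])"
        using permutes_inj_on[OF \<tau>] by (simp add: distinct_map del: upt_Suc)
      ultimately show "mset (map \<tau> [1..<Suc k]) = mset [1..<Suc k]"
        by (intro set_eq_iff_mset_eq_distinct[THEN iffD1]) (auto simp: atLeastLessThanSuc_atLeastAtMost simp del: upt_Suc)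
      have \<rho>: "\<tau> \<circ> \<sigma> \<circ> inv_into UNIV \<tau> permutes {1..k}"
        by (intro permutes_compose permutes_inv \<tau> \<sigma>)
      have gin: "(?X ((\<tau> \<circ> \<sigma> \<circ> inv_into UNIV \<tau>) b), ?X b) \<in> proper n \<times> proper n" if "b \<in> {1..k}" for b
        using seqs_proper[OF xs that] seqs_proper[OF xs, of "(\<tau> \<circ> \<sigma> \<circ> inv_into UNIV \<tau>) b"]
          permutes_in_image[OF \<rho>, of b] that by simp
      fix x y assume "x \<in> set (map \<tau> [1..<Suc k])" "y \<in> set (map \<tau> [1..<Suc k])"
      then have "x \<in> {1..k}" "y \<in> {1..k}" using \<open>set (map \<tau> [1..<Suc k]) = {1..k}\<close> by auto
      then show "?g x * ?g y = ?g y * ?g x" using gin SS_commute by blast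
    qed
    finally show ?thesis by simp
  qed
  have perm\<tau>: "permutation \<tau>" using \<tau> by (auto intro: permutation_permutes[THEN iffD2])
  have "minor k ys w = (\<Sum>\<sigma> | \<sigma> permutes {1..k}. of_int (sign (\<tau> \<circ> \<sigma> \<circ> inv_into UNIV \<tau>)) * ?G (\<tau> \<circ> \<sigma> \<circ> inv_into UNIV \<tau>))"
    unfolding minor_def
  proof (intro sum.cong refl)
    fix \<sigma> assume "\<sigma> \<in> {\<sigma>. \<sigma> permutes {1..k}}"
    then have \<sigma>: "\<sigma> permutes {1..k}" by simp
    have perm\<sigma>: "permutation \<sigma>" using \<sigma> by (auto intro: permutation_permutes[THEN iffD2])
    have "sign (\<tau> \<circ> \<sigma> \<circ> inv_into UNIV \<tau>) = sign \<tau> * sign \<sigma> * sign \<tau>"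
      using perm\<tau> perm\<sigma> by (simp add: sign_compose permutation_compose permutation_inverse sign_inverse)
    also have "\<dots> = sign \<sigma>" by (simp add: sign_def)
    finally show "of_int (sign \<sigma>) * app (SSprod (\<lambda>b. Prop (ys ! (\<sigma> b - 1))) (\<lambda>b. Prop (ys ! (b - 1))) [1..<Suc k]) vac0 w =
      of_int (sign (\<tau> \<circ> \<sigma> \<circ> inv_into UNIV \<tau>)) * ?G (\<tau> \<circ> \<sigma> \<circ> inv_into UNIV \<tau>)" using summand[OF \<sigma>] by simp
  qed
  also have "\<dots> = (\<Sum>\<sigma> | \<sigma> permutes {1..k}. of_int (sign (\<tau> \<circ> \<sigma>)) * ?G (\<tau> \<circ> \<sigma>))"
    using sum_permutations_compose_right[OF permutes_inv[OF \<tau>], of "\<lambda>\<sigma>. of_int (sign (\<tau> \<circ> \<sigma>)) * ?G (\<tau> \<circ> \<sigma>)"]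
    by (simp only: comp_assoc)
  also have "\<dots> = minor k xs w"
    using setum_permutations_compose_left[OF \<tau>, of "\<lambda>\<sigma>. of_int (sign \<sigma>) * ?G \<sigma>"]
    by (simp only: minor_def)
  finally show ?thesis .
qed

lemma minor_not_distinct:
  assumes "length s = k" "\<not> distinct s"
  shows "minor k s w = 0"
proof -
  obtain i j where ij: "i < k" "j < k" "i \<noteq> j" "s ! i = s ! j"
    using assms by (auto simp: distinct_conv_nth)
  define t where "t = Transposition.transpose (Suc i) (Suc j)"
  have t: "t permutes {1..k}" unfolding t_def using ij by (intro permutes_swap_id) auto
  let ?G = "\<lambda>\<sigma>. app (SSprod (\<lambda>b. Prop (s ! (\<sigma> b - 1))) (\<lambda>b. Prop (s ! (b - 1))) [1..<Suc k]) vac0 w"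
  have st: "s ! (t b - 1) = s ! (b - 1)" for b
    using ij by (auto simp: t_def Transposition.transpose_def)
  have "minor k s w = (\<Sum>\<sigma> | \<sigma> permutes {1..k}. of_int (sign (t \<circ> \<sigma>)) * ?G (t \<circ> \<sigma>))"
    unfolding minor_def by (rule setum_permutations_compose_left[OF t])
  also have "\<dots> = (\<Sum>\<sigma> | \<sigma> permutes {1..k}. - (of_int (sign \<sigma>) * ?G \<sigma>))"
  proof (intro sum.cong refl)
    fix \<sigma> assume "\<sigma> \<in> {\<sigma>. \<sigma> permutes {1..k}}"
    then have "permutation \<sigma>" by (auto intro: permutation_permutes[THEN iffD2])
    then have "sign (t \<circ> \<sigma>) = - sign \<sigma>"
      using ij by (simp add: t_def sign_compose permutation_swap_id sign_swap_id)
    moreover have "?G (t \<circ> \<sigma>) = ?G \<sigma>" by (simp only: comp_def st)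
    ultimately show "of_int (sign (t \<circ> \<sigma>)) * ?G (t \<circ> \<sigma>) = - (of_int (sign \<sigma>) * ?G \<sigma>)"
      by (simp only: of_int_minus mult_minus_left)
  qed
  also have "\<dots> = - minor k s w" by (simp add: minor_def sum_negf)
  finally show ?thesis by simp
qed

text \<open>Passing from increasing to arbitrary sequences makes the index set stable under changing
  one entry, as \<open>seqs_reindex\<close> requires. Minors with a repeated index vanish, and every
  other one occurs once for each order of its indices.\<close>

lemma sum_minor: "(\<Sum>s\<in>seqs n k. minor k s w) = fact k * (\<Sum>is\<in>incs n k. minor k is w)"
proof -
  have "(\<Sum>s\<in>seqs n k. minor k s w) =
      (\<Sum>is\<in>incs n k. of_nat (card (permutations_of_multiset (mset is))) * minor k is w)"
  proof (rule sum_by_mset)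
    show "ys \<in> seqs n k" if "xs \<in> seqs n k" "mset ys = mset xs" for xs ys
      using that mset_eq_setD[OF that(2)] mset_eq_length[OF that(2)] by (auto simp: seqs_def)
    show "inj_on mset (incs n k)"
    proof (rule inj_onI)
      fix xs ys assume "xs \<in> incs n k" "ys \<in> incs n k" and m: "mset xs = mset ys"
      then have s: "sorted xs" "sorted ys" by (simp_all add: incs_def strict_sorted_iff)
      have "sort xs = ys" by (rule properties_for_sort[OF m[symmetric] s(2)])
      then show "xs = ys" using sorted_sort_id[OF s(1)] by simp
    qed
    show "minor k xs w = 0" if xs: "xs \<in> seqs n k" "mset xs \<notin> mset ` incs n k" for xs
    proof (rule minor_not_distinct)
      show "length xs = k" using xs by (simp add: seqs_def)
      show "\<not> distinct xs"
      proof
        assume "distinct xs"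
        then have "sort xs \<in> incs n k" using xs(1) by (auto simp: incs_def seqs_def strict_sorted_iff)
        then show False using xs(2) by (metis image_eqI mset_sort)
      qed
    qed
    show "minor k ys w = minor k xs w" if "xs \<in> seqs n k" "mset ys = mset xs" for xs ys
      by (rule minor_mset[OF that])
  qed (rule finite_seqs incs_seqs)+
  also have "\<dots> = (\<Sum>is\<in>incs n k. fact k * minor k is w)"
  proof (intro sum.cong refl)
    fix "is" assume "is": "is \<in> incs n k"
    have "card (permutations_of_multiset (mset is)) * (\<Prod>x\<in>set_mset (mset is). fact (count (mset is) x)) = fact k"
      using card_permutations_of_multiset_aux[of "mset is"] "is" by (simp add: incs_def)
    moreover have "(\<Prod>x\<in>set_mset (mset is). fact (count (mset is) x)) = (1::nat)"
      using incs_distinct[OF "is"] by (intro prod.neutral) (simp add: distinct_count_atmost_1)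
    ultimately have "card (permutations_of_multiset (mset is)) = fact k" by simp
    then show "of_nat (card (permutations_of_multiset (mset is))) * minor k is w = fact k * minor k is w"
      by simp
  qed
  finally show ?thesis by (simp add: sum_distrib_left)
qed

lemma inv_vec_sum: "(\<And>i. i \<in> I \<Longrightarrow> inv_vec n (v i)) \<Longrightarrow> inv_vec n (\<lambda>w. \<Sum>i\<in>I. v i w)"
  using app_sum[of "DD a b" v I for a b] app_sum[of "RR a b" v I for a b]
  by (simp add: inv_vec_def DD.rep_eq RR.rep_eq fun_eq_iff)

lemma inv_vec_scale: "inv_vec n v \<Longrightarrow> inv_vec n (\<lambda>w. c * v w)"
  using app_linear(2)[of "DD a b" c v for a b] app_linear(2)[of "RR a b" c v for a b]
  by (simp add: inv_vec_def DD.rep_eq RR.rep_eq fun_eq_iff)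

text \<open>For fixed \<sigma> this sum is a product of traces of powers of the generic matrix, one
  for each cycle of \<sigma>. Row polarization turns a row index j into i, column polarization a
  column index i into j, and \<open>seqs_reindex\<close> identifies the two results.\<close>

lemma inv_vec_full:
  assumes \<sigma>: "\<sigma> permutes {1..k}"
  shows "inv_vec n (\<lambda>w. \<Sum>s\<in>seqs n k. app (SSprod (\<lambda>b. Prop (s ! (\<sigma> b - 1))) (\<lambda>b. Prop (s ! (b - 1))) [1..<Suc k]) vac0 w)"
  unfolding inv_vec_def
proof (intro ballI ext)
  fix i' j' w assume "i' \<in> proper n" "j' \<in> proper n"
  then obtain i j where ij: "i' = Prop i" "j' = Prop j" "i \<in> {1..n}" "j \<in> {1..n}"
    by (auto simp: proper_def)
  let ?R = "\<lambda>s b. Prop (s ! (\<sigma> b - 1))" and ?C = "\<lambda>s b. Prop (s ! (b - 1))" and ?bs = "[1..<Suc k]"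
  define F where "F = (\<lambda>u t. app (SSprod (?R u) (?C t) ?bs) vac0 w)"
  have set_bs: "set ?bs = {1..k}" by auto
  have \<sigma>in: "\<sigma> b \<in> {1..k} \<longleftrightarrow> b \<in> {1..k}" for b by (rule permutes_in_image[OF \<sigma>])
  have "app (DD a b) vac0 = (\<lambda>w. 0)" "app (RR a b) vac0 = (\<lambda>w. 0)" for a b
    by (auto simp: DD.rep_eq RR.rep_eq Dfun_vac0 Rfun_vac0)
  then have app_DD0: "app (T * DD a b) vac0 w = 0" "app (T * RR a b) vac0 w = 0" for T a b
    by (simp_all add: app_zero)
  have app_of_bool: "app (of_bool P * T) v w = of_bool P * app T v w" for P T v
    by (cases P) simp_all
  have D: "app (DD i' j' * SSprod (?R s) (?C s) ?bs) vac0 w = (\<Sum>p<k. of_bool (s ! p = j) * F (s[p := i]) s)"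
    if s: "s \<in> seqs n k" for s
  proof -
    have len: "length s = k" using s by (rule seqs_length)
    have "DD i' j' * SSprod (?R s) (?C s) ?bs = SSprod (?R s) (?C s) ?bs * DD i' j'
      + (\<Sum>b\<in>set ?bs. of_bool (?R s b = j') * SSprod ((?R s)(b := i')) (?C s) ?bs)"
      using ij s \<sigma>in seqs_proper[OF s] by (intro DD_SSprod) (auto simp: proper_def)
    then have "app (DD i' j' * SSprod (?R s) (?C s) ?bs) vac0 w =
      (\<Sum>b\<in>{1..k}. of_bool (s ! (\<sigma> b - 1) = j) * app (SSprod ((?R s)(b := i')) (?C s) ?bs) vac0 w)"
      by (simp only: app_simps(3) app_DD0 app_sum_op app_of_bool set_bs ij symb.inject add_0)
    also have "\<dots> = (\<Sum>b\<in>{1..k}. of_bool (s ! (\<sigma> b - 1) = j) * F (s[\<sigma> b - 1 := i]) s)"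
    proof (intro sum.cong refl arg_cong2[where f = "(*)"])
      fix b assume b: "b \<in> {1..k}"
      have "map (\<lambda>x. SS (((?R s)(b := i')) x, ?C s x)) ?bs = map (\<lambda>x. SS (?R (s[\<sigma> b - 1 := i]) x, ?C s x)) ?bs"
      proof (intro map_cong refl)
        fix x assume "x \<in> set ?bs"
        then have x: "x \<in> {1..k}" unfolding set_bs .
        have xb: "\<sigma> x \<in> {1..k}" "\<sigma> b \<in> {1..k}" using \<sigma>in x b by blast+
        have "((?R s)(b := i')) x = ?R (s[\<sigma> b - 1 := i]) x"
        proof (cases "x = b")
          case True
          have "\<sigma> b - 1 < length s" using xb(2) len by auto
          then show ?thesis using True ij(1) by simp
        next
          case False
          have "\<sigma> x \<noteq> \<sigma> b" using False permutes_inj[OF \<sigma>] by (auto dest: injD)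
          then have "\<sigma> x - 1 \<noteq> \<sigma> b - 1" using xb by (cases "\<sigma> x"; cases "\<sigma> b") auto
          then show ?thesis using False by simp
        qed
        then show "SS (((?R s)(b := i')) x, ?C s x) = SS (?R (s[\<sigma> b - 1 := i]) x, ?C s x)"
          by (simp only:)
      qed
      then show "app (SSprod ((?R s)(b := i')) (?C s) ?bs) vac0 w = F (s[\<sigma> b - 1 := i]) s"
        by (simp only: F_def)
    qed
    also have "\<dots> = (\<Sum>p<k. of_bool (s ! p = j) * F (s[p := i]) s)"
    proof (rule sum.reindex_bij_witness[of _ "\<lambda>p. inv_into UNIV \<sigma> (Suc p)" "\<lambda>b. \<sigma> b - 1"])
      fix b assume b: "b \<in> {1..k}"
      then have "Suc (\<sigma> b - 1) = \<sigma> b" using \<sigma>in[of b] by simp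
      then show "inv_into UNIV \<sigma> (Suc (\<sigma> b - 1)) = b" by (simp add: permutes_inverses(2)[OF \<sigma>])
      show "\<sigma> b - 1 \<in> {..<k}" using \<sigma>in[of b] b by auto
    next
      fix p assume p: "p \<in> {..<k}"
      show "inv_into UNIV \<sigma> (Suc p) \<in> {1..k}" using permutes_in_image[OF permutes_inv[OF \<sigma>], of "Suc p"] p by auto
      show "\<sigma> (inv_into UNIV \<sigma> (Suc p)) - 1 = p" by (simp add: permutes_inverses(1)[OF \<sigma>])
    qed simp
    finally show ?thesis .
  qed
  have R: "app (RR i' j' * SSprod (?R s) (?C s) ?bs) vac0 w = (\<Sum>p<k. of_bool (s ! p = i) * F s (s[p := j]))"
    if s: "s \<in> seqs n k" for s
  proof -
    have len: "length s = k" using s by (rule seqs_length)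
    have "RR i' j' * SSprod (?R s) (?C s) ?bs = SSprod (?R s) (?C s) ?bs * RR i' j'
      + (\<Sum>b\<in>set ?bs. of_bool (?C s b = i') * SSprod (?R s) ((?C s)(b := j')) ?bs)"
      by (rule RR_SSprod) simp
    then have "app (RR i' j' * SSprod (?R s) (?C s) ?bs) vac0 w =
      (\<Sum>b\<in>{1..k}. of_bool (s ! (b - 1) = i) * app (SSprod (?R s) ((?C s)(b := j')) ?bs) vac0 w)"
      by (simp only: app_simps(3) app_DD0 app_sum_op app_of_bool set_bs ij symb.inject add_0)
    also have "\<dots> = (\<Sum>b\<in>{1..k}. of_bool (s ! (b - 1) = i) * F s (s[b - 1 := j]))"
    proof (intro sum.cong refl arg_cong2[where f = "(*)"])
      fix b assume b: "b \<in> {1..k}"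
      have "map (\<lambda>x. SS (?R s x, ((?C s)(b := j')) x)) ?bs = map (\<lambda>x. SS (?R s x, ?C (s[b - 1 := j]) x)) ?bs"
      proof (intro map_cong refl)
        fix x assume "x \<in> set ?bs"
        then have x: "x \<in> {1..k}" unfolding set_bs .
        have "((?C s)(b := j')) x = ?C (s[b - 1 := j]) x"
        proof (cases "x = b")
          case True
          have "b - 1 < length s" using b len by (cases b) auto
          then show ?thesis using True ij(2) by simp
        next
          case False
          then have "x - 1 \<noteq> b - 1" using x b by (cases x; cases b) auto
          then show ?thesis using False by simp
        qed
        then show "SS (?R s x, ((?C s)(b := j')) x) = SS (?R s x, ?C (s[b - 1 := j]) x)"
          by (simp only:)
      qed
      then show "app (SSprod (?R s) ((?C s)(b := j')) ?bs) vac0 w = F s (s[b - 1 := j])"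
        by (simp only: F_def)
    qed
    also have "\<dots> = (\<Sum>p<k. of_bool (s ! p = i) * F s (s[p := j]))"
      by (rule sum.reindex_bij_witness[of _ Suc "\<lambda>b. b - 1"]) auto
    finally show ?thesis .
  qed
  have "Dfun i' j' (\<lambda>w. \<Sum>s\<in>seqs n k. app (SSprod (?R s) (?C s) ?bs) vac0 w) w =
      (\<Sum>s\<in>seqs n k. app (DD i' j' * SSprod (?R s) (?C s) ?bs) vac0 w)"
    using app_sum[of "DD i' j'" "\<lambda>s. app (SSprod (?R s) (?C s) ?bs) vac0" "seqs n k"]
    by (simp only: DD.rep_eq app_simps fun_eq_iff)
  also have "\<dots> = (\<Sum>s\<in>seqs n k. \<Sum>p<k. of_bool (s ! p = j) * F (s[p := i]) s)"
    by (intro sum.cong refl D)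
  also have "\<dots> = (\<Sum>s\<in>seqs n k. \<Sum>p<k. of_bool (s ! p = i) * F s (s[p := j]))"
    by (rule seqs_reindex[OF ij(3,4)])
  also have "\<dots> = (\<Sum>s\<in>seqs n k. app (RR i' j' * SSprod (?R s) (?C s) ?bs) vac0 w)"
    by (intro sum.cong refl R[symmetric])
  also have "\<dots> = Rfun i' j' (\<lambda>w. \<Sum>s\<in>seqs n k. app (SSprod (?R s) (?C s) ?bs) vac0 w) w"
    using app_sum[of "RR i' j'" "\<lambda>s. app (SSprod (?R s) (?C s) ?bs) vac0" "seqs n k"]
    by (simp only: RR.rep_eq app_simps fun_eq_iff)
  finally show "Dfun i' j' (\<lambda>w. \<Sum>s\<in>seqs n k. app (SSprod (?R s) (?C s) ?bs) vac0 w) w =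
      Rfun i' j' (\<lambda>w. \<Sum>s\<in>seqs n k. app (SSprod (?R s) (?C s) ?bs) vac0 w) w" .
qed

lemma inv_vec_capelli: "inv_vec n (vac n (capelli_tens n k))"
proof -
  have "(\<Sum>s\<in>seqs n k. minor k s w) = (\<Sum>\<sigma> | \<sigma> permutes {1..k}. of_int (sign \<sigma>) *
      (\<Sum>s\<in>seqs n k. app (SSprod (\<lambda>b. Prop (s ! (\<sigma> b - 1))) (\<lambda>b. Prop (s ! (b - 1))) [1..<Suc k]) vac0 w))" for w
    unfolding minor_def by (subst sum.swap) (simp only: sum_distrib_left)
  then have "inv_vec n (\<lambda>w. \<Sum>s\<in>seqs n k. minor k s w)"
    by (simp only:) (intro inv_vec_sum inv_vec_scale inv_vec_full, simp)
  then have "inv_vec n (\<lambda>w. (1 / fact k) * (\<Sum>s\<in>seqs n k. minor k s w))" by (rule inv_vec_scale)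
  then show ?thesis unfolding vac_capelli sum_minor by simp
qed

lemma central_inv_vec: "f \<in> fa (proper n) \<Longrightarrow> cls (proper n) f \<in> center (U (proper n)) \<longleftrightarrow> inv_vec n (vac n f)"
  by (simp add: central_iff inv_vec_def DD.rep_eq RR.rep_eq)

lemma FD_prod_list: "(\<And>f. f \<in> set fs \<Longrightarrow> f \<in> FD A 1) \<Longrightarrow> prod_list fs \<in> FD A (length fs)"
proof (induction fs)
  case Nil
  have "(1 :: tens) = const 1" by (simp add: const_hom)
  then show ?case using FD_const by (metis prod_list.Nil)
next
  case (Cons f fs)
  have "f * prod_list fs \<in> FD A (1 + length fs)" using Cons by (intro FD_mult) auto
  then show ?case by simp
qed

lemma const_of_nat: "(of_nat m :: 'a fword \<Rightarrow>\<^sub>0 complex) = const (of_nat m)"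
  by (induction m) (simp_all add: const_hom)

lemma const_of_int: "(of_int z :: 'a fword \<Rightarrow>\<^sub>0 complex) = const (of_int z)"
proof (cases z)
  case (neg m)
  have "(const (- 1 - of_nat m) :: 'a fword \<Rightarrow>\<^sub>0 complex) = - const 1 - const (of_nat m)"
    by (simp add: const_def single_diff single_uminus)
  then show ?thesis using neg by (simp add: const_of_nat const_hom(3))
qed (simp add: const_of_nat)

lemma FD_gen: "a \<in> A \<Longrightarrow> b \<in> A \<Longrightarrow> gen a b \<in> FD A 1"
  by (auto simp: gen_word intro!: FD_word)

lemma capelli_FD: "capelli_tens n k \<in> FD (proper n) k"
  unfolding capelli_tens_def cdet_def
proof (intro FD_sum)
  fix "is" \<sigma> assume "is": "is \<in> incs n k" and \<sigma>: "\<sigma> \<in> {\<sigma>. \<sigma> permutes {1..k}}"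
  let ?M = "\<lambda>a b. gen (Prop (is ! (a - 1))) (Prop (is ! (b - 1))) + of_bool (a = b) * of_nat (k - a) :: tens"
  have "?M (\<sigma> b) b \<in> FD (proper n) 1" if b: "b \<in> {1..k}" for b
  proof -
    have "\<sigma> b \<in> {1..k}" using \<sigma> b permutes_in_image[of \<sigma> "{1..k}" b] by simp
    moreover have "of_bool (\<sigma> b = b) * of_nat (k - \<sigma> b) \<in> FD (proper n) 1"
      by (cases "\<sigma> b = b") (simp_all add: const_of_nat FD_const FD_zero)
    ultimately show ?thesis
      using b "is" incs_seqs seqs_proper[of "is" n k] by (intro FD_add FD_gen) blast+
  qed
  then have "prod_list (map (\<lambda>b. ?M (\<sigma> b) b) [1..<Suc k]) \<in> FD (proper n) (length (map (\<lambda>b. ?M (\<sigma> b) b) [1..<Suc k]))"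
    by (intro FD_prod_list) auto
  then have "prod_list (map (\<lambda>b. ?M (\<sigma> b) b) [1..<Suc k]) \<in> FD (proper n) k"
    by (simp del: upt_Suc)
  then show "of_int (sign \<sigma>) * prod_list (map (\<lambda>b. ?M (\<sigma> b) b) [1..<Suc k]) \<in> FD (proper n) k"
    unfolding const_of_int by (rule FD_const_mult)
qed

lemma capelli_fa: "capelli_tens n k \<in> fa (proper n)"
  by (rule FD_fa[OF capelli_FD])

lemma capelli_central: "cls (proper n) (capelli_tens n k) \<in> center (U (proper n))"
  using central_inv_vec[OF capelli_fa] inv_vec_capelli by blast

section \<open>Principal symbols of the Capelli elements\<close>

lemma pol_SS_list:
  assumes "set xs \<subseteq> proper n \<times> proper n"
  shows "pol n (length xs) (app (prod_list (map SS xs)) vac0) X = fact (length xs) * prod_list (map X xs)"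
  using assms
proof (induction xs)
  case (Cons x xs)
  have "app (prod_list (map SS (x # xs))) vac0 = Sfun x (app (prod_list (map SS xs)) vac0)"
    by (simp add: SS.rep_eq)
  then have "pol n (length (x # xs)) (app (prod_list (map SS (x # xs))) vac0) X =
    of_nat (Suc (length xs)) * X x * pol n (length xs) (app (prod_list (map SS xs)) vac0) X"
    using pol_Sfun[of x n "length xs"] Cons.prems by (simp only: list.size add_Suc_right add_0_right) simp
  then show ?case using Cons by (simp add: algebra_simps)
qed (simp add: vac0_def)

text \<open>Since the vacuum vector is a sum of minors in commuting variables, its polynomial
  function is the sum of the principal minors of size k of X, up to sign a coefficient of the
  characteristic polynomial.\<close>

lemma capelli_symbol:
  "symbol k (capelli_tens n k) X = (\<Sum>is\<in>incs n k. \<Sum>\<sigma> | \<sigma> permutes {1..k}. of_int (sign \<sigma>) *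
     prod_list (map (\<lambda>b. X (Prop (is ! (\<sigma> b - 1)), Prop (is ! (b - 1)))) [1..<Suc k]))"
proof -
  have term_eq: "pol n k (app (SSprod (\<lambda>b. Prop (is ! (\<sigma> b - 1))) (\<lambda>b. Prop (is ! (b - 1))) [1..<Suc k]) vac0) X =
      fact k * prod_list (map (\<lambda>b. X (Prop (is ! (\<sigma> b - 1)), Prop (is ! (b - 1)))) [1..<Suc k])"
    if "is": "is \<in> incs n k" and \<sigma>: "\<sigma> permutes {1..k}" for "is" \<sigma>
  proof -
    let ?xs = "map (\<lambda>b. (Prop (is ! (\<sigma> b - 1)), Prop (is ! (b - 1)))) [1..<Suc k]"
    have "set ?xs \<subseteq> proper n \<times> proper n"
    proof
      fix x assume "x \<in> set ?xs"
      then obtain b where "b \<in> set [1..<Suc k]" and b2: "x = (Prop (is ! (\<sigma> b - 1)), Prop (is ! (b - 1)))"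
        unfolding set_map by blast
      then have b: "b \<in> {1..k}" by auto
      have "\<sigma> b \<in> {1..k}" using permutes_in_image[OF \<sigma>, of b] b by blast
      then show "x \<in> proper n \<times> proper n" using seqs_proper "is" incs_seqs b b2 by blast
    qed
    from pol_SS_list[OF this, of X] show ?thesis
      by (simp only: map_map comp_def length_map length_upt One_nat_def diff_Suc_Suc minus_nat.diff_0)
  qed
  have "fact k * symbol k (capelli_tens n k) X = pol n k (vac n (capelli_tens n k)) X"
    by (rule pol_vac[OF capelli_FD, symmetric])
  also have "\<dots> = (\<Sum>is\<in>incs n k. \<Sum>\<sigma> | \<sigma> permutes {1..k}. of_int (sign \<sigma>) *
      pol n k (app (SSprod (\<lambda>b. Prop (is ! (\<sigma> b - 1))) (\<lambda>b. Prop (is ! (b - 1))) [1..<Suc k]) vac0) X)"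
    unfolding vac_capelli minor_def pol_sum pol_linear ..
  also have "\<dots> = (\<Sum>is\<in>incs n k. \<Sum>\<sigma> | \<sigma> permutes {1..k}. of_int (sign \<sigma>) *
      (fact k * prod_list (map (\<lambda>b. X (Prop (is ! (\<sigma> b - 1)), Prop (is ! (b - 1)))) [1..<Suc k])))"
    using term_eq by (intro sum.cong refl) simp
  also have "\<dots> = fact k * (\<Sum>is\<in>incs n k. \<Sum>\<sigma> | \<sigma> permutes {1..k}. of_int (sign \<sigma>) *
     prod_list (map (\<lambda>b. X (Prop (is ! (\<sigma> b - 1)), Prop (is ! (b - 1)))) [1..<Suc k]))"
    unfolding sum_distrib_left by (intro sum.cong refl) (simp only: mult_ac)
  finally show ?thesis by simp
qed

text \<open>The cycle 1, 2, ..., k, the only permutation with a nonzero contribution for a companion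
  matrix.\<close>

definition cycle_perm :: "nat \<Rightarrow> nat \<Rightarrow> nat" where
  "cycle_perm k b = (if b \<in> {1..<k} then Suc b else if b = k then 1 else b)"

definition cycle_sign :: "nat \<Rightarrow> complex" where
  "cycle_sign k = of_int (sign (cycle_perm k))"

lemma cycle_perm_permutes: "k \<ge> 1 \<Longrightarrow> cycle_perm k permutes {1..k}"
proof (rule bij_imp_permutes)
  assume k: "k \<ge> 1"
  have "inj_on (cycle_perm k) {1..k}" by (auto simp: inj_on_def cycle_perm_def split: if_splits)
  moreover have "cycle_perm k ` {1..k} \<subseteq> {1..k}" using k by (auto simp: cycle_perm_def)
  ultimately show "bij_betw (cycle_perm k) {1..k} {1..k}" by (simp add: bij_betw_def endo_inj_surj)
qed (auto simp: cycle_perm_def)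

lemma cycle_sign_square: "cycle_sign k * cycle_sign k = 1"
  by (simp add: cycle_sign_def sign_def)

lemma mfun_companion:
  assumes "p \<in> {1..n}" "q \<in> {1..n}"
  shows "mfun (companion n a) (Prop p, Prop q) = (if q = n then a (p - 1) else of_bool (p = Suc q))"
  using assms by (auto simp: mfun_def companion_def)

text \<open>Outside the last column a companion matrix has only the subdiagonal. In a nonzero term
  \<sigma> therefore sends each chosen index other than n to its successor, which forces the chosen
  indices to be the last k ones and \<sigma> to be the cycle. Its factor in the last column is the
  entry \<open>a (n - k)\<close>.\<close>

lemma capelli_symbol_companion:
  assumes k: "1 \<le> k" "k \<le> n"
  shows "symbol k (capelli_tens n k) (mfun (companion n a)) = cycle_sign k * a (n - k)"
proof -
  let ?X = "mfun (companion n a)"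
  define i0 where "i0 = [Suc (n - k)..<Suc n]"
  define F where "F = (\<lambda>is \<sigma>. of_int (sign \<sigma>) *
     prod_list (map (\<lambda>b. ?X (Prop (is ! (\<sigma> b - 1)), Prop (is ! (b - 1)))) [1..<Suc k]))"
  have i0: "i0 \<in> incs n k" using k by (auto simp: i0_def incs_def simp del: upt_Suc)
  have i0_nth: "i0 ! (b - 1) = n - k + b" if "b \<in> {1..k}" for b
    using that k by (auto simp: i0_def simp del: upt_Suc)
  have zero: "is = i0 \<and> \<sigma> = cycle_perm k"
    if "is": "is \<in> incs n k" and \<sigma>: "\<sigma> permutes {1..k}" and nz: "F is \<sigma> \<noteq> 0" for "is" \<sigma>
  proof -
    define r where "r = (\<lambda>b. is ! (b - 1))"
    have len: "length is = k" using "is" by (simp add: incs_def)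
    have rin: "r b \<in> {1..n}" if "b \<in> {1..k}" for b
    proof -
      have "b - 1 < k" using that by (cases b) auto
      then show ?thesis using seqs_nth[of "is" n k "b - 1"] "is" incs_seqs unfolding r_def by blast
    qed
    have mono: "r b < r c" if "b \<in> {1..k}" "c \<in> {1..k}" "b < c" for b c
      using "is" that len unfolding r_def incs_def
      by (auto intro!: sorted_wrt_nth_less[of "(<)"])
    have \<sigma>in: "\<sigma> b \<in> {1..k}" if "b \<in> {1..k}" for b using permutes_in_image[OF \<sigma>, of b] that by blast
    have ne: "?X (Prop (r (\<sigma> b)), Prop (r b)) \<noteq> 0" if b: "b \<in> {1..k}" for b
    proof
      assume "?X (Prop (r (\<sigma> b)), Prop (r b)) = 0"
      then have "0 \<in> set (map (\<lambda>b. ?X (Prop (is ! (\<sigma> b - 1)), Prop (is ! (b - 1)))) [1..<Suc k])"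
        using b by (force simp: r_def simp del: upt_Suc)
      then have "prod_list (map (\<lambda>b. ?X (Prop (is ! (\<sigma> b - 1)), Prop (is ! (b - 1)))) [1..<Suc k]) = 0"
        unfolding prod_list_zero_iff .
      then have "F is \<sigma> = 0" unfolding F_def by (simp only: mult_zero_right)
      then show False using nz by contradiction
    qed
    have succ: "r (\<sigma> b) = Suc (r b)" if b: "b \<in> {1..k}" "r b \<noteq> n" for b
      using ne[OF b(1)] mfun_companion[OF rin[OF \<sigma>in[OF b(1)]] rin[OF b(1)], of a] b(2)
      by (auto split: if_splits)
    \<comment> \<open>The chosen indices increase with the position and r (\<sigma> b) is the
      integer after r b. No chosen index fits between them, so \<sigma> b is the next
      position.\<close>
    have step: "\<sigma> b = Suc b \<and> r (Suc b) = Suc (r b)" if b: "b \<in> {1..<k}" for b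
    proof -
      have b1: "b \<in> {1..k}" "Suc b \<in> {1..k}" using b by auto
      have lt: "r b < r (Suc b)" using mono[OF b1] by simp
      then have "r b \<noteq> n" using rin[OF b1(2)] by auto
      then have s: "r (\<sigma> b) = Suc (r b)" using succ b1 by blast
      have "\<not> \<sigma> b \<le> b"
      proof
        assume "\<sigma> b \<le> b"
        then have "r (\<sigma> b) \<le> r b" using mono[OF \<sigma>in[OF b1(1)] b1(1)] by (cases "\<sigma> b = b") auto
        then show False using s by simp
      qed
      moreover have "\<not> Suc b < \<sigma> b"
      proof
        assume "Suc b < \<sigma> b"
        then have "r (Suc b) < r (\<sigma> b)" using mono[OF b1(2) \<sigma>in[OF b1(1)]] by simp
        then show False using s lt by simp
      qed
      ultimately have "\<sigma> b = Suc b" by simp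
      then show ?thesis using s by simp
    qed
    have k1: "k \<in> {1..k}" "1 \<in> {1..k}" using k by auto
    have rlin: "r (Suc m) = r 1 + m" if "m < k" for m
      using that
    proof (induction m)
      case (Suc m)
      then show ?case using step[of "Suc m"] by simp
    qed simp
    have \<sigma>k: "\<sigma> k = 1"
    proof -
      obtain b where b: "b \<in> {1..k}" "\<sigma> b = 1"
        using permutes_image[OF \<sigma>] k1(2) by (metis imageE)
      have "\<not> b < k" using step[of b] b by auto
      then show ?thesis using b by auto
    qed
    have rk: "r k = n"
    proof (rule ccontr)
      assume "r k \<noteq> n"
      then have "r 1 = Suc (r k)" using succ[OF k1(1)] \<sigma>k by simp
      moreover have "r 1 \<le> r k" using mono[OF k1(2,1)] k by (cases "k = 1") auto
      ultimately show False by simp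
    qed
    have r1: "r 1 + (k - 1) = n" using rlin[of "k - 1"] rk k by simp
    have "is = i0"
    proof (rule nth_equalityI)
      show "length is = length i0" using i0 len by (simp add: incs_def)
      fix p assume "p < length is"
      then have p: "p < k" using len by simp
      then have "is ! p = r 1 + p" using rlin[OF p] by (simp add: r_def)
      also have "\<dots> = n - k + Suc p" using r1 k by simp
      also have "\<dots> = i0 ! p" using i0_nth[of "Suc p"] p by simp
      finally show "is ! p = i0 ! p" .
    qed
    moreover have "\<sigma> = cycle_perm k"
    proof
      fix b
      show "\<sigma> b = cycle_perm k b"
        using step[of b] \<sigma>k permutes_not_in[OF \<sigma>, of b] by (auto simp: cycle_perm_def)
    qed
    ultimately show ?thesis by simp
  qed
  have val: "F i0 (cycle_perm k) = cycle_sign k * a (n - k)"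
  proof -
    let ?Y = "\<lambda>b. ?X (Prop (i0 ! (cycle_perm k b - 1)), Prop (i0 ! (b - 1)))"
    have "?Y b = (if b = k then a (n - k) else 1)" if b: "b \<in> {1..k}" for b
    proof -
      have cb: "cycle_perm k b \<in> {1..k}" using b by (auto simp: cycle_perm_def)
      have "?Y b = ?X (Prop (n - k + cycle_perm k b), Prop (n - k + b))"
        by (simp only: i0_nth[OF b] i0_nth[OF cb])
      also have "\<dots> = (if n - k + b = n then a (n - k + cycle_perm k b - 1) else of_bool (n - k + cycle_perm k b = Suc (n - k + b)))"
        by (rule mfun_companion) (use b cb k in auto)
      finally show ?thesis using b k by (auto simp: cycle_perm_def)
    qed
    then have "prod_list (map ?Y [1..<Suc k]) = prod_list (map (\<lambda>b. if b = k then a (n - k) else 1) [1..<Suc k])"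
      by (intro arg_cong[where f = prod_list] map_cong) auto
    also have "\<dots> = a (n - k)"
    proof -
      have upt: "[1..<Suc k] = [1..<k] @ [k]" using k by simp
      have "prod_list (map (\<lambda>b. if b = k then a (n - k) else 1) [1..<k]) = prod_list (map (\<lambda>b. 1) [1..<k])"
        by (intro arg_cong[where f = prod_list] map_cong) auto
      also have "\<dots> = 1" by (simp add: map_replicate_const)
      finally show ?thesis unfolding upt by simp
    qed
    finally show ?thesis unfolding F_def cycle_sign_def by (rule arg_cong)
  qed
  have "symbol k (capelli_tens n k) ?X = (\<Sum>(is, \<sigma>)\<in>incs n k \<times> {\<sigma>. \<sigma> permutes {1..k}}. F is \<sigma>)"
    unfolding capelli_symbol F_def by (simp only: sum.cartesian_product)
  also have "\<dots> = (\<Sum>(is, \<sigma>)\<in>{(i0, cycle_perm k)}. F is \<sigma>)"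
  proof (rule sum.mono_neutral_right)
    show "finite (incs n k \<times> {\<sigma>. \<sigma> permutes {1..k}})"
      by (intro finite_cartesian_product finite_incs finite_permutations) simp
    show "{(i0, cycle_perm k)} \<subseteq> incs n k \<times> {\<sigma>. \<sigma> permutes {1..k}}"
      using i0 cycle_perm_permutes[OF k(1)] by blast
    show "\<forall>x\<in>incs n k \<times> {\<sigma>. \<sigma> permutes {1..k}} - {(i0, cycle_perm k)}. (case x of (is, \<sigma>) \<Rightarrow> F is \<sigma>) = 0"
    proof
      fix x assume x: "x \<in> incs n k \<times> {\<sigma>. \<sigma> permutes {1..k}} - {(i0, cycle_perm k)}"
      obtain "is" \<sigma> where "x = (is, \<sigma>)" by (cases x)
      then show "(case x of (is, \<sigma>) \<Rightarrow> F is \<sigma>) = 0" using x zero[of "is" \<sigma>] by (cases "F is \<sigma> = 0") simp_all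
    qed
  qed
  finally show ?thesis using val by simp
qed

section \<open>The center is generated by the Capelli elements\<close>

lemma center_commute:
  assumes "f \<in> fa A" "cls A f \<in> center (U A)" "g \<in> fa A"
  shows "f * g - g * f \<in> gl_ideal A"
proof -
  have "cls A (f * g) = cls A (g * f)"
    using assms by (simp add: center_def cls_ops cls_in_U)
  then show ?thesis using assms by (simp add: cls_iff free_alg_closed)
qed

lemma prod_list_perm_ideal:
  assumes f: "\<And>x. f x \<in> fa A" "\<And>x. cls A (f x) \<in> center (U A)" and "mset xs = mset ys"
  shows "prod_list (map f xs) - prod_list (map f ys) \<in> gl_ideal A"
  using assms(3)
proof (induction xs arbitrary: ys)
  case (Cons x xs)
  have fa: "prod_list (map f zs) \<in> fa A" for zs by (rule free_alg_prod_list) (use f in auto)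
  have "x \<in> set ys" using Cons.prems(1) by (metis list.set_intros(1) set_mset_mset)
  then obtain p q where ys: "ys = p @ x # q" by (meson split_list)
  have mset: "mset xs = mset (p @ q)" using Cons.prems(1) ys by simp
  have "f x * (prod_list (map f xs) - prod_list (map f (p @ q))) \<in> gl_ideal A"
    by (intro gl_ideal_closed(6) Cons.IH mset f)
  moreover have "(f x * prod_list (map f p) - prod_list (map f p) * f x) * prod_list (map f q) \<in> gl_ideal A"
    by (intro gl_ideal_closed(7) center_commute f fa)
  moreover have "prod_list (map f (x # xs)) - prod_list (map f ys) =
      f x * (prod_list (map f xs) - prod_list (map f (p @ q))) +
      (f x * prod_list (map f p) - prod_list (map f p) * f x) * prod_list (map f q)"
    by (simp add: ys algebra_simps)
  ultimately show ?case by (simp only: gl_ideal_closed(3))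
qed (simp add: gl_ideal_closed(1))

text \<open>The words in \<open>1, \<dots>, n\<close> stand for noncommutative polynomials in the Capelli elements.\<close>

definition evH :: "nat \<Rightarrow> (nat fword \<Rightarrow>\<^sub>0 complex) \<Rightarrow> tens" where
  "evH n = subst const (capelli_tens n)"

lemma evH_simps: "evH n 0 = 0" "evH n 1 = 1" "evH n (P + Q) = evH n P + evH n Q"
  "evH n (P * Q) = evH n P * evH n Q" "evH n (P - Q) = evH n P - evH n Q"
  "evH n (const c) = const c" "evH n (word u) = prod_list (map (capelli_tens n) u)"
  "evH n (sum F I) = (\<Sum>i\<in>I. evH n (F i))"
  by (simp_all add: evH_def subst_one subst_add subst_mult subst_diff subst_const subst_word subst_sum
      scalar_emb_const)

lemma evH_expand: "evH n P = (\<Sum>u\<in>Poly_Mapping.keys P. const (Poly_Mapping.lookup P u) *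
    prod_list (map (capelli_tens n) (letters u)))"
  by (simp add: evH_def subst_def)

lemma evH_word_fa: "prod_list (map (capelli_tens n) u) \<in> fa (proper n)"
  by (rule free_alg_prod_list) (use capelli_fa in auto)

lemma evH_fa: "evH n P \<in> fa (proper n)"
  unfolding evH_expand by (intro free_alg_sum free_alg_closed evH_word_fa)

lemma center_closed:
  assumes "x \<in> center (U A)" "y \<in> center (U A)"
  shows "x \<oplus>\<^bsub>U A\<^esub> y \<in> center (U A)" "x \<otimes>\<^bsub>U A\<^esub> y \<in> center (U A)"
proof -
  interpret ring "U A" by (rule ring_U)
  have x: "x \<in> carrier (U A)" "\<And>z. z \<in> carrier (U A) \<Longrightarrow> x \<otimes>\<^bsub>U A\<^esub> z = z \<otimes>\<^bsub>U A\<^esub> x"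
    and y: "y \<in> carrier (U A)" "\<And>z. z \<in> carrier (U A) \<Longrightarrow> y \<otimes>\<^bsub>U A\<^esub> z = z \<otimes>\<^bsub>U A\<^esub> y"
    using assms by (auto simp: center_def)
  show "x \<oplus>\<^bsub>U A\<^esub> y \<in> center (U A)"
    unfolding center_def
  proof (intro CollectI conjI ballI)
    fix z assume z: "z \<in> carrier (U A)"
    show "(x \<oplus>\<^bsub>U A\<^esub> y) \<otimes>\<^bsub>U A\<^esub> z = z \<otimes>\<^bsub>U A\<^esub> (x \<oplus>\<^bsub>U A\<^esub> y)"
      by (simp only: l_distr[OF x(1) y(1) z] r_distr[OF x(1) y(1) z] x(2)[OF z] y(2)[OF z])
  qed (rule a_closed[OF x(1) y(1)])
  show "x \<otimes>\<^bsub>U A\<^esub> y \<in> center (U A)"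
    unfolding center_def
  proof (intro CollectI conjI ballI)
    fix z assume z: "z \<in> carrier (U A)"
    have "x \<otimes>\<^bsub>U A\<^esub> y \<otimes>\<^bsub>U A\<^esub> z = x \<otimes>\<^bsub>U A\<^esub> (y \<otimes>\<^bsub>U A\<^esub> z)" by (rule m_assoc[OF x(1) y(1) z])
    also have "\<dots> = x \<otimes>\<^bsub>U A\<^esub> (z \<otimes>\<^bsub>U A\<^esub> y)" by (simp only: y(2)[OF z])
    also have "\<dots> = (x \<otimes>\<^bsub>U A\<^esub> z) \<otimes>\<^bsub>U A\<^esub> y" by (rule m_assoc[OF x(1) z y(1), symmetric])
    also have "\<dots> = (z \<otimes>\<^bsub>U A\<^esub> x) \<otimes>\<^bsub>U A\<^esub> y" by (simp only: x(2)[OF z])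
    also have "\<dots> = z \<otimes>\<^bsub>U A\<^esub> (x \<otimes>\<^bsub>U A\<^esub> y)" by (rule m_assoc[OF z x(1) y(1)])
    finally show "x \<otimes>\<^bsub>U A\<^esub> y \<otimes>\<^bsub>U A\<^esub> z = z \<otimes>\<^bsub>U A\<^esub> (x \<otimes>\<^bsub>U A\<^esub> y)" .
  qed (rule m_closed[OF x(1) y(1)])
qed

lemma center_const: "cls A (const c) \<in> center (U A)"
  by (rule commute_gens_central) (simp_all add: free_alg_closed const_commute gl_ideal_closed(1))

lemma center_sum:
  "(\<And>i. i \<in> I \<Longrightarrow> F i \<in> fa A) \<Longrightarrow> (\<And>i. i \<in> I \<Longrightarrow> cls A (F i) \<in> center (U A)) \<Longrightarrow> cls A (sum F I) \<in> center (U A)"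
proof (induction I rule: infinite_finite_induct)
  case (insert i I)
  then have "cls A (F i) \<oplus>\<^bsub>U A\<^esub> cls A (sum F I) \<in> center (U A)"
    by (intro center_closed insert.IH) auto
  moreover have "cls A (F i + sum F I) = cls A (F i) \<oplus>\<^bsub>U A\<^esub> cls A (sum F I)"
    using insert.prems by (intro cls_ops free_alg_sum) auto
  ultimately show ?case using insert.hyps by simp
qed (use center_const[of A 0] in \<open>simp_all add: const_hom(4)\<close>)

lemma evH_word_central: "cls (proper n) (prod_list (map (capelli_tens n) u)) \<in> center (U (proper n))"
proof (induction u)
  case Nil
  then show ?case using center_const[of "proper n" 1] by (simp add: const_hom)
next
  case (Cons k u)
  then show ?case by (simp add: cls_ops capelli_fa evH_word_fa center_closed capelli_central)
qed

lemma evH_central: "cls (proper n) (evH n P) \<in> center (U (proper n))"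
  unfolding evH_expand
proof (rule center_sum)
  fix u
  show "const (Poly_Mapping.lookup P u) * prod_list (map (capelli_tens n) (letters u)) \<in> fa (proper n)"
    by (intro free_alg_closed evH_word_fa)
  show "cls (proper n) (const (Poly_Mapping.lookup P u) * prod_list (map (capelli_tens n) (letters u))) \<in> center (U (proper n))"
    by (simp add: cls_ops free_alg_closed evH_word_fa center_closed center_const evH_word_central)
qed

text \<open>The hypothesis says that \<open>P\<close> vanishes after abelianization, and the Capelli
  elements commute with each other.\<close>

lemma evH_mset_zero:
  assumes "\<And>M. (\<Sum>u | u \<in> Poly_Mapping.keys P \<and> mset (letters u) = M. Poly_Mapping.lookup P u) = 0"
  shows "evH n P \<in> gl_ideal (proper n)"
proof -
  define rep where "rep = (\<lambda>M :: nat multiset. SOME u. mset u = M)"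
  have rep: "mset (rep M) = M" for M
    unfolding rep_def by (rule someI_ex) (rule ex_mset)
  let ?H = "\<lambda>u. prod_list (map (capelli_tens n) u)"
  let ?K = "Poly_Mapping.keys P"
  have "(\<Sum>u\<in>?K. const (Poly_Mapping.lookup P u) * ?H (rep (mset (letters u)))) =
      (\<Sum>M\<in>(\<lambda>u. mset (letters u)) ` ?K. \<Sum>u | u \<in> ?K \<and> mset (letters u) = M.
         const (Poly_Mapping.lookup P u) * ?H (rep (mset (letters u))))"
    by (rule sum.group[symmetric]) auto
  also have "\<dots> = (\<Sum>M\<in>(\<lambda>u. mset (letters u)) ` ?K.
      const (\<Sum>u | u \<in> ?K \<and> mset (letters u) = M. Poly_Mapping.lookup P u) * ?H (rep M))"
    by (intro sum.cong refl) (simp add: const_sum sum_distrib_right)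
  also have "\<dots> = 0" by (simp add: assms const_hom)
  finally have "evH n P = (\<Sum>u\<in>?K. const (Poly_Mapping.lookup P u) * (?H (letters u) - ?H (rep (mset (letters u)))))"
    by (simp add: evH_expand right_diff_distrib sum_subtractf)
  also have "\<dots> \<in> gl_ideal (proper n)"
    by (intro gl_ideal_sum gl_ideal_closed(6) prod_list_perm_ideal capelli_fa capelli_central free_alg_closed)
       (simp add: rep)
  finally show ?thesis .
qed

section \<open>Weights and principal symbols of polynomials in the Capelli elements\<close>

lemma symbol_superset:
  assumes "finite A" "Poly_Mapping.keys f \<subseteq> A"
  shows "symbol m f X = (\<Sum>w\<in>A. Poly_Mapping.lookup f w * (of_bool (length (letters w) = m) * prod_list (map X (letters w))))"
proof -
  have "symbol m f X = (\<Sum>w\<in>Poly_Mapping.keys f. if length (letters w) = m then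
      Poly_Mapping.lookup f w * prod_list (map X (letters w)) else 0)"
    unfolding symbol_def by (rule sum.inter_filter) simp
  also have "\<dots> = (\<Sum>w\<in>A. if length (letters w) = m then
      Poly_Mapping.lookup f w * prod_list (map X (letters w)) else 0)"
    by (rule sum.mono_neutral_left) (use assms in \<open>auto simp: in_keys_iff\<close>)
  also have "\<dots> = (\<Sum>w\<in>A. Poly_Mapping.lookup f w * (of_bool (length (letters w) = m) * prod_list (map X (letters w))))"
    by (intro sum.cong refl) auto
  finally show ?thesis .
qed

lemma symbol_add: "symbol m (f + g) X = symbol m f X + symbol m g X"
  using symbol_superset[of "Poly_Mapping.keys f \<union> Poly_Mapping.keys g" "f + g" m X]
    symbol_superset[of "Poly_Mapping.keys f \<union> Poly_Mapping.keys g" f m X]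
    symbol_superset[of "Poly_Mapping.keys f \<union> Poly_Mapping.keys g" g m X] keys_add[of f g]
  by (simp add: lookup_add distrib_right sum.distrib)

lemma symbol_const_word: "symbol m (const c * word w) X = c * (of_bool (length w = m) * prod_list (map X w))"
  using symbol_superset[of "{FWord w}" "const c * word w" m X] by (simp add: const_mult word_def)

lemma symbol_zero: "symbol m 0 X = 0"
  by (simp add: symbol_def)

lemma symbol_sum: "symbol m (sum F I) X = (\<Sum>i\<in>I. symbol m (F i) X)"
  by (induction I rule: infinite_finite_induct) (auto simp: symbol_add symbol_zero)

lemma symbol_const_mult: "symbol m (const c * f) X = c * symbol m f X"
proof (induction f rule: tens_induct)
  case (add d w f)
  have "const c * (const d * word w) = const (c * d) * word w" by (simp add: const_hom mult.assoc)
  then show ?case using add by (simp add: distrib_left symbol_add symbol_const_word)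
qed (simp add: symbol_zero)

lemma symbol_diff: "symbol m (f - g) X = symbol m f X - symbol m g X"
  using symbol_add[of m "f - g" g X] by simp

lemma symbol_FD_less: "f \<in> FD A k \<Longrightarrow> k < m \<Longrightarrow> symbol m f X = 0"
  unfolding symbol_def by (rule sum.neutral) (auto simp: FD_def)

text \<open>A product of two words has length k + m only if both factors have maximal
  length.\<close>

lemma symbol_mult:
  assumes f: "f \<in> FD A k" and g: "g \<in> FD A m"
  shows "symbol (k + m) (f * g) X = symbol k f X * symbol m g X"
proof -
  let ?K = "Poly_Mapping.keys f" and ?L = "Poly_Mapping.keys g"
  let ?c = "Poly_Mapping.lookup f" and ?d = "Poly_Mapping.lookup g"
  have prod: "const c * word u * (const d * word v) = const (c * d) * word (u @ v)" for c d and u v :: "letter list"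
    by (simp add: word_def const_mult mult_single plus_fword_def)
  have "f * g = (\<Sum>u\<in>?K. \<Sum>v\<in>?L. const (?c u * ?d v) * word (letters u @ letters v))"
  proof -
    have "f * g = (\<Sum>u\<in>?K. const (?c u) * word (letters u)) * (\<Sum>v\<in>?L. const (?d v) * word (letters v))"
      by (simp only: tens_expand[symmetric])
    then show ?thesis by (simp only: sum_product prod)
  qed
  then have "symbol (k + m) (f * g) X = (\<Sum>u\<in>?K. \<Sum>v\<in>?L. (?c u * ?d v) *
      (of_bool (length (letters u @ letters v) = k + m) * prod_list (map X (letters u @ letters v))))"
    by (simp only: symbol_sum symbol_const_word)
  also have "\<dots> = (\<Sum>u\<in>?K. \<Sum>v\<in>?L. (?c u * (of_bool (length (letters u) = k) * prod_list (map X (letters u)))) *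
      (?d v * (of_bool (length (letters v) = m) * prod_list (map X (letters v)))))"
  proof (intro sum.cong refl)
    fix u v assume "u \<in> ?K" "v \<in> ?L"
    then have "length (letters u) \<le> k" "length (letters v) \<le> m" using f g by (auto simp: FD_def)
    then have "length (letters u @ letters v) = k + m \<longleftrightarrow> length (letters u) = k \<and> length (letters v) = m" by auto
    then show "(?c u * ?d v) * (of_bool (length (letters u @ letters v) = k + m) * prod_list (map X (letters u @ letters v))) =
      (?c u * (of_bool (length (letters u) = k) * prod_list (map X (letters u)))) *
      (?d v * (of_bool (length (letters v) = m) * prod_list (map X (letters v))))"
      by (simp add: of_bool_conj)
  qed
  also have "\<dots> = symbol k f X * symbol m g X"
    by (simp only: symbol_superset[OF finite_keys subset_refl] sum_product)
  finally show ?thesis .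
qed

lemma symbol_cong:
  assumes "f \<in> fa A" "\<And>l. l \<in> A \<times> A \<Longrightarrow> X l = Y l"
  shows "symbol m f X = symbol m f Y"
  unfolding symbol_def
proof (intro sum.cong refl)
  fix w assume "w \<in> {w \<in> Poly_Mapping.keys f. length (letters w) = m}"
  then have "set (letters w) \<subseteq> A \<times> A" using assms(1) by (auto simp: fa_iff)
  then have "map X (letters w) = map Y (letters w)" using assms(2) by (intro map_cong) auto
  then show "Poly_Mapping.lookup f w * prod_list (map X (letters w)) =
      Poly_Mapping.lookup f w * prod_list (map Y (letters w))" by (simp only:)
qed

lemma symbol_scale: "symbol m f (\<lambda>l. t * X l) = t ^ m * symbol m f X"
proof -
  have "prod_list (map (\<lambda>l. t * X l) w) = t ^ length w * prod_list (map X w)" for w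
    by (induction w) auto
  then show ?thesis
    unfolding symbol_def sum_distrib_left by (intro sum.cong refl) auto
qed

text \<open>The letter \<open>k\<close> stands for a Capelli element of degree \<open>k\<close>, so
  this is the degree of the monomial.\<close>

abbreviation weight :: "nat fword \<Rightarrow> nat" where
  "weight u \<equiv> sum_list (letters u)"

lemma evH_word_FD: "prod_list (map (capelli_tens n) u) \<in> FD (proper n) (sum_list u)"
proof (induction u)
  case Nil
  then show ?case using FD_const[of 1] by (simp add: const_hom)
next
  case (Cons k u)
  then show ?case by (simp add: FD_mult capelli_FD)
qed

lemma evH_word_symbol:
  "symbol (sum_list u) (prod_list (map (capelli_tens n) u)) X = prod_list (map (\<lambda>k. symbol k (capelli_tens n k) X) u)"
proof (induction u)
  case Nil
  then show ?case using symbol_const_word[of 0 1 "[]" X] by (simp add: const_hom)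
next
  case (Cons k u)
  then show ?case by (simp add: symbol_mult[OF capelli_FD evH_word_FD])
qed

lemma evH_FD: "(\<And>u. u \<in> Poly_Mapping.keys P \<Longrightarrow> weight u \<le> m) \<Longrightarrow> evH n P \<in> FD (proper n) m"
  unfolding evH_expand using FD_mono evH_word_FD by (intro FD_sum FD_const_mult) blast

lemma evH_symbol:
  assumes "\<And>u. u \<in> Poly_Mapping.keys P \<Longrightarrow> weight u \<le> m"
  shows "symbol m (evH n P) X = (\<Sum>u | u \<in> Poly_Mapping.keys P \<and> weight u = m.
     Poly_Mapping.lookup P u * prod_list (map (\<lambda>k. symbol k (capelli_tens n k) X) (letters u)))"
proof -
  have "symbol m (evH n P) X = (\<Sum>u\<in>Poly_Mapping.keys P. if weight u = m then
      Poly_Mapping.lookup P u * prod_list (map (\<lambda>k. symbol k (capelli_tens n k) X) (letters u)) else 0)"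
    unfolding evH_expand symbol_sum symbol_const_mult
  proof (intro sum.cong refl)
    fix u assume u: "u \<in> Poly_Mapping.keys P"
    show "Poly_Mapping.lookup P u * symbol m (prod_list (map (capelli_tens n) (letters u))) X =
      (if weight u = m then Poly_Mapping.lookup P u * prod_list (map (\<lambda>k. symbol k (capelli_tens n k) X) (letters u)) else 0)"
      using assms[OF u] evH_word_symbol[of "letters u" n X] symbol_FD_less[OF evH_word_FD, of "letters u" m n X]
      by (cases "weight u = m") auto
  qed
  then show ?thesis by (simp add: sum.inter_filter)
qed

definition homog :: "nat \<Rightarrow> (nat fword \<Rightarrow>\<^sub>0 complex) \<Rightarrow> (nat fword \<Rightarrow>\<^sub>0 complex)" where
  "homog m P = (\<Sum>u | u \<in> Poly_Mapping.keys P \<and> weight u = m. Poly_Mapping.single u (Poly_Mapping.lookup P u))"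

lemma lookup_homog: "Poly_Mapping.lookup (homog m P) u = (if weight u = m then Poly_Mapping.lookup P u else 0)"
  by (auto simp: homog_def lookup_sum lookup_single when_def in_keys_iff)

lemma keys_homog: "Poly_Mapping.keys (homog m P) = {u \<in> Poly_Mapping.keys P. weight u = m}"
  by (auto simp: in_keys_iff lookup_homog split: if_splits)

lemma companion_surjective:
  "\<exists>a. \<forall>k. 1 \<le> k \<longrightarrow> k \<le> n \<longrightarrow> symbol k (capelli_tens n k) (mfun (companion n a)) = x k"
proof (intro exI allI impI)
  fix k assume k: "1 \<le> k" "k \<le> n"
  show "symbol k (capelli_tens n k) (mfun (companion n (\<lambda>i. cycle_sign (n - i) * x (n - i)))) = x k"
    using capelli_symbol_companion[OF k] k cycle_sign_square[of k] by (simp flip: mult.assoc)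
qed

text \<open>The component of top weight has vanishing symbol on companion matrices, where the
  symbols of the Capelli elements take arbitrary values. Hence its abelianization vanishes, it
  evaluates to zero in every size, and it can be removed. The conclusion for another size is the
  well-definedness of the map that sends a polynomial in the elements for n to the same polynomial
  in those for n'.\<close>

lemma capelli_independent:
  assumes "P \<in> carrier (free_alg {1..n})" "evH n P \<in> gl_ideal (proper n)"
  shows "evH n' P \<in> gl_ideal (proper n')"
proof -
  have *: "evH n' P \<in> gl_ideal (proper n')" if "P \<in> carrier (free_alg {1..n})" "evH n P \<in> gl_ideal (proper n)"
    "\<And>u. u \<in> Poly_Mapping.keys P \<Longrightarrow> weight u < m" for P m
    using that
  proof (induction m arbitrary: P)
    case 0
    then have "Poly_Mapping.keys P = {}" by blast
    then show ?case by (simp add: evH_expand gl_ideal_closed(1))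
  next
    case (Suc m)
    let ?W = "{u \<in> Poly_Mapping.keys P. weight u = m}"
    have wt: "weight u \<le> m" if "u \<in> Poly_Mapping.keys P" for u using Suc.prems(3)[OF that] by simp
    have sym0: "symbol m (evH n P) X = 0" for X
    proof -
      have "fact m * symbol m (evH n P) X = pol n m (vac n (evH n P)) X"
        by (rule pol_vac[OF evH_FD, symmetric]) (rule wt)
      also have "\<dots> = 0" by (rule pol_zero) (simp add: vac_gl_ideal[OF Suc.prems(2)])
      finally show ?thesis by simp
    qed
    have letters: "set (letters u) \<subseteq> {1..n}" if "u \<in> Poly_Mapping.keys P" for u
      using that Suc.prems(1) by (auto simp: free_alg_def)
    have zero: "(\<Sum>u\<in>?W. Poly_Mapping.lookup P u * prod_list (map x (letters u))) = 0" for x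
    proof -
      obtain a where a: "\<And>k. 1 \<le> k \<Longrightarrow> k \<le> n \<Longrightarrow> symbol k (capelli_tens n k) (mfun (companion n a)) = x k"
        using companion_surjective[of n x] by blast
      have "(\<Sum>u\<in>?W. Poly_Mapping.lookup P u * prod_list (map x (letters u))) =
        (\<Sum>u\<in>?W. Poly_Mapping.lookup P u * prod_list (map (\<lambda>k. symbol k (capelli_tens n k) (mfun (companion n a))) (letters u)))"
      proof (intro sum.cong refl arg_cong2[where f = "(*)"] arg_cong[where f = prod_list] map_cong)
        fix u k assume "u \<in> ?W" "k \<in> set (letters u)"
        then show "x k = symbol k (capelli_tens n k) (mfun (companion n a))" using letters a by fastforce
      qed
      also have "\<dots> = symbol m (evH n P) (mfun (companion n a))" by (rule evH_symbol[OF wt, symmetric])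
      finally show ?thesis using sym0 by simp
    qed
    have inj: "inj_on letters ?W" by (rule inj_onI) (metis fword.expand)
    define c where "c = (\<lambda>u. Poly_Mapping.lookup P (FWord u))"
    have cl: "c (letters u) = Poly_Mapping.lookup P u" for u by (simp add: c_def)
    have "(\<Sum>w\<in>letters ` ?W. c w * prod_list (map x w)) = 0" for x
      using zero[of x] by (simp add: sum.reindex[OF inj] cl)
    then have "(\<Sum>w | w \<in> letters ` ?W \<and> mset w = M. c w) = 0" for M
      by (intro monomials_independent) auto
    moreover have "(\<Sum>w | w \<in> letters ` ?W \<and> mset w = M. c w) =
      (\<Sum>u | u \<in> Poly_Mapping.keys (homog m P) \<and> mset (letters u) = M. Poly_Mapping.lookup (homog m P) u)" for M
    proof -
      have "{w. w \<in> letters ` ?W \<and> mset w = M} = letters ` {u \<in> ?W. mset (letters u) = M}" by auto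
      moreover have "inj_on letters {u \<in> ?W. mset (letters u) = M}"
        by (rule inj_on_subset[OF inj]) auto
      ultimately have "(\<Sum>w | w \<in> letters ` ?W \<and> mset w = M. c w) = (\<Sum>u\<in>{u \<in> ?W. mset (letters u) = M}. c (letters u))"
        by (simp add: sum.reindex)
      also have "\<dots> = (\<Sum>u | u \<in> Poly_Mapping.keys (homog m P) \<and> mset (letters u) = M. Poly_Mapping.lookup (homog m P) u)"
        by (rule sum.cong) (auto simp: keys_homog lookup_homog cl)
      finally show ?thesis .
    qed
    ultimately have hom: "evH k (homog m P) \<in> gl_ideal (proper k)" for k
      by (intro evH_mset_zero) simp
    have "evH n' (P - homog m P) \<in> gl_ideal (proper n')"
    proof (rule Suc.IH)
      have "homog m P \<in> carrier (free_alg {1..n})"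
        using Suc.prems(1) by (auto simp: free_alg_def keys_homog)
      then show "P - homog m P \<in> carrier (free_alg {1..n})"
        by (intro free_alg_closed Suc.prems(1))
      show "evH n (P - homog m P) \<in> gl_ideal (proper n)"
        unfolding evH_simps by (intro gl_ideal_closed(4) Suc.prems(2) hom)
      show "weight u < m" if u: "u \<in> Poly_Mapping.keys (P - homog m P)" for u
      proof -
        have "u \<in> Poly_Mapping.keys P" "weight u \<noteq> m"
          using u by (auto simp: in_keys_iff lookup_minus lookup_homog split: if_splits)
        then show ?thesis using wt by fastforce
      qed
    qed
    from gl_ideal_closed(3)[OF this hom] show ?case by (simp add: evH_simps)
  qed
  show ?thesis
  proof (rule *[OF assms])
    fix u assume "u \<in> Poly_Mapping.keys P"
    then show "weight u < Suc (Max (insert 0 (weight ` Poly_Mapping.keys P)))"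
      by (auto intro!: le_imp_less_Suc Max_ge)
  qed
qed

text \<open>\<open>capelli_symbol_companion\<close> solved for the entry: with k = n + 1 - p the
  parameter in row p of the last column is the symbol of the k-th Capelli element up to the sign of
  the cycle.\<close>

definition companion_entry :: "nat \<Rightarrow> letter \<Rightarrow> (nat fword \<Rightarrow>\<^sub>0 complex)" where
  "companion_entry n l = (case l of (Prop p, Prop q) \<Rightarrow>
     if q = n then const (cycle_sign (Suc n - p)) * word [Suc n - p] else of_bool (p = Suc q) | _ \<Rightarrow> 0)"

lemma companion_entry_closed:
  assumes "l \<in> proper n \<times> proper n"
  shows "companion_entry n l \<in> carrier (free_alg {1..n})"
proof -
  obtain p q where l: "l = (Prop p, Prop q)" "p \<in> {1..n}" "q \<in> {1..n}"
    using assms by (auto simp: proper_def)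
  then have "word [Suc n - p] \<in> carrier (free_alg {1..n})" by (intro free_alg_closed) auto
  then show ?thesis
    by (auto simp: companion_entry_def l free_alg_closed)
qed

lemma symbol_conj_invariant:
  assumes "f \<in> FD (proper n) m" "inv_vec n (vac n f)"
  shows "conj_invariant n (symbol m f)" "line_polynomial n (symbol m f)"
proof -
  have eq: "symbol m f X = (1 / fact m) * pol n m (vac n f) X" for X
    using pol_vac[OF assms(1), of X] by simp
  show "conj_invariant n (symbol m f)"
    using conj_invariant_pol[OF assms(2), of m] by (simp add: conj_invariant_def eq)
  show "line_polynomial n (symbol m f)"
    using line_polynomial_pol[of n m "vac n f"] polyfun_mult[OF polyfun_const]
    unfolding line_polynomial_def eq by blast
qed

lemma mfun_smult:
  assumes "M \<in> carrier_mat n n" "l \<in> proper n \<times> proper n"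
  shows "mfun (t \<cdot>\<^sub>m M) l = t * mfun M l"
proof -
  obtain i j where x: "l = (Prop (Suc i), Prop (Suc j))" "i < n" "j < n"
    using assms(2) by (auto simp: proper_def) (metis Suc_pred' less_eq_Suc_le Suc_le_lessD)
  then show ?thesis using assms by simp
qed

text \<open>A polynomial in the Capelli elements with the symbol of \<open>f\<close> is subtracted,
  which leaves a central element of lower degree. The letters stay below \<open>min m n\<close>
  because a letter is at most the weight of its word; this is where the degree bound of the theorem
  takes effect.\<close>

lemma center_generated:
  assumes "f \<in> FD (proper n) m" "cls (proper n) f \<in> center (U (proper n))"
  shows "\<exists>P\<in>carrier (free_alg {1..min m n}). (\<forall>u\<in>Poly_Mapping.keys P. weight u \<le> m) \<and>
    f - evH n P \<in> gl_ideal (proper n)"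
  using assms
proof (induction m arbitrary: f)
  case 0
  have "Poly_Mapping.keys f \<subseteq> {0}"
    using 0(1) by (auto simp: FD_def) (metis fword.expand letters_zero)
  then have "f = const (Poly_Mapping.lookup f 0)"
    by (intro poly_mapping_eqI) (auto simp: const_def lookup_single when_def in_keys_iff)
  then obtain c where f: "f = const c" by blast
  show ?case
  proof (intro bexI[of _ "const c"] conjI ballI)
    show "f - evH n (const c) \<in> gl_ideal (proper n)"
      by (simp add: f evH_simps gl_ideal_closed(1))
    fix u :: "nat fword" assume "u \<in> Poly_Mapping.keys (const c)"
    then show "weight u \<le> 0" by (auto simp: const_def split: if_splits)
  qed (rule free_alg_closed)
next
  case (Suc m)
  let ?B = "proper n"
  let ?c = "\<lambda>X k. symbol k (capelli_tens n k) X"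
  have ffa: "f \<in> fa ?B" by (rule FD_fa[OF Suc.prems(1)])
  have inv: "inv_vec n (vac n f)" using central_inv_vec[OF ffa] Suc.prems(2) by blast
  let ?W = "{w \<in> Poly_Mapping.keys f. length (letters w) = Suc m}"
  have W: "set (letters w) \<subseteq> ?B \<times> ?B" if "w \<in> ?W" for w
    using that ffa by (auto simp: fa_iff)
  \<comment> \<open>The top part of \<open>f\<close> on a generic companion matrix, each entry being
    written through the Capelli letters.\<close>
  define Q where "Q = (\<Sum>w\<in>?W. const (Poly_Mapping.lookup f w) * prod_list (map (companion_entry n) (letters w)))"
  have Qc: "Q \<in> carrier (free_alg {1..n})"
    unfolding Q_def
  proof (intro free_alg_sum free_alg_closed free_alg_prod_list)
    fix w g assume "w \<in> ?W" "g \<in> set (map (companion_entry n) (letters w))"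
    then show "g \<in> carrier (free_alg {1..n})" using W companion_entry_closed by fastforce
  qed
  define h where "h = (\<lambda>X. subst (\<lambda>c. c) (?c X) Q)"
  have h_comp: "symbol (Suc m) f (mfun (companion n a)) = h (mfun (companion n a))" for a
  proof -
    let ?X = "mfun (companion n a)"
    have entry: "subst (\<lambda>c. c) (?c ?X) (companion_entry n l) = ?X l" if l: "l \<in> ?B \<times> ?B" for l
    proof -
      obtain p q where l': "l = (Prop p, Prop q)" "p \<in> {1..n}" "q \<in> {1..n}"
        using l by (auto simp: proper_def)
      show ?thesis
      proof (cases "q = n")
        case True
        have "subst (\<lambda>c. c) (?c ?X) (companion_entry n l) = cycle_sign (Suc n - p) * ?c ?X (Suc n - p)"
          using True l' by (simp add: companion_entry_def subst_const_word[OF scalar_emb_id])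
        also have "?c ?X (Suc n - p) = cycle_sign (Suc n - p) * a (n - (Suc n - p))"
          by (rule capelli_symbol_companion) (use l' in auto)
        also have "n - (Suc n - p) = p - 1" using l' by auto
        finally show ?thesis
          using True l' cycle_sign_square[of "Suc n - p"] by (simp add: mfun_companion flip: mult.assoc)
      next
        case False
        then show ?thesis
          using l' by (simp add: companion_entry_def mfun_companion subst_one[OF scalar_emb_id] of_bool_def)
      qed
    qed
    have "h ?X = (\<Sum>w\<in>?W. Poly_Mapping.lookup f w * prod_list (map (\<lambda>l. subst (\<lambda>c. c) (?c ?X) (companion_entry n l)) (letters w)))"
      unfolding h_def Q_def
      by (simp add: subst_sum subst_mult subst_const subst_prod_list scalar_emb_id comp_def)
    also have "\<dots> = (\<Sum>w\<in>?W. Poly_Mapping.lookup f w * prod_list (map ?X (letters w)))"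
    proof (intro sum.cong refl arg_cong2[where f = "(*)"] arg_cong[where f = prod_list] map_cong)
      fix w l assume "w \<in> ?W" "l \<in> set (letters w)"
      then show "subst (\<lambda>c. c) (?c ?X) (companion_entry n l) = ?X l" using W by (intro entry) blast
    qed
    finally show ?thesis by (simp add: symbol_def)
  qed
  have cap: "conj_invariant n (symbol k (capelli_tens n k))" "line_polynomial n (symbol k (capelli_tens n k))" for k
    using symbol_conj_invariant[OF capelli_FD inv_vec_capelli] by auto
  have h_conj: "conj_invariant n h"
    using cap(1) unfolding conj_invariant_def h_def by (auto intro!: arg_cong[where f = "\<lambda>c. subst (\<lambda>c. c) c Q"])
  have h_line: "line_polynomial n h"
    unfolding line_polynomial_def h_def subst_def
    using cap(2) by (intro ballI polyfun_sum polyfun_mult polyfun_const polyfun_prod_list) (auto simp: line_polynomial_def)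
  have eq_mat: "symbol (Suc m) f (mfun M) = h (mfun M)" if "M \<in> carrier_mat n n" for M
    by (rule invariants_eqI[OF symbol_conj_invariant[OF Suc.prems(1) inv] h_conj h_line h_comp that])
  let ?L = "\<lambda>u X. Poly_Mapping.lookup Q u * prod_list (map (?c X) (letters u))"
  \<comment> \<open>\<open>Q\<close> need not be homogeneous in the weight. Replacing M by t M
    multiplies the symbol of \<open>f\<close> by t^(m+1) and a monomial by t to its weight, so
    comparing coefficients isolates the component of weight m + 1.\<close>
  have top: "symbol (Suc m) f (mfun M) = (\<Sum>u | u \<in> Poly_Mapping.keys Q \<and> weight u = Suc m. ?L u (mfun M))"
    if M: "M \<in> carrier_mat n n" for M
  proof -
    let ?X = "mfun M"
    define K where "K = Max (insert (Suc m) (weight ` Poly_Mapping.keys Q))"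
    have K: "Suc m \<le> K" "\<And>u. u \<in> Poly_Mapping.keys Q \<Longrightarrow> weight u \<le> K"
      unfolding K_def by (auto intro: Max_ge)
    define b where "b = (\<lambda>j. (\<Sum>u | u \<in> Poly_Mapping.keys Q \<and> weight u = j. ?L u ?X) - of_bool (j = Suc m) * symbol (Suc m) f ?X)"
    have "(\<Sum>j\<le>K. b j * t ^ j) = 0" for t
    proof -
      have scale: "symbol k g (mfun (t \<cdot>\<^sub>m M)) = t ^ k * symbol k g ?X" if "g \<in> fa ?B" for k g
        using symbol_cong[OF that, of "mfun (t \<cdot>\<^sub>m M)" "\<lambda>l. t * ?X l" k] mfun_smult[OF M]
        by (simp add: symbol_scale)
      have "prod_list (map (?c (mfun (t \<cdot>\<^sub>m M))) u) = t ^ sum_list u * prod_list (map (?c ?X) u)" for u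
        by (induction u) (simp_all add: scale capelli_fa power_add)
      then have "h (mfun (t \<cdot>\<^sub>m M)) = (\<Sum>u\<in>Poly_Mapping.keys Q. ?L u ?X * t ^ weight u)"
        unfolding h_def subst_def by (simp add: mult_ac)
      also have "\<dots> = (\<Sum>j\<le>K. \<Sum>u | u \<in> Poly_Mapping.keys Q \<and> weight u = j. ?L u ?X * t ^ weight u)"
        by (rule sum.group[symmetric]) (use K in auto)
      also have "\<dots> = (\<Sum>j\<le>K. (\<Sum>u | u \<in> Poly_Mapping.keys Q \<and> weight u = j. ?L u ?X) * t ^ j)"
        unfolding sum_distrib_right by (intro sum.cong refl) auto
      finally have 1: "h (mfun (t \<cdot>\<^sub>m M)) = (\<Sum>j\<le>K. (\<Sum>u | u \<in> Poly_Mapping.keys Q \<and> weight u = j. ?L u ?X) * t ^ j)" .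
      have "h (mfun (t \<cdot>\<^sub>m M)) = t ^ Suc m * symbol (Suc m) f ?X"
        using eq_mat[of "t \<cdot>\<^sub>m M"] M scale[OF ffa, of "Suc m"] by simp
      also have "\<dots> = (\<Sum>j\<le>K. if j = Suc m then symbol (Suc m) f ?X * t ^ j else 0)"
        using K(1) by simp
      also have "\<dots> = (\<Sum>j\<le>K. (of_bool (j = Suc m) * symbol (Suc m) f ?X) * t ^ j)"
        by (intro sum.cong refl) auto
      finally show ?thesis using 1 unfolding b_def left_diff_distrib sum_subtractf by simp
    qed
    then have "b (Suc m) = 0" by (rule poly_coeffs_zero) (rule K)
    then show ?thesis by (simp add: b_def)
  qed
  define R where "R = homog (Suc m) Q"
  have Rw: "weight u = Suc m" if "u \<in> Poly_Mapping.keys R" for u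
    using that by (simp add: R_def keys_homog)
  have R_FD: "evH n R \<in> FD ?B (Suc m)" by (rule evH_FD) (simp add: Rw)
  have sym_diff: "symbol (Suc m) (f - evH n R) X = 0" for X
  proof -
    define M where "M = mat n n (\<lambda>(i, j). X (Prop (Suc i), Prop (Suc j)))"
    have M: "M \<in> carrier_mat n n" by (simp add: M_def)
    have "symbol (Suc m) (f - evH n R) X = symbol (Suc m) (f - evH n R) (mfun M)"
    proof (rule symbol_cong)
      show "f - evH n R \<in> fa ?B" by (intro free_alg_closed ffa evH_fa)
      fix l assume "l \<in> ?B \<times> ?B"
      then obtain i j where "l = (Prop (Suc i), Prop (Suc j))" "i < n" "j < n"
        by (auto simp: proper_def) (metis Suc_pred' less_eq_Suc_le Suc_le_lessD)
      then show "X l = mfun M l" by (simp add: M_def)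
    qed
    also have "\<dots> = symbol (Suc m) f (mfun M) - symbol (Suc m) (evH n R) (mfun M)"
      by (rule symbol_diff)
    also have "symbol (Suc m) (evH n R) (mfun M) =
        (\<Sum>u | u \<in> Poly_Mapping.keys R \<and> weight u = Suc m. Poly_Mapping.lookup R u * prod_list (map (?c (mfun M)) (letters u)))"
      by (rule evH_symbol) (simp add: Rw)
    also have "\<dots> = (\<Sum>u | u \<in> Poly_Mapping.keys Q \<and> weight u = Suc m. ?L u (mfun M))"
      by (intro sum.cong) (auto simp: R_def keys_homog lookup_homog)
    finally show ?thesis using top[OF M] by simp
  qed
  have "lower ?B m (f - evH n R)"
    using symbol_zero_lower[OF FD_diff[OF Suc.prems(1) R_FD] sym_diff] by simp
  then obtain g where g: "g \<in> FD ?B m" "f - evH n R - g \<in> gl_ideal ?B"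
    by (auto simp: lower_def)
  have "cls ?B g = cls ?B (f + const (- 1) * evH n R)"
  proof -
    have "f - evH n R - g \<in> gl_ideal ?B \<longleftrightarrow> cls ?B (f - evH n R) = cls ?B g"
      by (rule cls_iff[symmetric]) (intro free_alg_closed ffa evH_fa FD_fa[OF g(1)])+
    then show ?thesis using g(2) by (simp add: const_hom)
  qed
  also have "\<dots> \<in> center (U ?B)"
    using Suc.prems(2) by (simp only: cls_ops ffa evH_fa free_alg_closed(3,5)) (intro center_closed center_const evH_central)
  finally have "cls ?B g \<in> center (U ?B)" .
  then obtain P where P: "P \<in> carrier (free_alg {1..min m n})" "\<forall>u\<in>Poly_Mapping.keys P. weight u \<le> m"
    "g - evH n P \<in> gl_ideal ?B"
    using Suc.IH[OF g(1)] by blast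
  show ?case
  proof (intro bexI[of _ "R + P"] conjI ballI)
    have "f - evH n (R + P) = (f - evH n R - g) + (g - evH n P)" by (simp add: evH_simps)
    then show "f - evH n (R + P) \<in> gl_ideal ?B" using gl_ideal_closed(3)[OF g(2) P(3)] by (simp only:)
    show "weight u \<le> Suc m" if "u \<in> Poly_Mapping.keys (R + P)" for u
      using that keys_add[of R P] Rw P(2) by fastforce
    show "R + P \<in> carrier (free_alg {1..min (Suc m) n})"
    proof (rule free_alg_closed(4))
      show "P \<in> carrier (free_alg {1..min (Suc m) n})"
      proof -
        have "{1..min m n} \<subseteq> {1..min (Suc m) n}" by auto
        from free_alg_mono[OF this] show ?thesis using P(1) by blast
      qed
      have "set (letters u) \<subseteq> {1..min (Suc m) n}" if u: "u \<in> Poly_Mapping.keys R" for u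
      proof
        fix k assume k: "k \<in> set (letters u)"
        have "set (letters u) \<subseteq> {1..n}" using u Qc by (simp add: R_def keys_homog free_alg_def)
        then have "k \<in> {1..n}" using k by blast
        moreover have "k \<le> Suc m" using Rw[OF u] member_le_sum_list[of k "letters u"] k by simp
        ultimately show "k \<in> {1..min (Suc m) n}" by auto
      qed
      then show "R \<in> carrier (free_alg {1..min (Suc m) n})" by (auto simp: free_alg_def)
    qed
  qed
qed

section \<open>The Capelli monomorphisms\<close>

lemma zeta_ops [simp]: "carrier (zeta n) = center (U (proper n))" "x \<otimes>\<^bsub>zeta n\<^esub> y = x \<otimes>\<^bsub>U (proper n)\<^esub> y"
  "x \<oplus>\<^bsub>zeta n\<^esub> y = x \<oplus>\<^bsub>U (proper n)\<^esub> y" "\<one>\<^bsub>zeta n\<^esub> = \<one>\<^bsub>U (proper n)\<^esub>"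
  by (simp_all add: zeta_def)

lemma fa_FD: "f \<in> fa A \<Longrightarrow> \<exists>m. f \<in> FD A m"
  by (rule exI[of _ "Max (insert 0 ((\<lambda>w. length (letters w)) ` Poly_Mapping.keys f))"])
     (auto simp: FD_def intro: Max_ge)

lemma center_evH:
  assumes "z \<in> center (U (proper n))"
  shows "\<exists>P\<in>carrier (free_alg {1..n}). z = cls (proper n) (evH n P)"
proof -
  obtain f where f: "f \<in> fa (proper n)" "z = cls (proper n) f"
    using assms by (auto simp: center_def U_carrier)
  obtain m where m: "f \<in> FD (proper n) m" using fa_FD[OF f(1)] by blast
  obtain P where P: "P \<in> carrier (free_alg {1..min m n})" "f - evH n P \<in> gl_ideal (proper n)"
    using center_generated[OF m] assms f(2) by blast
  have "P \<in> carrier (free_alg {1..n})" using P(1) free_alg_mono[of "{1..min m n}" "{1..n}"] by auto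
  moreover have "z = cls (proper n) (evH n P)" using f P(2) by (simp add: cls_iff evH_fa)
  ultimately show ?thesis by blast
qed

text \<open>Any map with the required properties is forced on polynomials in the Capelli elements,
  and these exhaust the center. Conversely, evaluating the same polynomial in size n + 1 defines
  such a map, by \<open>capelli_independent\<close>.\<close>

lemma capelli_mono_evH:
  assumes P: "P \<in> carrier (free_alg {1..n})"
  shows "capelli_mono n (cls (proper n) (evH n P)) = cls (proper (n + 1)) (evH (n + 1) P)"
proof -
  let ?B = "proper n" and ?B' = "proper (n + 1)"
  let ?spec = "\<lambda>\<phi>. \<phi> \<in> extensional (carrier (zeta n)) \<and> \<phi> \<in> Ring.ring_hom (zeta n) (zeta (n + 1)) \<and>
     (\<forall>c. \<forall>x\<in>carrier (zeta n). \<phi> (smul ?B c x) = smul ?B' c (\<phi> x)) \<and>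
     (\<forall>k\<in>{1..n}. \<phi> (capelli_H n k) = capelli_H (n + 1) k)"
  have hom_value: "\<phi> (cls ?B (evH n Q)) = cls ?B' (evH (n + 1) Q)"
    if \<phi>: "?spec \<phi>" and Q: "Q \<in> carrier (free_alg {1..n})" for \<phi> Q
  proof -
    have hom: "\<phi> \<in> Ring.ring_hom (zeta n) (zeta (n + 1))" using \<phi> by blast
    have word: "\<phi> (cls ?B (prod_list (map (capelli_tens n) u))) = cls ?B' (prod_list (map (capelli_tens (n + 1)) u))"
      if "set u \<subseteq> {1..n}" for u
      using that
    proof (induction u)
      case Nil
      then show ?case using Ring.ring_hom_one[OF hom] by (simp add: cls_one)
    next
      case (Cons k u)
      have "\<phi> (cls ?B (prod_list (map (capelli_tens n) (k # u)))) =
        \<phi> (cls ?B (capelli_tens n k) \<otimes>\<^bsub>zeta n\<^esub> cls ?B (prod_list (map (capelli_tens n) u)))"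
        by (simp add: cls_ops capelli_fa evH_word_fa)
      also have "\<dots> = \<phi> (cls ?B (capelli_tens n k)) \<otimes>\<^bsub>zeta (n + 1)\<^esub> \<phi> (cls ?B (prod_list (map (capelli_tens n) u)))"
        by (rule Ring.ring_hom_mult[OF hom]) (simp_all add: capelli_central evH_word_central)
      also have "\<dots> = cls ?B' (capelli_tens (n + 1) k) \<otimes>\<^bsub>U ?B'\<^esub> cls ?B' (prod_list (map (capelli_tens (n + 1)) u))"
        using Cons \<phi> by (simp add: capelli_H_eq)
      finally show ?case using cls_ops(2)[OF capelli_fa evH_word_fa, of "n + 1" k u] by simp
    qed
    let ?T = "\<lambda>n u. const (Poly_Mapping.lookup Q u) * prod_list (map (capelli_tens n) (letters u))"
    have Tfa: "?T n u \<in> fa (proper n)" for n u by (intro free_alg_closed evH_word_fa)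
    have Tc: "cls (proper n) (?T n u) \<in> center (U (proper n))" for n u
      by (simp add: cls_ops free_alg_closed evH_word_fa center_closed center_const evH_word_central)
    have term_val: "\<phi> (cls ?B (?T n u)) = cls ?B' (?T (n + 1) u)" if u: "u \<in> Poly_Mapping.keys Q" for u
    proof -
      have "set (letters u) \<subseteq> {1..n}" using u Q by (auto simp: free_alg_def)
      moreover have "\<phi> (smul ?B (Poly_Mapping.lookup Q u) (cls ?B (prod_list (map (capelli_tens n) (letters u))))) =
          smul ?B' (Poly_Mapping.lookup Q u) (\<phi> (cls ?B (prod_list (map (capelli_tens n) (letters u)))))"
        using \<phi> evH_word_central by simp
      ultimately show ?thesis using word by (simp add: smul_cls evH_word_fa)
    qed
    have "\<phi> (cls ?B (\<Sum>u\<in>A. ?T n u)) = cls ?B' (\<Sum>u\<in>A. ?T (n + 1) u)"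
      if "finite A" "A \<subseteq> Poly_Mapping.keys Q" for A
      using that
    proof (induction A)
      case empty
      \<comment> \<open>The value at zero is obtained from the scalar 0, as \<open>ring_hom\<close>
        prescribes only sums, products and one.\<close>
      have "\<phi> (smul ?B 0 (cls ?B 1)) = smul ?B' 0 (\<phi> (cls ?B 1))"
        using \<phi> center_const[of ?B 1] by (simp add: const_hom)
      moreover have "\<phi> (cls ?B 1) = cls ?B' 1"
        using Ring.ring_hom_one[OF hom] by (simp add: cls_one)
      ultimately show ?case by (simp add: smul_cls free_alg_closed const_hom)
    next
      case (insert u A)
      have "\<phi> (cls ?B (\<Sum>u\<in>insert u A. ?T n u)) = \<phi> (cls ?B (?T n u) \<oplus>\<^bsub>zeta n\<^esub> cls ?B (\<Sum>u\<in>A. ?T n u))"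
        using insert.hyps by (simp add: cls_ops(1) Tfa free_alg_sum)
      also have "\<dots> = \<phi> (cls ?B (?T n u)) \<oplus>\<^bsub>zeta (n + 1)\<^esub> \<phi> (cls ?B (\<Sum>u\<in>A. ?T n u))"
        by (rule Ring.ring_hom_add[OF hom]) (use Tc Tfa in \<open>auto intro: center_sum\<close>)
      also have "\<dots> = cls ?B' (?T (n + 1) u) \<oplus>\<^bsub>U ?B'\<^esub> cls ?B' (\<Sum>u\<in>A. ?T (n + 1) u)"
        using insert term_val by simp
      also have "\<dots> = cls ?B' (\<Sum>u\<in>insert u A. ?T (n + 1) u)"
      proof -
        have "(\<Sum>u\<in>A. ?T (n + 1) u) \<in> fa ?B'" by (rule free_alg_sum) (rule Tfa)
        then show ?thesis using insert.hyps cls_ops(1)[OF Tfa] by simp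
      qed
      finally show ?case .
    qed
    from this[OF finite_keys subset_refl] show ?thesis by (simp only: evH_expand)
  qed
  define \<psi> where "\<psi> = (\<lambda>z. SOME P. P \<in> carrier (free_alg {1..n}) \<and> z = cls ?B (evH n P))"
  have \<psi>: "\<psi> z \<in> carrier (free_alg {1..n})" "z = cls ?B (evH n (\<psi> z))" if "z \<in> center (U ?B)" for z
  proof -
    have "\<exists>P. P \<in> carrier (free_alg {1..n}) \<and> z = cls ?B (evH n P)" using center_evH[OF that] by blast
    from someI_ex[OF this] show "\<psi> z \<in> carrier (free_alg {1..n})" "z = cls ?B (evH n (\<psi> z))"
      by (auto simp: \<psi>_def)
  qed
  \<comment> \<open>A polynomial is chosen for each central element; by the next step the choice
    does not affect the value.\<close>
  define \<phi>0 where "\<phi>0 = restrict (\<lambda>z. cls ?B' (evH (n + 1) (\<psi> z))) (center (U ?B))"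
  have \<phi>0: "\<phi>0 (cls ?B (evH n Q)) = cls ?B' (evH (n + 1) Q)" if Q: "Q \<in> carrier (free_alg {1..n})" for Q
  proof -
    let ?z = "cls ?B (evH n Q)"
    have z: "?z \<in> center (U ?B)" by (rule evH_central)
    have "cls ?B (evH n (\<psi> ?z)) = cls ?B (evH n Q)" using \<psi>(2)[OF z] by (rule sym)
    then have "evH n (\<psi> ?z - Q) \<in> gl_ideal ?B"
      by (simp only: cls_iff[OF evH_fa evH_fa] evH_simps(5))
    then have "evH (n + 1) (\<psi> ?z - Q) \<in> gl_ideal ?B'"
      by (rule capelli_independent[OF free_alg_closed(6)[OF \<psi>(1)[OF z] Q]])
    then have "cls ?B' (evH (n + 1) (\<psi> ?z)) = cls ?B' (evH (n + 1) Q)"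
      by (simp only: cls_iff[OF evH_fa evH_fa] evH_simps(5))
    then show ?thesis unfolding \<phi>0_def restrict_apply'[OF z] .
  qed
  have spec0: "?spec \<phi>0"
  proof (intro conjI ballI allI)
    show "\<phi>0 \<in> extensional (carrier (zeta n))" by (simp add: \<phi>0_def)
    show "\<phi>0 \<in> Ring.ring_hom (zeta n) (zeta (n + 1))"
    proof (rule Ring.ring_hom_memI)
      fix x assume x: "x \<in> carrier (zeta n)"
      then obtain Px where Px: "Px \<in> carrier (free_alg {1..n})" "x = cls ?B (evH n Px)"
        using center_evH by auto
      show "\<phi>0 x \<in> carrier (zeta (n + 1))" using \<phi>0[OF Px(1)] Px(2) evH_central by simp
      fix y assume y: "y \<in> carrier (zeta n)"
      then obtain Py where Py: "Py \<in> carrier (free_alg {1..n})" "y = cls ?B (evH n Py)"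
        using center_evH by auto
      have "x \<otimes>\<^bsub>zeta n\<^esub> y = cls ?B (evH n (Px * Py))"
        using Px Py by (simp add: evH_simps cls_ops evH_fa)
      then show "\<phi>0 (x \<otimes>\<^bsub>zeta n\<^esub> y) = \<phi>0 x \<otimes>\<^bsub>zeta (n + 1)\<^esub> \<phi>0 y"
        using \<phi>0[OF Px(1)] \<phi>0[OF Py(1)] \<phi>0[OF free_alg_closed(5)[OF Px(1) Py(1)]] Px Py cls_ops(2)[OF evH_fa evH_fa, of "n + 1" Px Py]
        by (simp add: evH_simps)
      have "x \<oplus>\<^bsub>zeta n\<^esub> y = cls ?B (evH n (Px + Py))"
        using Px Py by (simp add: evH_simps cls_ops evH_fa)
      then show "\<phi>0 (x \<oplus>\<^bsub>zeta n\<^esub> y) = \<phi>0 x \<oplus>\<^bsub>zeta (n + 1)\<^esub> \<phi>0 y"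
        using \<phi>0[OF Px(1)] \<phi>0[OF Py(1)] \<phi>0[OF free_alg_closed(4)[OF Px(1) Py(1)]] Px Py cls_ops(1)[OF evH_fa evH_fa, of "n + 1" Px Py]
        by (simp add: evH_simps)
    next
      show "\<phi>0 \<one>\<^bsub>zeta n\<^esub> = \<one>\<^bsub>zeta (n + 1)\<^esub>"
        using \<phi>0[OF free_alg_closed(2)] by (simp add: evH_simps cls_one)
    qed
    show "\<phi>0 (smul ?B c x) = smul ?B' c (\<phi>0 x)" if x: "x \<in> carrier (zeta n)" for c x
    proof -
      obtain Px where Px: "Px \<in> carrier (free_alg {1..n})" "x = cls ?B (evH n Px)"
        using x center_evH by auto
      have "smul ?B c x = cls ?B (evH n (const c * Px))"
        using Px by (simp add: evH_simps smul_cls evH_fa)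
      then show ?thesis
        using \<phi>0[OF Px(1)] \<phi>0[OF free_alg_closed(5)[OF free_alg_closed(3) Px(1)]] Px smul_cls[OF evH_fa, of "n + 1" c Px]
        by (simp add: evH_simps)
    qed
    show "\<phi>0 (capelli_H n k) = capelli_H (n + 1) k" if k: "k \<in> {1..n}" for k
    proof -
      have "word [k] \<in> carrier (free_alg {1..n})" using k by (intro free_alg_closed) auto
      from \<phi>0[OF this] show ?thesis by (simp add: evH_simps capelli_H_eq)
    qed
  qed
  have "capelli_mono n = \<phi>0"
    unfolding capelli_mono_def
  proof (rule the_equality)
    show "?spec \<phi>0" by (rule spec0)
    fix \<phi> assume \<phi>: "?spec \<phi>"
    show "\<phi> = \<phi>0"
    proof
      fix z
      show "\<phi> z = \<phi>0 z"
      proof (cases "z \<in> center (U ?B)")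
        case True
        then obtain Q where "Q \<in> carrier (free_alg {1..n})" "z = cls ?B (evH n Q)"
          using center_evH by blast
        then show ?thesis using hom_value[OF \<phi>] \<phi>0 by simp
      next
        case False
        moreover have "\<phi> \<in> extensional (center (U ?B))" using \<phi> by simp
        ultimately show ?thesis by (simp add: extensional_def \<phi>0_def)
      qed
    qed
  qed
  then show ?thesis using \<phi>0[OF P] by simp
qed

section \<open>The Olshanski projection\<close>

text \<open>The vector of \<open>u\<close> has row symbols in \<open>proper n\<close> only, so there
  is no \<gamma> for e_{a,\<gamma>} to act on.\<close>

lemma vac_gen_kill:
  assumes "u \<in> fa (proper n)" "\<gamma> \<notin> proper n"
  shows "vac n (gen a \<gamma> * u) = (\<lambda>w. 0)"
proof -
  have "vac n (word ((a, \<gamma>) # letters v)) = (\<lambda>w. 0)" if "v \<in> Poly_Mapping.keys u" for v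
  proof -
    have "set (letters v) \<subseteq> proper n \<times> proper n" using that assms(1) by (auto simp: fa_iff)
    then have "count_list (map fst (letters v)) \<gamma> = 0"
      using assms(2) by (intro count_notin) auto
    then show ?thesis using vac_irregular[OF assms(2), where u = "[]" and a = a and b = \<gamma> and v = "letters v"] by simp
  qed
  then show ?thesis by (simp add: gen_word word_mult_expand vac_simps)
qed

lemma proper_Suc: "proper n \<subseteq> proper (n + 1)" "Prop (n + 1) \<notin> proper n"
  by (auto simp: proper_def)

lemma vac_act_cong: "vac n g = vac n h \<Longrightarrow> vac n (f * g) = vac n (f * h)"
  by (simp add: vac_mult)

text \<open>In an increasing sequence n + 1 can only come last, and the last column stands rightmost
  in a column determinant. Each product for such a sequence thus ends in some e_{i,n+1}, which
  annihilates vectors coming from U(gl(n)).\<close>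

lemma capelli_restrict:
  assumes u: "u \<in> fa (proper n)"
  shows "vac n (capelli_tens (n + 1) k * u) = vac n (capelli_tens n k * u)"
proof -
  let ?D = "\<lambda>is. cdet k (\<lambda>a b. gen (Prop (is ! (a - 1))) (Prop (is ! (b - 1))) + of_bool (a = b) * of_nat (k - a)) :: tens"
  have zero: "vac n (?D is * u) = (\<lambda>w. 0)" if "is": "is \<in> incs (n + 1) k - incs n k" for "is"
  proof -
    have len: "length is = k" and sorted: "sorted_wrt (<) is" and set: "set is \<subseteq> {1..n + 1}"
      using "is" by (auto simp: incs_def)
    have "n + 1 \<in> set is"
    proof (rule ccontr)
      assume "n + 1 \<notin> set is"
      then have "set is \<subseteq> {1..n}" using set by (auto simp: subset_iff le_Suc_eq)
      then show False using "is" len sorted by (simp add: incs_def)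
    qed
    then obtain p where p: "p < k" "is ! p = n + 1" using len by (auto simp: in_set_conv_nth)
    then have k: "k \<ge> 1" by simp
    have last: "is ! (k - 1) = n + 1"
    proof (rule ccontr)
      assume ne: "is ! (k - 1) \<noteq> n + 1"
      then have "p < k - 1" using p by (cases "p = k - 1") auto
      then have "is ! p < is ! (k - 1)" using sorted len by (intro sorted_wrt_nth_less[of "(<)"]) auto
      moreover have "is ! (k - 1) \<le> n + 1" using set len k nth_mem[of "k - 1" "is"] by fastforce
      ultimately show False using p by simp
    qed
    let ?M = "\<lambda>a b. gen (Prop (is ! (a - 1))) (Prop (is ! (b - 1))) + of_bool (a = b) * of_nat (k - a) :: tens"
    have "vac n (prod_list (map (\<lambda>j. ?M (\<sigma> j) j) [1..<Suc k]) * u) = (\<lambda>w. 0)" for \<sigma>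
    proof -
      \<comment> \<open>The shift appears only for \<sigma> k = k, where it is k - k = 0.\<close>
      have "?M (\<sigma> k) k = gen (Prop (is ! (\<sigma> k - 1))) (Prop (n + 1))" using last by simp
      moreover have "[1..<Suc k] = [1..<k] @ [k]" using k by simp
      ultimately have "prod_list (map (\<lambda>j. ?M (\<sigma> j) j) [1..<Suc k]) * u =
        prod_list (map (\<lambda>j. ?M (\<sigma> j) j) [1..<k]) * (gen (Prop (is ! (\<sigma> k - 1))) (Prop (n + 1)) * u)"
        by (simp only: map_append prod_list.append list.map prod_list.Cons prod_list.Nil mult.assoc mult_1_right mult_1_left)
      then show ?thesis using vac_gen_kill[OF u proper_Suc(2)] by (simp only: vac_mult[of n "prod_list _"] app_zero)
    qed
    then show ?thesis
      unfolding cdet_def sum_distrib_right mult.assoc vac_simps vac_mult[of n "of_int _"]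
      by (simp add: app_zero)
  qed
  have split: "(\<Sum>is\<in>incs (n + 1) k. ?D is * u) = (\<Sum>is\<in>incs (n + 1) k - incs n k. ?D is * u) + (\<Sum>is\<in>incs n k. ?D is * u)"
    by (rule sum.subset_diff[OF _ finite_incs]) (auto simp: incs_def)
  have "vac n (capelli_tens (n + 1) k * u) =
    vac n ((\<Sum>is\<in>incs (n + 1) k - incs n k. ?D is * u) + (\<Sum>is\<in>incs n k. ?D is * u))"
    unfolding capelli_tens_def sum_distrib_right split ..
  also have "\<dots> = vac n (\<Sum>is\<in>incs n k. ?D is * u)"
    using zero by (simp add: vac_simps)
  finally show ?thesis by (simp only: capelli_tens_def sum_distrib_right)
qed

text \<open>From the right, factor by factor: once the tail is replaced by its counterpart for n it
  lies in U(gl(n)), and \<open>capelli_restrict\<close> handles the next factor.\<close>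

lemma evH_restrict: "vac n (evH (n + 1) P) = vac n (evH n P)"
proof -
  have word: "vac n (prod_list (map (capelli_tens (n + 1)) u)) = vac n (prod_list (map (capelli_tens n) u))" for u
  proof (induction u)
    case (Cons k u)
    have "vac n (prod_list (map (capelli_tens (n + 1)) (k # u))) =
      vac n (capelli_tens (n + 1) k * prod_list (map (capelli_tens n) u))"
      using vac_act_cong[OF Cons] by simp
    also have "\<dots> = vac n (capelli_tens n k * prod_list (map (capelli_tens n) u))"
      by (rule capelli_restrict[OF evH_word_fa])
    finally show ?case by simp
  qed simp
  show ?thesis unfolding evH_expand vac_simps using word by simp
qed

text \<open>On U(gl(n+1)) the map \<open>vac n\<close> has a kernel, so the equality alone does not
  determine \<open>e\<close>. Centrality and degree do: they write \<open>e\<close> as a polynomial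
  in the first n Capelli elements, and \<open>vac n\<close> identifies the same polynomial for size
  n with \<open>e0\<close>.\<close>

theorem capelli_mono_stable:
  assumes e: "e \<in> FD (proper (n + 1)) M" "cls (proper (n + 1)) e \<in> center (U (proper (n + 1)))"
    and M: "M \<le> n" and e0: "e0 \<in> fa (proper n)" and eq: "vac n e = vac n e0"
  shows "capelli_mono n (cls (proper n) e0) = cls (proper (n + 1)) e"
proof -
  obtain P where P: "P \<in> carrier (free_alg {1..min M (n + 1)})" "e - evH (n + 1) P \<in> gl_ideal (proper (n + 1))"
    using center_generated[OF e] by blast
  have "{1..min M (n + 1)} \<subseteq> {1..n}" using M by auto
  from free_alg_mono[OF this] have Pn: "P \<in> carrier (free_alg {1..n})" using P(1) by blast
  have "vac n e = vac n (evH (n + 1) P)"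
    using vac_gl_ideal[OF P(2), of n] by (simp add: vac_simps fun_eq_iff)
  then have "vac n e0 = vac n (evH n P)" using eq evH_restrict by simp
  then have "cls (proper n) e0 = cls (proper n) (evH n P)"
    using cls_eq_iff_vac[OF e0 evH_fa] by blast
  moreover have "cls (proper (n + 1)) e = cls (proper (n + 1)) (evH (n + 1) P)"
    using P(2) cls_iff[OF FD_fa[OF e(1)] evH_fa] by blast
  ultimately show ?thesis using capelli_mono_evH[OF Pn] by simp
qed

section \<open>Central elements from virtual bilinear words\<close>

text \<open>A pair (s, c) is an entry together with its colour, the virtual symbol in the same cell.
  It contributes e_{s,c} to the left block and e_{c,s} to the right block, both in the order of the
  list.\<close>

definition Xw :: "(nat \<times> symb) list \<Rightarrow> letter list" where
  "Xw zs = map (\<lambda>(s, c). (Prop s, c)) zs"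

definition Yw :: "(nat \<times> symb) list \<Rightarrow> letter list" where
  "Yw zs = map (\<lambda>(s, c). (c, Prop s)) zs"

definition OX :: "nat \<Rightarrow> (nat \<times> symb) list \<Rightarrow> letter lop" where
  "OX n zs = prod_list (map (\<lambda>(s, c). AA n (Prop s) c) zs)"

definition OY :: "nat \<Rightarrow> (nat \<times> symb) list \<Rightarrow> letter lop" where
  "OY n zs = prod_list (map (\<lambda>(s, c). AA n c (Prop s)) zs)"

definition XZY :: "nat \<Rightarrow> letter list \<Rightarrow> (nat \<times> symb) list \<Rightarrow> letter vec" where
  "XZY n z0 zs = vac n (word (Xw zs @ z0 @ Yw zs))"

lemma act_Xw: "act n (word (Xw zs)) = OX n zs"
  unfolding act_simps Xw_def OX_def map_map by (intro arg_cong[where f = prod_list] map_cong) auto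

lemma act_Yw: "act n (word (Yw zs)) = OY n zs"
  unfolding act_simps Yw_def OY_def map_map by (intro arg_cong[where f = prod_list] map_cong) auto

lemma XZY_app: "XZY n z0 zs = app (OX n zs * (act n (word z0) * OY n zs)) vac0"
  by (simp add: XZY_def word_append vac_mult act_Xw act_Yw vac_def act_simps(6))

lemma OX_simps: "OX n [] = 1" "OX n ((s, c) # zs) = AA n (Prop s) c * OX n zs"
  "OX n (zs @ zs') = OX n zs * OX n zs'"
  by (simp_all add: OX_def)

lemma OY_simps: "OY n [] = 1" "OY n ((s, c) # zs) = AA n c (Prop s) * OY n zs"
  "OY n (zs @ zs') = OY n zs * OY n zs'"
  by (simp_all add: OY_def)

lemma virtual_neq_Prop: "virtual c \<Longrightarrow> c \<noteq> Prop s"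
  by (auto simp: virtual_def)

lemma comm_OX:
  assumes "length s = length c" "\<forall>\<gamma>\<in>set c. virtual \<gamma>"
  shows "AA n (Prop i) (Prop j) * OX n (zip s c) = OX n (zip s c) * AA n (Prop i) (Prop j)
    + (\<Sum>p<length c. of_bool (s ! p = j) * OX n (zip (s[p := i]) c))"
  using assms
proof (induction s c rule: list_induct2)
  case (Cons x s \<gamma> c)
  have \<gamma>: "virtual \<gamma>" using Cons.prems by simp
  let ?A = "AA n (Prop i) (Prop j)"
  have comm: "?A * AA n (Prop x) \<gamma> = AA n (Prop x) \<gamma> * ?A + of_bool (x = j) * AA n (Prop i) \<gamma>"
    using AA_AA[of n "Prop i" "Prop j" "Prop x" \<gamma>] \<gamma>
    by (cases "x = j") (auto simp: sg_even virtual_neq_Prop[OF \<gamma>, symmetric])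
  have "?A * OX n (zip (x # s) (\<gamma> # c)) = AA n (Prop x) \<gamma> * (?A * OX n (zip s c))
      + of_bool (x = j) * OX n (zip (i # s) (\<gamma> # c))"
    using comm by (simp add: OX_simps distrib_right flip: mult.assoc)
  also have "?A * OX n (zip s c) = OX n (zip s c) * ?A
    + (\<Sum>p<length c. of_bool (s ! p = j) * OX n (zip (s[p := i]) c))"
    using Cons by simp
  also have "AA n (Prop x) \<gamma> * (OX n (zip s c) * ?A
    + (\<Sum>p<length c. of_bool (s ! p = j) * OX n (zip (s[p := i]) c))) =
    OX n (zip (x # s) (\<gamma> # c)) * ?A + (\<Sum>p<length c. of_bool (s ! p = j) * OX n (zip ((x # s)[Suc p := i]) (\<gamma> # c)))"
    by (simp add: distrib_left sum_distrib_left of_bool_comm OX_simps mult.assoc)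
  finally show ?case
    by (simp only: list.size sum.lessThan_Suc_shift nth_Cons_0 nth_Cons_Suc list_update_code add_0_right
        add_Suc_right) (simp add: algebra_simps)
qed (simp add: OX_simps)

lemma comm_OY:
  assumes "length s = length c" "\<forall>\<gamma>\<in>set c. virtual \<gamma>"
  shows "AA n (Prop i) (Prop j) * OY n (zip s c) = OY n (zip s c) * AA n (Prop i) (Prop j)
    - (\<Sum>p<length c. of_bool (s ! p = i) * OY n (zip (s[p := j]) c))"
  using assms
proof (induction s c rule: list_induct2)
  case (Cons x s \<gamma> c)
  have \<gamma>: "virtual \<gamma>" using Cons.prems by simp
  let ?A = "AA n (Prop i) (Prop j)"
  have comm: "?A * AA n \<gamma> (Prop x) = AA n \<gamma> (Prop x) * ?A - of_bool (x = i) * AA n \<gamma> (Prop j)"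
    using AA_AA[of n "Prop i" "Prop j" \<gamma> "Prop x"] \<gamma>
    by (cases "x = i") (auto simp: sg_even virtual_neq_Prop[OF \<gamma>, symmetric])
  have "?A * OY n (zip (x # s) (\<gamma> # c)) = AA n \<gamma> (Prop x) * (?A * OY n (zip s c))
      - of_bool (x = i) * OY n (zip (j # s) (\<gamma> # c))"
    using comm by (simp add: OY_simps left_diff_distrib flip: mult.assoc)
  also have "?A * OY n (zip s c) = OY n (zip s c) * ?A
    - (\<Sum>p<length c. of_bool (s ! p = i) * OY n (zip (s[p := j]) c))"
    using Cons by simp
  also have "AA n \<gamma> (Prop x) * (OY n (zip s c) * ?A
    - (\<Sum>p<length c. of_bool (s ! p = i) * OY n (zip (s[p := j]) c))) =
    OY n (zip (x # s) (\<gamma> # c)) * ?A - (\<Sum>p<length c. of_bool (s ! p = i) * OY n (zip ((x # s)[Suc p := j]) (\<gamma> # c)))"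
    by (simp add: right_diff_distrib sum_distrib_left of_bool_comm OY_simps mult.assoc)
  finally show ?case
    by (simp only: list.size sum.lessThan_Suc_shift nth_Cons_0 nth_Cons_Suc list_update_code add_0_right
        add_Suc_right) (simp add: algebra_simps)
qed (simp add: OY_simps)

lemma comm_virtual_word:
  assumes "\<forall>l\<in>set z0. virtual (fst l) \<and> virtual (snd l)"
  shows "AA n (Prop i) (Prop j) * act n (word z0) = act n (word z0) * AA n (Prop i) (Prop j)"
  using assms
proof (induction z0)
  case (Cons l z0)
  obtain a b where l: "l = (a, b)" "virtual a" "virtual b" using Cons.prems by (cases l) auto
  let ?A = "AA n (Prop i) (Prop j)"
  have comm: "?A * AA n a b = AA n a b * ?A"
    using AA_AA[of n "Prop i" "Prop j" a b] l
    by (auto simp: sg_even virtual_neq_Prop[symmetric])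
  have "act n (word (l # z0)) = AA n a b * act n (word z0)" by (simp add: act_simps l)
  then show ?case using Cons comm by (metis list.set_intros(2) mult.assoc)
qed (simp add: act_simps)

text \<open>
  Commuting \<open>e\<^bsub>i,j\<^esub>\<close> through a word changes a \<open>j\<close> into an \<open>i\<close> on the left of \<open>z0\<close>, or, with the opposite sign,
  an \<open>i\<close> into a \<open>j\<close> on the right; in the sum over all fillings \<open>s\<close> the two kinds of terms cancel.
\<close>

lemma inv_vec_XZY:
  assumes c: "\<forall>\<gamma>\<in>set c. virtual \<gamma>" and z0: "\<forall>l\<in>set z0. virtual (fst l) \<and> virtual (snd l)"
  shows "inv_vec n (\<lambda>w. \<Sum>s\<in>seqs n (length c). XZY n z0 (zip s c) w)"
  unfolding inv_vec_def
proof (intro ballI ext)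
  fix i' j' w assume i'j': "i' \<in> proper n" "j' \<in> proper n"
  then obtain i j where ij: "i' = Prop i" "j' = Prop j" "i \<in> {1..n}" "j \<in> {1..n}"
    by (auto simp: proper_def)
  let ?M = "length c" and ?A = "AA n i' j'" and ?Z = "act n (word z0)"
  define F where "F = (\<lambda>u t. app (OX n (zip u c) * (?Z * OY n (zip t c))) vac0 w)"
  let ?E = "\<lambda>s. OX n (zip s c) * (?Z * OY n (zip s c))"
  define R where "R = RR i' j' + SS (i', j')"
  have RE: "R * ?E s = ?E s * R" for s
    using act_RR[OF i'j', of "word (Xw (zip s c) @ z0 @ Yw (zip s c))"]
    by (simp only: R_def word_append act_simps(6) act_Xw act_Yw)
  \<comment> \<open>Left and right multiplication by e_{i,j} agree on the vacuum. So
    \<open>?A\<close>, once moved to the right end, becomes \<open>R\<close>, which returns to the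
    left end without correction terms.\<close>
  have Rvac: "app ?A vac0 = app R vac0"
    using i'j' by (simp add: R_def AA_def DD.rep_eq RR.rep_eq Dfun_vac0 Rfun_vac0)
  have AE: "app (?A * ?E s) vac0 w = app (R * ?E s) vac0 w
      + (\<Sum>p<?M. of_bool (s ! p = j) * F (s[p := i]) s) - (\<Sum>p<?M. of_bool (s ! p = i) * F s (s[p := j]))"
    if s: "s \<in> seqs n ?M" for s
  proof -
    have len: "length s = length c" using s by (rule seqs_length)
    let ?X = "OX n (zip s c)" and ?Y = "OY n (zip s c)"
    have "?A * ?E s = (?A * ?X) * (?Z * ?Y)" by (simp only: mult.assoc)
    also have "\<dots> = ?X * (?A * (?Z * ?Y)) + (\<Sum>p<?M. of_bool (s ! p = j) * OX n (zip (s[p := i]) c)) * (?Z * ?Y)"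
      unfolding ij(1,2) comm_OX[OF len c] by (simp only: distrib_right mult.assoc)
    also have "?A * (?Z * ?Y) = ?Z * (?A * ?Y)"
      unfolding ij(1,2) using comm_virtual_word[OF z0] by (metis mult.assoc)
    also have "?A * ?Y = ?Y * ?A - (\<Sum>p<?M. of_bool (s ! p = i) * OY n (zip (s[p := j]) c))"
      unfolding ij(1,2) by (rule comm_OY[OF len c])
    finally have "?A * ?E s = ?E s * ?A
        - (\<Sum>p<?M. of_bool (s ! p = i) * (?X * (?Z * OY n (zip (s[p := j]) c))))
        + (\<Sum>p<?M. of_bool (s ! p = j) * (OX n (zip (s[p := i]) c) * (?Z * ?Y)))"
      by (simp only: right_diff_distrib sum_distrib_left sum_distrib_right of_bool_comm mult.assoc)
    moreover have ob: "app (of_bool P * T) vac0 w = of_bool P * app T vac0 w" for P T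
      by (cases P) simp_all
    ultimately have "app (?A * ?E s) vac0 w = app (?E s * ?A) vac0 w
        - (\<Sum>p<?M. of_bool (s ! p = i) * F s (s[p := j])) + (\<Sum>p<?M. of_bool (s ! p = j) * F (s[p := i]) s)"
      by (simp only: app_simps(3,4) app_sum_op ob F_def)
    moreover have "app (?E s * ?A) vac0 = app (R * ?E s) vac0"
      unfolding RE app_simps(6)[of "?E s"] Rvac ..
    ultimately show ?thesis by simp
  qed
  have "(\<Sum>s\<in>seqs n ?M. app (?A * ?E s) vac0 w) = (\<Sum>s\<in>seqs n ?M. app (R * ?E s) vac0 w)
     + (\<Sum>s\<in>seqs n ?M. \<Sum>p<?M. of_bool (s ! p = j) * F (s[p := i]) s)
     - (\<Sum>s\<in>seqs n ?M. \<Sum>p<?M. of_bool (s ! p = i) * F s (s[p := j]))"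
    unfolding sum.distrib[symmetric] sum_subtractf[symmetric] by (intro sum.cong refl AE)
  then have AR: "(\<Sum>s\<in>seqs n ?M. app (?A * ?E s) vac0 w) = (\<Sum>s\<in>seqs n ?M. app (R * ?E s) vac0 w)"
    using seqs_reindex[OF ij(3,4), where F = F and k = ?M] by simp
  let ?v = "\<lambda>w. \<Sum>s\<in>seqs n ?M. XZY n z0 (zip s c) w"
  have appv: "app T ?v w = (\<Sum>s\<in>seqs n ?M. app (T * ?E s) vac0 w)" for T
    unfolding XZY_app app_sum by (simp only: app_simps(6))
  have "app ?A ?v w = app R ?v w" unfolding appv AR ..
  then have "app (DD i' j') ?v w = app (RR i' j') ?v w"
    using i'j' by (simp add: R_def AA_def)
  then show "Dfun i' j' ?v w = Rfun i' j' ?v w" by (simp only: DD.rep_eq RR.rep_eq)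
qed

definition signed_eq :: "nat \<Rightarrow> (nat \<times> symb) list \<Rightarrow> (nat \<times> symb) list \<Rightarrow> bool" where
  "signed_eq n zs zs' \<longleftrightarrow> (OX n zs = OX n zs' \<and> OY n zs = OY n zs') \<or> (OX n zs = - OX n zs' \<and> OY n zs = - OY n zs')"

lemma signed_eq_XZY: "signed_eq n zs zs' \<Longrightarrow> XZY n z0 zs = XZY n z0 zs'"
proof -
  assume a: "signed_eq n zs zs'"
  have "OX n zs * (act n (word z0) * OY n zs) = OX n zs' * (act n (word z0) * OY n zs')"
    using a unfolding signed_eq_def
  proof
    assume "OX n zs = - OX n zs' \<and> OY n zs = - OY n zs'"
    then show ?thesis by (simp only: mult_minus_left mult_minus_right minus_minus)
  qed simp
  then show ?thesis by (simp only: XZY_app)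
qed

lemma signed_eq_trans: "signed_eq n x y \<Longrightarrow> signed_eq n y z \<Longrightarrow> signed_eq n x z"
  by (auto simp: signed_eq_def)

lemma signed_eq_append: "signed_eq n x y \<Longrightarrow> signed_eq n (a @ x @ b) (a @ y @ b)"
  by (auto simp: signed_eq_def OX_simps OY_simps)

text \<open>The brackets vanish because a virtual symbol differs from a proper one, and e_{s,c} has
  the parity of e_{c,s}; so both blocks acquire the same sign.\<close>

lemma signed_eq_swap:
  assumes "virtual (snd x)" "virtual (snd y)"
  shows "signed_eq n [x, y] [y, x]"
proof -
  obtain s c t d where xy: "x = (s, c)" "y = (t, d)" by (cases x; cases y)
  have v: "virtual c" "virtual d" using assms xy by auto
  have X: "AA n (Prop s) c * AA n (Prop t) d = sg (1 + parity c) (1 + parity d) * AA n (Prop t) d * AA n (Prop s) c"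
    using AA_AA[of n "Prop s" c "Prop t" d] v by (simp add: virtual_neq_Prop virtual_neq_Prop[symmetric])
  have Y: "AA n c (Prop s) * AA n d (Prop t) = sg (1 + parity c) (1 + parity d) * AA n d (Prop t) * AA n c (Prop s)"
    using AA_AA[of n c "Prop s" d "Prop t"] v by (simp add: virtual_neq_Prop virtual_neq_Prop[symmetric])
  show ?thesis
    using X Y sg_cases[of "1 + parity c" "1 + parity d"] unfolding signed_eq_def xy
    by (auto simp: OX_simps OY_simps)
qed

lemma signed_eq_move_front:
  assumes "\<forall>z\<in>set (p @ x # q). virtual (snd z)"
  shows "signed_eq n (p @ x # q) (x # p @ q)"
  using assms
proof (induction p arbitrary: q rule: rev_induct)
  case (snoc y p)
  have "signed_eq n (p @ [y, x] @ q) (p @ [x, y] @ q)"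
    using snoc.prems by (intro signed_eq_append signed_eq_swap) auto
  moreover have "signed_eq n (p @ x # y # q) (x # p @ y # q)" using snoc by simp
  ultimately show ?case using signed_eq_trans by simp
qed (simp add: signed_eq_def)

lemma signed_eq_perm:
  assumes "mset zs = mset zs'" "\<forall>z\<in>set zs. virtual (snd z)"
  shows "signed_eq n zs zs'"
  using assms
proof (induction zs arbitrary: zs')
  case (Cons x zs)
  have "x \<in> set zs'" using Cons.prems(1) by (metis list.set_intros(1) set_mset_mset)
  then obtain p q where zs': "zs' = p @ x # q" by (meson split_list)
  have "mset zs = mset (p @ q)" using Cons.prems(1) zs' by simp
  then have "signed_eq n zs (p @ q)" using Cons by simp
  then have 1: "signed_eq n (x # zs) (x # p @ q)" using signed_eq_append[of n zs "p @ q" "[x]" "[]"] by simp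
  have "set (p @ x # q) = set (x # zs)" using Cons.prems(1) zs' by (metis set_mset_mset)
  then have "signed_eq n (p @ x # q) (x # p @ q)" using Cons.prems(2) by (intro signed_eq_move_front) simp
  then have "signed_eq n (x # p @ q) (p @ x # q)" by (auto simp: signed_eq_def)
  then show ?case using signed_eq_trans[OF 1] zs' by simp
qed (simp add: signed_eq_def)

lemma XZY_perm:
  "mset zs = mset zs' \<Longrightarrow> \<forall>z\<in>set zs. virtual (snd z) \<Longrightarrow> XZY n z0 zs = XZY n z0 zs'"
  by (rule signed_eq_XZY[OF signed_eq_perm])

lemma lop_self_neg: "T = - T \<Longrightarrow> T = 0" for T :: "letter lop"
proof (rule lop_eqI)
  fix v w assume "T = - T"
  then have "app T v w = - app T v w" by (metis app_simps(5))
  then show "app T v w = app 0 v w" by simp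
qed

text \<open>For an even colour c the generator e_{s,c} is odd with zero bracket with itself, hence
  its square is zero. Two equal letters can be brought together by \<open>XZY_perm\<close>.\<close>

lemma XZY_repeated_odd:
  assumes virt: "\<forall>z\<in>set zs. virtual (snd z) \<and> parity (snd z) = 0" and "\<not> distinct zs"
  shows "XZY n z0 zs = (\<lambda>w. 0)"
proof -
  obtain p z q r where zs: "zs = p @ [z] @ q @ [z] @ r" using not_distinct_decomp[OF assms(2)] by auto
  obtain s c where z: "z = (s, c)" by (cases z)
  have c: "virtual c" "parity c = 0" using virt by (auto simp: zs z)
  have "XZY n z0 zs = XZY n z0 (z # z # p @ q @ r)"
    by (rule XZY_perm) (use virt in \<open>auto simp: zs\<close>)
  moreover have "AA n (Prop s) c * AA n (Prop s) c = 0"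
  proof (rule lop_self_neg)
    have "AA n (Prop s) c * AA n (Prop s) c = sg 1 1 * AA n (Prop s) c * AA n (Prop s) c"
      using AA_AA[of n "Prop s" c "Prop s" c] c by (simp add: virtual_neq_Prop virtual_neq_Prop[symmetric])
    moreover have "sg 1 1 = -1" by (simp add: sg_eq)
    ultimately show "AA n (Prop s) c * AA n (Prop s) c = - (AA n (Prop s) c * AA n (Prop s) c)" by simp
  qed
  then have "OX n (z # z # p @ q @ r) = 0" by (simp add: z OX_simps flip: mult.assoc)
  ultimately show ?thesis by (simp add: XZY_app)
qed

definition colored :: "nat \<Rightarrow> symb list \<Rightarrow> (nat \<times> symb) list set" where
  "colored n c = {zs. mset (map snd zs) = mset c \<and> set (map fst zs) \<subseteq> {1..n}}"

lemma mult_fact_card: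
  "of_nat (card (permutations_of_multiset (mset zs))) = (fact (length zs) / (\<Prod>x\<in>set zs. fact (count_list zs x)) :: complex)"
proof -
  have "card (permutations_of_multiset (mset zs)) * (\<Prod>x\<in>set_mset (mset zs). fact (count (mset zs) x)) = fact (size (mset zs))"
    by (rule card_permutations_of_multiset_aux)
  then have "card (permutations_of_multiset (mset zs)) * (\<Prod>x\<in>set zs. fact (count_list zs x)) = fact (length zs)"
    by (simp add: count_mset)
  then have "of_nat (card (permutations_of_multiset (mset zs))) * (\<Prod>x\<in>set zs. fact (count_list zs x)) = (fact (length zs) :: complex)"
    by (subst (asm) of_nat_eq_iff[where 'a = complex, symmetric]) (simp only: of_nat_fact of_nat_mult of_nat_prod)
  moreover have "(\<Prod>x\<in>set zs. fact (count_list zs x)) \<noteq> (0 :: complex)" by simp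
  ultimately show ?thesis by (simp add: field_simps)
qed

text \<open>The full sum over all words with the given colours splits over the rearrangements of
  \<open>c\<close> into invariant sums. Grouped by multisets, each representative occurs as often as
  it has rearrangements, which is a factorial divided by the factorials of its
  multiplicities.\<close>

lemma inv_vec_colored:
  assumes c: "\<forall>\<gamma>\<in>set c. virtual \<gamma>" and z0: "\<forall>l\<in>set z0. virtual (fst l) \<and> virtual (snd l)"
    and R: "R \<subseteq> colored n c" "inj_on mset R"
    and zero: "\<And>zs. zs \<in> colored n c \<Longrightarrow> mset zs \<notin> mset ` R \<Longrightarrow> XZY n z0 zs = (\<lambda>w. 0)"
  shows "inv_vec n (\<lambda>w. \<Sum>zs\<in>R. (1 / (\<Prod>x\<in>set zs. fact (count_list zs x))) * XZY n z0 zs w)"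
proof -
  let ?M = "length c"
  have virt: "\<forall>z\<in>set zs. virtual (snd z)" if "zs \<in> colored n c" for zs
  proof -
    have "set (map snd zs) = set c" using that mset_eq_setD[of "map snd zs" c] by (simp only: colored_def mem_Collect_eq)
    then show ?thesis using c by auto
  qed
  have len: "length zs = ?M" if "zs \<in> colored n c" for zs
    using that mset_eq_length[of "map snd zs" c] by (simp add: colored_def)
  have union: "colored n c = (\<Union>c'\<in>permutations_of_multiset (mset c). (\<lambda>s. zip s c') ` seqs n ?M)"
  proof (intro equalityI subsetI)
    fix zs assume zs: "zs \<in> colored n c"
    have "zs = zip (map fst zs) (map snd zs)" by (simp add: zip_map_fst_snd)
    moreover have "map fst zs \<in> seqs n ?M" using zs len by (auto simp: seqs_def colored_def)
    moreover have "map snd zs \<in> permutations_of_multiset (mset c)"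
      using zs by (simp add: permutations_of_multiset_def colored_def)
    ultimately show "zs \<in> (\<Union>c'\<in>permutations_of_multiset (mset c). (\<lambda>s. zip s c') ` seqs n ?M)" by blast
  next
    fix zs assume "zs \<in> (\<Union>c'\<in>permutations_of_multiset (mset c). (\<lambda>s. zip s c') ` seqs n ?M)"
    then obtain c' s where cs: "mset c' = mset c" "s \<in> seqs n ?M" "zs = zip s c'"
      by (auto simp: permutations_of_multiset_def)
    then have "length s = length c'" using mset_eq_length[OF cs(1)] by (simp add: seqs_def)
    then have "map snd zs = c'" "map fst zs = s" using cs(3) by simp_all
    then show "zs \<in> colored n c" using cs(1,2) by (simp add: colored_def seqs_def del: mset_map set_map)
  qed
  have fin: "finite (colored n c)" unfolding union by simp
  have sum_eq: "(\<Sum>zs\<in>colored n c. XZY n z0 zs w) =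
      (\<Sum>c'\<in>permutations_of_multiset (mset c). \<Sum>s\<in>seqs n ?M. XZY n z0 (zip s c') w)" for w
  proof -
    have disj: "(\<lambda>s. zip s c1) ` seqs n ?M \<inter> (\<lambda>s. zip s c2) ` seqs n ?M = {}"
      if c12: "c1 \<in> permutations_of_multiset (mset c)" "c2 \<in> permutations_of_multiset (mset c)" "c1 \<noteq> c2" for c1 c2
    proof (rule ccontr)
      assume "\<not> ?thesis"
      then obtain s1 s2 where s: "s1 \<in> seqs n ?M" "s2 \<in> seqs n ?M" "zip s1 c1 = zip s2 c2" by blast
      have "length c1 = ?M" "length c2 = ?M" using c12 mset_eq_length by (auto simp: permutations_of_multiset_def)
      then have "map snd (zip s1 c1) = c1" "map snd (zip s2 c2) = c2" using s(1,2) by (simp_all add: seqs_length)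
      then show False using s(3) c12(3) by metis
    qed
    have "(\<Sum>zs\<in>colored n c. XZY n z0 zs w) =
      (\<Sum>c'\<in>permutations_of_multiset (mset c). \<Sum>zs\<in>(\<lambda>s. zip s c') ` seqs n ?M. XZY n z0 zs w)"
      unfolding union by (rule sum.UNION_disjoint) (use disj in auto)
    also have "\<dots> = (\<Sum>c'\<in>permutations_of_multiset (mset c). \<Sum>s\<in>seqs n ?M. XZY n z0 (zip s c') w)"
    proof (intro sum.cong refl)
      fix c' assume "c' \<in> permutations_of_multiset (mset c)"
      then have len': "length c' = ?M" using mset_eq_length by (auto simp: permutations_of_multiset_def)
      have "inj_on (\<lambda>s. zip s c') (seqs n ?M)"
      proof (rule inj_onI)
        fix s1 s2 assume s: "s1 \<in> seqs n ?M" "s2 \<in> seqs n ?M" "zip s1 c' = zip s2 c'"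
        have "map fst (zip s1 c') = s1" "map fst (zip s2 c') = s2" using s(1,2) len' by (simp_all add: seqs_length)
        then show "s1 = s2" using s(3) by metis
      qed
      then show "(\<Sum>zs\<in>(\<lambda>s. zip s c') ` seqs n ?M. XZY n z0 zs w) = (\<Sum>s\<in>seqs n ?M. XZY n z0 (zip s c') w)"
        by (simp add: sum.reindex)
    qed
    finally show ?thesis .
  qed
  have inv_all: "inv_vec n (\<lambda>w. \<Sum>zs\<in>colored n c. XZY n z0 zs w)"
    unfolding sum_eq
  proof (rule inv_vec_sum)
    fix c' assume c': "c' \<in> permutations_of_multiset (mset c)"
    then have "mset c' = mset c" by (simp add: permutations_of_multiset_def)
    then have "length c' = ?M" "set c' = set c"
      by (rule mset_eq_length, rule mset_eq_setD)
    then show "inv_vec n (\<lambda>w. \<Sum>s\<in>seqs n ?M. XZY n z0 (zip s c') w)"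
      using inv_vec_XZY[of c' z0 n] c z0 by simp
  qed
  have grouped: "(\<Sum>zs\<in>colored n c. XZY n z0 zs w) =
      fact ?M * (\<Sum>zs\<in>R. (1 / (\<Prod>x\<in>set zs. fact (count_list zs x))) * XZY n z0 zs w)" for w
  proof -
    have "(\<Sum>zs\<in>colored n c. XZY n z0 zs w) =
      (\<Sum>zs\<in>R. of_nat (card (permutations_of_multiset (mset zs))) * XZY n z0 zs w)"
    proof (rule sum_by_mset[OF fin])
      show "ys \<in> colored n c" if "xs \<in> colored n c" "mset ys = mset xs" for xs ys
        using that mset_eq_setD[OF that(2)] by (auto simp: colored_def)
      show "XZY n z0 ys w = XZY n z0 xs w" if "xs \<in> colored n c" "mset ys = mset xs" for xs ys
        using XZY_perm[OF that(2)[symmetric] virt[OF that(1)], of n z0] by simp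
      show "XZY n z0 xs w = 0" if "xs \<in> colored n c" "mset xs \<notin> mset ` R" for xs
        using zero[OF that] by simp
    qed (use R in auto)
    also have "\<dots> = (\<Sum>zs\<in>R. fact ?M * ((1 / (\<Prod>x\<in>set zs. fact (count_list zs x))) * XZY n z0 zs w))"
      using R(1) len by (intro sum.cong refl) (auto simp: mult_fact_card)
    finally show ?thesis by (simp add: sum_distrib_left)
  qed
  have "inv_vec n (\<lambda>w. (1 / fact ?M) * (\<Sum>zs\<in>colored n c. XZY n z0 zs w))"
    by (rule inv_vec_scale[OF inv_all])
  then show ?thesis unfolding grouped by simp
qed

text \<open>Some letter e_{c,s} of the right block has a column symbol outside
  \<open>proper n\<close>, while the row symbols to its right are all virtual colours; so the word
  is irregular for \<open>vac n\<close>.\<close>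

lemma XZY_vanish:
  assumes "\<forall>z\<in>set zs. virtual (snd z)" "Prop s \<notin> proper n" "s \<in> fst ` set zs"
  shows "XZY n z0 zs = (\<lambda>w. 0)"
proof -
  obtain c where "(s, c) \<in> set zs" using assms(3) by auto
  then obtain p q where zs: "zs = p @ (s, c) # q" by (meson split_list)
  have "Prop s \<notin> set (map fst (Yw q))"
  proof
    assume "Prop s \<in> set (map fst (Yw q))"
    then obtain z where "z \<in> set q" "snd z = Prop s" by (auto simp: Yw_def)
    then show False using assms(1) by (auto simp: zs virtual_def)
  qed
  then have "count_list (map fst (Yw q)) (Prop s) = 0" by (rule count_notin)
  then have "vac n (word ((Xw zs @ z0 @ Yw p) @ (c, Prop s) # Yw q)) = (\<lambda>w. 0)"
    by (intro vac_irregular[OF assms(2)]) simp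
  then show ?thesis by (simp add: XZY_def zs Yw_def)
qed

section \<open>Words sorted within each colour\<close>

definition sub :: "('a \<times> 'b) list \<Rightarrow> 'b \<Rightarrow> 'a list" where
  "sub zs \<gamma> = map fst (filter (\<lambda>z. snd z = \<gamma>) zs)"

lemma sub_simps [simp]:
  "sub [] \<gamma> = []" "sub (zs @ zs') \<gamma> = sub zs \<gamma> @ sub zs' \<gamma>"
  "sub ((x, c) # zs) \<gamma> = (if c = \<gamma> then x # sub zs \<gamma> else sub zs \<gamma>)"
  by (simp_all add: sub_def)

lemma set_sub: "x \<in> set (sub zs \<gamma>) \<longleftrightarrow> (x, \<gamma>) \<in> set zs"
  by (auto simp: sub_def image_iff)

lemma count_list_sub: "count_list (sub zs \<gamma>) x = count_list zs (x, \<gamma>)"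
proof (induction zs)
  case (Cons z zs)
  then show ?case by (cases z; cases "snd z = \<gamma>"; cases "fst z = x") simp_all
qed simp

lemma mset_sub: "mset (sub zs \<gamma>) = image_mset fst (filter_mset (\<lambda>z. snd z = \<gamma>) (mset zs))"
  by (simp add: sub_def flip: mset_filter)

lemma length_sub: "length (sub zs \<gamma>) = count_list (map snd zs) \<gamma>"
  by (induction zs) auto

lemma distinct_sub: "distinct zs \<longleftrightarrow> (\<forall>\<gamma>. distinct (sub zs \<gamma>))"
proof (induction zs)
  case (Cons z zs)
  obtain x c where z: "z = (x, c)" by (cases z)
  have "(\<forall>\<gamma>. distinct (sub (z # zs) \<gamma>)) \<longleftrightarrow> (x, c) \<notin> set zs \<and> (\<forall>\<gamma>. distinct (sub zs \<gamma>))"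
    by (auto simp: z set_sub)
  then show ?case using Cons by (simp add: z)
qed simp

lemma sub_eqD:
  assumes "map snd zs = map snd zs'" "\<And>\<gamma>. sub zs \<gamma> = sub zs' \<gamma>"
  shows "zs = zs'"
  using assms
proof (induction zs arbitrary: zs')
  case (Cons z zs)
  obtain x c where z: "z = (x, c)" by (cases z)
  obtain y ys where zs': "zs' = (y, c) # ys" using Cons.prems(1) by (cases zs') (auto simp: z)
  have "x = y" using Cons.prems(2)[of c] by (simp add: z zs')
  moreover have "zs = ys"
  proof (rule Cons.IH)
    show "map snd zs = map snd ys" using Cons.prems(1) by (simp add: zs')
    show "sub zs \<gamma> = sub ys \<gamma>" for \<gamma> using Cons.prems(2)[of \<gamma>] by (auto simp: z zs' split: if_splits)
  qed
  ultimately show ?case by (simp add: z zs')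
qed simp

lemma sub_exists:
  assumes "\<And>\<gamma>. length (l \<gamma>) = count_list c \<gamma>"
  shows "\<exists>zs. map snd zs = c \<and> (\<forall>\<gamma>. sub zs \<gamma> = l \<gamma>)"
  using assms
proof (induction c arbitrary: l)
  case (Cons a c)
  obtain x r where l: "l a = x # r" using Cons.prems[of a] by (cases "l a") auto
  have "length ((l(a := r)) \<gamma>) = count_list c \<gamma>" for \<gamma> using Cons.prems[of \<gamma>] l by (auto split: if_splits)
  then obtain zs where "map snd zs = c" "\<forall>\<gamma>. sub zs \<gamma> = (l(a := r)) \<gamma>" using Cons.IH by blast
  then show ?case using l by (intro exI[of _ "(x, a) # zs"]) auto
qed simp

text \<open>
  The signs of reordering the letters on the left and on the right cancel, so \<open>XZY\<close> depends on the multiset of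
  coloured letters only, and \<open>canon n c\<close> contains one word for each such multiset. Its elements correspond to the tableaux, respectively multi-indices, over which
  the central elements are summed.
\<close>

definition canon :: "nat \<Rightarrow> symb list \<Rightarrow> (nat \<times> symb) list set" where
  "canon n c = {zs. map snd zs = c \<and> set (map fst zs) \<subseteq> {1..n} \<and> (\<forall>\<gamma>. sorted (sub zs \<gamma>))}"

text \<open>The reciprocal of the order of the stabilizer of the word under permutations of
  positions. It specializes to 1/o_S for tableaux and to the reciprocal of the factorials of a
  multi-index.\<close>

definition mult_weight :: "(nat \<times> symb) list \<Rightarrow> complex" where
  "mult_weight zs = 1 / (\<Prod>x\<in>set zs. fact (count_list zs x))"

lemma canon_colored: "canon n c \<subseteq> colored n c"
  by (auto simp: canon_def colored_def simp flip: mset_map)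

lemma finite_canon: "finite (canon n c)"
proof (rule finite_subset)
  show "canon n c \<subseteq> (\<lambda>s. zip s c) ` seqs n (length c)"
  proof
    fix zs assume zs: "zs \<in> canon n c"
    have "zs = zip (map fst zs) (map snd zs)" by (simp add: zip_map_fst_snd)
    then show "zs \<in> (\<lambda>s. zip s c) ` seqs n (length c)"
      using zs by (intro image_eqI[of _ _ "map fst zs"]) (auto simp: canon_def seqs_def)
  qed
qed simp

text \<open>The multiset determines the entries of each colour, sortedness their order, and the
  common colour sequence how the colours interleave.\<close>

lemma inj_on_mset_canon: "inj_on mset (canon n c)"
proof (rule inj_onI, rule sub_eqD)
  fix zs zs' assume z: "zs \<in> canon n c" "zs' \<in> canon n c" "mset zs = mset zs'"
  show "map snd zs = map snd zs'" using z by (simp add: canon_def)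
  show "sub zs \<gamma> = sub zs' \<gamma>" for \<gamma>
  proof -
    have "mset (sub zs \<gamma>) = mset (sub zs' \<gamma>)" using z(3) by (simp only: mset_sub)
    moreover have "sorted (sub zs \<gamma>)" "sorted (sub zs' \<gamma>)" using z by (simp_all add: canon_def)
    ultimately show ?thesis using properties_for_sort[of "sub zs \<gamma>" "sub zs' \<gamma>"] by (simp add: sorted_sort_id)
  qed
qed

lemma canon_exists:
  assumes "zs \<in> colored n c"
  shows "mset zs \<in> mset ` canon n c"
proof -
  have c: "mset (map snd zs) = mset c" and s: "set (map fst zs) \<subseteq> {1..n}" using assms by (simp_all add: colored_def)
  have "length (sort (sub zs \<gamma>)) = count_list c \<gamma>" for \<gamma>
    using arg_cong[OF c, of "\<lambda>m. count m \<gamma>"] by (simp add: length_sub count_mset del: mset_map)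
  then obtain zs' where zs': "map snd zs' = c" "\<And>\<gamma>. sub zs' \<gamma> = sort (sub zs \<gamma>)"
    using sub_exists[of "\<lambda>\<gamma>. sort (sub zs \<gamma>)" c] by blast
  have "mset zs' = mset zs"
  proof (rule multiset_eqI)
    fix z :: "nat \<times> symb"
    obtain x \<gamma> where z: "z = (x, \<gamma>)" by (cases z)
    have "count (mset zs') z = count (mset (sub zs' \<gamma>)) x" by (simp add: count_mset count_list_sub z)
    also have "mset (sub zs' \<gamma>) = mset (sub zs \<gamma>)" by (simp add: zs'(2))
    also have "count \<dots> x = count (mset zs) z" by (simp add: count_mset count_list_sub z)
    finally show "count (mset zs') z = count (mset zs) z" .
  qed
  moreover have "zs' \<in> canon n c"
    using zs' s mset_eq_setD[OF calculation] by (simp add: canon_def)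
  ultimately show ?thesis by (metis imageI)
qed

lemma inv_vec_canon:
  assumes "\<forall>\<gamma>\<in>set c. virtual \<gamma>" "\<forall>l\<in>set z0. virtual (fst l) \<and> virtual (snd l)"
  shows "inv_vec n (\<lambda>w. \<Sum>zs\<in>canon n c. mult_weight zs * XZY n z0 zs w)"
  unfolding mult_weight_def using canon_exists
  by (intro inv_vec_colored[OF assms canon_colored inj_on_mset_canon]) blast

text \<open>A filling that contains \<open>n + 1\<close> gives an irregular word once \<open>n + 1\<close> is treated like a virtual symbol.\<close>

lemma canon_restrict:
  assumes "\<forall>\<gamma>\<in>set c. virtual \<gamma>"
  shows "(\<Sum>zs\<in>canon (n + 1) c. mult_weight zs * XZY n z0 zs w) = (\<Sum>zs\<in>canon n c. mult_weight zs * XZY n z0 zs w)"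
proof (rule sum.mono_neutral_right[OF finite_canon])
  show "canon n c \<subseteq> canon (n + 1) c" by (force simp: canon_def)
  show "\<forall>zs\<in>canon (n + 1) c - canon n c. mult_weight zs * XZY n z0 zs w = 0"
  proof
    fix zs assume zs: "zs \<in> canon (n + 1) c - canon n c"
    then have "\<not> set (map fst zs) \<subseteq> {1..n}" "set (map fst zs) \<subseteq> {1..n + 1}" by (auto simp: canon_def)
    then obtain t where t: "t \<in> fst ` set zs" "t \<notin> {1..n}" "t \<in> {1..n + 1}"
      unfolding set_map by blast
    then have "t = n + 1" by auto
    then have "n + 1 \<in> fst ` set zs" using t(1) by simp
    moreover have "\<forall>z\<in>set zs. virtual (snd z)" using zs assms by (force simp: canon_def)
    ultimately show "mult_weight zs * XZY n z0 zs w = 0" using XZY_vanish[OF _ proper_Suc(2)] by simp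
  qed
qed

section \<open>Representatives of virtual elements\<close>

text \<open>The vacuum vectors are recorded for all n', since an element for size n + 1 is needed at
  n' = n + 1 for centrality and at n' = n for comparison.\<close>

definition rep :: "nat \<Rightarrow> nat \<Rightarrow> tens set \<Rightarrow> (nat \<Rightarrow> letter vec) \<Rightarrow> bool" where
  "rep n M x v \<longleftrightarrow> (\<exists>e\<in>FD (proper n) M. x = cls (proper n) e \<and> (\<forall>n'. vac n' e = v n'))"

lemma rep_smul: "rep n M x v \<Longrightarrow> rep n M (smul (proper n) c x) (\<lambda>n' w. c * v n' w)"
  unfolding rep_def by (force simp: smul_cls FD_fa FD_const_mult vac_simps)

lemma rep_finsum:
  assumes "finite T" "\<And>S. S \<in> T \<Longrightarrow> rep n M (F S) (v S)"
  shows "rep n M (\<Oplus>\<^bsub>U (proper n)\<^esub>S\<in>T. F S) (\<lambda>n' w. \<Sum>S\<in>T. v S n' w)"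
proof -
  obtain e where e: "\<And>S. S \<in> T \<Longrightarrow> e S \<in> FD (proper n) M" "\<And>S. S \<in> T \<Longrightarrow> F S = cls (proper n) (e S)"
    "\<And>S n'. S \<in> T \<Longrightarrow> vac n' (e S) = v S n'"
    using assms(2) unfolding rep_def by metis
  interpret ring "U (proper n)" by (rule ring_U)
  have "(\<Oplus>\<^bsub>U (proper n)\<^esub>S\<in>T. F S) = (\<Oplus>\<^bsub>U (proper n)\<^esub>S\<in>T. cls (proper n) (e S))"
    using e by (intro finsum_cong') (auto intro!: cls_in_U FD_fa[OF e(1)])
  also have "\<dots> = cls (proper n) (\<Sum>S\<in>T. e S)" using e FD_fa by (intro finsum_cls[OF assms(1)]) blast
  finally show ?thesis unfolding rep_def using e
    by (intro bexI[of _ "\<Sum>S\<in>T. e S"]) (auto simp: vac_simps intro: FD_sum)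
qed

text \<open>This reduces each family to checks on vacuum vectors: invariance for n and for n + 1,
  and agreement of the two vectors at n.\<close>

lemma rep_stable:
  assumes x: "rep n M x v" and x': "rep (n + 1) M x' v'" and M: "M \<le> n"
    and inv: "inv_vec n (v n)" "inv_vec (n + 1) (v' (n + 1))" and eq: "v' n = v n"
  shows "x \<in> zeta_filt n M \<and> capelli_mono n x = x'"
proof
  obtain e e' where e: "e \<in> FD (proper n) M" "x = cls (proper n) e" "\<And>n'. vac n' e = v n'"
    and e': "e' \<in> FD (proper (n + 1)) M" "x' = cls (proper (n + 1)) e'" "\<And>n'. vac n' e' = v' n'"
    using x x' unfolding rep_def by blast
  have "x \<in> center (U (proper n))" using central_inv_vec[OF FD_fa[OF e(1)]] inv(1) e by simp
  then show "x \<in> zeta_filt n M" using e by (simp add: zeta_filt_def zeta_def U_filt_FD)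
  have "x' \<in> center (U (proper (n + 1)))" using central_inv_vec[OF FD_fa[OF e'(1)]] inv(2) e' by simp
  then show "capelli_mono n x = x'"
    unfolding e(2) e'(2) using capelli_mono_stable[OF e'(1) _ M FD_fa[OF e(1)]] eq e(3) e'(3) by simp
qed

lemma rep_virt_proj:
  assumes w: "set w \<subseteq> alphabet m0 m1 n \<times> alphabet m0 m1 n"
    and balanced: "\<And>\<gamma>. virtual \<gamma> \<Longrightarrow> count_list (map fst w) \<gamma> = count_list (map snd w) \<gamma>"
    and M: "length (filter (\<lambda>l. snd l \<in> proper n) w) \<le> M"
  shows "rep n M (virt_proj m0 m1 n (cls (alphabet m0 m1 n) (word w))) (\<lambda>n'. vac n' (word w))"
  using virt_proj_word[OF w balanced] FD_mono[OF M] unfolding rep_def by blast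

text \<open>Exactly the letters of the right block have proper column symbols, whence the degree
  bound. The two blocks may list their letters in different orders because I_k uses opposite
  orders.\<close>

lemma rep_XZY:
  assumes xs: "mset xs = mset zs" and s: "set (map fst zs) \<subseteq> {1..n}" and c: "set (map snd zs) \<subseteq> V"
    and z0: "set z0 \<subseteq> V \<times> V" "mset (map fst z0) = mset (map snd z0)"
    and V: "V \<subseteq> alphabet m0 m1 n" "\<forall>\<gamma>\<in>V. virtual \<gamma>" and M: "length zs = M"
  shows "rep n M (virt_proj m0 m1 n (cls (alphabet m0 m1 n) (word (Xw xs @ z0 @ Yw zs))))
    (\<lambda>n'. vac n' (word (Xw xs @ z0 @ Yw zs)))"
proof (rule rep_virt_proj)
  have zs: "Prop x \<in> alphabet m0 m1 n" "c \<in> V" if "(x, c) \<in> set zs" for x c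
  proof -
    have "x \<in> set (map fst zs)" "c \<in> set (map snd zs)" using that by force+
    then show "Prop x \<in> alphabet m0 m1 n" "c \<in> V" using s c by (auto simp: alphabet_def)
  qed
  then have "set (Xw xs) \<subseteq> alphabet m0 m1 n \<times> alphabet m0 m1 n" "set (Yw zs) \<subseteq> alphabet m0 m1 n \<times> alphabet m0 m1 n"
    using V(1) mset_eq_setD[OF xs] unfolding Xw_def Yw_def by auto
  moreover have "set z0 \<subseteq> alphabet m0 m1 n \<times> alphabet m0 m1 n" using z0(1) V(1) by blast
  ultimately show "set (Xw xs @ z0 @ Yw zs) \<subseteq> alphabet m0 m1 n \<times> alphabet m0 m1 n" by simp
  have np: "snd l \<notin> proper n" if l: "l \<in> set (Xw xs @ z0)" for l
  proof -
    have "snd l \<in> V" using l zs(2) z0(1) mset_eq_setD[OF xs] by (auto simp: Xw_def)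
    then show ?thesis using V(2) by (auto simp: virtual_def proper_def)
  qed
  have "length (filter (\<lambda>l. snd l \<in> proper n) (Xw xs @ z0 @ Yw zs)) = length (filter (\<lambda>l. snd l \<in> proper n) (Yw zs))"
    using np by (simp add: filter_empty_conv)
  also have "\<dots> \<le> M" using length_filter_le[of "\<lambda>l. snd l \<in> proper n" "Yw zs"] M by (simp add: Yw_def)
  finally show "length (filter (\<lambda>l. snd l \<in> proper n) (Xw xs @ z0 @ Yw zs)) \<le> M" .
  fix \<gamma> assume "virtual \<gamma>"
  then have nP: "\<forall>x. Prop x \<noteq> \<gamma>" by (auto simp: virtual_def)
  have "count_list (map fst (Xw xs)) \<gamma> = 0" "count_list (map snd (Xw xs)) \<gamma> = count_list (map snd xs) \<gamma>"
    by (induction xs) (use nP in \<open>auto simp: Xw_def\<close>)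
  moreover have "count_list (map snd xs) \<gamma> = count_list (map snd zs) \<gamma>"
    using xs by (metis count_mset mset_map)
  moreover have
    "count_list (map fst (Yw zs)) \<gamma> = count_list (map snd zs) \<gamma>" "count_list (map snd (Yw zs)) \<gamma> = 0"
    by (induction zs) (use nP in \<open>auto simp: Yw_def\<close>)
  moreover have "count_list (map fst z0) \<gamma> = count_list (map snd z0) \<gamma>"
    using z0(2) by (metis count_mset)
  ultimately show "count_list (map fst (Xw xs @ z0 @ Yw zs)) \<gamma> = count_list (map snd (Xw xs @ z0 @ Yw zs)) \<gamma>"
    by (simp add: count_list_append)
qed

section \<open>Relabelling virtual symbols\<close>

text \<open>The elements \<open>I\<^sub>k\<close> for \<open>n\<close> and for \<open>n + 1\<close> may be formed with different symbols \<open>\<beta>\<close>.\<close>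

locale relabelling =
  fixes \<rho> :: "symb \<Rightarrow> symb"
  assumes inj: "\<rho> a = \<rho> b \<longleftrightarrow> a = b" and parity [simp]: "parity (\<rho> a) = parity a" and Prop [simp]: "\<rho> (Prop i) = Prop i"
begin

definition rel :: "letter vec \<Rightarrow> letter vec" where
  "rel v = (\<lambda>w. v (map (map_prod \<rho> id) w))"

lemma rel_Dfun: "rel (Dfun (\<rho> a) (\<rho> b) v) w = Dfun a b (rel v) w"
proof (induction w arbitrary: v)
  case (Cons y w)
  have "rel (Dfun (\<rho> a) (\<rho> b) (\<lambda>u. v (map_prod \<rho> id y # u))) w = Dfun a b (rel (\<lambda>u. v (map_prod \<rho> id y # u))) w"
    by (rule Cons)
  then show ?case by (cases y) (simp add: rel_def inj letter_par_def)
qed (simp add: rel_def)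

lemma rel_Sfun: "rel (Sfun (map_prod \<rho> id x) v) w = Sfun x (rel v) w"
proof (induction w arbitrary: v)
  case (Cons y w)
  have "rel (Sfun (map_prod \<rho> id x) (\<lambda>u. v (map_prod \<rho> id y # u))) w = Sfun x (rel (\<lambda>u. v (map_prod \<rho> id y # u))) w"
    by (rule Cons)
  then show ?case by (cases x; cases y) (simp add: rel_def inj letter_par_def)
qed (simp add: rel_def)

lemma proper_iff: "\<rho> b \<in> proper n \<longleftrightarrow> b \<in> proper n"
  unfolding proper_def image_iff by (metis inj Prop)

lemma rel_AA: "rel (app (AA n (\<rho> a) (\<rho> b)) v) = app (AA n a b) (rel v)"
proof
  fix w
  have "rel (Sfun (\<rho> a, b) v) w = Sfun (a, b) (rel v) w" using rel_Sfun[of "(a, b)"] by simp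
  moreover have "\<rho> b = b" if "b \<in> proper n" using that by (auto simp: proper_def)
  ultimately show "rel (app (AA n (\<rho> a) (\<rho> b)) v) w = app (AA n a b) (rel v) w"
    using rel_Dfun[of a b v w] by (auto simp: AA_def proper_iff DD.rep_eq SS.rep_eq rel_def)
qed

lemma rel_vac_word: "rel (vac n (word (map (map_prod \<rho> \<rho>) w))) = vac n (word w)"
proof (induction w)
  case Nil
  show ?case by (auto simp: vac_def rel_def vac0_def act_simps fun_eq_iff)
next
  case (Cons l w)
  then show ?case by (cases l) (simp add: vac_word_Cons rel_AA)
qed

lemma rel_vac_proper:
  assumes "y \<in> fa (proper n)"
  shows "rel (vac n y) = vac n y"
proof -
  have 1: "rel (vac n (word u)) = vac n (word u)" if "set u \<subseteq> proper n \<times> proper n" for u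
  proof -
    have "map (map_prod \<rho> \<rho>) u = u" by (rule map_idI) (use that in \<open>auto simp: proper_def\<close>)
    then show ?thesis using rel_vac_word[of n u] by simp
  qed
  have "vac n y = vac n (\<Sum>v\<in>Poly_Mapping.keys y. const (Poly_Mapping.lookup y v) * word (letters v))"
    by (rule arg_cong[OF tens_expand])
  then have y: "vac n y = (\<lambda>w. \<Sum>v\<in>Poly_Mapping.keys y. Poly_Mapping.lookup y v * vac n (word (letters v)) w)"
    by (simp only: vac_simps(5,6))
  have "rel (vac n (word (letters v))) = vac n (word (letters v))" if "v \<in> Poly_Mapping.keys y" for v
    using that assms by (intro 1) (auto simp: fa_iff)
  then show ?thesis unfolding y rel_def fun_eq_iff by (intro allI sum.cong refl) simp
qed

text \<open>\<open>rel\<close> carries the vector of the relabelled word to that of the original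
  one, and it fixes that vector because it is also the vector of an element of U(gl(n)), where only
  proper symbols occur.\<close>

lemma vac_relabel:
  assumes "vac n (word (map (map_prod \<rho> \<rho>) w)) = vac n y" "y \<in> fa (proper n)"
  shows "vac n (word w) = vac n (word (map (map_prod \<rho> \<rho>) w))"
  using rel_vac_word[of n w] rel_vac_proper[OF assms(2)] assms(1) by simp

end

section \<open>Tableaux as coloured words\<close>

lemma concat_eqD: "map length S = map length S' \<Longrightarrow> concat S = concat S' \<Longrightarrow> S = S'"
proof (induction S arbitrary: S')
  case (Cons r S)
  then obtain r' R where "S' = r' # R" by (cases S') auto
  then show ?case using Cons by auto
qed simp

lemma unconcat: "length s = sum_list lam \<Longrightarrow> \<exists>S. map length S = lam \<and> concat S = s"
proof (induction lam arbitrary: s)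
  case (Cons l lam)
  then have "length (drop l s) = sum_list lam" by simp
  then obtain S where "map length S = lam" "concat S = drop l s" using Cons.IH by blast
  then show ?case using Cons.prems by (intro exI[of _ "take l s # S"]) simp
qed simp

lemma length_rows_C_tab: "map length (C_tab lam) = lam"
  by (simp add: C_tab_def comp_def map_nth)

lemma length_rows_D_tab: "map length (D_tab lam) = lam"
  by (simp add: D_tab_def comp_def)

lemma C_tab_snoc: "C_tab (lam @ [l]) = C_tab lam @ [replicate l (Alpha (Suc (length lam)))]"
  by (simp add: C_tab_def nth_append)

lemma sub_notin: "\<gamma> \<notin> set (map snd zs) \<Longrightarrow> sub zs \<gamma> = []"
  by (induction zs) auto

text \<open>The letters coloured \<open>Alpha (i + 1)\<close> form row i counted from 0. All other
  colours give the empty list, where the assumption on \<open>P\<close> is used.\<close>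

lemma sub_C_tab:
  assumes "P []"
  shows "(\<forall>\<gamma>. P (sub (zip (concat S) (concat (C_tab (map length S)))) \<gamma>)) \<longleftrightarrow> (\<forall>r\<in>set S. P r)"
proof (induction S rule: rev_induct)
  case Nil
  show ?case using assms by (simp add: C_tab_def)
next
  case (snoc r S)
  let ?zs = "zip (concat S) (concat (C_tab (map length S)))" and ?a = "Alpha (Suc (length S))"
  have len: "length (concat S) = length (concat (C_tab (map length S)))"
    by (simp add: length_concat length_rows_C_tab)
  have "sub (zip r (replicate (length r) ?a)) \<gamma> = (if \<gamma> = ?a then r else [])" for \<gamma>
    by (induction r) auto
  then have sub: "sub (zip (concat (S @ [r])) (concat (C_tab (map length (S @ [r]))))) \<gamma> =
      sub ?zs \<gamma> @ (if \<gamma> = ?a then r else [])" for \<gamma>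
    using len by (simp add: C_tab_snoc)
  have "?a \<notin> set (concat (C_tab (map length S)))" by (auto simp: C_tab_def)
  then have "sub ?zs ?a = []" using len by (intro sub_notin) simp
  then have "P (sub ?zs \<gamma> @ (if \<gamma> = ?a then r else [])) \<longleftrightarrow> P (sub ?zs \<gamma>) \<and> (\<gamma> = ?a \<longrightarrow> P r)" for \<gamma>
    using assms by (cases "\<gamma> = ?a") simp_all
  then have "(\<forall>\<gamma>. P (sub ?zs \<gamma> @ (if \<gamma> = ?a then r else []))) \<longleftrightarrow> (\<forall>\<gamma>. P (sub ?zs \<gamma>)) \<and> P r"
    by blast
  then show ?case unfolding sub using snoc by auto
qed

lemma sub_D_row:
  "sub (zip r (map (\<lambda>j. symb.Beta (Suc j)) [0..<length r])) (symb.Beta (Suc j)) = (if j < length r then [r ! j] else [])"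
  by (induction r rule: rev_induct) (auto simp: nth_append less_Suc_eq)

lemma sub_D_tab: "sub (zip (concat S) (concat (D_tab (map length S)))) (symb.Beta (Suc j)) = Defs.column S j"
proof (induction S)
  case (Cons r S)
  have "D_tab (map length (r # S)) = map (\<lambda>j. symb.Beta (Suc j)) [0..<length r] # D_tab (map length S)"
    by (simp add: D_tab_def)
  then show ?case using Cons sub_D_row[of r j] by (simp add: Defs.column_def del: upt_Suc)
qed (simp add: Defs.column_def D_tab_def)

lemma sub_D_tab_other:
  assumes "\<forall>j. \<gamma> \<noteq> symb.Beta (Suc j)"
  shows "sub (zip (concat S) (concat (D_tab (map length S)))) \<gamma> = []"
  using assms by (intro sub_notin) (auto simp: D_tab_def dest!: set_zip_rightD)

lemma sum_list_of_bool: "r \<le> m \<Longrightarrow> (\<Sum>j<m. of_bool (j < r)) = (r :: nat)"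
proof -
  assume "r \<le> m"
  then have "{..<m} \<inter> {j. j < r} = {..<r}" by auto
  then show ?thesis by simp
qed

lemma partition_le_hd: "sorted_wrt (\<ge>) lam \<Longrightarrow> r \<in> set lam \<Longrightarrow> r \<le> hd lam" for lam :: "nat list"
  by (cases lam) auto

lemma sum_list_conjugate:
  assumes "sorted_wrt (\<ge>) lam"
  shows "sum_list (Defs.conjugate lam) = sum_list lam"
proof -
  let ?m = "if lam = [] then 0 else hd lam"
  have len: "length (filter (\<lambda>r. j < r) xs) = (\<Sum>r\<leftarrow>xs. of_bool (j < r))" for j :: nat and xs
    by (induction xs) auto
  have swap: "(\<Sum>j<m. \<Sum>r\<leftarrow>xs. of_bool (j < r)) = (\<Sum>r\<leftarrow>xs. \<Sum>j<m. of_bool (j < r) :: nat)" for m and xs :: "nat list"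
    by (induction xs) (simp_all add: sum.distrib del: sum_of_bool_eq)
  have "sum_list (Defs.conjugate lam) = (\<Sum>j<?m. length (filter (\<lambda>r. j < r) lam))"
    by (simp add: Defs.conjugate_def sum_list_distinct_conv_sum_set atLeast0LessThan)
  also have "\<dots> = (\<Sum>j<?m. \<Sum>r\<leftarrow>lam. of_bool (j < r))"
    by (intro sum.cong refl len)
  also have "\<dots> = (\<Sum>r\<leftarrow>lam. \<Sum>j<?m. of_bool (j < r))"
    by (rule swap)
  also have "\<dots> = sum_list (map (\<lambda>r. r) lam)"
    using partition_le_hd[OF assms] by (intro arg_cong[where f = sum_list] map_cong refl sum_list_of_bool) auto
  finally show ?thesis by simp
qed

lemma sorted_conjugate: "sorted_wrt (\<ge>) (Defs.conjugate lam)"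
proof -
  have "length (filter (\<lambda>r. j < r) lam) \<le> length (filter (\<lambda>r. i < r) lam)" if "i < j" for i j
    using that by (induction lam) auto
  then show ?thesis unfolding Defs.conjugate_def sorted_wrt_map by (intro sorted_wrt_mono_rel[OF _ sorted_wrt_upt]) auto
qed

text \<open>The multiplicity of the pair (s, \<beta>) is that of s in the column of \<beta>.
  Decreasing row lengths ensure that all columns are among those counted by the first row.\<close>

lemma weight_D_tab:
  assumes "sorted_wrt (\<ge>) (map length S)"
  shows "mult_weight (zip (concat S) (concat (D_tab (map length S)))) = 1 / of_nat (col_mult_fact S)"
proof -
  let ?zs = "zip (concat S) (concat (D_tab (map length S)))" and ?J = "length (Defs.conjugate (map length S))"
  let ?f = "\<lambda>j s. (s, symb.Beta (Suc j))"
  have J: "?J = (if S = [] then 0 else length (hd S))" by (simp add: Defs.conjugate_def hd_map)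
  have bound: "j < ?J" if s: "s \<in> set (Defs.column S j)" for s j
  proof -
    obtain r where r: "r \<in> set S" "j < length r" using s by (auto simp: Defs.column_def)
    have "length r \<le> length (hd S)" using partition_le_hd[OF assms, of "length r"] r by (cases S) auto
    then show ?thesis using r J by auto
  qed
  have set_eq: "set ?zs = (\<Union>j<?J. ?f j ` set (Defs.column S j))"
  proof (intro equalityI subsetI)
    fix z assume z: "z \<in> set ?zs"
    obtain s \<gamma> where sc: "z = (s, \<gamma>)" by (cases z)
    then have s: "s \<in> set (sub ?zs \<gamma>)" using z by (simp add: set_sub)
    obtain j where j: "\<gamma> = symb.Beta (Suc j)" using s sub_D_tab_other[of \<gamma> S] by fastforce
    have "s \<in> set (Defs.column S j)" using s unfolding j sub_D_tab .
    then show "z \<in> (\<Union>j<?J. ?f j ` set (Defs.column S j))" using bound sc j by blast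
  next
    fix z assume "z \<in> (\<Union>j<?J. ?f j ` set (Defs.column S j))"
    then obtain j s where "z = ?f j s" "s \<in> set (Defs.column S j)" by blast
    then show "z \<in> set ?zs" by (simp only: set_sub[symmetric] sub_D_tab)
  qed
  have "(\<Prod>x\<in>set ?zs. fact (count_list ?zs x)) = (\<Prod>j<?J. \<Prod>x\<in>?f j ` set (Defs.column S j). fact (count_list ?zs x) :: complex)"
    unfolding set_eq by (rule prod.UNION_disjoint) auto
  also have "\<dots> = (\<Prod>j<?J. \<Prod>s\<in>set (Defs.column S j). fact (count_list (Defs.column S j) s))"
    by (intro prod.cong refl) (simp add: prod.reindex inj_on_def sub_D_tab flip: count_list_sub)
  also have "\<dots> = of_nat (col_mult_fact S)" by (simp add: col_mult_fact_def)
  finally show ?thesis by (simp add: mult_weight_def)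
qed

lemma weight_distinct:
  assumes "distinct zs"
  shows "mult_weight zs = 1"
proof -
  have "count_list zs x = 1" if "x \<in> set zs" for x
    using assms that by (induction zs) (auto simp: count_notin)
  then show ?thesis by (simp add: mult_weight_def)
qed

lemma tableaux_canon:
  assumes T: "map length T = lam"
  shows "bij_betw (\<lambda>S. zip (concat S) (concat T))
    {S \<in> tableaux lam n. \<forall>\<gamma>. sorted (sub (zip (concat S) (concat T)) \<gamma>)} (canon n (concat T))"
  unfolding bij_betw_def
proof
  have len: "length (concat S) = length (concat T)" if "map length S = lam" for S :: "nat list list"
    using that T by (simp add: length_concat)
  show "inj_on (\<lambda>S. zip (concat S) (concat T)) {S \<in> tableaux lam n. \<forall>\<gamma>. sorted (sub (zip (concat S) (concat T)) \<gamma>)}"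
  proof (rule inj_onI)
    fix S S' assume S: "S \<in> {S \<in> tableaux lam n. \<forall>\<gamma>. sorted (sub (zip (concat S) (concat T)) \<gamma>)}"
      "S' \<in> {S \<in> tableaux lam n. \<forall>\<gamma>. sorted (sub (zip (concat S) (concat T)) \<gamma>)}"
      and eq: "zip (concat S) (concat T) = zip (concat S') (concat T)"
    have l: "map length S = lam" "map length S' = lam" using S by (simp_all add: tableaux_def)
    have "concat S = concat S'" using arg_cong[OF eq, of "map fst"] len[OF l(1)] len[OF l(2)] by simp
    then show "S = S'" using l by (intro concat_eqD) simp_all
  qed
  show "(\<lambda>S. zip (concat S) (concat T)) ` {S \<in> tableaux lam n. \<forall>\<gamma>. sorted (sub (zip (concat S) (concat T)) \<gamma>)} = canon n (concat T)"
  proof (intro equalityI subsetI)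
    fix zs assume "zs \<in> (\<lambda>S. zip (concat S) (concat T)) ` {S \<in> tableaux lam n. \<forall>\<gamma>. sorted (sub (zip (concat S) (concat T)) \<gamma>)}"
    then obtain S where S: "zs = zip (concat S) (concat T)" "S \<in> tableaux lam n" "\<forall>\<gamma>. sorted (sub zs \<gamma>)" by auto
    have "map snd zs = concat T" "map fst zs = concat S" using S len by (simp_all add: tableaux_def)
    then show "zs \<in> canon n (concat T)" using S(2,3) by (simp add: canon_def tableaux_def del: set_map)
  next
    fix zs assume zs: "zs \<in> canon n (concat T)"
    have "length (map fst zs) = length (concat T)"
      using zs by (metis (mono_tags, lifting) canon_def length_map mem_Collect_eq)
    then have "length (map fst zs) = sum_list lam" using T by (simp add: length_concat)
    then obtain S where S: "map length S = lam" "concat S = map fst zs" using unconcat by blast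
    have "map snd zs = concat T" using zs by (simp add: canon_def)
    then have eq: "zs = zip (concat S) (concat T)" using S(2) zip_map_fst_snd[of zs] by metis
    have "S \<in> tableaux lam n" using zs S by (simp add: canon_def tableaux_def del: set_concat)
    then show "zs \<in> (\<lambda>S. zip (concat S) (concat T)) ` {S \<in> tableaux lam n. \<forall>\<gamma>. sorted (sub (zip (concat S) (concat T)) \<gamma>)}"
      using zs by (intro image_eqI[of _ _ S] eq) (simp add: canon_def flip: eq)
  qed
qed

text \<open>Strictly increasing means sorted and without repetition, row by row. The sorted fillings
  with a repetition are the ones whose words vanish by oddness.\<close>

lemma row_strict_tableaux_C_tab:
  "row_strict_tableaux lam n = {S \<in> {S \<in> tableaux lam n. \<forall>\<gamma>. sorted (sub (zip (concat S) (concat (C_tab lam))) \<gamma>)}.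
    distinct (zip (concat S) (concat (C_tab lam)))}"
proof -
  have "(\<forall>r\<in>set S. sorted_wrt (<) r) \<longleftrightarrow> (\<forall>\<gamma>. sorted (sub (zip (concat S) (concat (C_tab lam))) \<gamma>)) \<and>
      distinct (zip (concat S) (concat (C_tab lam)))" if "S \<in> tableaux lam n" for S
  proof -
    have lam: "lam = map length S" using that by (simp add: tableaux_def)
    show ?thesis unfolding lam distinct_sub using sub_C_tab[of sorted S] sub_C_tab[of distinct S]
      by (auto simp: strict_sorted_iff)
  qed
  then show ?thesis unfolding row_strict_tableaux_def by blast
qed

lemma column_weak_tableaux_D_tab:
  "column_weak_tableaux lam n = {S \<in> tableaux lam n. \<forall>\<gamma>. sorted (sub (zip (concat S) (concat (D_tab lam))) \<gamma>)}"
proof -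
  have "(\<forall>j. sorted (Defs.column S j)) \<longleftrightarrow> (\<forall>\<gamma>. sorted (sub (zip (concat S) (concat (D_tab lam))) \<gamma>))"
    if "S \<in> tableaux lam n" for S
  proof -
    have lam: "lam = map length S" using that by (simp add: tableaux_def)
    have "sorted (sub (zip (concat S) (concat (D_tab lam))) \<gamma>)" if s: "\<forall>j. sorted (Defs.column S j)" for \<gamma>
    proof (cases "\<exists>j. \<gamma> = symb.Beta (Suc j)")
      case True
      then show ?thesis using s by (auto simp: lam sub_D_tab)
    next
      case False
      then show ?thesis using sub_D_tab_other[of \<gamma> S] by (simp add: lam)
    qed
    then show ?thesis using sub_D_tab[of S] by (metis lam)
  qed
  then show ?thesis unfolding column_weak_tableaux_def by blast
qed

section \<open>Compatibility with the Capelli monomorphisms\<close>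

text \<open>The first number bounds the fillings, the second selects the vacuum map; the pair (n +
  1, n) is to be compared with (n, n).\<close>

definition canon_sum :: "letter list \<Rightarrow> symb list \<Rightarrow> nat \<Rightarrow> nat \<Rightarrow> letter vec" where
  "canon_sum z0 c n n' = (\<lambda>w. \<Sum>zs\<in>canon n c. mult_weight zs * XZY n' z0 zs w)"

lemma inv_vec_canon_sum:
  assumes "\<forall>\<gamma>\<in>set c. virtual \<gamma>" "\<forall>l\<in>set z0. virtual (fst l) \<and> virtual (snd l)"
  shows "inv_vec n (canon_sum z0 c n n)"
  unfolding canon_sum_def by (rule inv_vec_canon[OF assms])

lemma canon_sum_restrict:
  "\<forall>\<gamma>\<in>set c. virtual \<gamma> \<Longrightarrow> canon_sum z0 c (n + 1) n = canon_sum z0 c n n"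
  unfolding canon_sum_def by (intro ext canon_restrict)

section \<open>Representatives of the elements attached to tableaux\<close>

lemma tab_prod_Xw: "tab_prod (prop_tab S) T = word (Xw (zip (concat S) (concat T)))"
  by (simp only: tab_prod_def prod_list_gen' prop_tab_def flip: map_concat) (simp only: Xw_def zip_map1)

lemma tab_prod_Yw:
  "tab_prod T (prop_tab S) = word (Yw (zip (concat S) (concat T)))"
proof -
  have zip_Prop: "zip v (map Prop u) = map (\<lambda>(s, c). (c, Prop s)) (zip u v)" for u and v :: "symb list"
  proof (induction u arbitrary: v)
    case (Cons x u)
    then show ?case by (cases v) simp_all
  qed simp
  show ?thesis
    by (simp only: tab_prod_def prod_list_gen' prop_tab_def flip: map_concat) (simp only: Yw_def zip_Prop)
qed

lemma tab_prod_word: "tab_prod S T = word (zip (concat S) (concat T))"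
  by (simp add: tab_prod_def prod_list_gen')

lemma length_concat_C_tab: "length (concat (C_tab lam)) = sum_list lam"
  by (simp only: length_concat length_rows_C_tab)

lemma length_concat_D_tab: "length (concat (D_tab lam)) = sum_list lam"
  by (simp only: length_concat length_rows_D_tab)

lemma virtual_C_tab: "\<forall>\<gamma>\<in>set (concat (C_tab lam)). virtual \<gamma> \<and> parity \<gamma> = 0"
  by (auto simp: C_tab_def virtual_def)

lemma virtual_D_tab: "\<forall>\<gamma>\<in>set (concat (D_tab lam)). virtual \<gamma>"
  by (auto simp: D_tab_def virtual_def)

lemma C_tab_alphabet: "length lam \<le> m0 \<Longrightarrow> set (concat (C_tab lam)) \<subseteq> alphabet m0 m1 n"
  by (auto simp: C_tab_def alphabet_def)

lemma D_tab_alphabet: "\<forall>r\<in>set lam. r \<le> m1 \<Longrightarrow> set (concat (D_tab lam)) \<subseteq> alphabet m0 m1 n"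
  by (fastforce simp: D_tab_def alphabet_def)

lemma finite_tableaux: "finite (tableaux lam n)"
proof (rule finite_subset)
  show "tableaux lam n \<subseteq> {S. set S \<subseteq> {r. set r \<subseteq> {1..n} \<and> length r \<le> sum_list lam} \<and> length S = length lam}"
  proof
    fix S assume "S \<in> tableaux lam n"
    then have S: "map length S = lam" "set (concat S) \<subseteq> {1..n}" by (simp_all add: tableaux_def)
    have "length r \<le> sum_list lam" if "r \<in> set S" for r
      using that member_le_sum_list[of "length r" lam] S(1) by auto
    then show "S \<in> {S. set S \<subseteq> {r. set r \<subseteq> {1..n} \<and> length r \<le> sum_list lam} \<and> length S = length lam}"
      using S by auto
  qed
  show "finite {S. set S \<subseteq> {r. set r \<subseteq> {1..n} \<and> length r \<le> sum_list lam} \<and> length S = length lam}"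
    by (intro finite_lists_length_eq finite_subset[OF _ finite_lists_length_le[of "{1..n}" "sum_list lam"]]) auto
qed

lemma rep_tableau:
  assumes S: "S \<in> tableaux lam n" and T: "map length T = lam"
    and V: "V \<subseteq> alphabet m0 m1 n" "\<forall>\<gamma>\<in>V. virtual \<gamma>"
    and c: "set (concat T) \<subseteq> V" and z0: "set z0 \<subseteq> V \<times> V" "mset (map fst z0) = mset (map snd z0)"
  shows "rep n (sum_list lam) (virt_proj m0 m1 n (cls (alphabet m0 m1 n)
      (word (Xw (zip (concat S) (concat T)) @ z0 @ Yw (zip (concat S) (concat T))))))
    (\<lambda>n'. XZY n' z0 (zip (concat S) (concat T)))"
  unfolding XZY_def
proof (rule rep_XZY[OF refl _ _ z0 V])
  have len: "length (concat S) = length (concat T)" "length (concat T) = sum_list lam"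
    using S T by (simp_all add: length_concat tableaux_def)
  show "set (map fst (zip (concat S) (concat T))) \<subseteq> {1..n}" "set (map snd (zip (concat S) (concat T))) \<subseteq> V"
    "length (zip (concat S) (concat T)) = sum_list lam"
    using S c len by (simp_all add: tableaux_def del: set_map set_concat)
qed

text \<open>The canonical words outside the row-strict tableaux contain a repeated odd letter and
  contribute zero, and the others have weight 1. So the unweighted sum over tableaux is a canonical
  sum.\<close>

lemma rep_row_strict:
  assumes V: "V \<subseteq> alphabet m0 m1 n" "\<forall>\<gamma>\<in>V. virtual \<gamma>"
    and c: "set (concat (C_tab lam)) \<subseteq> V" and z0: "set z0 \<subseteq> V \<times> V" "mset (map fst z0) = mset (map snd z0)"
  shows "rep n (sum_list lam) (\<Oplus>\<^bsub>U (proper n)\<^esub>S\<in>row_strict_tableaux lam n.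
      virt_proj m0 m1 n (cls (alphabet m0 m1 n) (word (Xw (zip (concat S) (concat (C_tab lam))) @ z0 @
        Yw (zip (concat S) (concat (C_tab lam)))))))
    (canon_sum z0 (concat (C_tab lam)) n)"
proof -
  let ?c = "concat (C_tab lam)"
  let ?f = "\<lambda>S. zip (concat S) ?c"
  let ?T = "{S \<in> tableaux lam n. \<forall>\<gamma>. sorted (sub (?f S) \<gamma>)}"
  have fin: "finite ?T" by (rule finite_subset[OF _ finite_tableaux]) auto
  have "(\<Sum>S\<in>row_strict_tableaux lam n. XZY n' z0 (?f S) w) = canon_sum z0 ?c n n' w" for n' w
  proof -
    have zero: "XZY n' z0 (?f S) = (\<lambda>w. 0)" if "\<not> distinct (?f S)" for S
      by (rule XZY_repeated_odd[OF _ that]) (use virtual_C_tab[of lam] in \<open>auto simp del: set_concat dest: set_zip_rightD\<close>)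
    have "(\<Sum>S\<in>row_strict_tableaux lam n. XZY n' z0 (?f S) w) = (\<Sum>S\<in>row_strict_tableaux lam n. mult_weight (?f S) * XZY n' z0 (?f S) w)"
      by (intro sum.cong refl) (simp add: row_strict_tableaux_C_tab weight_distinct del: distinct_zipI1 distinct_zipI2)
    also have "\<dots> = (\<Sum>S\<in>?T. mult_weight (?f S) * XZY n' z0 (?f S) w)"
      unfolding row_strict_tableaux_C_tab
    proof (intro sum.mono_neutral_left fin ballI)
      fix S assume "S \<in> ?T - {S \<in> ?T. distinct (?f S)}"
      then have "\<not> distinct (?f S)" by blast
      then show "mult_weight (?f S) * XZY n' z0 (?f S) w = 0" by (subst zero) simp_all
    qed blast
    also have "\<dots> = canon_sum z0 ?c n n' w"
      unfolding canon_sum_def by (rule sum.reindex_bij_betw[OF tableaux_canon[OF length_rows_C_tab]])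
    finally show ?thesis .
  qed
  then have eq: "canon_sum z0 ?c n = (\<lambda>n' w. \<Sum>S\<in>row_strict_tableaux lam n. XZY n' z0 (?f S) w)"
    by (simp add: fun_eq_iff)
  show ?thesis unfolding eq
  proof (rule rep_finsum)
    show "finite (row_strict_tableaux lam n)"
      unfolding row_strict_tableaux_def by (rule finite_subset[OF _ finite_tableaux]) auto
    show "rep n (sum_list lam) (virt_proj m0 m1 n (cls (alphabet m0 m1 n) (word (Xw (?f S) @ z0 @ Yw (?f S)))))
        (\<lambda>n' w. XZY n' z0 (?f S) w)" if "S \<in> row_strict_tableaux lam n" for S
      using that by (intro rep_tableau[OF _ length_rows_C_tab V c z0]) (simp add: row_strict_tableaux_def)
  qed
qed

lemma rep_K:
  assumes "length lam \<le> m0"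
  shows "rep n (sum_list lam) (elt_K m0 m1 lam n) (canon_sum [] (concat (C_tab lam)) n)"
  using rep_row_strict[OF C_tab_alphabet[OF assms, of m1 n] _ order_refl, of "[]"] virtual_C_tab[of lam]
  by (simp add: elt_K_def tab_prod_Xw tab_prod_Yw flip: word_append del: set_concat)

text \<open>The middle block pairs \<open>C_tab\<close> with \<open>D_tab\<close> and then in the
  opposite direction, so it is balanced and purely virtual, and invariance holds as without
  it.\<close>

lemma rep_S:
  assumes "length lam \<le> m0" "\<forall>r\<in>set lam. r \<le> m1"
  shows "rep n (sum_list lam) (elt_S m0 m1 lam n) (\<lambda>n' w. 1 / of_nat (hook_product lam) *
    canon_sum (zip (concat (C_tab lam)) (concat (D_tab lam)) @ zip (concat (D_tab lam)) (concat (C_tab lam)))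
      (concat (C_tab lam)) n n' w)"
proof -
  let ?C = "concat (C_tab lam)" and ?D = "concat (D_tab lam)"
  let ?V = "set ?C \<union> set ?D" and ?z = "zip ?C ?D @ zip ?D ?C"
  have V: "?V \<subseteq> alphabet m0 m1 n" "\<forall>\<gamma>\<in>?V. virtual \<gamma>"
    using C_tab_alphabet[OF assms(1)] D_tab_alphabet[OF assms(2)] virtual_C_tab virtual_D_tab by blast+
  have z: "set ?z \<subseteq> ?V \<times> ?V" by (auto simp del: set_concat dest: set_zip_leftD set_zip_rightD)
  have "map fst ?z = ?C @ ?D" "map snd ?z = ?D @ ?C" by (simp_all add: length_concat_C_tab length_concat_D_tab)
  then have "mset (map fst ?z) = mset (map snd ?z)" by simp
  then have "rep n (sum_list lam) (\<Oplus>\<^bsub>U (proper n)\<^esub>S\<in>row_strict_tableaux lam n.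
      virt_proj m0 m1 n (cls (alphabet m0 m1 n) (word (Xw (zip (concat S) ?C) @ ?z @ Yw (zip (concat S) ?C)))))
    (canon_sum ?z ?C n)"
    by (intro rep_row_strict[OF V _ z]) auto
  then show ?thesis
    unfolding elt_S_def tab_prod_Xw tab_prod_Yw tab_prod_word[of "C_tab lam" "D_tab lam"] tab_prod_word[of "D_tab lam" "C_tab lam"]
    by (intro rep_smul) (simp only: word_append mult.assoc)
qed

text \<open>Weakly increasing columns are the sorted colour classes of \<open>D_tab\<close>. Here
  the generators are even, so repeated entries survive and are accounted for by the weights.\<close>

lemma rep_J:
  assumes "sorted_wrt (\<ge>) mu" "\<forall>r\<in>set mu. r \<le> m1"
  shows "rep n (sum_list mu) (\<Oplus>\<^bsub>U (proper n)\<^esub>S\<in>column_weak_tableaux mu n.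
        smul (proper n) (1 / of_nat (col_mult_fact S))
          (virt_proj m0 m1 n (cls (alphabet m0 m1 n) (tab_prod (prop_tab S) (D_tab mu) * tab_prod (D_tab mu) (prop_tab S)))))
    (canon_sum [] (concat (D_tab mu)) n)"
proof -
  let ?c = "concat (D_tab mu)"
  let ?f = "\<lambda>S. zip (concat S) ?c"
  have tab: "S \<in> tableaux mu n" "map length S = mu" if "S \<in> column_weak_tableaux mu n" for S
    using that by (simp_all add: column_weak_tableaux_def tableaux_def)
  have "(\<Sum>S\<in>column_weak_tableaux mu n. 1 / of_nat (col_mult_fact S) * XZY n' [] (?f S) w) = canon_sum [] ?c n n' w" for n' w
  proof -
    have "1 / of_nat (col_mult_fact S) = mult_weight (?f S)" if "S \<in> column_weak_tableaux mu n" for S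
      using weight_D_tab[of S] assms(1) tab(2)[OF that] by simp
    then have "(\<Sum>S\<in>column_weak_tableaux mu n. 1 / of_nat (col_mult_fact S) * XZY n' [] (?f S) w) =
      (\<Sum>S\<in>column_weak_tableaux mu n. mult_weight (?f S) * XZY n' [] (?f S) w)"
      by (intro sum.cong refl) simp
    also have "\<dots> = canon_sum [] ?c n n' w"
      unfolding canon_sum_def column_weak_tableaux_D_tab
      by (rule sum.reindex_bij_betw[OF tableaux_canon[OF length_rows_D_tab]])
    finally show ?thesis .
  qed
  then have eq: "canon_sum [] ?c n = (\<lambda>n' w. \<Sum>S\<in>column_weak_tableaux mu n. 1 / of_nat (col_mult_fact S) * XZY n' [] (?f S) w)"
    by (simp add: fun_eq_iff)
  show ?thesis unfolding eq tab_prod_Xw tab_prod_Yw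
  proof (intro rep_finsum rep_smul)
    show "finite (column_weak_tableaux mu n)"
      unfolding column_weak_tableaux_def by (rule finite_subset[OF _ finite_tableaux]) auto
    fix S assume "S \<in> column_weak_tableaux mu n"
    then show "rep n (sum_list mu) (virt_proj m0 m1 n (cls (alphabet m0 m1 n) (word (Xw (?f S)) * word (Yw (?f S)))))
        (\<lambda>n' w. XZY n' [] (?f S) w)"
      using rep_tableau[OF tab(1) length_rows_D_tab D_tab_alphabet[OF assms(2)] virtual_D_tab order_refl, of S "[]"]
      by (simp add: word_append)
  qed
qed

section \<open>Multi-indices as weakly increasing sequences\<close>

definition weak_seqs :: "nat \<Rightarrow> nat \<Rightarrow> nat list set" where
  "weak_seqs n k = {s. length s = k \<and> set s \<subseteq> {1..n} \<and> sorted s}"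

definition colour :: "symb \<Rightarrow> nat list \<Rightarrow> (nat \<times> symb) list" where
  "colour \<gamma> s = map (\<lambda>i. (i, \<gamma>)) s"

lemma colour_simps [simp]: "colour \<gamma> [] = []" "colour \<gamma> (i # s) = (i, \<gamma>) # colour \<gamma> s"
  "colour \<gamma> (s @ t) = colour \<gamma> s @ colour \<gamma> t" "length (colour \<gamma> s) = length s"
  "map fst (colour \<gamma> s) = s" "map snd (colour \<gamma> s) = replicate (length s) \<gamma>"
  by (simp_all add: colour_def comp_def map_replicate_const)

lemma sub_colour: "sub (colour \<gamma> s) \<delta> = (if \<delta> = \<gamma> then s else [])"
  by (induction s) auto

lemma weight_colour: "mult_weight (colour \<gamma> s) = 1 / (\<Prod>x\<in>set s. fact (count_list s x))"
proof -
  have "count_list (colour \<gamma> s) (x, \<gamma>) = count_list s x" for x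
    by (simp add: sub_colour flip: count_list_sub)
  moreover have "inj_on (\<lambda>i. (i, \<gamma>)) (set s)" by (simp add: inj_on_def)
  moreover have "set (colour \<gamma> s) = (\<lambda>i. (i, \<gamma>)) ` set s" by (simp add: colour_def)
  ultimately show ?thesis by (simp add: mult_weight_def prod.reindex)
qed

lemma canon_replicate: "bij_betw (colour \<gamma>) (weak_seqs n k) (canon n (replicate k \<gamma>))"
  unfolding bij_betw_def
proof
  show "inj_on (colour \<gamma>) (weak_seqs n k)"
    by (rule inj_onI) (metis colour_simps(5))
  show "colour \<gamma> ` weak_seqs n k = canon n (replicate k \<gamma>)"
  proof (intro equalityI subsetI)
    fix zs assume "zs \<in> colour \<gamma> ` weak_seqs n k"
    then show "zs \<in> canon n (replicate k \<gamma>)"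
      by (auto simp: weak_seqs_def canon_def sub_colour simp del: set_map)
  next
    fix zs assume zs: "zs \<in> canon n (replicate k \<gamma>)"
    have snd: "map snd zs = replicate k \<gamma>" using zs by (simp add: canon_def)
    have len: "length zs = k" using arg_cong[OF snd, of length] by simp
    have col: "zs = colour \<gamma> (map fst zs)"
      using zip_map_fst_snd[of zs] len unfolding snd colour_def by (simp add: zip_replicate2)
    moreover have "sorted (sub zs \<gamma>)" using zs by (simp add: canon_def)
    then have "sorted (map fst zs)" using arg_cong[OF col, of "\<lambda>z. sub z \<gamma>"] by (simp add: sub_colour)
    ultimately show "zs \<in> colour \<gamma> ` weak_seqs n k"
      using zs len by (intro image_eqI[of _ _ "map fst zs"]) (simp_all add: canon_def weak_seqs_def)
  qed
qed

lemma canon_sum_replicate: "canon_sum z0 (replicate k \<gamma>) n n' w =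
    (\<Sum>s\<in>weak_seqs n k. 1 / (\<Prod>x\<in>set s. fact (count_list s x)) * XZY n' z0 (colour \<gamma> s) w)"
  unfolding canon_sum_def sum.reindex_bij_betw[OF canon_replicate, symmetric] weight_colour ..

definition spread :: "nat list \<Rightarrow> (nat \<Rightarrow> nat) \<Rightarrow> nat list" where
  "spread is h = concat (map (\<lambda>i. replicate (h i) i) is)"

lemma spread_simps: "spread [] h = []" "spread (i # is) h = replicate (h i) i @ spread is h"
  "spread (is @ js) h = spread is h @ spread js h"
  by (simp_all add: spread_def)

lemma count_spread: "distinct is \<Longrightarrow> count_list (spread is h) i = (if i \<in> set is then h i else 0)"
proof (induction "is")
  case (Cons j "is")
  have "count_list (replicate m j) i = (if i = j then m else 0)" for m by (induction m) auto
  then show ?case using Cons by (auto simp: spread_simps count_list_append)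
qed (simp add: spread_simps)

lemma sorted_spread: "sorted is \<Longrightarrow> sorted (spread is h)"
  by (induction "is") (auto simp: spread_simps sorted_append spread_def)

lemma length_spread: "distinct is \<Longrightarrow> length (spread is h) = (\<Sum>i\<in>set is. h i)"
  by (induction "is") (simp_all add: spread_simps)

lemma mset_spread_rev: "mset (spread (rev is) h) = mset (spread is h)"
  by (induction "is") (simp_all add: spread_simps)

abbreviation multiindices :: "nat \<Rightarrow> nat \<Rightarrow> (nat \<Rightarrow> nat) set" where
  "multiindices n k \<equiv> {h \<in> {1..n} \<rightarrow>\<^sub>E UNIV. (\<Sum>i=1..n. h i) = k}"

lemma spread_multiindices: "bij_betw (spread [1..<Suc n]) (multiindices n k) (weak_seqs n k)"
  unfolding bij_betw_def
proof
  have count: "count_list (spread [1..<Suc n] h) i = (if i \<in> {1..n} then h i else 0)" for h i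
    using count_spread[of "[1..<Suc n]" h i] by (simp add: atLeastLessThanSuc_atLeastAtMost del: upt_Suc)
  show "inj_on (spread [1..<Suc n]) (multiindices n k)"
  proof (rule inj_onI)
    fix h h' assume h: "h \<in> multiindices n k" "h' \<in> multiindices n k" "spread [1..<Suc n] h = spread [1..<Suc n] h'"
    have "h i = h' i" if "i \<in> {1..n}" for i
      using count[of h i] count[of h' i] h(3) that by (simp del: upt_Suc)
    then show "h = h'" using h(1,2) by (intro PiE_ext[of h "{1..n}" "\<lambda>_. UNIV" h']) auto
  qed
  show "spread [1..<Suc n] ` multiindices n k = weak_seqs n k"
  proof (intro equalityI subsetI)
    fix s assume "s \<in> spread [1..<Suc n] ` multiindices n k"
    then obtain h where h: "(\<Sum>i=1..n. h i) = k" "s = spread [1..<Suc n] h" by auto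
    have "length s = k" using h length_spread[of "[1..<Suc n]" h]
      by (simp add: atLeastLessThanSuc_atLeastAtMost del: upt_Suc)
    moreover have "set s \<subseteq> {1..n}" by (auto simp: h(2) spread_def)
    moreover have "sorted s" unfolding h(2) by (intro sorted_spread) (simp del: upt_Suc)
    ultimately show "s \<in> weak_seqs n k" by (simp add: weak_seqs_def)
  next
    fix s assume s: "s \<in> weak_seqs n k"
    define h where "h = restrict (count_list s) {1..n}"
    have "(\<Sum>i=1..n. h i) = (\<Sum>i=1..n. count_list s i)" by (intro sum.cong refl) (simp add: h_def)
    also have "\<dots> = k" using s sum_count_set[of s "{1..n}"] by (simp add: weak_seqs_def)
    finally have "h \<in> multiindices n k" by (simp add: h_def)
    moreover have "mset s = mset (spread [1..<Suc n] h)"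
    proof (rule multiset_eqI)
      fix i
      have "count_list s i = 0" if "i \<notin> {1..n}" using s that by (intro count_notin) (auto simp: weak_seqs_def)
      then show "count (mset s) i = count (mset (spread [1..<Suc n] h)) i"
        unfolding count_mset count by (simp add: h_def)
    qed
    then have "s = spread [1..<Suc n] h"
      using s properties_for_sort[of s "spread [1..<Suc n] h"] sorted_spread[of "[1..<Suc n]" h]
      by (simp add: weak_seqs_def sorted_sort_id del: upt_Suc)
    ultimately show "s \<in> spread [1..<Suc n] ` multiindices n k" by blast
  qed
qed

lemma prod_fact_spread:
  "(\<Prod>x\<in>set (spread [1..<Suc n] h). fact (count_list (spread [1..<Suc n] h) x)) = (\<Prod>i=1..n. fact (h i) :: complex)"
proof -
  have count: "count_list (spread [1..<Suc n] h) i = (if i \<in> {1..n} then h i else 0)" for i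
    using count_spread[of "[1..<Suc n]" h i] by (simp add: atLeastLessThanSuc_atLeastAtMost del: upt_Suc)
  have "(\<Prod>x\<in>set (spread [1..<Suc n] h). fact (count_list (spread [1..<Suc n] h) x)) =
    (\<Prod>i=1..n. fact (count_list (spread [1..<Suc n] h) i) :: complex)"
  proof (rule prod.mono_neutral_left)
    show "set (spread [1..<Suc n] h) \<subseteq> {1..n}" by (auto simp: spread_def)
  qed (auto simp: count_notin simp del: upt_Suc)
  also have "\<dots> = (\<Prod>i=1..n. fact (h i))" by (intro prod.cong refl) (subst count, simp)
  finally show ?thesis .
qed

lemma prod_gen_powers:
  "prod_list (map (\<lambda>i. gen (Prop i) \<gamma> ^ h i) is) = word (Xw (colour \<gamma> (spread is h)))"
  "prod_list (map (\<lambda>i. gen \<gamma> (Prop i) ^ h i) is) = word (Yw (colour \<gamma> (spread is h)))"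
proof -
  have "word (Xw (colour \<gamma> (replicate m i))) = gen (Prop i) \<gamma> ^ m" for m i
    by (induction m) (simp_all add: Xw_def word_Cons_gen)
  then show "prod_list (map (\<lambda>i. gen (Prop i) \<gamma> ^ h i) is) = word (Xw (colour \<gamma> (spread is h)))"
    by (induction "is") (simp_all add: spread_simps Xw_def word_append)
  have "word (Yw (colour \<gamma> (replicate m i))) = gen \<gamma> (Prop i) ^ m" for m i
    by (induction m) (simp_all add: Yw_def word_Cons_gen)
  then show "prod_list (map (\<lambda>i. gen \<gamma> (Prop i) ^ h i) is) = word (Yw (colour \<gamma> (spread is h)))"
    by (induction "is") (simp_all add: spread_simps Yw_def word_append)
qed

text \<open>For an odd colour the letters e_{s,c} are even and commute, so the reversed left block
  of I_k may be reordered without a sign.\<close>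

lemma OX_perm_even:
  assumes "mset xs = mset zs" "\<forall>z\<in>set xs. virtual (snd z) \<and> parity (snd z) = 1"
  shows "OX n xs = OX n zs"
  unfolding OX_def
proof (rule prod_list_perm[OF assms(1)])
  fix x y assume "x \<in> set xs" "y \<in> set xs"
  then have v: "virtual (snd x)" "parity (snd x) = 1" "virtual (snd y)" using assms(2) by auto
  obtain s c t d where xy: "x = (s, c)" "y = (t, d)" by (cases x; cases y)
  show "(case x of (s, c) \<Rightarrow> AA n (Prop s) c) * (case y of (s, c) \<Rightarrow> AA n (Prop s) c) =
    (case y of (s, c) \<Rightarrow> AA n (Prop s) c) * (case x of (s, c) \<Rightarrow> AA n (Prop s) c)"
    using AA_AA[of n "Prop s" c "Prop t" d] v
    by (simp add: xy sg_even virtual_neq_Prop virtual_neq_Prop[symmetric])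
qed

lemma XZY_Xw_perm:
  assumes "mset xs = mset zs" "\<forall>z\<in>set xs. virtual (snd z) \<and> parity (snd z) = 1"
  shows "vac n (word (Xw xs @ z0 @ Yw zs)) = XZY n z0 zs"
  using OX_perm_even[OF assms, of n] by (simp add: XZY_def word_append vac_mult act_Xw)

lemma rep_I:
  assumes b: "b \<in> {1..m1}"
  shows "rep n k (elt_I m0 m1 b k n) (canon_sum [] (replicate k (symb.Beta b)) n)"
proof -
  let ?\<beta> = "symb.Beta b"
  let ?f = "\<lambda>h. colour ?\<beta> (spread [1..<Suc n] h)"
  have eq: "canon_sum [] (replicate k ?\<beta>) n =
    (\<lambda>n' w. \<Sum>h\<in>multiindices n k. 1 / (\<Prod>i=1..n. fact (h i)) * XZY n' [] (?f h) w)"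
    unfolding canon_sum_replicate[abs_def] sum.reindex_bij_betw[OF spread_multiindices, symmetric] prod_fact_spread ..
  have fin: "finite (multiindices n k)"
  proof -
    have "finite (weak_seqs n k)" using finite_lists_length_eq[of "{1..n}" k]
      by (rule rev_finite_subset) (auto simp: weak_seqs_def)
    then show ?thesis using bij_betw_finite[OF spread_multiindices] by blast
  qed
  show ?thesis
    unfolding eq elt_I_def prod_gen_powers
  proof (intro rep_finsum rep_smul fin)
    fix h assume h: "h \<in> multiindices n k"
    let ?xs = "colour ?\<beta> (spread (rev [1..<Suc n]) h)"
    have perm: "mset ?xs = mset (?f h)"
      unfolding colour_def mset_map mset_spread_rev ..
    have s: "spread [1..<Suc n] h \<in> weak_seqs n k" using bij_betwE[OF spread_multiindices] h by blast
    have "rep n k (virt_proj m0 m1 n (cls (alphabet m0 m1 n) (word (Xw ?xs @ [] @ Yw (?f h)))))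
        (\<lambda>n'. vac n' (word (Xw ?xs @ [] @ Yw (?f h))))"
    proof (rule rep_XZY[OF perm])
      show "{?\<beta>} \<subseteq> alphabet m0 m1 n" using b by (auto simp: alphabet_def)
    qed (use s in \<open>auto simp: weak_seqs_def virtual_def simp del: upt_Suc set_map\<close>)
    moreover have "vac n' (word (Xw ?xs @ [] @ Yw (?f h))) = XZY n' [] (?f h)" for n'
      by (rule XZY_Xw_perm[OF perm]) (auto simp: colour_def virtual_def)
    ultimately show "rep n k (virt_proj m0 m1 n (cls (alphabet m0 m1 n) (word (Xw ?xs) * word (Yw (?f h)))))
        (\<lambda>n' w. XZY n' [] (?f h) w)"
      by (simp only: append_Nil word_append)
  qed
qed

text \<open>The transposition of the two symbols preserves parity and fixes proper symbols, so
  \<open>vac_relabel\<close> applies once the second word is known to have a representative in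
  U(gl(n)).\<close>

lemma XZY_recolour:
  assumes s: "set s \<subseteq> {1..n}" and b': "b' \<ge> 1"
  shows "XZY n [] (colour (symb.Beta b) s) = XZY n [] (colour (symb.Beta b') s)"
proof -
  let ?\<rho> = "Transposition.transpose (symb.Beta b) (symb.Beta b')"
  interpret relabelling ?\<rho>
  proof
    show "?\<rho> x = ?\<rho> y \<longleftrightarrow> x = y" for x y by (metis transpose_involutory)
    show "parity (?\<rho> a) = parity a" for a by (simp add: Transposition.transpose_def)
    show "?\<rho> (Prop i) = Prop i" for i by (simp add: Transposition.transpose_def)
  qed
  let ?w = "\<lambda>\<gamma>. Xw (colour \<gamma> s) @ [] @ Yw (colour \<gamma> s)"
  have map: "map (map_prod ?\<rho> ?\<rho>) (?w (symb.Beta b)) = ?w (symb.Beta b')"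
    by (simp add: Xw_def Yw_def colour_def Transposition.transpose_def)
  \<comment> \<open>A superalgebra just large enough to contain \<beta> with index b'; vacuum
    vectors of words make no reference to the alphabet.\<close>
  have "rep n (length s) (virt_proj 0 b' n (cls (alphabet 0 b' n) (word (?w (symb.Beta b')))))
      (\<lambda>n'. vac n' (word (?w (symb.Beta b'))))"
    by (rule rep_XZY[where V = "{symb.Beta b'}"]) (use s b' in \<open>auto simp: alphabet_def virtual_def simp del: set_map\<close>)
  then obtain y where "y \<in> fa (proper n)" "vac n y = vac n (word (?w (symb.Beta b')))"
    unfolding rep_def using FD_fa by blast
  then have "vac n (word (?w (symb.Beta b))) = vac n (word (map (map_prod ?\<rho> ?\<rho>) (?w (symb.Beta b))))"
    by (intro vac_relabel) (simp_all only: map)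
  then show ?thesis unfolding map XZY_def .
qed

lemma canon_sum_recolour:
  assumes "b' \<ge> 1"
  shows "canon_sum [] (replicate k (symb.Beta b)) n n = canon_sum [] (replicate k (symb.Beta b')) n n"
proof -
  have "XZY n [] (colour (symb.Beta b) s) = XZY n [] (colour (symb.Beta b') s)" if "s \<in> weak_seqs n k" for s
    using that by (intro XZY_recolour assms) (simp add: weak_seqs_def)
  then show ?thesis unfolding canon_sum_replicate fun_eq_iff by (intro allI sum.cong refl) simp
qed

theorem theorem5p11:
  fixes k :: nat and lam :: "nat list" and m0 m1 b :: "nat \<Rightarrow> nat"
  assumes "k \<ge> 1" and "is_partition lam"
    and "\<And>n. length lam \<le> m0 n" and "\<And>n. length lam \<le> m1 n"
    and "\<And>n i. i < length lam \<Longrightarrow> lam ! i \<le> m1 n"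
    and "\<And>n. b n \<in> {1..m1 n}"
  shows "(\<forall>n\<ge>1. n \<ge> k \<longrightarrow>
           elt_I (m0 n) (m1 n) (b n) k n \<in> zeta_filt n k \<and>
           capelli_mono n (elt_I (m0 n) (m1 n) (b n) k n)
             = elt_I (m0 (n + 1)) (m1 (n + 1)) (b (n + 1)) k (n + 1)) \<and>
         (\<forall>n\<ge>1. n \<ge> sum_list lam \<longrightarrow>
           elt_K (m0 n) (m1 n) lam n \<in> zeta_filt n (sum_list lam) \<and>
           capelli_mono n (elt_K (m0 n) (m1 n) lam n)
             = elt_K (m0 (n + 1)) (m1 (n + 1)) lam (n + 1)) \<and>
         (\<forall>n\<ge>1. n \<ge> sum_list lam \<longrightarrow>
           elt_J (m0 n) (m1 n) lam n \<in> zeta_filt n (sum_list lam) \<and>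
           capelli_mono n (elt_J (m0 n) (m1 n) lam n)
             = elt_J (m0 (n + 1)) (m1 (n + 1)) lam (n + 1)) \<and>
         (\<forall>n\<ge>1. n \<ge> sum_list lam \<longrightarrow>
           elt_S (m0 n) (m1 n) lam n \<in> zeta_filt n (sum_list lam) \<and>
           capelli_mono n (elt_S (m0 n) (m1 n) lam n)
             = elt_S (m0 (n + 1)) (m1 (n + 1)) lam (n + 1))"
proof -
  let ?C = "concat (C_tab lam)" and ?D = "concat (D_tab lam)" and ?mu = "Defs.conjugate lam"
  let ?E = "concat (D_tab ?mu)" and ?z = "zip (concat (C_tab lam)) (concat (D_tab lam)) @ zip (concat (D_tab lam)) (concat (C_tab lam))"
  have rows: "\<forall>r\<in>set lam. r \<le> m1 n" for n using assms(5)[of _ n] by (auto simp: in_set_conv_nth)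
  \<comment> \<open>The rows of the conjugate are the columns of \<open>lam\<close>, whose length is
    at most the number of rows of \<open>lam\<close>. This many symbols \<beta> are needed for
    J.\<close>
  have mu: "\<forall>r\<in>set ?mu. r \<le> m1 n" for n
    using assms(4)[of n] by (auto simp: Defs.conjugate_def intro: order_trans[OF length_filter_le])
  have sum_mu: "sum_list ?mu = sum_list lam"
    using assms(2) by (intro sum_list_conjugate) (simp add: is_partition_def)
  have virt: "\<forall>\<gamma>\<in>set ?C. virtual \<gamma>" using virtual_C_tab by blast
  have virt_z: "\<forall>l\<in>set ?z. virtual (fst l) \<and> virtual (snd l)"
    using virt virtual_D_tab[of lam] by (auto simp del: set_concat dest: set_zip_leftD set_zip_rightD)
  have no_z: "\<forall>l\<in>set []. virtual (fst l) \<and> virtual (snd l)" by simp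
  have I: "elt_I (m0 n) (m1 n) (b n) k n \<in> zeta_filt n k \<and>
      capelli_mono n (elt_I (m0 n) (m1 n) (b n) k n) = elt_I (m0 (n + 1)) (m1 (n + 1)) (b (n + 1)) k (n + 1)"
    if "n \<ge> k" for n
  proof -
    have v: "\<forall>\<gamma>\<in>set (replicate k (symb.Beta c)). virtual \<gamma>" for c by (simp add: virtual_def)
    \<comment> \<open>The restricted vector for n + 1 carries the symbol chosen for n + 1 and is
      rewritten with the one chosen for n.\<close>
    have "canon_sum [] (replicate k (symb.Beta (b (n + 1)))) n n = canon_sum [] (replicate k (symb.Beta (b n))) n n"
      using assms(6)[of n] by (intro canon_sum_recolour) simp
    then show ?thesis
      using rep_stable[OF rep_I[OF assms(6)] rep_I[OF assms(6)] that
        inv_vec_canon_sum[OF v no_z] inv_vec_canon_sum[OF v no_z]] canon_sum_restrict[OF v]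
      by simp
  qed
  have K: "elt_K (m0 n) (m1 n) lam n \<in> zeta_filt n (sum_list lam) \<and>
      capelli_mono n (elt_K (m0 n) (m1 n) lam n) = elt_K (m0 (n + 1)) (m1 (n + 1)) lam (n + 1)"
    if "n \<ge> sum_list lam" for n
    by (rule rep_stable[OF rep_K[OF assms(3)] rep_K[OF assms(3)] that
      inv_vec_canon_sum[OF virt no_z] inv_vec_canon_sum[OF virt no_z] canon_sum_restrict[OF virt]])
  have J: "elt_J (m0 n) (m1 n) lam n \<in> zeta_filt n (sum_list lam) \<and>
      capelli_mono n (elt_J (m0 n) (m1 n) lam n) = elt_J (m0 (n + 1)) (m1 (n + 1)) lam (n + 1)"
    if "n \<ge> sum_list lam" for n
  proof -
    have rep: "rep n (sum_list lam) (elt_J (m0 n) (m1 n) lam n) (canon_sum [] ?E n)" for n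
      unfolding elt_J_def sum_mu[symmetric] by (rule rep_J[OF sorted_conjugate mu])
    show ?thesis
      by (rule rep_stable[OF rep rep that inv_vec_canon_sum[OF virtual_D_tab no_z]
        inv_vec_canon_sum[OF virtual_D_tab no_z] canon_sum_restrict[OF virtual_D_tab]])
  qed
  have S: "elt_S (m0 n) (m1 n) lam n \<in> zeta_filt n (sum_list lam) \<and>
      capelli_mono n (elt_S (m0 n) (m1 n) lam n) = elt_S (m0 (n + 1)) (m1 (n + 1)) lam (n + 1)"
    if "n \<ge> sum_list lam" for n
    by (rule rep_stable[OF rep_S[OF assms(3) rows] rep_S[OF assms(3) rows] that])
      (intro inv_vec_scale inv_vec_canon_sum virt virt_z, intro inv_vec_scale inv_vec_canon_sum virt virt_z,
        simp only: canon_sum_restrict[OF virt])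
  show ?thesis using I K J S by blast
qed

end
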